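(* Let $k$ be an $F$-finite field of characteristic $p>0$, $S=k[x_1,\dots,x_N]$ a polynomial ring with a $\mathbb Z_{\ge0}^{q}$-grading such that each $x_i$ is homogeneous of nonzero degree $\mu_i$ and $k$ has degree $0$; put $\mu:=\sum_i\mu_i$ and $\mathfrak m:=(x_1,\dots,x_N)$. Let $f'_1,\dots,f'_m$ be a homogeneous regular sequence in $S$, $I:=(f'_1,\dots,f'_m)$ and $f:=f'_1\cdots f'_m$. Suppose that $f$ is homogeneous of degree $\mu$. Take a representative in $S$ of $\Delta_1(f^{p-1})$ which is homogeneous of degree $p(p-1)\mu$, also denoted $\Delta_1(f^{p-1})$. Define the $S$-module homomorphism $$\theta\colon F_*S\to S,\qquad F_*a\mapsto u(F_*(\Delta_1(f^{p-1})a)),$$ and define $f_1:=f^{p-1}$ and $f_n:=f^{p-1}\Delta_1(f^{p-1})^{1+p+\cdots+p^{n-2}}$ for $n\ge2$. Then $$\operatorname{ht}(S/I)=\inf\{n\mid\theta^{n-1}(F^{n-1}_*(f^{p-1}k))\nsubseteq\mathfrak m^{[p]}\}=\inf\{n\mid f_n\notin\mathfrak m^{[p^n]}\}.$$ In particular, $\operatorname{ht}(S/I)=\operatorname{ht}(S/f)$.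
   Context: Quasi-$F$-split height: for an $\mathbb F_p$-scheme $X$ and $n\ge1$, let $W_n\mathcal O_X$ be the sheaf of ($p$-typical) Witt vectors of length $n$, $F\colon W_n\mathcal O_X\to F_*W_n\mathcal O_X$ the Frobenius and $R^{n-1}\colon W_n\mathcal O_X\to\mathcal O_X$ the restriction. $X$ is $n$-quasi-$F$-split if there is a $W_n\mathcal O_X$-module homomorphism $\phi\colon F_*W_n\mathcal O_X\to\mathcal O_X$ with $\phi\circ F=R^{n-1}$. $\operatorname{ht}(X)$ is the infimum of such $n$ ($\inf\emptyset=\infty$); for a ring $B$, $\operatorname{ht}(B):=\operatorname{ht}(\operatorname{Spec}B)$. Notation: $F_*S$ is $S$ with $S$-action $a\cdot F_*b=F_*(a^pb)$, and $F^n_*$ is the iterate; $I^{[p^n]}$ is the ideal generated by $p^n$-th powers of elements of $I$. $\theta^{n-1}\colon F^{n-1}_*S\to S$ is the iterate: $\theta^0=\mathrm{id}$, $\theta^j(F^j_*a)=\theta(F_*(\theta^{j-1}(F^{j-1}_*a)))$. Let $y_1,\dots,y_s$ be a $p$-basis of $k$ (the $F_*(\prod y_i^{e_i})$, $0\le e_i\le p-1$, form a $k$-basis of $F_*k$). Write $v_1,\dots,v_d$ for the elements $y_1^{j_1}\cdots y_s^{j_s}x_1^{i_1}\cdots x_N^{i_N}$ with $0\le j_l,i_l\le p-1$; $F_*v_1,\dots,F_*v_d$ is an $S$-basis of $F_*S$. Put $v=v_d=(y_1\cdots y_sx_1\cdots x_N)^{p-1}$ and let $u\in\operatorname{Hom}_S(F_*S,S)$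 be the dual basis element of $F_*v$. A $p$-monomial is an element of the form $b^pv_i$. For $a\in S$ with a decomposition $a=a_1+\cdots+a_r$ into $p$-monomials, $\Delta_1(a)\in S/F(S)$, where $F(S)=\{b^p\mid b\in S\}$, is the class (independent of choices) of $$\sum_{\substack{0\le\alpha_1,\dots,\alpha_r\le p-1\\ \alpha_1+\cdots+\alpha_r=p}}\frac1p\binom{p}{\alpha_1,\dots,\alpha_r}a_1^{\alpha_1}\cdots a_r^{\alpha_r}.$$ If $a$ is homogeneous of degree $e$, then $\Delta_1(a)$ has a representative homogeneous of degree $pe$. *)

theory Defs
  imports
    "HOL-Algebra.Algebraic_Closure_Type"
    "HOL-Library.Poly_Mapping"
    "HOL-Library.Extended_Nat"
    "HOL-Analysis.Finite_Cartesian_Product"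
begin

section \<open>Polynomial rings, gradings, Frobenius powers and regular sequences\<close>

text \<open>
  The polynomial ring over \<open>'k\<close> with one variable for each element of the finite type \<open>'n\<close>:
  finitely supported functions from exponent vectors to coefficients.
  \<open>Poly_Mapping.single e c\<close> is the term $c x^e$.
\<close>

type_synonym ('n, 'k) mpoly = "('n \<Rightarrow>\<^sub>0 nat) \<Rightarrow>\<^sub>0 'k"

definition Const :: "'k \<Rightarrow> ('n, 'k::zero) mpoly" where
  "Const c = Poly_Mapping.single 0 c"

definition Var :: "'n \<Rightarrow> ('n, 'k::zero_neq_one) mpoly" where
  "Var i = Poly_Mapping.single (Poly_Mapping.single i 1) 1"

text \<open>The grading in which \<open>x\<^sub>i\<close> has degree \<open>\<mu> i\<close> and the constants have degree 0.\<close>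

definition monom_degree :: "('n::finite \<Rightarrow> nat ^ 'q) \<Rightarrow> ('n \<Rightarrow>\<^sub>0 nat) \<Rightarrow> nat ^ 'q" where
  "monom_degree \<mu> e = (\<Sum>i\<in>UNIV. Poly_Mapping.lookup e i *s \<mu> i)"

definition homogeneous ::
    "('n::finite \<Rightarrow> nat ^ 'q) \<Rightarrow> nat ^ 'q \<Rightarrow> ('n, 'k::zero) mpoly \<Rightarrow> bool" where
  "homogeneous \<mu> d g \<longleftrightarrow> (\<forall>e\<in>Poly_Mapping.keys g. monom_degree \<mu> e = d)"

text \<open>\<open>frobenius_power R I q\<close> is \<open>I\<^sup>[\<^sup>q\<^sup>]\<close>.\<close>

definition frobenius_power :: "('a, 'm) ring_scheme \<Rightarrow> 'a set \<Rightarrow> nat \<Rightarrow> 'a set" where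
  "frobenius_power R I q = Idl\<^bsub>R\<^esub> {a [^]\<^bsub>R\<^esub> q | a. a \<in> I}"

definition regular_sequence :: "('a, 'm) ring_scheme \<Rightarrow> 'a list \<Rightarrow> bool" where
  "regular_sequence R gs \<longleftrightarrow>
     set gs \<subseteq> carrier R \<and>
     (\<forall>i<length gs. \<forall>a\<in>carrier R.
        a \<otimes>\<^bsub>R\<^esub> gs ! i \<in> Idl\<^bsub>R\<^esub> (set (take i gs)) \<longrightarrow> a \<in> Idl\<^bsub>R\<^esub> (set (take i gs))) \<and>
     Idl\<^bsub>R\<^esub> (set gs) \<noteq> carrier R"


section \<open>Witt vectors\<close>

definition ghost :: "nat \<Rightarrow> (nat \<Rightarrow> 'a::comm_ring_1) \<Rightarrow> nat \<Rightarrow> 'a" where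
  "ghost p z n = (\<Sum>i\<le>n. of_nat p ^ i * z i ^ (p ^ (n - i)))"

text \<open>
  The universal polynomials are polynomials over \<open>\<int>\<close> in the variables
  \<open>X\<^sub>i\<close> (index \<open>Inl i\<close>) and \<open>Y\<^sub>i\<close> (index \<open>Inr i\<close>). They are the unique sequences of integral
  polynomials whose ghost components are the sums, respectively the products, of the ghost
  components of \<open>X\<close> and \<open>Y\<close>.
\<close>

type_synonym witt_poly = "(nat + nat, int) mpoly"

definition witt_add_poly :: "nat \<Rightarrow> nat \<Rightarrow> witt_poly" where
  "witt_add_poly p = (THE z. \<forall>n. ghost p z n =
     ghost p (\<lambda>i. Var (Inl i)) n + ghost p (\<lambda>i. Var (Inr i)) n)"

definition witt_mult_poly :: "nat \<Rightarrow> nat \<Rightarrow> witt_poly" where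
  "witt_mult_poly p = (THE z. \<forall>n. ghost p z n =
     ghost p (\<lambda>i. Var (Inl i)) n * ghost p (\<lambda>i. Var (Inr i)) n)"

definition eval_int_poly ::
    "('a, 'm) ring_scheme \<Rightarrow> ('v, int) mpoly \<Rightarrow> ('v \<Rightarrow> 'a) \<Rightarrow> 'a" where
  "eval_int_poly R P \<rho> =
     finsum R (\<lambda>e. [Poly_Mapping.lookup P e] \<cdot>\<^bsub>R\<^esub>
       finprod R (\<lambda>v. \<rho> v [^]\<^bsub>R\<^esub> Poly_Mapping.lookup e v) (Poly_Mapping.keys e))
     (Poly_Mapping.keys P)"

text \<open>\<open>witt_ring p n R\<close> is \<open>W\<^sub>n(R)\<close>; a Witt vector is the list of its \<open>n\<close> components.\<close>

definition witt_ring :: "nat \<Rightarrow> nat \<Rightarrow> ('a, 'm) ring_scheme \<Rightarrow> 'a list ring" where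
  "witt_ring p n R = \<lparr>
     carrier = {x. length x = n \<and> set x \<subseteq> carrier R},
     monoid.mult = (\<lambda>x y. map (\<lambda>i. eval_int_poly R (witt_mult_poly p i)
                       (case_sum (nth x) (nth y))) [0..<n]),
     one = map (\<lambda>i. if i = 0 then \<one>\<^bsub>R\<^esub> else \<zero>\<^bsub>R\<^esub>) [0..<n],
     ring.zero = replicate n \<zero>\<^bsub>R\<^esub>,
     add = (\<lambda>x y. map (\<lambda>i. eval_int_poly R (witt_add_poly p i)
                       (case_sum (nth x) (nth y))) [0..<n]) \<rparr>"

text \<open>
  For \<open>R\<close> of characteristic \<open>p\<close>, the Frobenius of \<open>W\<^sub>n(R)\<close> raises all components to the \<open>p\<close>-th
  power; the restriction \<open>W\<^sub>n(R) \<rightarrow> W\<^sub>1(R) = R\<close> is \<open>hd\<close>.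
\<close>

definition witt_frob :: "nat \<Rightarrow> ('a, 'm) ring_scheme \<Rightarrow> 'a list \<Rightarrow> 'a list" where
  "witt_frob p R x = map (\<lambda>a. a [^]\<^bsub>R\<^esub> p) x"


section \<open>Quasi-F-split height\<close>

text \<open>
  \<open>witt_frob_linear p n R \<phi>\<close>: \<open>\<phi>\<close> is a \<open>W\<^sub>n(R)\<close>-module homomorphism \<open>F\<^sub>*W\<^sub>n(R) \<rightarrow> R\<close>. Here
  \<open>a \<in> W\<^sub>n(R)\<close> acts on \<open>F\<^sub>*W\<^sub>n(R)\<close> as multiplication by \<open>F(a)\<close> and on \<open>R\<close> as multiplication by
  the restriction of \<open>a\<close>.
\<close>

definition witt_frob_linear ::
    "nat \<Rightarrow> nat \<Rightarrow> ('a, 'm) ring_scheme \<Rightarrow> ('a list \<Rightarrow> 'a) \<Rightarrow> bool" where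
  "witt_frob_linear p n R \<phi> \<longleftrightarrow>
     \<phi> \<in> carrier (witt_ring p n R) \<rightarrow> carrier R \<and>
     (\<forall>x\<in>carrier (witt_ring p n R). \<forall>y\<in>carrier (witt_ring p n R).
        \<phi> (x \<oplus>\<^bsub>witt_ring p n R\<^esub> y) = \<phi> x \<oplus>\<^bsub>R\<^esub> \<phi> y) \<and>
     (\<forall>a\<in>carrier (witt_ring p n R). \<forall>x\<in>carrier (witt_ring p n R).
        \<phi> (witt_frob p R a \<otimes>\<^bsub>witt_ring p n R\<^esub> x) = hd a \<otimes>\<^bsub>R\<^esub> \<phi> x)"

text \<open>
  A ringed space over the prime field of characteristic \<open>p\<close> is given by its set \<open>T\<close> of open sets,
  the rings of sections \<open>\<O> U\<close> and the restriction maps \<open>res U V\<close> from \<open>\<O> U\<close> to \<open>\<O> V\<close>. The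
  sections over \<open>U\<close> of the sheaf of Witt vectors are \<open>W\<^sub>n(\<O> U)\<close>, with componentwise restriction,
  and a homomorphism of sheaves is a family \<open>\<phi> U\<close> compatible with restriction.
\<close>

definition n_quasi_F_split ::
    "nat \<Rightarrow> nat \<Rightarrow> 'x set set \<Rightarrow> ('x set \<Rightarrow> ('a, 'm) ring_scheme) \<Rightarrow>
     ('x set \<Rightarrow> 'x set \<Rightarrow> 'a \<Rightarrow> 'a) \<Rightarrow> bool" where
  "n_quasi_F_split p n T \<O> res \<longleftrightarrow> (\<exists>\<phi> :: 'x set \<Rightarrow> 'a list \<Rightarrow> 'a.
     (\<forall>U\<in>T. witt_frob_linear p n (\<O> U) (\<phi> U)) \<and>
     (\<forall>U\<in>T. \<forall>V\<in>T. V \<subseteq> U \<longrightarrow> (\<forall>x\<in>carrier (witt_ring p n (\<O> U)).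
        \<phi> V (map (res U V) x) = res U V (\<phi> U x))) \<and>
     (\<forall>U\<in>T. \<forall>x\<in>carrier (witt_ring p n (\<O> U)). \<phi> U (witt_frob p (\<O> U) x) = hd x))"

definition ht_ringed_space ::
    "nat \<Rightarrow> 'x set set \<Rightarrow> ('x set \<Rightarrow> ('a, 'm) ring_scheme) \<Rightarrow>
     ('x set \<Rightarrow> 'x set \<Rightarrow> 'a \<Rightarrow> 'a) \<Rightarrow> enat" where
  "ht_ringed_space p T \<O> res = Inf {enat n | n. n \<ge> 1 \<and> n_quasi_F_split p n T \<O> res}"

text \<open>
  \<open>fraction R M a s\<close> is the fraction \<open>a / s\<close> in the localization of \<open>R\<close> at the multiplicative set
  \<open>M\<close>, as an equivalence class of pairs.
\<close>

definition fraction :: "('a, 'm) ring_scheme \<Rightarrow> 'a set \<Rightarrow> 'a \<Rightarrow> 'a \<Rightarrow> ('a \<times> 'a) set" where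
  "fraction R M a s = {(b, t). b \<in> carrier R \<and> t \<in> M \<and>
     (\<exists>w\<in>M. w \<otimes>\<^bsub>R\<^esub> (a \<otimes>\<^bsub>R\<^esub> t) = w \<otimes>\<^bsub>R\<^esub> (b \<otimes>\<^bsub>R\<^esub> s))}"

definition localization :: "('a, 'm) ring_scheme \<Rightarrow> 'a set \<Rightarrow> ('a \<times> 'a) set ring" where
  "localization R M = \<lparr>
     carrier = {fraction R M a s | a s. a \<in> carrier R \<and> s \<in> M},
     monoid.mult = (\<lambda>x y. \<Union>(a, s)\<in>x. \<Union>(b, t)\<in>y. fraction R M (a \<otimes>\<^bsub>R\<^esub> b) (s \<otimes>\<^bsub>R\<^esub> t)),
     one = fraction R M \<one>\<^bsub>R\<^esub> \<one>\<^bsub>R\<^esub>,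
     ring.zero = fraction R M \<zero>\<^bsub>R\<^esub> \<one>\<^bsub>R\<^esub>,
     add = (\<lambda>x y. \<Union>(a, s)\<in>x. \<Union>(b, t)\<in>y.
             fraction R M (a \<otimes>\<^bsub>R\<^esub> t \<oplus>\<^bsub>R\<^esub> b \<otimes>\<^bsub>R\<^esub> s) (s \<otimes>\<^bsub>R\<^esub> t)) \<rparr>"

definition Spec :: "('a, 'm) ring_scheme \<Rightarrow> 'a set set" where
  "Spec R = {P. primeideal P R}"

definition zariski_opens :: "('a, 'm) ring_scheme \<Rightarrow> 'a set set set" where
  "zariski_opens R = {{P \<in> Spec R. \<not> J \<subseteq> P} | J. J \<subseteq> carrier R}"

text \<open>
  Sections over \<open>U\<close> are families of elements of the local rings at the points of \<open>U\<close> that are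
  locally given by a fraction; they are \<open>undefined\<close> outside \<open>U\<close>.
\<close>

definition spec_sections :: "('a, 'm) ring_scheme \<Rightarrow> 'a set set \<Rightarrow> ('a set \<Rightarrow> ('a \<times> 'a) set) set" where
  "spec_sections R U =
     {\<sigma> \<in> (\<Pi>\<^sub>E P\<in>U. carrier (localization R (carrier R - P))).
        \<forall>P\<in>U. \<exists>V\<in>zariski_opens R. P \<in> V \<and> V \<subseteq> U \<and>
          (\<exists>a\<in>carrier R. \<exists>s\<in>carrier R. \<forall>Q\<in>V. s \<notin> Q \<and> \<sigma> Q = fraction R (carrier R - Q) a s)}"

definition spec_sheaf ::
    "('a, 'm) ring_scheme \<Rightarrow> 'a set set \<Rightarrow> ('a set \<Rightarrow> ('a \<times> 'a) set) ring" where
  "spec_sheaf R U = \<lparr>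
     carrier = spec_sections R U,
     monoid.mult = (\<lambda>\<sigma> \<tau>. \<lambda>P\<in>U. \<sigma> P \<otimes>\<^bsub>localization R (carrier R - P)\<^esub> \<tau> P),
     one = (\<lambda>P\<in>U. \<one>\<^bsub>localization R (carrier R - P)\<^esub>),
     ring.zero = (\<lambda>P\<in>U. \<zero>\<^bsub>localization R (carrier R - P)\<^esub>),
     add = (\<lambda>\<sigma> \<tau>. \<lambda>P\<in>U. \<sigma> P \<oplus>\<^bsub>localization R (carrier R - P)\<^esub> \<tau> P) \<rparr>"

definition ht :: "nat \<Rightarrow> ('a, 'm) ring_scheme \<Rightarrow> enat" where
  "ht p B = ht_ringed_space p (zariski_opens B) (spec_sheaf B) (\<lambda>U V \<sigma>. restrict \<sigma> V)"


section \<open>p-bases and the operator Delta_1\<close>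

text \<open>
  \<open>F\<^sub>*A\<close> is \<open>A\<close> with this scalar multiplication, so \<open>module_hom (frob_scale p) (*) u\<close> says that
  \<open>u\<close> is an \<open>A\<close>-module homomorphism \<open>F\<^sub>*A \<rightarrow> A\<close>.
\<close>

definition frob_scale :: "nat \<Rightarrow> 'a::comm_ring_1 \<Rightarrow> 'a \<Rightarrow> 'a" where
  "frob_scale p a b = a ^ p * b"

definition F_finite :: "'k::field itself \<Rightarrow> bool" where
  "F_finite _ \<longleftrightarrow> (\<exists>B :: 'k set. finite B \<and> Modules.module.span (frob_scale CHAR('k)) B = UNIV)"

definition p_exponents :: "nat \<Rightarrow> nat \<Rightarrow> (nat \<Rightarrow> nat) set" where
  "p_exponents p s = {..<s} \<rightarrow>\<^sub>E {0..p - 1}"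

text \<open>
  A \<open>p\<close>-basis \<open>y 0, \<dots>, y (s - 1)\<close>; it may be empty. Injectivity makes the basis condition one on
  the family of monomials rather than on the set of its values.
\<close>

definition p_basis :: "nat \<Rightarrow> nat \<Rightarrow> (nat \<Rightarrow> 'k::field) \<Rightarrow> bool" where
  "p_basis p s y \<longleftrightarrow>
     inj_on (\<lambda>j. \<Prod>l<s. y l ^ j l) (p_exponents p s) \<and>
     \<not> Modules.module.dependent (frob_scale p) ((\<lambda>j. \<Prod>l<s. y l ^ j l) ` p_exponents p s) \<and>
     Modules.module.span (frob_scale p) ((\<lambda>j. \<Prod>l<s. y l ^ j l) ` p_exponents p s) = UNIV"

definition basis_monomials ::
    "nat \<Rightarrow> nat \<Rightarrow> (nat \<Rightarrow> 'k::field) \<Rightarrow> ('n::finite, 'k) mpoly set" where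
  "basis_monomials p s y =
     {Const (\<Prod>l<s. y l ^ j l) * (\<Prod>i\<in>UNIV. Var i ^ e i) | j e.
        j \<in> p_exponents p s \<and> (\<forall>i. e i \<le> p - 1)}"

definition top_monomial ::
    "nat \<Rightarrow> nat \<Rightarrow> (nat \<Rightarrow> 'k::field) \<Rightarrow> ('n::finite, 'k) mpoly" where
  "top_monomial p s y = (Const (\<Prod>l<s. y l) * (\<Prod>i\<in>UNIV. Var i)) ^ (p - 1)"

definition is_dual_top ::
    "nat \<Rightarrow> nat \<Rightarrow> (nat \<Rightarrow> 'k::field) \<Rightarrow>
     (('n::finite, 'k) mpoly \<Rightarrow> ('n, 'k) mpoly) \<Rightarrow> bool" where
  "is_dual_top p s y u \<longleftrightarrow>
     module_hom (frob_scale p) (*) u \<and>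
     (\<forall>w\<in>basis_monomials p s y. u w = (if w = top_monomial p s y then 1 else 0))"

definition p_monomial ::
    "nat \<Rightarrow> nat \<Rightarrow> (nat \<Rightarrow> 'k::field) \<Rightarrow> ('n::finite, 'k) mpoly \<Rightarrow> bool" where
  "p_monomial p s y c \<longleftrightarrow> (\<exists>b. \<exists>w\<in>basis_monomials p s y. c = b ^ p * w)"

text \<open>Both integer divisions are exact, because all \<open>\<alpha> i\<close> are smaller than the prime \<open>p\<close>.\<close>

definition Delta1_sum :: "nat \<Rightarrow> 'a::comm_ring_1 list \<Rightarrow> 'a" where
  "Delta1_sum p as =
     (\<Sum>\<alpha> | \<alpha> \<in> {..<length as} \<rightarrow>\<^sub>E {0..p - 1} \<and> (\<Sum>i<length as. \<alpha> i) = p.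
        of_nat (fact p div (\<Prod>i<length as. fact (\<alpha> i)) div p) *
        (\<Prod>i<length as. (as ! i) ^ \<alpha> i))"

text \<open>
  The class of \<open>\<Delta>\<^sub>1(a)\<close> modulo \<open>p\<close>-th powers, as the set of all its representatives. The class does
  not depend on the decomposition \<open>as\<close>, so the union over all decompositions is a single coset.
\<close>

definition Delta1 ::
    "nat \<Rightarrow> nat \<Rightarrow> (nat \<Rightarrow> 'k::field) \<Rightarrow> ('n::finite, 'k) mpoly \<Rightarrow> ('n, 'k) mpoly set" where
  "Delta1 p s y a =
     {Delta1_sum p as + b ^ p | as b. (\<forall>c\<in>set as. p_monomial p s y c) \<and> sum_list as = a}"

end

(*
  On W_n(S), S = k[x_1,...,x_N], the logarithmic coordinates L_j = p^{-j}(w_j - sigma w_{j-1}) of a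
  lift to a polynomial ring over the integers are additive, and modulo p and p-th powers
  L_j(z) = z_j + sum_{i<j} z_i^{p^{j-i}-p} Delta_1(z_i). Hence every sequence g_0,...,g_{n-1} with
  u(g_0) = 1 and u(g_j) = 0 for j > 0 gives a splitting Phi(z) = sum_j u^{j+1}(g_j L_j(z)) of W_n(S),
  and Phi descends to S/I if and only if, for every generator x of I and i < n, the obstruction
  g_i x + sum_{j>0} u^j(g_{i+j} x^{p^j-p} Delta_1(x)) lies in I^[p^{i+1}].

  If theta^{n-1}(f^{p-1} c) is not in m^[p] and n is minimal, put h_{n-1} = f^{p-1} c (c rescaled) and
  h_i = theta(h_{i+1}): then the g_i = f^{p^{i+1}-p} h_i satisfy these conditions, because of the product
  rule for Delta_1(f^{p-1}) applied to f = x G. Conversely, a splitting on Spec S/I induces one with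
  values in the local ring at the irrelevant ideal, into which S/I embeds by the grading; clearing
  denominators, it is given by a sequence g satisfying them, with u(g_0) not in m. The colon
  ideals I^[q] : I = (f^{q-1}) + I^[q] show, by descending induction on i, that the component of g_i of
  degree (p^{i+1}-1) mu is f^{p^{i+1}-p} h_i modulo I^[p^{i+1}], where
  h_i = theta(h_{i+1}) + f^{p-1} c_i with c_i in k; so some theta^{j-1}(f^{p-1} k) with j <= n is not
  contained in m^[p].
*)
theory Submission
  imports Defs "HOL-Number_Theory.Residues"
begin

section \<open>Integral polynomials and their evaluation\<close>

text \<open>Addition and multiplication of Witt vectors are known only through ghost components,
  which lose information in characteristic p. Identities are therefore proved over the integers,
  where ghost components determine a sequence, and then evaluated in S. Since Delta_1 is a class
  modulo p-th powers, so is L_j for j > 0, whence the condition u(g_j) = 0: it gives u^{j+1}(g_j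
  r^p) = u^j(u(g_j) r) = 0. L_0 is the component z_0 itself, and u(g_0) is free to be 1.

  That deg f = mu enters through degrees. The map u sends degree p d + (p-1) mu to degree d, so
  theta preserves the degree (p-1) mu and u sends it to 0. All h_i have this degree, so every u(h_i)
  is a constant, zero or a unit; minimality of n makes it zero for i > 0. The multigrading is
  collapsed to the sum of its coordinates: each x_i then has positive weight, so the part of degree
  0 is k.

  A splitting of W_n(S/I) must also be spread out over the localizations. Because the Witt
  polynomials are isobaric, components z_i / t^{p^{i+1}} form the Witt vector F([1/t]) z, and the
  splitting is forced to be Phi(z) / t there.\<close>

lemma poly_mapping_eq_sum_single:
  "a = (\<Sum>e\<in>Poly_Mapping.keys a. Poly_Mapping.single e (Poly_Mapping.lookup a e))"
  by (rule poly_mapping_eqI)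
    (auto simp: lookup_sum lookup_single when_def in_keys_iff sum.delta' if_distrib cong: if_cong)

lemma poly_mapping_single_induct [case_names zero single add]:
  fixes a :: "'x \<Rightarrow>\<^sub>0 'b::comm_monoid_add"
  assumes "P 0" "\<And>e c. P (Poly_Mapping.single e c)" "\<And>a b. P a \<Longrightarrow> P b \<Longrightarrow> P (a + b)"
  shows "P a"
proof -
  have "finite A \<Longrightarrow> P (\<Sum>e\<in>A. Poly_Mapping.single e (Poly_Mapping.lookup a e))" for A
    by (induction A rule: finite_induct) (auto intro: assms)
  from this[OF finite_keys, of a] show ?thesis
    using poly_mapping_eq_sum_single[of a] by simp
qed

definition mpoly_monom :: "('v \<Rightarrow> 'a::comm_monoid_mult) \<Rightarrow> ('v \<Rightarrow>\<^sub>0 nat) \<Rightarrow> 'a" where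
  "mpoly_monom \<rho> e = (\<Prod>v\<in>Poly_Mapping.keys e. \<rho> v ^ Poly_Mapping.lookup e v)"

lemma mpoly_monom_superset:
  assumes "finite A" "Poly_Mapping.keys e \<subseteq> A"
  shows "mpoly_monom \<rho> e = (\<Prod>v\<in>A. \<rho> v ^ Poly_Mapping.lookup e v)"
  unfolding mpoly_monom_def using assms
  by (intro prod.mono_neutral_left) (auto simp: in_keys_iff)

lemma mpoly_monom_add: "mpoly_monom \<rho> (e + e') = mpoly_monom \<rho> e * mpoly_monom \<rho> e'"
proof -
  define A where "A = Poly_Mapping.keys e \<union> Poly_Mapping.keys e'"
  have A: "finite A" "Poly_Mapping.keys e \<subseteq> A" "Poly_Mapping.keys e' \<subseteq> A"
      "Poly_Mapping.keys (e + e') \<subseteq> A"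
    using keys_add[of e e'] by (auto simp: A_def)
  show ?thesis
    using A by (simp add: mpoly_monom_superset lookup_add power_add prod.distrib)
qed

lemma mpoly_monom_0 [simp]: "mpoly_monom \<rho> 0 = 1"
  by (simp add: mpoly_monom_def)

lemma mpoly_monom_single [simp]: "mpoly_monom \<rho> (Poly_Mapping.single v n) = \<rho> v ^ n"
  by (simp add: mpoly_monom_def)

definition ev :: "('v \<Rightarrow> 'a::comm_ring_1) \<Rightarrow> ('v, int) mpoly \<Rightarrow> 'a" where
  "ev \<rho> P = (\<Sum>e\<in>Poly_Mapping.keys P. of_int (Poly_Mapping.lookup P e) * mpoly_monom \<rho> e)"

lemma ev_superset:
  assumes "finite A" "Poly_Mapping.keys P \<subseteq> A"
  shows "ev \<rho> P = (\<Sum>e\<in>A. of_int (Poly_Mapping.lookup P e) * mpoly_monom \<rho> e)"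
  unfolding ev_def using assms by (intro sum.mono_neutral_left) (auto simp: in_keys_iff)

lemma ev_add: "ev \<rho> (P + Q) = ev \<rho> P + ev \<rho> Q"
proof -
  define A where "A = Poly_Mapping.keys P \<union> Poly_Mapping.keys Q"
  have A: "finite A" "Poly_Mapping.keys P \<subseteq> A" "Poly_Mapping.keys Q \<subseteq> A"
      "Poly_Mapping.keys (P + Q) \<subseteq> A"
    using keys_add[of P Q] by (auto simp: A_def)
  show ?thesis
    using A by (simp add: ev_superset lookup_add sum.distrib distrib_right)
qed

lemma ev_0 [simp]: "ev \<rho> 0 = 0"
  by (simp add: ev_def)

lemma ev_single: "ev \<rho> (Poly_Mapping.single e c) = of_int c * mpoly_monom \<rho> e"
  by (simp add: ev_def)

lemma ev_mult: "ev \<rho> (P * Q) = ev \<rho> P * ev \<rho> Q"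
proof (induction P rule: poly_mapping_single_induct)
  case (single e c)
  show ?case
    by (induction Q rule: poly_mapping_single_induct)
      (auto simp: ev_single mult_single mpoly_monom_add ev_add distrib_left)
qed (auto simp: ev_add distrib_right)

lemma ev_1 [simp]: "ev \<rho> 1 = 1"
  unfolding single_one[symmetric] by (simp add: ev_single del: single_one)

lemma ev_uminus: "ev \<rho> (- P) = - ev \<rho> P"
  using ev_add[of \<rho> P "- P"] by (simp add: eq_neg_iff_add_eq_0 add.commute)

lemma ev_diff: "ev \<rho> (P - Q) = ev \<rho> P - ev \<rho> Q"
  using ev_add[of \<rho> P "- Q"] by (simp add: ev_uminus)

lemma ev_power: "ev \<rho> (P ^ n) = ev \<rho> P ^ n"
  by (induction n) (auto simp: ev_mult)

lemma ev_sum: "ev \<rho> (sum g A) = (\<Sum>a\<in>A. ev \<rho> (g a))"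
  by (induction A rule: infinite_finite_induct) (auto simp: ev_add)

lemma ev_prod: "ev \<rho> (prod g A) = (\<Prod>a\<in>A. ev \<rho> (g a))"
  by (induction A rule: infinite_finite_induct) (auto simp: ev_mult)

lemma ev_of_nat [simp]: "ev \<rho> (of_nat n) = of_nat n"
  by (induction n) (auto simp: ev_add)

lemma ev_of_int [simp]: "ev \<rho> (of_int n) = of_int n"
  by (cases n) (auto simp: ev_diff ev_uminus)

lemma ev_Var [simp]: "ev \<rho> (Var v) = \<rho> v"
  by (simp add: Var_def ev_single)

lemmas ev_simps = ev_add ev_mult ev_uminus ev_diff ev_power ev_sum ev_prod

lemma ev_ring_hom:
  fixes h :: "'a::comm_ring_1 \<Rightarrow> 'b::comm_ring_1"
    and P :: "('c, int) mpoly"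
  assumes "h 1 = 1" "\<And>a b. h (a + b) = h a + h b" "\<And>a b. h (a * b) = h a * h b"
  shows "h (ev \<rho> P) = ev (\<lambda>v. h (\<rho> v)) P"
proof -
  have h0: "h 0 = 0" using assms(2)[of 0 0] by simp
  have hs: "h (sum g A) = (\<Sum>x\<in>A. h (g x))" for g :: "('c \<Rightarrow>\<^sub>0 nat) \<Rightarrow> 'a" and A
    by (induction A rule: infinite_finite_induct) (auto simp: h0 assms)
  have hp: "h (prod g A) = (\<Prod>x\<in>A. h (g x))" for g :: "'c \<Rightarrow> 'a" and A
    by (induction A rule: infinite_finite_induct) (auto simp: assms)
  have hpow: "h (a ^ n) = h a ^ n" for a n
    by (induction n) (auto simp: assms)
  have hn: "h (of_nat n) = of_nat n" for n
    by (induction n) (auto simp: h0 assms)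
  have hm: "h (- a) = - h a" for a
    using assms(2)[of a "- a"] h0 by (simp add: eq_neg_iff_add_eq_0 add.commute)
  have hi: "h (of_int n) = of_int n" for n
    by (cases n rule: int_diff_cases) (simp add: hn assms(2) hm flip: uminus_add_conv_diff)
  show ?thesis
    by (simp add: ev_def mpoly_monom_def hs assms(3) hi hp hpow)
qed

lemma ev_ev: "ev \<rho> (ev \<tau> P) = ev (\<lambda>v. ev \<rho> (\<tau> v)) P"
  by (rule ev_ring_hom) (auto simp: ev_simps)

text \<open>The polynomial ring over the integers is generated as a ring by its variables. This form
  suits congruences, which pass to sums and products, better than induction over terms.\<close>

lemma mpoly_int_induct [case_names const Var add mult]:
  fixes a :: "('v, int) mpoly"
  assumes "\<And>c. P (of_int c)" "\<And>v. P (Var v)" "\<And>a b. P a \<Longrightarrow> P b \<Longrightarrow> P (a + b)"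
    "\<And>a b. P a \<Longrightarrow> P b \<Longrightarrow> P (a * b)"
  shows "P a"
proof -
  have *: "P (Poly_Mapping.single e 1)" for e :: "'v \<Rightarrow>\<^sub>0 nat"
  proof (induction e rule: poly_mapping_single_induct)
    case zero then show ?case using assms(1)[of 1] by simp
  next
    case (single v n)
    show ?case
    proof (induction n)
      case 0 then show ?case using assms(1)[of 1] by simp
    next
      case (Suc n)
      have "Poly_Mapping.single (Poly_Mapping.single v (Suc n)) (1::int)
          = Var v * Poly_Mapping.single (Poly_Mapping.single v n) 1"
        by (simp add: Var_def mult_single flip: single_add)
      then show ?case using assms(2,4) Suc by simp
    qed
  next
    case (add a b)
    then show ?case using assms(4)[of "Poly_Mapping.single a 1" "Poly_Mapping.single b 1"]
      by (simp add: mult_single)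
  qed
  show ?thesis
  proof (induction a rule: poly_mapping_single_induct)
    case (single e c)
    have "Poly_Mapping.single e c = of_int c * Poly_Mapping.single e 1"
      by (simp add: mult_single flip: single_of_int)
    then show ?case using assms(1,4) * by simp
  qed (use assms(1)[of 0] assms(3) in auto)
qed

text \<open>Integral polynomials are torsion-free. This is what lifting to them buys: powers of p
  can be cancelled, which is impossible in the characteristic p rings where the results are
  applied.\<close>

lemma mpoly_of_nat_mult_cancel:
  fixes a b :: "('v, int) mpoly"
  assumes "of_nat n * a = of_nat n * b" "n > 0"
  shows "a = b"
proof -
  have *: "of_nat n * c = Poly_Mapping.map ((*) (int n)) c" for c :: "('v, int) mpoly"
    by (simp add: mult_map_scale_conv_mult)
  show ?thesis
  proof (rule poly_mapping_eqI)
    fix e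
    have "Poly_Mapping.lookup (of_nat n * a) e = Poly_Mapping.lookup (of_nat n * b) e"
      using assms(1) by simp
    then show "Poly_Mapping.lookup a e = Poly_Mapping.lookup b e"
      unfolding * using assms(2) by (simp add: Poly_Mapping.map.rep_eq when_def split: if_splits)
  qed
qed

lemma mpoly_of_nat_power_mult_cancel:
  fixes a b :: "('v, int) mpoly"
  assumes "of_nat p ^ n * a = of_nat p ^ n * b" "p > 0"
  shows "a = b"
  using mpoly_of_nat_mult_cancel[of "p ^ n" a b] assms by simp

section \<open>Ghost components and the universal Witt polynomials\<close>

text \<open>The integral form of $((a+b)^p - a^p - b^p)/p$; the division is exact for prime \<open>p\<close>.\<close>

definition cocyc :: "nat \<Rightarrow> 'a::comm_ring_1 \<Rightarrow> 'a \<Rightarrow> 'a" where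
  "cocyc p a b = (\<Sum>i\<in>{1..<p}. of_nat ((p choose i) div p) * a ^ i * b ^ (p - i))"

lemma add_power_prime:
  fixes a b :: "'a::comm_ring_1"
  assumes "prime p"
  shows "(a + b) ^ p = a ^ p + b ^ p + of_nat p * cocyc p a b"
proof -
  have p: "p > 0" using assms prime_gt_0_nat by blast
  have ch: "of_nat (p choose i) = (of_nat p * of_nat ((p choose i) div p) :: 'a)" if "i \<in> {1..<p}" for i
  proof -
    have "p dvd (p choose i)" using that assms by (intro dvd_choose_prime) auto
    then show ?thesis by (simp flip: of_nat_mult)
  qed
  have "(a + b) ^ p = (\<Sum>i\<le>p. of_nat (p choose i) * a ^ i * b ^ (p - i))"
    by (rule binomial_ring)
  also have "{..p} = insert 0 (insert p {1..<p})" using p by auto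
  also have "(\<Sum>i\<in>\<dots>. of_nat (p choose i) * a ^ i * b ^ (p - i)) =
      a ^ p + b ^ p + (\<Sum>i\<in>{1..<p}. of_nat (p choose i) * a ^ i * b ^ (p - i))"
    using p by simp
  also have "(\<Sum>i\<in>{1..<p}. of_nat (p choose i) * a ^ i * b ^ (p - i)) = of_nat p * cocyc p a b"
    unfolding cocyc_def sum_distrib_left by (rule sum.cong) (auto simp: ch mult.assoc)
  finally show ?thesis .
qed

text \<open>Each p-th power gains one factor p: A^p - B^p is A - B times a sum of p products, and
  modulo p all of these equal B^{p-1} because A and B agree there.\<close>

lemma dvd_diff_power_prime:
  fixes a b :: "'a::comm_ring_1"
  assumes "of_nat p dvd a - b"
  shows "of_nat p ^ Suc m dvd a ^ (p ^ m) - b ^ (p ^ m)"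
proof (induction m)
  case 0
  then show ?case using assms by simp
next
  case (Suc m)
  define A B where "A = a ^ (p ^ m)" and "B = b ^ (p ^ m)"
  have AB: "of_nat p ^ Suc m dvd A - B" using Suc by (simp add: A_def B_def)
  then have p_AB: "of_nat p dvd A - B" by (auto intro: dvd_trans[rotated])
  have pow: "of_nat p dvd A ^ i - B ^ i" for i
    using p_AB unfolding power_diff_sumr2[of A i B] by simp
  have "(\<Sum>i<p. B ^ (p - Suc i) * A ^ i) =
      (\<Sum>i<p. B ^ (p - Suc i) * (A ^ i - B ^ i)) + of_nat p * B ^ (p - 1)"
  proof -
    have "(\<Sum>i<p. B ^ (p - Suc i) * B ^ i) = (\<Sum>i<p. B ^ (p - 1))"
      by (rule sum.cong) (auto simp flip: power_add)
    then show ?thesis by (simp add: right_diff_distrib sum_subtractf)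
  qed
  moreover have "of_nat p dvd \<dots>" by (intro dvd_add dvd_sum) (auto intro: dvd_mult pow)
  ultimately have "of_nat p dvd (\<Sum>i<p. B ^ (p - Suc i) * A ^ i)" by simp
  then have "of_nat p ^ Suc m * of_nat p dvd (A - B) * (\<Sum>i<p. B ^ (p - Suc i) * A ^ i)"
    using AB by (rule mult_dvd_mono[rotated])
  then have "of_nat p ^ Suc (Suc m) dvd A ^ p - B ^ p"
    by (simp add: power_diff_sumr2[of A p B] mult.commute)
  then show ?case by (simp add: A_def B_def mult.commute flip: power_mult)
qed

definition frob_lift :: "nat \<Rightarrow> ('v, int) mpoly \<Rightarrow> ('v, int) mpoly" where
  "frob_lift p = ev (\<lambda>v. Var v ^ p)"

lemma frob_lift_simps:
  "frob_lift p (a + b) = frob_lift p a + frob_lift p b"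
  "frob_lift p (a * b) = frob_lift p a * frob_lift p b"
  "frob_lift p (a - b) = frob_lift p a - frob_lift p b"
  "frob_lift p (a ^ n) = frob_lift p a ^ n"
  "frob_lift p (of_nat n) = of_nat n"
  "frob_lift p 0 = 0" "frob_lift p 1 = 1"
  "frob_lift p (Var v) = Var v ^ p"
  "frob_lift p (sum g A) = (\<Sum>x\<in>A. frob_lift p (g x))"
  by (auto simp: frob_lift_def ev_simps)

lemma prime_dvd_int_power_diff:
  assumes "prime p"
  shows "int p dvd c ^ p - c"
proof -
  have "[c ^ p = c] (mod int p)"
  proof (cases "int p dvd c")
    case True
    then have "int p dvd c ^ p" using prime_gt_0_nat[OF assms] by (cases p) auto
    then show ?thesis using True by (simp add: cong_iff_dvd_diff)
  next
    case False
    have "[c ^ (p - 1) = 1] (mod int p)"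
    proof -
      have "c mod int p \<noteq> 0" using False by presburger
      moreover have "0 \<le> c mod int p" "c mod int p < int p" using prime_gt_0_nat[OF assms] by auto
      ultimately have "0 < nat (c mod int p)" "nat (c mod int p) < p" by linarith+
      then have "\<not> p dvd nat (c mod int p)" by (rule nat_dvd_not_less)
      then have "[nat (c mod int p) ^ (p - 1) = 1] (mod p)"
        by (rule fermat_theorem[OF assms])
      then have "[int (nat (c mod int p) ^ (p - 1)) = int 1] (mod int p)"
        by (simp only: cong_int_iff)
      then have "[int (nat (c mod int p)) ^ (p - 1) = 1] (mod int p)"
        by (simp only: of_nat_power of_nat_1)
      moreover have "int (nat (c mod int p)) = c mod int p"
        using prime_gt_0_nat[OF assms] by simp
      ultimately show ?thesis by (simp add: cong_def power_mod)
    qed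
    then have "[c * c ^ (p - 1) = c * 1] (mod int p)" by (rule cong_scalar_left)
    then show ?thesis using prime_gt_0_nat[OF assms] by (cases p) auto
  qed
  then show ?thesis by (simp add: cong_iff_dvd_diff)
qed

text \<open>Both sides are multiplicative, and additive modulo p by the binomial theorem; they agree
  on variables, and on integers this is Fermat's little theorem.\<close>

lemma frob_lift_cong:
  assumes "prime p"
  shows "of_nat p dvd a ^ p - frob_lift p a"
proof (induction a rule: mpoly_int_induct)
  case (const c)
  have "int p dvd c ^ p - c" by (rule prime_dvd_int_power_diff[OF assms])
  then obtain k where "c ^ p - c = int p * k" by (elim dvdE)
  then have "(of_int (c ^ p - c) :: ('a, int) mpoly) = of_nat p * of_int k"
    by (simp only: of_int_mult of_int_of_nat_eq)
  then show ?case by (simp add: frob_lift_def)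
next
  case (add a b)
  have "(a + b) ^ p - frob_lift p (a + b) =
      (a ^ p - frob_lift p a) + (b ^ p - frob_lift p b) + of_nat p * cocyc p a b"
    by (simp add: add_power_prime[OF assms] frob_lift_simps)
  then show ?case using add by simp
next
  case (mult a b)
  have "(a * b) ^ p - frob_lift p (a * b) =
      a ^ p * (b ^ p - frob_lift p b) + frob_lift p b * (a ^ p - frob_lift p a)"
    by (simp add: power_mult_distrib frob_lift_simps algebra_simps)
  then show ?case using mult by simp
qed (simp add: frob_lift_simps)

lemma ghost_0 [simp]: "ghost p z 0 = z 0"
  by (simp add: ghost_def)

lemma ghost_split: "ghost p z n = (\<Sum>i<n. of_nat p ^ i * z i ^ (p ^ (n - i))) + of_nat p ^ n * z n"
  by (simp add: ghost_def flip: lessThan_Suc_atMost)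

lemma ghost_Suc: "ghost p z (Suc n) = ghost p (\<lambda>i. z i ^ p) n + of_nat p ^ Suc n * z (Suc n)"
proof -
  have "(\<Sum>i<Suc n. of_nat p ^ i * z i ^ (p ^ (Suc n - i))) = ghost p (\<lambda>i. z i ^ p) n"
    unfolding ghost_def lessThan_Suc_atMost
    by (rule sum.cong) (auto simp: Suc_diff_le simp flip: power_mult)
  then show ?thesis by (simp only: ghost_split)
qed

lemma ghost_ring_hom:
  fixes h :: "'a::comm_ring_1 \<Rightarrow> 'b::comm_ring_1"
  assumes "h 1 = 1" "\<And>a b. h (a + b) = h a + h b" "\<And>a b. h (a * b) = h a * h b"
  shows "h (ghost p z n) = ghost p (\<lambda>i. h (z i)) n"
proof -
  have h0: "h 0 = 0" using assms(2)[of 0 0] by simp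
  have hs: "h (sum g A) = (\<Sum>x\<in>A. h (g x))" for g :: "nat \<Rightarrow> 'a" and A
    by (induction A rule: infinite_finite_induct) (auto simp: h0 assms)
  have hpow: "h (a ^ n) = h a ^ n" for a n
    by (induction n) (auto simp: assms)
  have hn: "h (of_nat n) = of_nat n" for n
    by (induction n) (auto simp: h0 assms)
  show ?thesis by (simp add: ghost_def hs assms(3) hpow hn)
qed

lemma frob_lift_ghost: "frob_lift p (ghost p z n) = ghost p (\<lambda>i. frob_lift p (z i)) n"
  by (rule ghost_ring_hom) (auto simp: frob_lift_simps)

lemma ev_ghost: "ev \<rho> (ghost p z n) = ghost p (\<lambda>i. ev \<rho> (z i)) n"
  by (rule ghost_ring_hom) (auto simp: ev_simps)

text \<open>The term with index i carries p^i, and the p^{n-i}-th powers of two elements congruent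
  modulo p agree modulo p^{n-i+1}.\<close>

lemma ghost_frob_cong:
  assumes "prime p"
  shows "of_nat p ^ Suc n dvd ghost p (\<lambda>i. z i ^ p) n - frob_lift p (ghost p z n)"
proof -
  have "of_nat p ^ Suc n dvd of_nat p ^ i * (z i ^ p) ^ (p ^ (n - i))
      - of_nat p ^ i * frob_lift p (z i) ^ (p ^ (n - i))" if "i \<le> n" for i
  proof -
    have "of_nat p ^ i * of_nat p ^ Suc (n - i) dvd
        of_nat p ^ i * ((z i ^ p) ^ (p ^ (n - i)) - frob_lift p (z i) ^ (p ^ (n - i)))"
      by (intro mult_dvd_mono dvd_diff_power_prime frob_lift_cong assms) simp
    moreover have "of_nat p ^ i * of_nat p ^ Suc (n - i) = (of_nat p ^ Suc n :: ('a, int) mpoly)"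
      unfolding power_add[symmetric] using that by (simp del: power_Suc)
    ultimately show ?thesis by (simp only: right_diff_distrib)
  qed
  then show ?thesis
    unfolding frob_lift_ghost unfolding ghost_def sum_subtractf[symmetric]
    by (intro dvd_sum) auto
qed

lemma ghost_dwork:
  assumes "prime p"
  shows "of_nat p ^ Suc n dvd ghost p z (Suc n) - frob_lift p (ghost p z n)"
proof -
  have "ghost p z (Suc n) - frob_lift p (ghost p z n) =
      (ghost p (\<lambda>i. z i ^ p) n - frob_lift p (ghost p z n)) + of_nat p ^ Suc n * z (Suc n)"
    by (simp add: ghost_Suc)
  then show ?thesis by (simp only:) (intro dvd_add ghost_frob_cong assms dvd_triv_left)
qed

text \<open>The ghost map is triangular with p^n in front of the new component, and p^n can be
  cancelled.\<close>

lemma ghost_inj: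
  fixes z z' :: "nat \<Rightarrow> ('v, int) mpoly"
  assumes "p > 0" "\<And>n. ghost p z n = ghost p z' n"
  shows "z = z'"
proof
  fix n show "z n = z' n"
  proof (induction n rule: less_induct)
    case (less n)
    then have "(\<Sum>i<n. of_nat p ^ i * z i ^ (p ^ (n - i))) = (\<Sum>i<n. of_nat p ^ i * z' i ^ (p ^ (n - i)))"
      by (intro sum.cong) auto
    then have "of_nat p ^ n * z n = of_nat p ^ n * z' n"
      using assms(2)[of n] by (simp add: ghost_split)
    then show ?case using assms(1) by (rule mpoly_of_nat_power_mult_cancel)
  qed
qed

text \<open>Dwork's lemma, the converse of \<open>ghost_dwork\<close>. Once the components up to m
  realize w_m, \<open>ghost_frob_cong\<close> makes the remainder of w_{m+1} divisible by p^{m+1},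
  and the quotient is the next component.\<close>

lemma dwork_exists:
  fixes w :: "nat \<Rightarrow> ('v, int) mpoly"
  assumes "prime p" "\<And>n. of_nat p ^ Suc n dvd w (Suc n) - frob_lift p (w n)"
  shows "\<exists>z. \<forall>n. ghost p z n = w n"
proof -
  define Q where "Q f n r \<longleftrightarrow> (\<Sum>i<n. of_nat p ^ i * f i ^ (p ^ (n - i))) + of_nat p ^ n * r = w n"
    for f :: "nat \<Rightarrow> ('v, int) mpoly" and n r
  have "\<exists>z. \<forall>n. Q z n (z n)"
  proof (rule dependent_wf_choice)
    show "wf {(x, y). x < (y::nat)}" by (rule wf)
    show "Q f n r = Q g n r" if "\<And>z. (z, n) \<in> {(x, y). x < y} \<Longrightarrow> f z = g z" for f g n r
      using that by (auto simp: Q_def intro!: sum.cong arg_cong[where f="\<lambda>x. x + _ = _"])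
    show "\<exists>r. Q f n r" if *: "\<And>y. (y, n) \<in> {(x, y). x < y} \<Longrightarrow> Q f y (f y)" for f n
    proof (cases n)
      case 0
      then show ?thesis by (auto simp: Q_def)
    next
      case (Suc m)
      have "ghost p f m = w m" using *[of m] Suc by (simp add: Q_def ghost_split)
      then have "of_nat p ^ Suc m dvd ghost p (\<lambda>i. f i ^ p) m - frob_lift p (w m)"
        using ghost_frob_cong[OF assms(1), of m f] by simp
      then have "of_nat p ^ Suc m dvd
          (w (Suc m) - frob_lift p (w m)) - (ghost p (\<lambda>i. f i ^ p) m - frob_lift p (w m))"
        by (rule dvd_diff[OF assms(2)])
      then obtain r where "w (Suc m) - ghost p (\<lambda>i. f i ^ p) m = of_nat p ^ Suc m * r"
        by (auto elim: dvdE simp del: power_Suc)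
      then have "ghost p (\<lambda>i. f i ^ p) m + of_nat p ^ Suc m * r = w (Suc m)"
        by (simp add: algebra_simps)
      moreover have "ghost p (\<lambda>i. f i ^ p) m = (\<Sum>i<Suc m. of_nat p ^ i * f i ^ (p ^ (Suc m - i)))"
        unfolding ghost_def lessThan_Suc_atMost
        by (rule sum.cong) (auto simp: Suc_diff_le simp flip: power_mult)
      ultimately show ?thesis unfolding Suc Q_def by metis
    qed
  qed
  then show ?thesis by (auto simp: Q_def ghost_split)
qed

text \<open>\<open>dwork_exists\<close> and \<open>ghost_inj\<close> give existence and uniqueness,
  so the definite description in \<open>witt_add_poly\<close> denotes.\<close>

lemma ghost_witt_add:
  assumes "prime p"
  shows "ghost p (witt_add_poly p) n =
    ghost p (\<lambda>i. Var (Inl i)) n + ghost p (\<lambda>i. Var (Inr i)) n"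
proof -
  let ?w = "\<lambda>n. ghost p (\<lambda>i. Var (Inl i)) n + ghost p (\<lambda>i. Var (Inr i)) n :: witt_poly"
  have "\<exists>z. \<forall>n. ghost p z n = ?w n"
  proof (rule dwork_exists[OF assms])
    fix n
    have "?w (Suc n) - frob_lift p (?w n) =
      (ghost p (\<lambda>i. Var (Inl i)) (Suc n) - frob_lift p (ghost p (\<lambda>i. Var (Inl i)) n)) +
      (ghost p (\<lambda>i. Var (Inr i)) (Suc n) - frob_lift p (ghost p (\<lambda>i. Var (Inr i)) n))"
      by (simp add: frob_lift_simps)
    then show "of_nat p ^ Suc n dvd ?w (Suc n) - frob_lift p (?w n)"
      by (simp only:) (intro dvd_add ghost_dwork assms)
  qed
  then have "\<exists>!z. \<forall>n. ghost p z n = ?w n"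
    by (auto intro!: ghost_inj[OF prime_gt_0_nat[OF assms]])
  from theI'[OF this] show ?thesis unfolding witt_add_poly_def by blast
qed

lemma ghost_witt_mult:
  assumes "prime p"
  shows "ghost p (witt_mult_poly p) n =
    ghost p (\<lambda>i. Var (Inl i)) n * ghost p (\<lambda>i. Var (Inr i)) n"
proof -
  let ?w = "\<lambda>n. ghost p (\<lambda>i. Var (Inl i)) n * ghost p (\<lambda>i. Var (Inr i)) n :: witt_poly"
  have "\<exists>z. \<forall>n. ghost p z n = ?w n"
  proof (rule dwork_exists[OF assms])
    fix n
    let ?a = "ghost p (\<lambda>i. Var (Inl i)) :: nat \<Rightarrow> witt_poly" and ?b = "ghost p (\<lambda>i. Var (Inr i)) :: nat \<Rightarrow> witt_poly"
    have "?w (Suc n) - frob_lift p (?w n) =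
      ?a (Suc n) * (?b (Suc n) - frob_lift p (?b n)) + frob_lift p (?b n) * (?a (Suc n) - frob_lift p (?a n))"
      by (simp add: frob_lift_simps algebra_simps)
    then show "of_nat p ^ Suc n dvd ?w (Suc n) - frob_lift p (?w n)"
      by (simp only:) (intro dvd_add dvd_mult ghost_dwork assms)
  qed
  then have "\<exists>!z. \<forall>n. ghost p z n = ?w n"
    by (auto intro!: ghost_inj[OF prime_gt_0_nat[OF assms]])
  from theI'[OF this] show ?thesis unfolding witt_mult_poly_def by blast
qed

section \<open>Isobaric integral polynomials and the weights of the Witt polynomials\<close>

definition isobaric :: "('v \<Rightarrow> nat) \<Rightarrow> 'v set \<Rightarrow> nat \<Rightarrow> ('v, int) mpoly \<Rightarrow> bool" where
  "isobaric wt V k P \<longleftrightarrow> (\<forall>e\<in>Poly_Mapping.keys P. Poly_Mapping.keys e \<subseteq> V \<and>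
     (\<Sum>v\<in>Poly_Mapping.keys e. wt v * Poly_Mapping.lookup e v) = k)"

lemma weight_superset:
  fixes wt :: "'v \<Rightarrow> nat"
  assumes "finite A" "Poly_Mapping.keys e \<subseteq> A"
  shows "(\<Sum>v\<in>Poly_Mapping.keys e. wt v * Poly_Mapping.lookup e v) =
    (\<Sum>v\<in>A. wt v * Poly_Mapping.lookup e v)"
  using assms by (intro sum.mono_neutral_left) (auto simp: in_keys_iff)

lemma weight_add:
  fixes wt :: "'v \<Rightarrow> nat"
  shows "(\<Sum>v\<in>Poly_Mapping.keys (e + e'). wt v * Poly_Mapping.lookup (e + e') v) =
    (\<Sum>v\<in>Poly_Mapping.keys e. wt v * Poly_Mapping.lookup e v) +
    (\<Sum>v\<in>Poly_Mapping.keys e'. wt v * Poly_Mapping.lookup e' v)"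
proof -
  define A where "A = Poly_Mapping.keys e \<union> Poly_Mapping.keys e'"
  have A: "finite A" "Poly_Mapping.keys e \<subseteq> A" "Poly_Mapping.keys e' \<subseteq> A"
      "Poly_Mapping.keys (e + e') \<subseteq> A"
    using keys_add[of e e'] by (auto simp: A_def)
  show ?thesis
    unfolding weight_superset[OF A(1,2)] weight_superset[OF A(1,3)] weight_superset[OF A(1,4)]
    by (simp add: lookup_add distrib_left sum.distrib)
qed

lemma isobaric_0: "isobaric wt V k 0"
  by (simp add: isobaric_def)

lemma isobaric_add: "isobaric wt V k P \<Longrightarrow> isobaric wt V k Q \<Longrightarrow> isobaric wt V k (P + Q)"
  using keys_add[of P Q] by (force simp: isobaric_def)

lemma isobaric_diff: "isobaric wt V k P \<Longrightarrow> isobaric wt V k Q \<Longrightarrow> isobaric wt V k (P - Q)"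
  using keys_diff[of P Q] by (force simp: isobaric_def)

lemma isobaric_sum: "(\<And>a. a \<in> A \<Longrightarrow> isobaric wt V k (g a)) \<Longrightarrow> isobaric wt V k (sum g A)"
  by (induction A rule: infinite_finite_induct) (auto intro: isobaric_0 isobaric_add)

lemma isobaric_1: "isobaric wt V 0 1"
  by (simp add: isobaric_def)

lemma isobaric_mult:
  assumes "isobaric wt V k P" "isobaric wt V l Q"
  shows "isobaric wt V (k + l) (P * Q)"
  unfolding isobaric_def
proof
  fix e assume "e \<in> Poly_Mapping.keys (P * Q)"
  then obtain a b where ab: "e = a + b" "a \<in> Poly_Mapping.keys P" "b \<in> Poly_Mapping.keys Q"
    using keys_mult[of P Q] by blast
  then show "Poly_Mapping.keys e \<subseteq> V \<and>
      (\<Sum>v\<in>Poly_Mapping.keys e. wt v * Poly_Mapping.lookup e v) = k + l"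
    using assms keys_add[of a b] by (fastforce simp: isobaric_def weight_add)
qed

lemma isobaric_power: "isobaric wt V k P \<Longrightarrow> isobaric wt V (k * n) (P ^ n)"
  by (induction n) (auto simp: isobaric_1 isobaric_mult)

lemma lookup_of_nat_mult:
  "Poly_Mapping.lookup (of_nat n * (P :: ('v, int) mpoly)) e = int n * Poly_Mapping.lookup P e"
proof -
  have "of_nat n * P = Poly_Mapping.map ((*) (int n)) P"
    by (simp add: mult_map_scale_conv_mult)
  then show ?thesis by (simp add: Poly_Mapping.map.rep_eq when_def)
qed

lemma isobaric_of_nat_mult:
  "isobaric wt V k P \<Longrightarrow> isobaric wt V k (of_nat n * P)"
  by (auto simp: isobaric_def in_keys_iff lookup_of_nat_mult)

lemma isobaric_of_nat_mult_cancel: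
  "n > 0 \<Longrightarrow> isobaric wt V k (of_nat n * P) \<Longrightarrow> isobaric wt V k P"
  by (auto simp: isobaric_def in_keys_iff lookup_of_nat_mult)

lemma isobaric_Var: "v \<in> V \<Longrightarrow> isobaric wt V (wt v) (Var v)"
  by (simp add: isobaric_def Var_def)

lemma isobaric_ghost:
  assumes "\<And>i. i \<le> n \<Longrightarrow> isobaric wt V (p ^ i * d) (z i)"
  shows "isobaric wt V (p ^ n * d) (ghost p z n)"
proof -
  have "isobaric wt V (p ^ n * d) (of_nat p ^ i * z i ^ (p ^ (n - i)))" if "i \<le> n" for i
  proof -
    have "isobaric wt V (p ^ i * d * p ^ (n - i)) (of_nat (p ^ i) * z i ^ (p ^ (n - i)))"
      using assms that by (intro isobaric_of_nat_mult isobaric_power) auto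
    moreover have "p ^ i * d * p ^ (n - i) = p ^ n * d"
      using that by (metis le_add_diff_inverse mult.assoc mult.commute power_add)
    ultimately show ?thesis by simp
  qed
  then show ?thesis unfolding ghost_def by (intro isobaric_sum) auto
qed

text \<open>Solving the triangular system for the last component preserves weights, since division
  by p^n does not change which monomials occur. The variable sets grow with the index so that
  earlier components may be substituted.\<close>

lemma isobaric_of_ghost:
  fixes z :: "nat \<Rightarrow> ('v, int) mpoly"
  assumes "p > 0" "\<And>i. isobaric wt (V i) (p ^ i * d) (ghost p z i)" "\<And>i j. i \<le> j \<Longrightarrow> V i \<subseteq> V j"
  shows "isobaric wt (V n) (p ^ n * d) (z n)"
proof (induction n rule: less_induct)
  case (less n)
  have V: "isobaric wt (V n) k P" if "isobaric wt (V i) k P" "i < n" for i k P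
    using that assms(3)[of i n] by (fastforce simp: isobaric_def)
  have "isobaric wt (V n) (p ^ n * d) (of_nat p ^ i * z i ^ (p ^ (n - i)))" if "i < n" for i
  proof -
    have "isobaric wt (V n) (p ^ i * d * p ^ (n - i)) (of_nat (p ^ i) * z i ^ (p ^ (n - i)))"
      using less V that by (intro isobaric_of_nat_mult isobaric_power) auto
    moreover have "p ^ i * d * p ^ (n - i) = p ^ n * d"
      using that by (metis le_add_diff_inverse less_imp_le mult.assoc mult.commute power_add)
    ultimately show ?thesis by simp
  qed
  then have "isobaric wt (V n) (p ^ n * d)
      (ghost p z n - (\<Sum>i<n. of_nat p ^ i * z i ^ (p ^ (n - i))))"
    using assms(2) by (intro isobaric_diff isobaric_sum) auto
  then have "isobaric wt (V n) (p ^ n * d) (of_nat (p ^ n) * z n)"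
    by (simp add: ghost_split)
  then show ?case using assms(1) isobaric_of_nat_mult_cancel[of "p ^ n"] by simp
qed

definition witt_vars :: "nat \<Rightarrow> (nat + nat) set" where
  "witt_vars n = Inl ` {..n} \<union> Inr ` {..n}"

lemma isobaric_ghost_Var:
  assumes "\<And>i. i \<le> n \<Longrightarrow> v i \<in> V" "\<And>i. i \<le> n \<Longrightarrow> wt (v i) = p ^ i * d"
  shows "isobaric wt V (p ^ n * d) (ghost p (\<lambda>i. Var (v i)) n)"
  by (rule isobaric_ghost) (metis assms isobaric_Var)

text \<open>Isobaricity serves two purposes. The bound on the variables says that component n of a
  sum involves only components up to n, so evaluation at lists is meaningful; the weight p^n gives
  the scaling law by which denominators are cleared.\<close>

lemma isobaric_witt_add:
  assumes "prime p"
  shows "isobaric (case_sum ((^) p) ((^) p)) (witt_vars n) (p ^ n) (witt_add_poly p n)"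
proof -
  have "isobaric (case_sum ((^) p) ((^) p)) (witt_vars n) (p ^ n * 1) (witt_add_poly p n)"
  proof (rule isobaric_of_ghost)
    fix i show "isobaric (case_sum ((^) p) ((^) p)) (witt_vars i) (p ^ i * 1) (ghost p (witt_add_poly p) i)"
      unfolding ghost_witt_add[OF assms]
      by (intro isobaric_add isobaric_ghost_Var) (auto simp: witt_vars_def)
  qed (use assms prime_gt_0_nat in \<open>auto simp: witt_vars_def\<close>)
  then show ?thesis by simp
qed

text \<open>The product polynomials are bihomogeneous, so the two families of variables may be
  weighted independently by a and b: (1, 0) and (0, 1) scale one factor at a time, and (0, 0) keeps
  only the bound on the variables.\<close>

lemma isobaric_witt_mult:
  assumes "prime p"
  shows "isobaric (case_sum (\<lambda>i. p ^ i * a) (\<lambda>i. p ^ i * b)) (witt_vars n) (p ^ n * (a + b)) (witt_mult_poly p n)"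
proof (rule isobaric_of_ghost)
  fix i show "isobaric (case_sum (\<lambda>i. p ^ i * a) (\<lambda>i. p ^ i * b)) (witt_vars i) (p ^ i * (a + b))
      (ghost p (witt_mult_poly p) i)"
    unfolding ghost_witt_mult[OF assms] distrib_left
    by (intro isobaric_mult isobaric_ghost_Var) (auto simp: witt_vars_def)
qed (use assms prime_gt_0_nat in \<open>auto simp: witt_vars_def\<close>)

section \<open>Evaluation in commutative rings\<close>

lemma (in cring) eval_int_poly_closed: "eval_int_poly R P \<rho> \<in> carrier R"
  if "\<And>v. v \<in> V \<Longrightarrow> \<rho> v \<in> carrier R" "isobaric wt V k P"
  unfolding eval_int_poly_def using that
  by (intro finsum_closed Pi_I add.int_pow_closed finprod_closed nat_pow_closed)
    (auto simp: isobaric_def)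

lemma eval_int_poly_cong:
  assumes "cring R" "isobaric wt V k P" "\<And>v. v \<in> V \<Longrightarrow> \<rho> v = \<tau> v" "\<And>v. v \<in> V \<Longrightarrow> \<tau> v \<in> carrier R"
  shows "eval_int_poly R P \<rho> = eval_int_poly R P \<tau>"
proof -
  interpret cring R by fact
  show ?thesis
    unfolding eval_int_poly_def using assms(2-4)
    by (intro finsum_cong' refl arg_cong[where f="add_pow R _"] finprod_cong' Pi_I
        add.int_pow_closed finprod_closed nat_pow_closed)
      (auto simp: isobaric_def subset_eq)
qed

lemma eval_int_poly_hom:
  assumes "cring R" "cring R'" "h \<in> ring_hom R R'" "isobaric wt V k P" "\<And>v. v \<in> V \<Longrightarrow> \<rho> v \<in> carrier R"
  shows "h (eval_int_poly R P \<rho>) = eval_int_poly R' P (\<lambda>v. h (\<rho> v))"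
proof -
  interpret R: cring R by fact
  interpret R': cring R' by fact
  interpret h: ring_hom_cring R R' h using assms by (intro ring_hom_cringI)
  have hpow: "h (a [^]\<^bsub>R\<^esub> n) = h a [^]\<^bsub>R'\<^esub> n" if "a \<in> carrier R" for a and n :: nat
    using that by simp
  have hint: "h ([m] \<cdot>\<^bsub>R\<^esub> a) = [m] \<cdot>\<^bsub>R'\<^esub> h a" if "a \<in> carrier R" for a and m :: int
  proof -
    have "h ([n] \<cdot>\<^bsub>R\<^esub> a) = [n] \<cdot>\<^bsub>R'\<^esub> h a" for n :: nat
      using that by (induction n) auto
    then show ?thesis using that
      by (cases m rule: int_cases2) (auto simp: R.add.int_pow_neg R'.add.int_pow_neg add_pow_int_ge)
  qed
  show ?thesis
    unfolding eval_int_poly_def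
  proof (subst h.hom_finsum)
    show "(\<lambda>e. [poly_mapping.lookup P e] \<cdot>\<^bsub>R\<^esub> (\<Otimes>\<^bsub>R\<^esub>v\<in>Poly_Mapping.keys e. \<rho> v [^]\<^bsub>R\<^esub> poly_mapping.lookup e v))
      \<in> Poly_Mapping.keys P \<rightarrow> carrier R"
      using assms(4,5) by (intro Pi_I R.add.int_pow_closed R.finprod_closed R.nat_pow_closed)
        (auto simp: isobaric_def)
  next
    show "finsum R' (h \<circ> (\<lambda>e. [poly_mapping.lookup P e] \<cdot>\<^bsub>R\<^esub> (\<Otimes>\<^bsub>R\<^esub>v\<in>Poly_Mapping.keys e. \<rho> v [^]\<^bsub>R\<^esub> poly_mapping.lookup e v)))
       (Poly_Mapping.keys P) =
      (\<Oplus>\<^bsub>R'\<^esub>e\<in>Poly_Mapping.keys P. [poly_mapping.lookup P e] \<cdot>\<^bsub>R'\<^esub>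
         (\<Otimes>\<^bsub>R'\<^esub>v\<in>Poly_Mapping.keys e. h (\<rho> v) [^]\<^bsub>R'\<^esub> poly_mapping.lookup e v))"
    proof (rule R'.finsum_cong')
      fix e assume e: "e \<in> Poly_Mapping.keys P"
      then have \<rho>: "\<rho> v \<in> carrier R" if "v \<in> Poly_Mapping.keys e" for v
        using assms(4,5) that by (auto simp: isobaric_def)
      show "(h \<circ> (\<lambda>e. [poly_mapping.lookup P e] \<cdot>\<^bsub>R\<^esub> (\<Otimes>\<^bsub>R\<^esub>v\<in>Poly_Mapping.keys e. \<rho> v [^]\<^bsub>R\<^esub> poly_mapping.lookup e v))) e =
        [poly_mapping.lookup P e] \<cdot>\<^bsub>R'\<^esub> (\<Otimes>\<^bsub>R'\<^esub>v\<in>Poly_Mapping.keys e. h (\<rho> v) [^]\<^bsub>R'\<^esub> poly_mapping.lookup e v)"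
        using \<rho> by (auto simp: hint R.finprod_closed h.hom_finprod hpow Pi_def intro!: arg_cong[where f="add_pow R' _"] R'.finprod_cong')
    next
      show "(\<lambda>e. [poly_mapping.lookup P e] \<cdot>\<^bsub>R'\<^esub> (\<Otimes>\<^bsub>R'\<^esub>v\<in>Poly_Mapping.keys e. h (\<rho> v) [^]\<^bsub>R'\<^esub> poly_mapping.lookup e v))
        \<in> Poly_Mapping.keys P \<rightarrow> carrier R'"
        using assms(4,5) by (intro Pi_I R'.add.int_pow_closed R'.finprod_closed R'.nat_pow_closed h.hom_closed)
          (auto simp: isobaric_def)
    qed simp
  qed
qed

text \<open>For the Witt polynomials, whose variables of index j have weight p^j, this expresses
  that the operations are compatible with multiplication by a Teichmueller representative.\<close>

lemma eval_int_poly_scale: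
  assumes "cring R" "isobaric wt V k P" "\<And>v. v \<in> V \<Longrightarrow> \<rho> v \<in> carrier R" "r \<in> carrier R"
  shows "eval_int_poly R P (\<lambda>v. r [^]\<^bsub>R\<^esub> wt v \<otimes>\<^bsub>R\<^esub> \<rho> v) = r [^]\<^bsub>R\<^esub> k \<otimes>\<^bsub>R\<^esub> eval_int_poly R P \<rho>"
proof -
  interpret R: cring R by fact
  let ?m = "\<lambda>e. \<Otimes>\<^bsub>R\<^esub>v\<in>Poly_Mapping.keys e. \<rho> v [^]\<^bsub>R\<^esub> poly_mapping.lookup e v"
  have m: "?m e \<in> carrier R" if "e \<in> Poly_Mapping.keys P" for e
    using assms that by (intro R.finprod_closed) (auto simp: isobaric_def)
  have "(\<Otimes>\<^bsub>R\<^esub>v\<in>Poly_Mapping.keys e. (r [^]\<^bsub>R\<^esub> wt v \<otimes>\<^bsub>R\<^esub> \<rho> v) [^]\<^bsub>R\<^esub> poly_mapping.lookup e v) =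
      r [^]\<^bsub>R\<^esub> k \<otimes>\<^bsub>R\<^esub> ?m e" if e: "e \<in> Poly_Mapping.keys P" for e
  proof -
    have \<rho>: "\<rho> v \<in> carrier R" if "v \<in> Poly_Mapping.keys e" for v
      using assms(2,3) e that by (auto simp: isobaric_def)
    have A: "(\<Otimes>\<^bsub>R\<^esub>v\<in>A. (r [^]\<^bsub>R\<^esub> wt v \<otimes>\<^bsub>R\<^esub> \<rho> v) [^]\<^bsub>R\<^esub> l v) =
      r [^]\<^bsub>R\<^esub> (\<Sum>v\<in>A. wt v * l v) \<otimes>\<^bsub>R\<^esub> (\<Otimes>\<^bsub>R\<^esub>v\<in>A. \<rho> v [^]\<^bsub>R\<^esub> l v)"
      if "finite A" "A \<subseteq> Poly_Mapping.keys e" for A and l :: "_ \<Rightarrow> nat"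
      using that
    proof (induction A rule: finite_induct)
      case (insert v A)
      have [simp]: "(\<Otimes>\<^bsub>R\<^esub>v\<in>A. \<rho> v [^]\<^bsub>R\<^esub> l v) \<in> carrier R"
        using insert.prems \<rho> by (intro R.finprod_closed) auto
      show ?case using insert \<rho> assms(4)
        by (subst (1 2) R.finprod_insert)
          (auto simp: R.nat_pow_distrib R.nat_pow_pow R.nat_pow_mult[symmetric] R.m_ac Pi_def subset_eq)
    qed (use assms(4) in auto)
    show ?thesis using A[of "Poly_Mapping.keys e" "poly_mapping.lookup e"] e assms(2)
      by (auto simp: isobaric_def)
  qed
  then have "eval_int_poly R P (\<lambda>v. r [^]\<^bsub>R\<^esub> wt v \<otimes>\<^bsub>R\<^esub> \<rho> v) =
      (\<Oplus>\<^bsub>R\<^esub>e\<in>Poly_Mapping.keys P. [poly_mapping.lookup P e] \<cdot>\<^bsub>R\<^esub> (r [^]\<^bsub>R\<^esub> k \<otimes>\<^bsub>R\<^esub> ?m e))"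
    unfolding eval_int_poly_def using m assms(4)
    by (intro R.finsum_cong' refl arg_cong[where f="add_pow R _"] Pi_I R.add.int_pow_closed) auto
  also have "\<dots> = (\<Oplus>\<^bsub>R\<^esub>e\<in>Poly_Mapping.keys P. r [^]\<^bsub>R\<^esub> k \<otimes>\<^bsub>R\<^esub> ([poly_mapping.lookup P e] \<cdot>\<^bsub>R\<^esub> ?m e))"
    using m assms(4) by (intro R.finsum_cong' refl) (auto simp: R.add_pow_rdistr_int)
  also have "\<dots> = r [^]\<^bsub>R\<^esub> k \<otimes>\<^bsub>R\<^esub> eval_int_poly R P \<rho>"
    unfolding eval_int_poly_def using m assms(4) by (subst R.finsum_rdistr) auto
  finally show ?thesis .
qed

text \<open>Ideals are plain sets over a type class, so that the algebra of S needs no carrier;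
  \<open>ideal_iff_is_ideal\<close> translates to the ideals of
  \<open>ring_of_type_algebra\<close>.\<close>

definition is_ideal :: "'a::comm_ring_1 set \<Rightarrow> bool" where
  "is_ideal J \<longleftrightarrow> 0 \<in> J \<and> (\<forall>a\<in>J. \<forall>b\<in>J. a + b \<in> J) \<and> (\<forall>c. \<forall>a\<in>J. c * a \<in> J)"

lemma is_idealI:
  "0 \<in> J \<Longrightarrow> (\<And>a b. a \<in> J \<Longrightarrow> b \<in> J \<Longrightarrow> a + b \<in> J) \<Longrightarrow> (\<And>c a. a \<in> J \<Longrightarrow> c * a \<in> J) \<Longrightarrow> is_ideal J"
  by (auto simp: is_ideal_def)

lemma is_ideal_0: "is_ideal J \<Longrightarrow> 0 \<in> J"
  and is_ideal_add: "is_ideal J \<Longrightarrow> a \<in> J \<Longrightarrow> b \<in> J \<Longrightarrow> a + b \<in> J"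
  and is_ideal_mult: "is_ideal J \<Longrightarrow> a \<in> J \<Longrightarrow> c * a \<in> J"
  and is_ideal_mult2: "is_ideal J \<Longrightarrow> a \<in> J \<Longrightarrow> a * c \<in> J"
  by (auto simp: is_ideal_def mult.commute[of a c])

lemma is_ideal_uminus: "is_ideal J \<Longrightarrow> a \<in> J \<Longrightarrow> - a \<in> J"
  using is_ideal_mult[of J a "- 1"] by simp

lemma is_ideal_diff: "is_ideal J \<Longrightarrow> a \<in> J \<Longrightarrow> b \<in> J \<Longrightarrow> a - b \<in> J"
  using is_ideal_add[of J a "- b"] by (simp add: is_ideal_uminus)

lemma is_ideal_sum: "is_ideal J \<Longrightarrow> (\<And>a. a \<in> A \<Longrightarrow> g a \<in> J) \<Longrightarrow> sum g A \<in> J"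
  by (induction A rule: infinite_finite_induct) (auto intro: is_ideal_0 is_ideal_add)

lemma ev_cong_ideal:
  assumes "is_ideal J" "\<And>v. \<rho> v - \<tau> v \<in> J"
  shows "ev \<rho> P - ev \<tau> P \<in> J"
proof (induction P rule: mpoly_int_induct)
  case (const c)
  then show ?case using assms by (simp add: is_ideal_0)
next
  case (Var v)
  then show ?case using assms by simp
next
  case (add a b)
  have "ev \<rho> (a + b) - ev \<tau> (a + b) = (ev \<rho> a - ev \<tau> a) + (ev \<rho> b - ev \<tau> b)"
    by (simp add: ev_add)
  then show ?case using add assms(1) by (simp only: is_ideal_add)
next
  case (mult a b)
  have "ev \<rho> (a * b) - ev \<tau> (a * b) = ev \<rho> a * (ev \<rho> b - ev \<tau> b) + ev \<tau> b * (ev \<rho> a - ev \<tau> a)"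
    by (simp add: ev_mult algebra_simps)
  then show ?case using mult assms(1) by (simp only: is_ideal_add is_ideal_mult)
qed

section \<open>Witt vectors as sequences\<close>

text \<open>Subtraction gets polynomials of its own, again from Dwork's lemma, so that leading
  components can be peeled off a Witt vector without first making Witt vectors a group.\<close>

definition witt_sub_poly :: "nat \<Rightarrow> nat \<Rightarrow> witt_poly" where
  "witt_sub_poly p = (SOME z. \<forall>n. ghost p z n =
     ghost p (\<lambda>i. Var (Inl i)) n - ghost p (\<lambda>i. Var (Inr i)) n)"

lemma ghost_witt_sub:
  assumes "prime p"
  shows "ghost p (witt_sub_poly p) n =
    ghost p (\<lambda>i. Var (Inl i)) n - ghost p (\<lambda>i. Var (Inr i)) n"
proof -
  let ?w = "\<lambda>n. ghost p (\<lambda>i. Var (Inl i)) n - ghost p (\<lambda>i. Var (Inr i)) n :: witt_poly"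
  have "\<exists>z. \<forall>n. ghost p z n = ?w n"
  proof (rule dwork_exists[OF assms])
    fix n
    have "?w (Suc n) - frob_lift p (?w n) =
      (ghost p (\<lambda>i. Var (Inl i)) (Suc n) - frob_lift p (ghost p (\<lambda>i. Var (Inl i)) n)) -
      (ghost p (\<lambda>i. Var (Inr i)) (Suc n) - frob_lift p (ghost p (\<lambda>i. Var (Inr i)) n))"
      by (simp add: frob_lift_simps)
    then show "of_nat p ^ Suc n dvd ?w (Suc n) - frob_lift p (?w n)"
      by (simp only:) (intro dvd_diff ghost_dwork assms)
  qed
  from someI_ex[OF this] show ?thesis unfolding witt_sub_poly_def by blast
qed

text \<open>Witt vectors are infinite sequences here. As component i depends only on components up
  to i, the length n appears only in the functionals, which read the first n entries.\<close>

definition wadd :: "nat \<Rightarrow> (nat \<Rightarrow> 'a::comm_ring_1) \<Rightarrow> (nat \<Rightarrow> 'a) \<Rightarrow> nat \<Rightarrow> 'a" where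
  "wadd p x y i = ev (case_sum x y) (witt_add_poly p i)"

definition wmul :: "nat \<Rightarrow> (nat \<Rightarrow> 'a::comm_ring_1) \<Rightarrow> (nat \<Rightarrow> 'a) \<Rightarrow> nat \<Rightarrow> 'a" where
  "wmul p x y i = ev (case_sum x y) (witt_mult_poly p i)"

definition wsub :: "nat \<Rightarrow> (nat \<Rightarrow> 'a::comm_ring_1) \<Rightarrow> (nat \<Rightarrow> 'a) \<Rightarrow> nat \<Rightarrow> 'a" where
  "wsub p x y i = ev (case_sum x y) (witt_sub_poly p i)"

text \<open>\<open>wshift i a\<close> is $V^i[a]$; in particular \<open>wshift 0 a\<close> is the Teichmueller representative.\<close>

definition wshift :: "nat \<Rightarrow> 'a::zero \<Rightarrow> nat \<Rightarrow> 'a" where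
  "wshift i a = (\<lambda>j. if j = i then a else 0)"

lemma ghost_wadd: "prime p \<Longrightarrow> ghost p (wadd p x y) n = ghost p x n + ghost p y n"
  using arg_cong[OF ghost_witt_add[of p n], of "ev (case_sum x y)"]
  by (simp add: ev_ghost ev_add wadd_def[abs_def])

lemma ghost_wmul: "prime p \<Longrightarrow> ghost p (wmul p x y) n = ghost p x n * ghost p y n"
  using arg_cong[OF ghost_witt_mult[of p n], of "ev (case_sum x y)"]
  by (simp add: ev_ghost ev_mult wmul_def[abs_def])

lemma ghost_wsub: "prime p \<Longrightarrow> ghost p (wsub p x y) n = ghost p x n - ghost p y n"
  using arg_cong[OF ghost_witt_sub[of p n], of "ev (case_sum x y)"]
  by (simp add: ev_ghost ev_diff wsub_def[abs_def])

lemma ev_case_sum: "(\<lambda>v. ev \<rho> (case_sum x y v)) = case_sum (\<lambda>i. ev \<rho> (x i)) (\<lambda>i. ev \<rho> (y i))"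
  by (auto simp: fun_eq_iff split: sum.split)

lemma ev_wadd: "ev \<rho> (wadd p x y i) = wadd p (\<lambda>i. ev \<rho> (x i)) (\<lambda>i. ev \<rho> (y i)) i"
  by (simp add: wadd_def ev_ev ev_case_sum)

lemma ev_wmul: "ev \<rho> (wmul p x y i) = wmul p (\<lambda>i. ev \<rho> (x i)) (\<lambda>i. ev \<rho> (y i)) i"
  by (simp add: wmul_def ev_ev ev_case_sum)

lemma ev_wsub: "ev \<rho> (wsub p x y i) = wsub p (\<lambda>i. ev \<rho> (x i)) (\<lambda>i. ev \<rho> (y i)) i"
  by (simp add: wsub_def ev_ev ev_case_sum)

text \<open>Identities between Witt vectors are lifted to an integral polynomial ring, where a sequence
  is determined by its ghost components.\<close>

definition wlift :: "(nat \<Rightarrow> 'a::comm_ring_1) \<Rightarrow> nat \<Rightarrow> ('a, int) mpoly" where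
  "wlift x i = (if x i = 0 then 0 else Var (x i))"

lemma ev_wlift [simp]: "ev (\<lambda>v. v) (wlift x i) = x i"
  by (simp add: wlift_def)

lemma wadd_wsub:
  assumes "prime p"
  shows "wadd p v (wsub p z v) = z"
proof
  fix i
  have "wadd p (wlift v) (wsub p (wlift z) (wlift v)) = wlift z"
    by (rule ghost_inj[OF prime_gt_0_nat[OF assms]]) (simp add: ghost_wadd ghost_wsub assms)
  from arg_cong[OF fun_cong[OF this, of i], of "ev (\<lambda>v. v)"]
  show "wadd p v (wsub p z v) i = z i" by (simp add: ev_wadd ev_wsub)
qed

lemma ghost_const_0: "p > 0 \<Longrightarrow> ghost p (\<lambda>_. 0) n = 0"
  by (simp add: ghost_def power_0_left)

lemma wsub_self:
  assumes "prime p"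
  shows "wsub p z z = (\<lambda>_. 0)"
proof
  fix i
  have "wsub p (wlift z) (wlift z) = (\<lambda>_. 0)"
    by (rule ghost_inj[OF prime_gt_0_nat[OF assms]])
      (simp add: ghost_wsub assms ghost_const_0 prime_gt_0_nat[OF assms])
  from arg_cong[OF fun_cong[OF this, of i], of "ev (\<lambda>v. v)"]
  show "wsub p z z i = 0" by (simp add: ev_wsub)
qed

lemma ghost_wshift_0: "p > 0 \<Longrightarrow> ghost p (wshift 0 a) n = a ^ (p ^ n)"
  by (simp add: ghost_def wshift_def if_distrib[of "\<lambda>x. x ^ _"] if_distrib[of "\<lambda>x. _ * x"]
      power_0_left sum.delta cong: if_cong)

text \<open>The ghost component r^{p^n} of [r] equals (r^{p^i})^{p^{n-i}} and is absorbed
  termwise.\<close>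

lemma wmul_wshift_0:
  assumes "prime p"
  shows "wmul p (wshift 0 r) y i = r ^ (p ^ i) * y i"
proof -
  have p: "p > 0" using assms prime_gt_0_nat by blast
  have "wmul p (wshift 0 (Var r)) (wlift y) = (\<lambda>i. Var r ^ (p ^ i) * wlift y i)"
  proof (rule ghost_inj[OF p])
    fix n
    have "(Var r :: ('a, int) mpoly) ^ (p ^ n) * (of_nat p ^ i * wlift y i ^ (p ^ (n - i))) =
      of_nat p ^ i * (Var r ^ (p ^ i) * wlift y i) ^ (p ^ (n - i))" if "i \<le> n" for i
    proof -
      have "(Var r :: ('a, int) mpoly) ^ (p ^ n) = (Var r ^ (p ^ i)) ^ (p ^ (n - i))"
        using that by (simp flip: power_mult power_add)
      then show ?thesis by (simp add: power_mult_distrib algebra_simps)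
    qed
    then show "ghost p (wmul p (wshift 0 (Var r)) (wlift y)) n = ghost p (\<lambda>i. Var r ^ (p ^ i) * wlift y i) n"
      unfolding ghost_wmul[OF assms] ghost_wshift_0[OF p]
      by (auto simp: ghost_def sum_distrib_left intro!: sum.cong)
  qed
  from arg_cong[OF fun_cong[OF this, of i], of "ev (\<lambda>v. v)"]
  have "wmul p (\<lambda>i. ev (\<lambda>v. v) (wshift 0 (Var r) i)) y i = r ^ (p ^ i) * y i"
    by (simp add: ev_wmul ev_simps)
  moreover have "(\<lambda>i. ev (\<lambda>v. v) (wshift 0 (Var r) i)) = wshift 0 r"
    by (auto simp: wshift_def)
  ultimately show ?thesis by simp
qed

lemma ghost_low:
  fixes z :: "nat \<Rightarrow> ('v, int) mpoly"
  assumes "p > 0" "\<And>j. j < i \<Longrightarrow> ghost p z j = 0"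
  shows "j < i \<Longrightarrow> z j = 0" "ghost p z i = of_nat p ^ i * z i"
proof -
  have *: "\<forall>j<k. z j = 0" if "k \<le> i" for k
    using that
  proof (induction k)
    case (Suc k)
    then have "(\<Sum>i<k. of_nat p ^ i * z i ^ (p ^ (k - i))) = 0"
      using assms(1) by (intro sum.neutral) (auto simp: power_0_left)
    then have "of_nat p ^ k * z k = of_nat p ^ k * 0"
      using assms(2)[of k] Suc.prems by (simp add: ghost_split)
    from mpoly_of_nat_power_mult_cancel[OF this assms(1)] show ?case
      using Suc by (auto simp: less_Suc_eq)
  qed simp
  then show "j < i \<Longrightarrow> z j = 0" by blast
  have "(\<Sum>k<i. of_nat p ^ k * z k ^ (p ^ (i - k))) = 0"
    using *[of i] assms(1) by (intro sum.neutral) (auto simp: power_0_left)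
  then show "ghost p z i = of_nat p ^ i * z i" by (simp add: ghost_split)
qed

lemma ghost_low_zero:
  assumes "p > 0" "\<And>j. j < i \<Longrightarrow> z j = 0"
  shows "ghost p z i = of_nat p ^ i * z i" "j < i \<Longrightarrow> ghost p z j = 0"
proof -
  have "(\<Sum>k<i. of_nat p ^ k * z k ^ (p ^ (i - k))) = 0"
    using assms by (intro sum.neutral) (auto simp: power_0_left)
  then show "ghost p z i = of_nat p ^ i * z i" by (simp add: ghost_split)
  show "ghost p z j = 0" if "j < i"
    unfolding ghost_def using assms that by (intro sum.neutral) (auto simp: power_0_left)
qed

text \<open>If the first i components vanish, the ghost component of index i is p^i times the next
  component, so additivity of ghost components becomes ordinary addition: the graded pieces of the
  V-filtration are copies of the additive group of the ring.\<close>

lemma wadd_low: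
  assumes "prime p" "\<And>j. j < i \<Longrightarrow> x j = 0" "\<And>j. j < i \<Longrightarrow> y j = 0"
  shows "j < i \<Longrightarrow> wadd p x y j = 0" "wadd p x y i = x i + y i"
proof -
  have p: "p > 0" using assms prime_gt_0_nat by blast
  let ?z = "wadd p (wlift x) (wlift y)"
  \<comment> \<open>The lift of a zero component is 0 and not a variable, so leading zeros survive
    the lifting.\<close>
  have z: "\<And>j. j < i \<Longrightarrow> wlift x j = 0" "\<And>j. j < i \<Longrightarrow> wlift y j = 0"
    using assms by (auto simp: wlift_def)
  have 0: "ghost p ?z j = 0" if "j < i" for j
    using ghost_low_zero(2)[OF p z(1)] ghost_low_zero(2)[OF p z(2)] that by (simp add: ghost_wadd assms(1))
  show "wadd p x y j = 0" if "j < i"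
    using arg_cong[OF ghost_low(1)[OF p 0 that], of "ev (\<lambda>v. v)"] by (simp add: ev_wadd)
  have "of_nat p ^ i * ?z i = of_nat p ^ i * (wlift x i + wlift y i)"
    using ghost_low(2)[OF p 0] ghost_low_zero(1)[OF p z(1)] ghost_low_zero(1)[OF p z(2)]
    by (simp add: ghost_wadd assms(1) distrib_left)
  from arg_cong[OF mpoly_of_nat_power_mult_cancel[OF this p], of "ev (\<lambda>v. v)"]
  show "wadd p x y i = x i + y i" by (simp add: ev_wadd ev_add)
qed

lemma wsub_low:
  assumes "prime p" "\<And>j. j < i \<Longrightarrow> x j = 0" "\<And>j. j < i \<Longrightarrow> y j = 0"
  shows "j < i \<Longrightarrow> wsub p x y j = 0" "wsub p x y i = x i - y i"
proof -
  have p: "p > 0" using assms prime_gt_0_nat by blast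
  let ?z = "wsub p (wlift x) (wlift y)"
  have z: "\<And>j. j < i \<Longrightarrow> wlift x j = 0" "\<And>j. j < i \<Longrightarrow> wlift y j = 0"
    using assms by (auto simp: wlift_def)
  have 0: "ghost p ?z j = 0" if "j < i" for j
    using ghost_low_zero(2)[OF p z(1)] ghost_low_zero(2)[OF p z(2)] that by (simp add: ghost_wsub assms(1))
  show "wsub p x y j = 0" if "j < i"
    using arg_cong[OF ghost_low(1)[OF p 0 that], of "ev (\<lambda>v. v)"] by (simp add: ev_wsub)
  have "of_nat p ^ i * ?z i = of_nat p ^ i * (wlift x i - wlift y i)"
    using ghost_low(2)[OF p 0] ghost_low_zero(1)[OF p z(1)] ghost_low_zero(1)[OF p z(2)]
    by (simp add: ghost_wsub assms(1) right_diff_distrib)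
  from arg_cong[OF mpoly_of_nat_power_mult_cancel[OF this p], of "ev (\<lambda>v. v)"]
  show "wsub p x y i = x i - y i" by (simp add: ev_wsub ev_diff)
qed

text \<open>Evaluation of polynomials respects congruences modulo J, so the difference is congruent
  to that of y with itself, which is 0.\<close>

lemma wsub_cong_ideal:
  assumes "prime p" "is_ideal J" "\<And>j. x j - y j \<in> J"
  shows "wsub p x y i \<in> J"
proof -
  have "wsub p x y i - wsub p y y i \<in> J"
    unfolding wsub_def using assms(2,3)
    by (intro ev_cong_ideal) (auto simp: is_ideal_0 split: sum.split)
  then show ?thesis by (simp add: wsub_self[OF assms(1)])
qed

lemma wadd_0: "prime p \<Longrightarrow> wadd p x y 0 = x 0 + y 0"
  using ghost_wadd[of p x y 0] by simp

lemma wmul_0: "prime p \<Longrightarrow> wmul p x y 0 = x 0 * y 0"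
  using ghost_wmul[of p x y 0] by simp

section \<open>Divided Frobenius differences\<close>

text \<open>This is (a^p - sigma(a)) / p, the characteristic 0 source of Delta_1; by
  torsion-freeness the choice is the only one.\<close>

definition delta_lift :: "nat \<Rightarrow> ('v, int) mpoly \<Rightarrow> ('v, int) mpoly" where
  "delta_lift p a = (SOME d. of_nat p * d = a ^ p - frob_lift p a)"

lemma delta_lift:
  assumes "prime p"
  shows "a ^ p = frob_lift p a + of_nat p * delta_lift p a"
proof -
  have "\<exists>d. of_nat p * d = a ^ p - frob_lift p a"
    using frob_lift_cong[OF assms, of a] by (metis dvdE)
  from someI_ex[OF this] show ?thesis unfolding delta_lift_def by (simp add: algebra_simps)
qed

lemma delta_lift_unique:
  assumes "prime p" "a ^ p = frob_lift p a + of_nat p * d"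
  shows "delta_lift p a = d"
  using mpoly_of_nat_mult_cancel[of p "delta_lift p a" d] delta_lift[OF assms(1), of a] assms
    prime_gt_0_nat[OF assms(1)] by simp

lemma delta_lift_add:
  assumes "prime p"
  shows "delta_lift p (a + b) = delta_lift p a + delta_lift p b + cocyc p a b"
  by (rule delta_lift_unique[OF assms])
    (simp add: add_power_prime[OF assms] frob_lift_simps delta_lift[OF assms, of a]
      delta_lift[OF assms, of b] algebra_simps)

lemma delta_lift_mult:
  assumes "prime p"
  shows "delta_lift p (a * b) = a ^ p * delta_lift p b + frob_lift p b * delta_lift p a"
proof (rule delta_lift_unique[OF assms])
  have "(a * b) ^ p = a ^ p * b ^ p" by (rule power_mult_distrib)
  also have "\<dots> = a ^ p * frob_lift p b + of_nat p * (a ^ p * delta_lift p b)"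
    by (subst delta_lift[OF assms, of b]) (simp add: algebra_simps)
  also have "a ^ p * frob_lift p b = frob_lift p a * frob_lift p b + of_nat p * (frob_lift p b * delta_lift p a)"
    by (subst delta_lift[OF assms, of a]) (simp add: algebra_simps)
  finally show "(a * b) ^ p = frob_lift p (a * b) +
      of_nat p * (a ^ p * delta_lift p b + frob_lift p b * delta_lift p a)"
    by (simp add: frob_lift_simps algebra_simps)
qed

lemma ev_cocyc: "ev \<rho> (cocyc p a b) = cocyc p (ev \<rho> a) (ev \<rho> b)"
  by (simp add: cocyc_def ev_simps)

lemma cocyc_0_right: "cocyc p a 0 = 0"
  unfolding cocyc_def by (rule sum.neutral) (auto simp: power_0_left)

lemma cocyc_commute:
  assumes "prime p"
  shows "cocyc p a b = cocyc p b a"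
proof -
  let ?V = "Var :: _ \<Rightarrow> ('a, int) mpoly"
  have "?V a ^ p + ?V b ^ p + of_nat p * cocyc p (?V a) (?V b) =
      ?V b ^ p + ?V a ^ p + of_nat p * cocyc p (?V b) (?V a)"
    unfolding add_power_prime[OF assms, symmetric] by (simp only: add.commute)
  then have "of_nat p * cocyc p (?V a) (?V b) = of_nat p * cocyc p (?V b) (?V a)"
    by (simp add: add.commute)
  from arg_cong[OF mpoly_of_nat_mult_cancel[OF this prime_gt_0_nat[OF assms]], of "ev (\<lambda>v. v)"]
  show ?thesis by (simp add: ev_cocyc)
qed

text \<open>Both sides are ((a+b+c)^p - a^p - b^p - c^p) / p: the expression \<open>cocyc p\<close>
  is the coboundary of x^p divided by p. The division takes place in an integral polynomial
  ring.\<close>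

lemma cocyc_assoc:
  assumes "prime p"
  shows "cocyc p a b + cocyc p (a + b) c = cocyc p b c + cocyc p a (b + c)"
proof -
  let ?V = "Var :: _ \<Rightarrow> ('a, int) mpoly"
  have "of_nat p * (cocyc p (?V a) (?V b) + cocyc p (?V a + ?V b) (?V c)) =
      of_nat p * (cocyc p (?V b) (?V c) + cocyc p (?V a) (?V b + ?V c))"
    using add_power_prime[OF assms, of "?V a" "?V b"] add_power_prime[OF assms, of "?V a + ?V b" "?V c"]
      add_power_prime[OF assms, of "?V b" "?V c"] add_power_prime[OF assms, of "?V a" "?V b + ?V c"]
    by (simp add: algebra_simps)
  from arg_cong[OF mpoly_of_nat_mult_cancel[OF this prime_gt_0_nat[OF assms]], of "ev (\<lambda>v. v)"]
  show ?thesis by (simp add: ev_cocyc ev_add)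
qed

lemma cocyc_mult: "prime p \<Longrightarrow> cocyc p (c * a) (c * b) = c ^ p * cocyc p a b"
  unfolding cocyc_def sum_distrib_left
proof (rule sum.cong)
  fix i assume "i \<in> {1..<p}"
  then have "c ^ p = c ^ i * c ^ (p - i)" by (simp flip: power_add)
  then show "of_nat ((p choose i) div p) * (c * a) ^ i * (c * b) ^ (p - i) =
      c ^ p * (of_nat ((p choose i) div p) * a ^ i * b ^ (p - i))"
    by (simp add: power_mult_distrib mult_ac)
qed simp

section \<open>Congruence modulo p-th powers in characteristic p\<close>

locale char_p_ring =
  fixes p :: nat and R :: "'a::comm_ring_1 itself"
  assumes prime_p: "prime p" and char_p: "of_nat p = (0::'a)"
begin

lemma p_gt_0: "p > 0" using prime_gt_0_nat[OF prime_p] .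
lemma p_ge_2: "p \<ge> 2" using prime_ge_2_nat[OF prime_p] .

lemma zero_power_p [simp]: "0 ^ p = (0 :: 'b::semiring_1)" using p_gt_0 by (simp add: power_0_left)

lemma frobenius_add: "(a + b :: 'a) ^ p = a ^ p + b ^ p"
  by (simp add: add_power_prime[OF prime_p] char_p)

lemma frobenius_sum: "(sum g A :: 'a) ^ p = (\<Sum>x\<in>A. g x ^ p)"
  using p_gt_0 by (induction A rule: infinite_finite_induct) (auto simp: frobenius_add)

lemma frobenius_of_int: "(of_int c :: 'a) ^ p = of_int c"
proof -
  obtain k where "c ^ p - c = int p * k" using prime_dvd_int_power_diff[OF prime_p, of c] by (elim dvdE)
  then have "(of_int (c ^ p - c) :: 'a) = of_nat p * of_int k"
    by (simp only: of_int_mult of_int_of_nat_eq)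
  then show ?thesis by (simp add: char_p)
qed

lemma frobenius_of_nat: "(of_nat c :: 'a) ^ p = of_nat c"
  using frobenius_of_int[of "int c"] by simp

lemma frobenius_uminus: "(- a :: 'a) ^ p = - (a ^ p)"
proof -
  have "a ^ p + (- a) ^ p = 0" using frobenius_add[of a "- a"] p_gt_0 by simp
  then show ?thesis by (simp add: eq_neg_iff_add_eq_0 add.commute)
qed

text \<open>Equality in S/F(S). The p-th powers form a subring and not an ideal, so this relation is
  stable only under sums and under multiplication by p-th powers; exponents such as p^j - p below
  qualify because they are multiples of p.\<close>

definition eqp :: "'a \<Rightarrow> 'a \<Rightarrow> bool" (infix "\<approx>" 50) where
  "a \<approx> b \<longleftrightarrow> (\<exists>r. a = b + r ^ p)"

lemma eqp_refl [simp]: "a \<approx> a"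
  using p_gt_0 by (auto simp: eqp_def intro!: exI[of _ 0])

lemma eqp_sym: "a \<approx> b \<Longrightarrow> b \<approx> a"
proof -
  assume "a \<approx> b"
  then obtain r where "a = b + r ^ p" by (auto simp: eqp_def)
  then have "b = a + (- r) ^ p" by (simp add: frobenius_uminus)
  then show ?thesis by (auto simp: eqp_def)
qed

lemma eqp_add: "a \<approx> b \<Longrightarrow> c \<approx> d \<Longrightarrow> a + c \<approx> b + d"
proof -
  assume "a \<approx> b" "c \<approx> d"
  then obtain r s where "a = b + r ^ p" "c = d + s ^ p" by (auto simp: eqp_def)
  then have "a + c = (b + d) + (r + s) ^ p" by (simp add: frobenius_add)
  then show ?thesis by (auto simp: eqp_def)
qed

lemma eqp_trans [trans]: "a \<approx> b \<Longrightarrow> b \<approx> c \<Longrightarrow> a \<approx> c"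
proof -
  assume "a \<approx> b" "b \<approx> c"
  then obtain r s where "a = b + r ^ p" "b = c + s ^ p" by (auto simp: eqp_def)
  then have "a = c + (s + r) ^ p" by (simp add: frobenius_add)
  then show ?thesis by (auto simp: eqp_def)
qed

lemma eqp_eq_trans [trans]: "a \<approx> b \<Longrightarrow> b = c \<Longrightarrow> a \<approx> c" "a = b \<Longrightarrow> b \<approx> c \<Longrightarrow> a \<approx> c"
  by auto

lemma eqp_mult: "a \<approx> b \<Longrightarrow> c ^ p * a \<approx> c ^ p * b"
  by (force simp: eqp_def distrib_left power_mult_distrib[symmetric])

lemma eqp_sum: "(\<And>x. x \<in> A \<Longrightarrow> g x \<approx> h x) \<Longrightarrow> sum g A \<approx> sum h A"
  by (induction A rule: infinite_finite_induct) (auto intro: eqp_add)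

lemma eqp_pow: "r ^ p \<approx> 0"
  by (auto simp: eqp_def)

lemma eqp_add_pow: "a + r ^ p \<approx> a"
  by (auto simp: eqp_def)

end

text \<open>\<open>M\<close> plays the role of the \<open>p\<close>-monomials and \<open>\<Delta>\<close> that of $\Delta_1$, made single-valued.\<close>

locale delta_ring = char_p_ring p "TYPE('a)" for p :: nat and M :: "'a::comm_ring_1 set" and \<Delta> :: "'a \<Rightarrow> 'a" +
  assumes M_of_int: "of_int c \<in> M"
    and M_mult: "a \<in> M \<Longrightarrow> b \<in> M \<Longrightarrow> a * b \<in> M"
    and M_generate: "\<exists>as. set as \<subseteq> M \<and> a = sum_list as"
    and \<Delta>_add: "\<Delta> (a + b) \<approx> \<Delta> a + \<Delta> b + cocyc p a b"
    and \<Delta>_M: "a \<in> M \<Longrightarrow> \<Delta> a \<approx> 0"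
    and \<Delta>_0 [simp]: "\<Delta> 0 = 0"
begin

text \<open>A presentation of the ring by integral polynomials with one variable for each element of
  M; variables named by other elements go to 0. Every term maps into M, where \<Delta> vanishes
  modulo p-th powers, and this is why p-monomials serve as generators.\<close>

definition proj :: "('a, int) mpoly \<Rightarrow> 'a" where
  "proj = ev (\<lambda>v. if v \<in> M then v else 0)"

lemma proj_simps:
  "proj (a + b) = proj a + proj b" "proj (a * b) = proj a * proj b" "proj (a - b) = proj a - proj b"
  "proj (a ^ n) = proj a ^ n" "proj (of_nat n) = of_nat n" "proj 0 = 0" "proj 1 = 1"
  "proj (- a) = - proj a" "proj (sum g A) = (\<Sum>x\<in>A. proj (g x))"
  by (auto simp: proj_def ev_simps)

lemma proj_surj: "\<exists>t. proj t = a"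
proof -
  have "set as \<subseteq> M \<Longrightarrow> \<exists>t. proj t = sum_list as" for as
  proof (induction as)
    case (Cons a as)
    then obtain t where "proj t = sum_list as" by auto
    then have "proj (Var a + t) = sum_list (a # as)" using Cons.prems by (simp add: proj_def ev_add)
    then show ?case by blast
  qed (auto intro!: exI[of _ 0] simp: proj_simps)
  then show ?thesis using M_generate[of a] by blast
qed

lemma proj_lift_seq: "\<exists>z. \<forall>i. proj (z i) = x i"
  using proj_surj by (intro choice) blast

lemma proj_frob_lift: "proj (frob_lift p t) = proj t ^ p"
proof -
  have "proj (t ^ p) = proj (frob_lift p t + of_nat p * delta_lift p t)"
    by (simp add: delta_lift[OF prime_p])
  then show ?thesis by (simp add: proj_simps char_p)
qed

lemma mpoly_monom_M: "mpoly_monom (\<lambda>v. if v \<in> M then v else 0) e \<in> M"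
proof -
  have 1: "1 \<in> M" "0 \<in> M" using M_of_int[of 1] M_of_int[of 0] by auto
  have pw: "a ^ n \<in> M" if "a \<in> M" for a n
    by (induction n) (auto simp: 1 that M_mult)
  have "prod g A \<in> M" if "\<And>x. x \<in> A \<Longrightarrow> g x \<in> M" for g :: "'a \<Rightarrow> 'a" and A
    using that by (induction A rule: infinite_finite_induct) (auto simp: 1 M_mult)
  then show ?thesis unfolding mpoly_monom_def using 1 by (simp add: pw)
qed

lemma mpoly_monom_single_1: "mpoly_monom Var e = (Poly_Mapping.single e 1 :: ('v, int) mpoly)"
proof (induction e rule: poly_mapping_single_induct)
  case (single v n)
  show ?case
    by (induction n) (simp_all add: mpoly_monom_single Var_def mult_single flip: single_add)
next
  case (add a b)
  then show ?case by (simp add: mpoly_monom_add mult_single)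
qed simp

text \<open>The two sides obey the same addition rule, so terms suffice. On c X^e the lift sigma is
  the p-th power of X^e, so \<open>delta_lift\<close> gives X^{pe} (c^p - c)/p, whose image is a
  p-th power; and \<Delta> vanishes modulo p-th powers on the image of the term, which lies in
  M.\<close>

lemma proj_delta_lift: "proj (delta_lift p t) \<approx> \<Delta> (proj t)"
proof (induction t rule: poly_mapping_single_induct)
  case zero
  have "delta_lift p (0 :: ('a, int) mpoly) = 0" by (rule delta_lift_unique[OF prime_p]) (simp add: frob_lift_simps p_gt_0)
  then show ?case using eqp_sym[OF \<Delta>_M[OF M_of_int[of 0]]] by (simp add: proj_simps)
next
  case (single e c)
  let ?X = "mpoly_monom Var e :: ('a, int) mpoly"
  have X: "Poly_Mapping.single e c = of_int c * ?X"
    by (simp add: mpoly_monom_single_1 mult_single flip: single_of_int)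
  obtain k where k: "c ^ p - c = int p * k" using prime_dvd_int_power_diff[OF prime_p, of c] by (elim dvdE)
  then have k': "(of_int c :: ('a, int) mpoly) ^ p = of_int c + of_nat p * of_int k"
    by (metis add.commute diff_add_cancel of_int_add of_int_mult of_int_of_nat_eq of_int_power)
  have "frob_lift p ?X = ?X ^ p"
    by (simp add: frob_lift_def mpoly_monom_def ev_prod ev_power prod_power_distrib mult.commute flip: power_mult)
  then have "delta_lift p (of_int c * ?X) = of_int k * ?X ^ p"
    by (intro delta_lift_unique[OF prime_p])
      (simp add: power_mult_distrib k' frob_lift_def ev_mult algebra_simps)
  then have "proj (delta_lift p (Poly_Mapping.single e c)) = (of_int k * proj ?X) ^ p"
    unfolding X by (simp add: proj_simps power_mult_distrib frobenius_of_int) (simp add: proj_def)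
  then have 1: "proj (delta_lift p (Poly_Mapping.single e c)) \<approx> 0" by (simp add: eqp_pow)
  have "proj (Poly_Mapping.single e c) \<in> M"
    by (simp add: proj_def ev_single M_mult M_of_int mpoly_monom_M)
  from \<Delta>_M[OF this] show ?case using 1 eqp_sym eqp_trans by blast
next
  case (add a b)
  have "proj (delta_lift p (a + b)) = proj (delta_lift p a) + proj (delta_lift p b) + cocyc p (proj a) (proj b)"
    by (simp add: delta_lift_add[OF prime_p] proj_simps) (simp add: proj_def ev_cocyc)
  also have "\<dots> \<approx> \<Delta> (proj a) + \<Delta> (proj b) + cocyc p (proj a) (proj b)"
    by (intro eqp_add add eqp_refl)
  also have "\<dots> \<approx> \<Delta> (proj a + proj b)" by (rule eqp_sym[OF \<Delta>_add])
  finally show ?case by (simp add: proj_simps)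
qed

lemma \<Delta>_mult: "\<Delta> (a * b) \<approx> a ^ p * \<Delta> b + b ^ p * \<Delta> a"
proof -
  obtain s t where st: "proj s = a" "proj t = b" using proj_surj by metis
  have "\<Delta> (proj (s * t)) \<approx> proj (delta_lift p (s * t))" by (rule eqp_sym[OF proj_delta_lift])
  also have "\<dots> = a ^ p * proj (delta_lift p t) + b ^ p * proj (delta_lift p s)"
    by (simp add: delta_lift_mult[OF prime_p] proj_simps proj_frob_lift st)
  also have "\<dots> \<approx> a ^ p * \<Delta> b + b ^ p * \<Delta> a"
    using proj_delta_lift[of s] proj_delta_lift[of t] by (intro eqp_add eqp_mult) (simp_all add: st)
  finally show ?thesis by (simp add: proj_simps st)
qed

lemma \<Delta>_M_mult: "c \<in> M \<Longrightarrow> \<Delta> (c * a) \<approx> c ^ p * \<Delta> a"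
proof -
  assume "c \<in> M"
  have "\<Delta> (c * a) \<approx> c ^ p * \<Delta> a + a ^ p * \<Delta> c" by (rule \<Delta>_mult)
  also have "\<dots> \<approx> c ^ p * \<Delta> a + a ^ p * 0" by (intro eqp_add eqp_mult \<Delta>_M \<open>c \<in> M\<close> eqp_refl)
  finally show ?thesis by simp
qed

lemma \<Delta>_power: "\<Delta> (a ^ n) \<approx> of_nat n * (a ^ (p * (n - 1)) * \<Delta> a)"
proof (induction n)
  case 0
  then show ?case using \<Delta>_M[OF M_of_int[of 1]] by simp
next
  case (Suc n)
  have "\<Delta> (a * a ^ n) \<approx> a ^ p * \<Delta> (a ^ n) + (a ^ n) ^ p * \<Delta> a" by (rule \<Delta>_mult)
  also have "\<dots> \<approx> a ^ p * (of_nat n * (a ^ (p * (n - 1)) * \<Delta> a)) + (a ^ n) ^ p * \<Delta> a"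
    by (intro eqp_add eqp_mult Suc eqp_refl)
  also have "\<dots> = of_nat (Suc n) * (a ^ (p * (Suc n - 1)) * \<Delta> a)"
    by (cases n) (simp_all add: algebra_simps power_add flip: power_mult)
  finally show ?case by simp
qed

lemma \<Delta>_frobenius: "\<Delta> (a ^ p) \<approx> 0"
  using \<Delta>_power[of a p] by (simp add: char_p)

text \<open>Here E is (t^{p^{k+1}} - sigma(t)^{p^k}) / p^{k+1}. When A = B + P E with P = p^{k+1} is
  raised to the p-th power, the linear term p P B^{p-1} E dominates: the other mixed terms carry a
  further factor P, and (P E)^p contributes a p-th power after reduction.\<close>

lemma power_prime_iterate_diff:
  fixes t :: "('a, int) mpoly"
  shows "\<exists>E. (t ^ p) ^ (p ^ k) = frob_lift p t ^ (p ^ k) + of_nat p ^ Suc k * E \<and>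
    proj E \<approx> proj t ^ (p ^ Suc k - p) * \<Delta> (proj t)"
proof (induction k)
  case 0
  then show ?case
    using delta_lift[OF prime_p, of t] proj_delta_lift[of t] by (intro exI[of _ "delta_lift p t"]) simp
next
  case (Suc k)
  define A B where "A = (t ^ p) ^ (p ^ k)" and "B = frob_lift p t ^ (p ^ k)"
  define P where "P = (of_nat p :: ('a, int) mpoly) ^ Suc k"
  from Suc obtain E where E: "A = B + P * E" "proj E \<approx> proj t ^ (p ^ Suc k - p) * \<Delta> (proj t)"
    by (auto simp: A_def B_def P_def)
  \<comment> \<open>Only i = p - 1 is linear in P E, with coefficient (p choose p-1) / p = 1; all
    other summands contain its square.\<close>
  have "\<exists>G. cocyc p B (P * E) = P * (B ^ (p - 1) * E + P * G)"
  proof -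
    have 1: "{1..<p} = insert (p - 1) {1..<p - 1}" using p_ge_2 by auto
    have "cocyc p B (P * E) = B ^ (p - 1) * (P * E) +
        (\<Sum>i\<in>{1..<p - 1}. of_nat ((p choose i) div p) * B ^ i * (P * E) ^ (p - i))"
    proof -
      have "p choose (p - 1) = p" "p - (p - 1) = 1"
        using p_ge_2 binomial_symmetric[of "p - 1" p] by auto
      then show ?thesis unfolding cocyc_def 1 using p_gt_0 by (subst sum.insert) auto
    qed
    also have "(\<Sum>i\<in>{1..<p - 1}. of_nat ((p choose i) div p) * B ^ i * (P * E) ^ (p - i)) =
        (\<Sum>i\<in>{1..<p - 1}. P * P * (of_nat ((p choose i) div p) * B ^ i * E ^ 2 * (P * E) ^ (p - i - 2)))"
    proof (rule sum.cong)
      fix i assume "i \<in> {1..<p - 1}"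
      then have "p - i = 2 + (p - i - 2)" by auto
      then have "(P * E) ^ (p - i) = (P * E) ^ 2 * (P * E) ^ (p - i - 2)" by (metis power_add)
      then show "of_nat ((p choose i) div p) * B ^ i * (P * E) ^ (p - i) =
          P * P * (of_nat ((p choose i) div p) * B ^ i * E ^ 2 * (P * E) ^ (p - i - 2))"
        by (simp add: power2_eq_square mult_ac)
    qed simp
    finally show ?thesis by (auto simp flip: sum_distrib_left simp: algebra_simps)
  qed
  then obtain G where G: "cocyc p B (P * E) = P * (B ^ (p - 1) * E + P * G)" by blast
  have "Suc k * p = Suc (Suc k) + (Suc k * p - Suc (Suc k))"
  proof -
    have "Suc k * 2 \<le> Suc k * p" using p_ge_2 by (intro mult_left_mono) auto
    then show ?thesis by simp
  qed
  then have Pp: "P ^ p = of_nat p ^ Suc (Suc k) * of_nat p ^ (Suc k * p - Suc (Suc k))"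
    unfolding P_def power_mult[symmetric] by (metis power_add)
  define H where "H = B ^ (p - 1) * E + P * G + of_nat p ^ (Suc k * p - Suc (Suc k)) * E ^ p"
  have "A ^ p = B ^ p + (P * E) ^ p + of_nat p * (P * (B ^ (p - 1) * E + P * G))"
    unfolding E(1) add_power_prime[OF prime_p] G ..
  also have "\<dots> = B ^ p + of_nat p ^ Suc (Suc k) * H"
  proof -
    have "of_nat p * (P * x) = of_nat p ^ Suc (Suc k) * x" for x by (simp add: P_def mult.assoc)
    moreover have "(P * E) ^ p = of_nat p ^ Suc (Suc k) * (of_nat p ^ (Suc k * p - Suc (Suc k)) * E ^ p)"
      by (simp only: power_mult_distrib Pp mult.assoc)
    ultimately show ?thesis by (simp only: H_def distrib_left add_ac)
  qed
  finally have 1: "(t ^ p) ^ (p ^ Suc k) = frob_lift p t ^ (p ^ Suc k) + of_nat p ^ Suc (Suc k) * H"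
    by (simp add: A_def B_def mult.commute flip: power_mult)
  have "proj B = proj t ^ (p ^ Suc k)"
    by (simp add: B_def proj_simps proj_frob_lift flip: power_mult)
  then have pB: "proj B ^ (p - 1) = (proj t ^ (p ^ k * (p - 1))) ^ p"
    by (simp add: mult_ac flip: power_mult)
  \<comment> \<open>For p = 2 and k = 0 the exponent of p is 0 and E^2 survives the reduction; being
    a p-th power it is still harmless.\<close>
  have "\<exists>r. proj (of_nat p ^ (Suc k * p - Suc (Suc k)) * E ^ p) = r ^ p"
    by (rule exI[of _ "proj (of_nat p ^ (Suc k * p - Suc (Suc k)) * E)"])
      (use frobenius_of_nat[of "p ^ (Suc k * p - Suc (Suc k))"] in
        \<open>simp only: proj_simps power_mult_distrib of_nat_power\<close>)
  then obtain r where r: "proj (of_nat p ^ (Suc k * p - Suc (Suc k)) * E ^ p) = r ^ p" by blast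
  have "proj H = proj B ^ (p - 1) * proj E + r ^ p"
    using r by (simp add: H_def proj_simps P_def char_p)
  also have "\<dots> \<approx> proj B ^ (p - 1) * proj E" by (rule eqp_add_pow)
  also have "\<dots> \<approx> proj B ^ (p - 1) * (proj t ^ (p ^ Suc k - p) * \<Delta> (proj t))"
    unfolding pB by (intro eqp_mult E)
  also have "\<dots> = proj t ^ (p ^ Suc (Suc k) - p) * \<Delta> (proj t)"
  proof -
    have "p \<le> p ^ Suc k" using p_gt_0 by simp
    then have "p ^ k * (p - 1) * p + (p ^ Suc k - p) = p ^ Suc (Suc k) - p"
      using p_gt_0 by (simp add: algebra_simps diff_mult_distrib2)
    then show ?thesis unfolding pB by (simp only: power_mult[symmetric] mult.assoc[symmetric] power_add[symmetric])
  qed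
  finally show ?case using 1 by blast
qed

text \<open>The logarithmic coordinates $p^{-j} (w_j - \sigma w_{j-1})$ of a Witt vector: they are additive,
  and modulo \<open>p\<close> and \<open>p\<close>-th powers they are given by \<open>wlog\<close>.\<close>

definition wlog :: "(nat \<Rightarrow> 'a) \<Rightarrow> nat \<Rightarrow> 'a" where
  "wlog x j = x j + (\<Sum>i<j. x i ^ (p ^ (j - i) - p) * \<Delta> (x i))"

lemma wlog_0 [simp]: "wlog x 0 = x 0"
  by (simp add: wlog_def)

text \<open>The defining equation of the exact coordinate L_{m+1}, written without division by
  p^{m+1}.\<close>

definition glog :: "(nat \<Rightarrow> ('a, int) mpoly) \<Rightarrow> nat \<Rightarrow> ('a, int) mpoly \<Rightarrow> bool" where
  "glog z m l \<longleftrightarrow> ghost p z (Suc m) = frob_lift p (ghost p z m) + of_nat p ^ Suc m * l"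

text \<open>By \<open>ghost_Suc\<close>, w_{m+1}(z) is w_m of the p-th powers plus p^{m+1} z_{m+1}.
  Comparing w_m of the p-th powers with sigma(w_m(z)) term by term, by
  \<open>power_prime_iterate_diff\<close>, produces the Delta_1 terms of
  \<open>wlog\<close>.\<close>

lemma glog_exists: "\<exists>l. glog z m l \<and> proj l \<approx> wlog (\<lambda>i. proj (z i)) (Suc m)"
proof -
  have "\<exists>E. (z i ^ p) ^ (p ^ (m - i)) = frob_lift p (z i) ^ (p ^ (m - i)) + of_nat p ^ Suc (m - i) * E \<and>
    proj E \<approx> proj (z i) ^ (p ^ Suc (m - i) - p) * \<Delta> (proj (z i))" for i
    by (rule power_prime_iterate_diff)
  then obtain E where E: "\<And>i. (z i ^ p) ^ (p ^ (m - i)) = frob_lift p (z i) ^ (p ^ (m - i)) + of_nat p ^ Suc (m - i) * E i"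
      "\<And>i. proj (E i) \<approx> proj (z i) ^ (p ^ Suc (m - i) - p) * \<Delta> (proj (z i))"
    by metis
  have "ghost p (\<lambda>i. z i ^ p) m = frob_lift p (ghost p z m) + of_nat p ^ Suc m * (\<Sum>i\<le>m. E i)"
  proof -
    have "of_nat p ^ i * (z i ^ p) ^ (p ^ (m - i)) =
      of_nat p ^ i * frob_lift p (z i) ^ (p ^ (m - i)) + of_nat p ^ Suc m * E i" if "i \<le> m" for i
    proof -
      have "(of_nat p :: ('a, int) mpoly) ^ Suc m = of_nat p ^ i * of_nat p ^ Suc (m - i)"
        unfolding power_add[symmetric] using that by (simp del: power_Suc)
      then show ?thesis by (simp only: E(1) distrib_left mult.assoc)
    qed
    then show ?thesis unfolding frob_lift_ghost unfolding ghost_def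
      by (simp only: sum_distrib_left sum.distrib[symmetric]) (rule sum.cong, auto)
  qed
  then have "glog z m ((\<Sum>i\<le>m. E i) + z (Suc m))"
    by (simp add: glog_def ghost_Suc distrib_left del: power_Suc)
  moreover have "proj ((\<Sum>i\<le>m. E i) + z (Suc m)) \<approx>
      (\<Sum>i\<le>m. proj (z i) ^ (p ^ (Suc m - i) - p) * \<Delta> (proj (z i))) + proj (z (Suc m))"
    unfolding proj_simps
  proof (intro eqp_add eqp_sum eqp_refl)
    fix i assume "i \<in> {..m}"
    then have i: "Suc m - i = Suc (m - i)" by auto
    show "proj (E i) \<approx> proj (z i) ^ (p ^ (Suc m - i) - p) * \<Delta> (proj (z i))"
      unfolding i by (rule E(2))
  qed
  ultimately show ?thesis
    unfolding wlog_def lessThan_Suc_atMost add.commute[of "proj (z (Suc m))"] by blast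
qed

lemma glog_unique: "glog z m l \<Longrightarrow> glog z m l' \<Longrightarrow> l = l'"
  unfolding glog_def using mpoly_of_nat_power_mult_cancel[of p "Suc m" l l'] p_gt_0 by simp

lemma proj_glog: "glog z m l \<Longrightarrow> proj l \<approx> wlog (\<lambda>i. proj (z i)) (Suc m)"
  using glog_exists[of z m] glog_unique by blast

lemma proj_wadd: "proj (wadd p x y i) = wadd p (\<lambda>i. proj (x i)) (\<lambda>i. proj (y i)) i"
  by (simp add: proj_def ev_wadd)

lemma proj_wmul: "proj (wmul p x y i) = wmul p (\<lambda>i. proj (x i)) (\<lambda>i. proj (y i)) i"
  by (simp add: proj_def ev_wmul)

text \<open>The exact coordinates are additive because ghost components and sigma are; projection
  costs only p-th powers.\<close>

lemma wlog_wadd: "wlog (wadd p x y) (Suc m) \<approx> wlog x (Suc m) + wlog y (Suc m)"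
proof -
  obtain X' Y' where XY: "\<And>i. proj (X' i) = x i" "\<And>i. proj (Y' i) = y i"
    using proj_lift_seq[of x] proj_lift_seq[of y] by blast
  obtain l k where l: "glog X' m l" and k: "glog Y' m k" using glog_exists by blast
  then have lk: "glog (wadd p X' Y') m (l + k)"
    by (simp add: glog_def ghost_wadd prime_p frob_lift_simps algebra_simps)
  have "wlog (\<lambda>i. proj (wadd p X' Y' i)) (Suc m) \<approx> proj (l + k)"
    by (rule eqp_sym[OF proj_glog[OF lk]])
  also have "proj (l + k) = proj l + proj k" by (simp add: proj_simps)
  also have "\<dots> \<approx> wlog x (Suc m) + wlog y (Suc m)"
    using proj_glog[OF l] proj_glog[OF k] by (intro eqp_add) (simp_all add: XY)
  also have "(\<lambda>i. proj (wadd p X' Y' i)) = wadd p x y" by (simp add: proj_wadd XY fun_eq_iff)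
  finally show ?thesis .
qed

text \<open>With b = F(a), the difference w_{m+1} - sigma w_m of a product b x splits into
  w_{m+1}(b) times the difference for x and the difference for b times sigma(w_m(x)). After division
  by p^{m+1} and reduction the first factor is a_0 to the power p^{m+2}, while the second product is
  a p-th power.\<close>

lemma wlog_wmul:
  "wlog (wmul p (\<lambda>i. a i ^ p) x) (Suc m) \<approx> a 0 ^ (p ^ Suc (Suc m)) * wlog x (Suc m)"
proof -
  obtain X' A' where XA: "\<And>i. proj (X' i) = x i" "\<And>i. proj (A' i) = a i"
    using proj_lift_seq[of x] proj_lift_seq[of a] by blast
  define P where "P = (of_nat p :: ('a, int) mpoly) ^ Suc m"
  obtain l k where l: "glog X' m l" and k: "glog A' (Suc m) k" using glog_exists by blast
  let ?AP = "\<lambda>i. A' i ^ p"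
  \<comment> \<open>The ghost component w_{m+1} of F(A') is w_{m+2}(A') without its last term, which
    is why the coordinate of \<open>A'\<close> is taken one index higher than that of
    \<open>X'\<close>.\<close>
  have 1: "ghost p ?AP (Suc m) = frob_lift p (ghost p A' (Suc m)) + P * (of_nat p * (k - A' (Suc (Suc m))))"
    using k unfolding glog_def ghost_Suc[of p A' "Suc m"] by (simp add: P_def algebra_simps)
  have "ghost p ?AP m = ghost p A' (Suc m) - P * A' (Suc m)"
    by (simp add: ghost_Suc[of p A' m] P_def)
  then have 2: "frob_lift p (ghost p ?AP m) = frob_lift p (ghost p A' (Suc m)) - P * frob_lift p (A' (Suc m))"
    by (simp add: frob_lift_simps P_def)
  define w where "w = ghost p ?AP (Suc m) * l +
    (frob_lift p (A' (Suc m)) + of_nat p * (k - A' (Suc (Suc m)))) * frob_lift p (ghost p X' m)"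
  have "glog (wmul p ?AP X') m w"
  proof -
    have x: "ghost p X' (Suc m) = frob_lift p (ghost p X' m) + P * l" using l by (simp add: glog_def P_def)
    have a: "ghost p ?AP (Suc m) = frob_lift p (ghost p ?AP m) +
        P * (frob_lift p (A' (Suc m)) + of_nat p * (k - A' (Suc (Suc m))))"
      unfolding 1 2 by (simp add: algebra_simps)
    have "ghost p ?AP (Suc m) * ghost p X' (Suc m) =
      ghost p ?AP (Suc m) * frob_lift p (ghost p X' m) + P * (ghost p ?AP (Suc m) * l)"
      unfolding x by (simp add: algebra_simps)
    also have "ghost p ?AP (Suc m) * frob_lift p (ghost p X' m) =
      frob_lift p (ghost p ?AP m) * frob_lift p (ghost p X' m) +
      P * ((frob_lift p (A' (Suc m)) + of_nat p * (k - A' (Suc (Suc m)))) * frob_lift p (ghost p X' m))"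
      by (subst a) (simp only: distrib_right mult.assoc)
    finally show ?thesis
      unfolding glog_def ghost_wmul[OF prime_p] frob_lift_simps w_def P_def[symmetric]
      by (simp only: distrib_left add.assoc add.commute[of "P * (_ * l)"])
  qed
  from eqp_sym[OF proj_glog[OF this]]
  have "wlog (\<lambda>i. proj (wmul p ?AP X' i)) (Suc m) \<approx> proj w" .
  also have "proj w = a 0 ^ (p ^ Suc (Suc m)) * proj l + (a (Suc m) * proj (ghost p X' m)) ^ p"
  proof -
    have "(\<Sum>i\<le>n. of_nat p ^ i * (b i :: 'a)) = b 0" for b and n :: nat
      by (induction n) (auto simp: char_p)
    then have "proj (ghost p ?AP (Suc m)) = (a 0 ^ p) ^ (p ^ Suc m)"
      unfolding ghost_def by (simp add: proj_simps XA del: sum.atMost_Suc)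
    then show ?thesis
      by (simp add: w_def proj_simps proj_frob_lift XA char_p power_mult_distrib power_mult[symmetric] mult_ac)
  qed
  also have "\<dots> \<approx> a 0 ^ (p ^ Suc (Suc m)) * proj l" by (rule eqp_add_pow)
  also have "\<dots> = (a 0 ^ (p ^ Suc m)) ^ p * proj l" by (simp add: mult_ac flip: power_mult)
  also have "\<dots> \<approx> (a 0 ^ (p ^ Suc m)) ^ p * wlog x (Suc m)"
    using proj_glog[OF l] by (intro eqp_mult) (simp add: XA)
  also have "\<dots> = a 0 ^ (p ^ Suc (Suc m)) * wlog x (Suc m)" by (simp add: mult_ac flip: power_mult)
  also have "(\<lambda>i. proj (wmul p ?AP X' i)) = wmul p (\<lambda>i. a i ^ p) x"
    by (simp add: proj_wmul XA proj_simps fun_eq_iff)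
  finally show ?thesis .
qed

lemma wlog_frobenius: "wlog (\<lambda>i. x i ^ p) (Suc m) \<approx> 0"
proof -
  have "(x i ^ p) ^ e * \<Delta> (x i ^ p) \<approx> 0" for i e
  proof -
    have "(x i ^ p) ^ e = (x i ^ e) ^ p" by (simp add: mult.commute flip: power_mult)
    then show ?thesis using eqp_mult[OF \<Delta>_frobenius, of "x i ^ e" "x i"] by simp
  qed
  then have "wlog (\<lambda>i. x i ^ p) (Suc m) \<approx> x (Suc m) ^ p + (\<Sum>i<Suc m. 0)"
    unfolding wlog_def by (intro eqp_add eqp_refl eqp_sum) simp
  then show ?thesis using eqp_pow eqp_trans by simp
qed

end

section \<open>Ideals and Frobenius powers\<close>

definition idl :: "'a::comm_ring_1 set \<Rightarrow> 'a set" where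
  "idl A = \<Inter>{J. is_ideal J \<and> A \<subseteq> J}"

lemma is_ideal_idl: "is_ideal (idl A)"
  by (auto simp: idl_def is_ideal_def)

lemma idl_superset: "A \<subseteq> idl A"
  by (auto simp: idl_def)

lemma idl_minimal: "is_ideal J \<Longrightarrow> A \<subseteq> J \<Longrightarrow> idl A \<subseteq> J"
  by (auto simp: idl_def)

lemma idl_mono: "A \<subseteq> idl B \<Longrightarrow> idl A \<subseteq> idl B"
  by (rule idl_minimal[OF is_ideal_idl])

lemma idl_base: "a \<in> A \<Longrightarrow> a \<in> idl A"
  using idl_superset by blast

definition fpow :: "'a::comm_ring_1 set \<Rightarrow> nat \<Rightarrow> 'a set" where
  "fpow J q = idl ((\<lambda>a. a ^ q) ` J)"

lemma is_ideal_fpow: "is_ideal (fpow J q)"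
  by (simp add: fpow_def is_ideal_idl)

lemma fpow_base: "a \<in> J \<Longrightarrow> a ^ q \<in> fpow J q"
  by (simp add: fpow_def idl_base)

lemma fpow_1:
  assumes J: "is_ideal J" shows "fpow J (Suc 0) = J"
proof
  show "fpow J (Suc 0) \<subseteq> J" unfolding fpow_def by (rule idl_minimal[OF J]) auto
  show "J \<subseteq> fpow J (Suc 0)" using fpow_base[of _ J "Suc 0"] by auto
qed

context char_p_ring
begin

lemma frobenius_iterate_add: "(a + b :: 'a) ^ (p ^ i) = a ^ (p ^ i) + b ^ (p ^ i)"
proof (induction i)
  case (Suc i)
  have "(a + b) ^ (p ^ Suc i) = ((a + b) ^ (p ^ i)) ^ p" by (simp add: mult.commute flip: power_mult)
  also have "\<dots> = (a ^ (p ^ i)) ^ p + (b ^ (p ^ i)) ^ p" by (simp only: Suc frobenius_add)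
  finally show ?case by (simp add: mult.commute flip: power_mult)
qed simp

lemma is_ideal_frobenius_preimage:
  assumes "is_ideal (J :: 'a set)"
  shows "is_ideal {a. a ^ (p ^ i) \<in> J}"
  using assms p_gt_0
  by (intro is_idealI) (auto simp: power_0_left is_ideal_0 frobenius_iterate_add is_ideal_add power_mult_distrib is_ideal_mult)

text \<open>In characteristic p the map a -> a^{p^i} is a ring homomorphism, so the preimage of an
  ideal is an ideal and the generators decide.\<close>

lemma fpow_idl: "fpow (idl A) (p ^ i) = idl ((\<lambda>a :: 'a. a ^ (p ^ i)) ` A)"
proof
  let ?J = "idl ((\<lambda>a. a ^ (p ^ i)) ` A)"
  have "idl A \<subseteq> {a. a ^ (p ^ i) \<in> ?J}"
    by (rule idl_minimal[OF is_ideal_frobenius_preimage[OF is_ideal_idl]]) (auto intro: idl_base)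
  then show "fpow (idl A) (p ^ i) \<subseteq> ?J"
    unfolding fpow_def by (intro idl_mono) auto
  show "?J \<subseteq> fpow (idl A) (p ^ i)"
    unfolding fpow_def by (intro idl_mono) (auto intro!: idl_base)
qed

lemma fpow_fpow: "fpow (fpow J (p ^ i)) (p ^ j) = fpow (J :: 'a set) (p ^ (i + j))"
  unfolding fpow_def[of J] fpow_idl by (simp add: image_image power_add flip: power_mult)

end

section \<open>Splittings in terms of a dual basis\<close>

text \<open>\<open>DB\<close> lists the pairs \<open>(d, v)\<close> of a basis element \<open>v\<close> of \<open>F\<^sub>*S\<close> and the \<open>d\<close> for which
  \<open>a \<mapsto> u (d * a)\<close> is the dual basis element.\<close>

locale fdual = delta_ring p M \<Delta> for p :: nat and M :: "'a::comm_ring_1 set" and \<Delta> +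
  fixes u :: "'a \<Rightarrow> 'a" and DB :: "('a \<times> 'a) list"
  assumes u_add: "u (a + b) = u a + u b"
    and u_scale: "u (a ^ p * b) = a * u b"
    and u_dual: "(\<Sum>(d, v)\<leftarrow>DB. u (d * a) ^ p * v) = a"
begin

lemma u_0 [simp]: "u 0 = 0"
  using u_scale[of 0 0] by simp

lemma ui_0 [simp]: "(u ^^ i) 0 = 0"
  by (induction i) auto

lemma ui_add: "(u ^^ i) (a + b) = (u ^^ i) a + (u ^^ i) b"
  by (induction i) (auto simp: u_add)

lemma ui_scale: "(u ^^ i) (a ^ (p ^ i) * b) = a * (u ^^ i) b"
proof (induction i arbitrary: a b)
  case (Suc i)
  have "(u ^^ Suc i) (a ^ (p ^ Suc i) * b) = u ((u ^^ i) ((a ^ p) ^ (p ^ i) * b))"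
    by (simp add: power_mult)
  then show ?case by (simp add: Suc u_scale)
qed simp

lemma ui_uminus: "(u ^^ i) (- a) = - (u ^^ i) a"
  using ui_add[of i a "- a"] by (simp add: eq_neg_iff_add_eq_0 add.commute)

lemma ui_diff: "(u ^^ i) (a - b) = (u ^^ i) a - (u ^^ i) b"
  using ui_add[of i a "- b"] by (simp add: ui_uminus)

lemma ui_sum: "(u ^^ i) (sum h A) = (\<Sum>x\<in>A. (u ^^ i) (h x))"
  by (induction A rule: infinite_finite_induct) (auto simp: ui_add)

lemma ui_pow: "(u ^^ Suc i) (g * r ^ p) = (u ^^ i) (u g * r)"
  by (simp add: funpow_Suc_right mult.commute[of _ "r ^ p"] u_scale mult.commute[of r] del: funpow.simps)

lemma pairing_mem:
  assumes "is_ideal J" "a \<in> fpow J (p ^ i)"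
  shows "(u ^^ i) (b * a) \<in> J"
proof -
  have "fpow J (p ^ i) \<subseteq> {a. \<forall>b. (u ^^ i) (b * a) \<in> J}"
    unfolding fpow_def
  proof (rule idl_minimal)
    show "is_ideal {a. \<forall>b. (u ^^ i) (b * a) \<in> J}"
      using assms(1) by (intro is_idealI)
        (auto simp: is_ideal_0 distrib_left ui_add is_ideal_add mult.assoc[symmetric])
    show "(\<lambda>a. a ^ (p ^ i)) ` J \<subseteq> {a. \<forall>b. (u ^^ i) (b * a) \<in> J}"
      using assms(1) by (auto simp: mult.commute[of _ "_ ^ _"] ui_scale is_ideal_mult2)
  qed
  then show ?thesis using assms(2) by blast
qed

lemma is_ideal_sum_list: "is_ideal J \<Longrightarrow> (\<And>x. x \<in> set xs \<Longrightarrow> h x \<in> J) \<Longrightarrow> (\<Sum>x\<leftarrow>xs. h x) \<in> J"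
  by (induction xs) (auto intro: is_ideal_0 is_ideal_add)

text \<open>Together with \<open>pairing_mem\<close> this says that a lies in J^[p^i] if and only if
  u^i sends S a into J. Each step expands a in the basis of F_*S, whose coefficients are the
  elements u(d a).\<close>

lemma pairing_detect:
  assumes "is_ideal J" "\<And>b. (u ^^ i) (b * a) \<in> J"
  shows "a \<in> fpow J (p ^ i)"
  using assms
proof (induction i arbitrary: a)
  case 0
  then show ?case using 0(2)[of 1] by (simp add: fpow_1)
next
  case (Suc i)
  have "u (b * a) \<in> fpow J (p ^ i)" for b
  proof (rule Suc.IH[OF Suc.prems(1)])
    fix c
    have "(u ^^ Suc i) ((c ^ p * b) * a) \<in> J" by (rule Suc.prems)
    then show "(u ^^ i) (c * u (b * a)) \<in> J"
      by (simp add: funpow_Suc_right mult.assoc u_scale del: funpow.simps)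
  qed
  then have "(\<Sum>(d, v)\<leftarrow>DB. u (d * a) ^ p * v) \<in> fpow (fpow J (p ^ i)) (p ^ 1)"
    by (intro is_ideal_sum_list is_ideal_fpow) (auto intro!: is_ideal_mult2[OF is_ideal_fpow] fpow_base)
  then show ?case unfolding u_dual fpow_fpow by simp
qed

lemma ui_fpow:
  assumes "is_ideal J" "a \<in> fpow J (p ^ (i + j))"
  shows "(u ^^ i) a \<in> fpow J (p ^ j)"
proof -
  have "a \<in> fpow (fpow J (p ^ j)) (p ^ i)" using assms by (simp add: fpow_fpow add.commute)
  from pairing_mem[OF is_ideal_fpow this, of 1] show ?thesis by simp
qed

text \<open>Dual bases compose along the iteration: the products \<open>d' ^ p * d\<close> and
  \<open>v' ^ p * v\<close> serve for the next iterate of u.\<close>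

lemma dual_basis_iterate: "\<exists>ws. \<forall>a. (\<Sum>(d, v)\<leftarrow>ws. (u ^^ i) (d * a) ^ (p ^ i) * v) = a"
proof (induction i)
  case 0
  show ?case by (rule exI[of _ "[(1, 1)]"]) simp
next
  case (Suc i)
  then obtain ws where ws: "\<And>a. (\<Sum>(d, v)\<leftarrow>ws. (u ^^ i) (d * a) ^ (p ^ i) * v) = a" by blast
  define us where "us = concat (map (\<lambda>(d, v). map (\<lambda>(d', v'). (d' ^ p * d, v' ^ p * v)) ws) DB)"
  have frob: "(sum_list xs :: 'a) ^ p = (\<Sum>x\<leftarrow>xs. x ^ p)" for xs
    by (induction xs) (auto simp: frobenius_add)
  have "(\<Sum>(d, v)\<leftarrow>us. (u ^^ Suc i) (d * a) ^ (p ^ Suc i) * v) = a" for a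
  proof -
    have inner: "(\<Sum>(d', v')\<leftarrow>ws. (u ^^ Suc i) (d' ^ p * d * a) ^ (p ^ Suc i) * (v' ^ p * v)) = u (d * a) ^ p * v" for d v
    proof -
      have "(u ^^ Suc i) (d' ^ p * d * a) = (u ^^ i) (d' * u (d * a))" for d'
        by (simp add: funpow_Suc_right mult.assoc u_scale del: funpow.simps)
      then have "(\<Sum>(d', v')\<leftarrow>ws. (u ^^ Suc i) (d' ^ p * d * a) ^ (p ^ Suc i) * (v' ^ p * v)) =
          (\<Sum>(d', v')\<leftarrow>ws. ((u ^^ i) (d' * u (d * a)) ^ (p ^ i) * v') ^ p * v)"
        by (intro arg_cong[where f=sum_list] map_cong)
          (auto simp: power_mult_distrib mult_ac simp flip: power_mult)
      also have "\<dots> = (\<Sum>(d', v')\<leftarrow>ws. (u ^^ i) (d' * u (d * a)) ^ (p ^ i) * v') ^ p * v"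
        unfolding frob by (simp add: sum_list_mult_const[symmetric] case_prod_unfold o_def)
      finally show ?thesis by (simp only: ws)
    qed
    have "(\<Sum>(d, v)\<leftarrow>us. (u ^^ Suc i) (d * a) ^ (p ^ Suc i) * v) =
        (\<Sum>(d, v)\<leftarrow>xs. (\<Sum>(d', v')\<leftarrow>ws. (u ^^ Suc i) (d' ^ p * d * a) ^ (p ^ Suc i) * (v' ^ p * v)))"
      if "us = concat (map (\<lambda>(d, v). map (\<lambda>(d', v'). (d' ^ p * d, v' ^ p * v)) ws) xs)" for us xs
      unfolding that by (induction xs) (auto simp: case_prod_unfold o_def)
    from this[OF us_def] show ?thesis by (simp only: inner u_dual)
  qed
  then show ?case by blast
qed

text \<open>The functional Phi is \<open>psi 0 g n\<close>. The lower limit i discards the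
  coordinates with j < i, which vanish on Witt vectors with i leading zeros, and allows g to be
  built one entry at a time.\<close>

definition psi :: "nat \<Rightarrow> (nat \<Rightarrow> 'a) \<Rightarrow> nat \<Rightarrow> (nat \<Rightarrow> 'a) \<Rightarrow> 'a" where
  "psi i g n z = (\<Sum>j\<in>{i..<n}. (u ^^ Suc j) (g j * wlog z j))"

text \<open>For a \<open>p\<close>-monomial \<open>c\<close>, the functional \<open>psi 0 g n\<close> takes the value
  $u^{i+1}(c \cdot \mathit{obstruction}\ g\ n\ i\ x)$ at $V^i[c x]$. It therefore descends to the
  quotient by an ideal once the obstructions of generators lie in its Frobenius powers.\<close>

definition obstruction :: "(nat \<Rightarrow> 'a) \<Rightarrow> nat \<Rightarrow> nat \<Rightarrow> 'a \<Rightarrow> 'a" where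
  "obstruction g n i x = g i * x + (\<Sum>j\<in>{1..<n - i}. (u ^^ j) (g (i + j) * (x ^ (p ^ j - p) * \<Delta> x)))"

lemma wlog_wshift: "wlog (wshift i b) j = (if j < i then 0 else if j = i then b else b ^ (p ^ (j - i) - p) * \<Delta> b)"
proof -
  have "(\<Sum>k<j. wshift i b k ^ (p ^ (j - k) - p) * \<Delta> (wshift i b k)) =
      (\<Sum>k<j. if k = i then b ^ (p ^ (j - i) - p) * \<Delta> b else 0)"
    by (rule sum.cong) (auto simp: wshift_def)
  then show ?thesis by (auto simp: wlog_def wshift_def sum.delta)
qed

lemma wlog_low:
  assumes "\<And>k. k < i \<Longrightarrow> z k = 0" "j \<le> i"
  shows "wlog z j = z j"
  using assms by (auto simp: wlog_def intro!: sum.neutral)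

text \<open>For a sequence \<open>g\<close> which kills \<open>p\<close>-th powers modulo \<open>K\<close>, the ambiguity in \<open>wlog\<close> disappears.\<close>

definition kills :: "'a set \<Rightarrow> nat \<Rightarrow> (nat \<Rightarrow> 'a) \<Rightarrow> nat \<Rightarrow> bool" where
  "kills K i g n \<longleftrightarrow> (\<forall>j\<in>{i..<n}. j \<noteq> 0 \<longrightarrow> (\<forall>r. (u ^^ Suc j) (g j * r ^ p) \<in> K))"

lemma psi_term_cong:
  assumes "is_ideal K" "kills K i g n" "j \<in> {i..<n}" "j \<noteq> 0" "a \<approx> b"
  shows "(u ^^ Suc j) (g j * a) - (u ^^ Suc j) (g j * b) \<in> K"
proof -
  obtain r where "a = b + r ^ p" using assms(5) by (auto simp: eqp_def)
  then have "(u ^^ Suc j) (g j * a) = (u ^^ Suc j) (g j * b) + (u ^^ Suc j) (g j * r ^ p)"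
    by (simp only: distrib_left ui_add)
  then show ?thesis using assms(2-4) by (simp add: kills_def del: funpow.simps)
qed

lemma psi_wadd:
  assumes "is_ideal K" "kills K i g n"
  shows "psi i g n (wadd p x y) - (psi i g n x + psi i g n y) \<in> K"
proof -
  have "(u ^^ Suc j) (g j * wlog (wadd p x y) j) -
      ((u ^^ Suc j) (g j * wlog x j) + (u ^^ Suc j) (g j * wlog y j)) \<in> K" if "j \<in> {i..<n}" for j
  proof (cases j)
    case 0
    then show ?thesis using assms(1) by (simp add: wadd_0[OF prime_p] distrib_left u_add is_ideal_0)
  next
    case (Suc m)
    have "(u ^^ Suc j) (g j * wlog (wadd p x y) j) - (u ^^ Suc j) (g j * (wlog x j + wlog y j)) \<in> K"
      using Suc that by (intro psi_term_cong[OF assms]) (auto simp: wlog_wadd)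
    then show ?thesis by (simp only: distrib_left ui_add)
  qed
  from is_ideal_sum[OF assms(1) this, of "{i..<n}" "\<lambda>x. x"] show ?thesis
    by (simp add: psi_def sum_subtractf sum.distrib del: funpow.simps)
qed

lemma psi_wmul:
  assumes "is_ideal K" "kills K i g n"
  shows "psi i g n (wmul p (\<lambda>k. a k ^ p) x) - a 0 * psi i g n x \<in> K"
proof -
  have "(u ^^ Suc j) (g j * wlog (wmul p (\<lambda>k. a k ^ p) x) j) - a 0 * (u ^^ Suc j) (g j * wlog x j) \<in> K"
    if "j \<in> {i..<n}" for j
  proof -
    have 1: "(u ^^ Suc j) (g j * (a 0 ^ (p ^ Suc j) * wlog x j)) = a 0 * (u ^^ Suc j) (g j * wlog x j)"
      by (subst mult.left_commute) (rule ui_scale)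
    show ?thesis
    proof (cases j)
      case 0
      then show ?thesis using assms(1) 1 by (simp add: wmul_0[OF prime_p] is_ideal_0)
    next
      case (Suc m)
      have "(u ^^ Suc j) (g j * wlog (wmul p (\<lambda>k. a k ^ p) x) j) -
          (u ^^ Suc j) (g j * (a 0 ^ (p ^ Suc j) * wlog x j)) \<in> K"
        using Suc that wlog_wmul[of a x m] by (intro psi_term_cong[OF assms]) auto
      then show ?thesis by (simp only: 1)
    qed
  qed
  from is_ideal_sum[OF assms(1) this, of "{i..<n}" "\<lambda>x. x"] show ?thesis
    by (simp add: psi_def sum_subtractf sum_distrib_left del: funpow.simps)
qed

lemma psi_frobenius:
  assumes "is_ideal K" "kills K i g n" "i \<noteq> 0"
  shows "psi i g n (\<lambda>k. x k ^ p) \<in> K"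
  unfolding psi_def
proof (rule is_ideal_sum[OF assms(1)])
  fix j assume j: "j \<in> {i..<n}"
  then obtain m where "j = Suc m" using assms(3) by (cases j) auto
  then have "wlog (\<lambda>k. x k ^ p) j \<approx> 0" using wlog_frobenius by simp
  from psi_term_cong[OF assms(1,2) j _ this] show "(u ^^ Suc j) (g j * wlog (\<lambda>k. x k ^ p) j) \<in> K"
    using assms(3) j by (simp del: funpow.simps)
qed

lemma kills_mono: "kills K i g n \<Longrightarrow> i \<le> j \<Longrightarrow> kills K j g n"
  by (auto simp: kills_def)

text \<open>For c in M, \<Delta> of c x is c^p times \<Delta> x modulo p-th powers, so the
  coordinate of V^i[c x] of index i + j is that of V^i[x] times c^{p^j}, and u^j extracts c. For
  general c the product rule adds a term x^p \<Delta> c; hence the restriction to M.\<close>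

lemma psi_wshift_mult:
  assumes "is_ideal K" "kills K 0 g n" "c \<in> M" "i < n"
  shows "psi 0 g n (wshift i (c * x)) - (u ^^ Suc i) (c * obstruction g n i x) \<in> K"
proof -
  define t where "t = (\<lambda>j. (u ^^ Suc j) (g j * wlog (wshift i (c * x)) j))"
  have "psi 0 g n (wshift i (c * x)) = (\<Sum>j\<in>{0..<i}. t j) + t i + (\<Sum>j\<in>{1..<n - i}. t (i + j))"
  proof -
    have "(\<Sum>j\<in>{Suc i..<n}. t j) = (\<Sum>j\<in>{1..<n - i}. t (i + j))"
      by (rule sum.reindex_bij_witness[of _ "\<lambda>j. i + j" "\<lambda>j. j - i"]) auto
    then show ?thesis
      using assms(4) unfolding psi_def t_def[symmetric]
      by (simp add: sum.atLeastLessThan_concat[of 0 i n t, symmetric] sum.atLeast_Suc_lessThan[of i n t] add.assoc)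
  qed
  also have "(\<Sum>j\<in>{0..<i}. t j) = 0"
    by (rule sum.neutral) (auto simp: t_def wlog_wshift)
  finally have A: "psi 0 g n (wshift i (c * x)) = t i + (\<Sum>j\<in>{1..<n - i}. t (i + j))" by simp
  have B: "(u ^^ Suc i) (c * obstruction g n i x) = t i +
      (\<Sum>j\<in>{1..<n - i}. (u ^^ Suc i) (c * (u ^^ j) (g (i + j) * (x ^ (p ^ j - p) * \<Delta> x))))"
    by (simp only: obstruction_def distrib_left ui_add sum_distrib_left ui_sum t_def wlog_wshift)
      (simp add: mult.left_commute del: funpow.simps)
  have "t (i + j) - (u ^^ Suc i) (c * (u ^^ j) (g (i + j) * (x ^ (p ^ j - p) * \<Delta> x))) \<in> K"
    if j: "j \<in> {1..<n - i}" for j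
  proof -
    have pj: "p \<le> p ^ j" using j p_gt_0 by (cases j) auto
    \<comment> \<open>As a multiple of p this exponent gives a p-th power, by which a congruence
      modulo p-th powers may be multiplied.\<close>
    have ex: "p ^ j - p = (p ^ (j - 1) - 1) * p" using j by (cases j) (auto simp: algebra_simps diff_mult_distrib)
    have "\<Delta> (c * x) \<approx> c ^ p * \<Delta> x" by (rule \<Delta>_M_mult[OF assms(3)])
    then have "((c * x) ^ (p ^ (j - 1) - 1)) ^ p * \<Delta> (c * x) \<approx> ((c * x) ^ (p ^ (j - 1) - 1)) ^ p * (c ^ p * \<Delta> x)"
      by (rule eqp_mult)
    then have 1: "(c * x) ^ (p ^ j - p) * \<Delta> (c * x) \<approx> (c * x) ^ (p ^ j - p) * (c ^ p * \<Delta> x)"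
      by (simp add: ex flip: power_mult)
    have "c ^ (p ^ j) = c ^ (p ^ j - p) * c ^ p" using pj by (simp flip: power_add)
    then have 2: "(c * x) ^ (p ^ j - p) * (c ^ p * \<Delta> x) = c ^ (p ^ j) * (x ^ (p ^ j - p) * \<Delta> x)"
      by (simp add: power_mult_distrib mult_ac)
    have "(u ^^ Suc (i + j)) (g (i + j) * (c ^ (p ^ j) * (x ^ (p ^ j - p) * \<Delta> x))) =
        (u ^^ Suc i) ((u ^^ j) (c ^ (p ^ j) * (g (i + j) * (x ^ (p ^ j - p) * \<Delta> x))))"
      by (simp only: add_Suc[symmetric] funpow_add o_apply mult.left_commute[of "g _"])
    also have "\<dots> = (u ^^ Suc i) (c * (u ^^ j) (g (i + j) * (x ^ (p ^ j - p) * \<Delta> x)))"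
      by (simp only: ui_scale)
    finally have 3: "(u ^^ Suc (i + j)) (g (i + j) * (c ^ (p ^ j) * (x ^ (p ^ j - p) * \<Delta> x))) = \<dots>" .
    have "(u ^^ Suc (i + j)) (g (i + j) * ((c * x) ^ (p ^ j - p) * \<Delta> (c * x))) -
        (u ^^ Suc (i + j)) (g (i + j) * (c ^ (p ^ j) * (x ^ (p ^ j - p) * \<Delta> x))) \<in> K"
      using j by (intro psi_term_cong[OF assms(1,2)] 1[unfolded 2]) auto
    then show ?thesis using j unfolding 3 by (simp add: t_def wlog_wshift del: funpow.simps)
  qed
  from is_ideal_sum[OF assms(1) this, of "{1..<n - i}" "\<lambda>x. x"] show ?thesis
    unfolding A B by (simp add: sum_subtractf)
qed

end

section \<open>Passage between splittings and sequences g\<close>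

lemma is_ideal_zero: "is_ideal {0}"
  by (auto simp: is_ideal_def)

context fdual
begin

lemma psi_cong: "(\<And>j. j < n \<Longrightarrow> z j = z' j) \<Longrightarrow> psi i g n z = psi i g n z'"
  by (auto simp: psi_def wlog_def intro!: sum.cong)

lemma psi_split: "i < n \<Longrightarrow> psi i g n z = (u ^^ Suc i) (g i * wlog z i) + psi (Suc i) g n z"
  by (simp add: psi_def sum.atLeast_Suc_lessThan del: funpow.simps)

lemma psi_low:
  assumes "\<And>j. j < n \<Longrightarrow> z j = 0"
  shows "psi i g n z = 0"
proof -
  have "wlog z j = 0" if "j < n" for j
    using assms that wlog_low[of j z j] by auto
  then show ?thesis by (simp add: psi_def del: funpow.simps)
qed

text \<open>Every coefficient is a sum of elements of M, so the coefficients may be taken in M, as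
  \<open>psi_wshift_mult\<close> demands.\<close>

lemma idl_M_combination:
  assumes "a \<in> idl B"
  shows "\<exists>as. set as \<subseteq> M \<times> B \<and> a = (\<Sum>(c, x)\<leftarrow>as. c * x)"
proof -
  let ?J = "{a. \<exists>as. set as \<subseteq> M \<times> B \<and> a = (\<Sum>(c, x)\<leftarrow>as. c * x)}"
  have add: "a + b \<in> ?J" if "a \<in> ?J" "b \<in> ?J" for a b
  proof -
    from that obtain as bs where "set as \<subseteq> M \<times> B" "a = (\<Sum>(c, x)\<leftarrow>as. c * x)"
      "set bs \<subseteq> M \<times> B" "b = (\<Sum>(c, x)\<leftarrow>bs. c * x)" by blast
    then have "set (as @ bs) \<subseteq> M \<times> B" "a + b = (\<Sum>(c, x)\<leftarrow>as @ bs. c * x)" by auto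
    then show ?thesis by blast
  qed
  have 0: "0 \<in> ?J" by (auto intro!: exI[of _ "[]"])
  have mult_M: "m * a \<in> ?J" if "m \<in> M" "a \<in> ?J" for m a
  proof -
    from that(2) obtain as where as: "set as \<subseteq> M \<times> B" "a = (\<Sum>(c, x)\<leftarrow>as. c * x)" by blast
    let ?as = "map (\<lambda>(c, x). (m * c, x)) as"
    have "set ?as \<subseteq> M \<times> B" using as(1) that(1) by (auto intro!: M_mult)
    moreover have "m * a = (\<Sum>(c, x)\<leftarrow>?as. c * x)"
      unfolding as(2) by (simp add: sum_list_const_mult[symmetric] case_prod_unfold o_def mult.assoc)
    ultimately show ?thesis by blast
  qed
  have "is_ideal ?J"
  proof (rule is_idealI[OF 0 add])
    fix c a assume a: "a \<in> ?J"
    obtain ms where ms: "set ms \<subseteq> M" "c = sum_list ms" using M_generate by blast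
    have "set ms \<subseteq> M \<Longrightarrow> sum_list ms * a \<in> ?J" for ms
    proof (induction ms)
      case (Cons m ms)
      then show ?case using add[OF mult_M[OF _ a, of m], of "sum_list ms * a"] by (simp only: sum_list.Cons distrib_right) simp
    qed (use 0 in simp)
    then show "c * a \<in> ?J" using ms by blast
  qed
  moreover have "B \<subseteq> ?J"
  proof
    fix x assume "x \<in> B"
    then have "set [(1, x)] \<subseteq> M \<times> B" "x = (\<Sum>(c, x)\<leftarrow>[(1, x)]. c * x)"
      using M_of_int[of 1] by auto
    then show "x \<in> ?J" by blast
  qed
  ultimately show ?thesis using assms idl_minimal[of ?J B] by blast
qed

text \<open>The vanishing of the u (g j) makes the first three identities exact: the lemmas on
  \<open>psi\<close> are applied with K = {0}. For the descent, additivity reduces the claim to Witt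
  vectors with all components in the ideal.\<close>

lemma splitting_of_data:
  assumes g0: "u (g 0) = 1" and gj: "\<And>j. 0 < j \<Longrightarrow> j < n \<Longrightarrow> u (g j) = 0" and n: "n > 0"
    and obs: "\<And>i x. i < n \<Longrightarrow> x \<in> B \<Longrightarrow> obstruction g n i x \<in> fpow (idl B) (p ^ Suc i)"
  defines "\<Phi> \<equiv> psi 0 g n"
  shows "\<Phi> (wadd p x y) = \<Phi> x + \<Phi> y"
    and "\<Phi> (wmul p (\<lambda>k. a k ^ p) x) = a 0 * \<Phi> x"
    and "\<Phi> (\<lambda>k. x k ^ p) = x 0"
    and "(\<And>j. j < n \<Longrightarrow> x j - y j \<in> idl B) \<Longrightarrow> \<Phi> x - \<Phi> y \<in> idl B"
proof -
  have kills: "kills {0} 0 g n"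
    using gj by (auto simp: kills_def ui_pow simp del: funpow.simps)
  show add: "\<Phi> (wadd p x y) = \<Phi> x + \<Phi> y" for x y
    using psi_wadd[OF is_ideal_zero kills] by (simp add: \<Phi>_def)
  show "\<Phi> (wmul p (\<lambda>k. a k ^ p) x) = a 0 * \<Phi> x"
    using psi_wmul[OF is_ideal_zero kills] by (simp add: \<Phi>_def)
  have "u (g 0 * x 0 ^ p) = x 0" by (simp add: mult.commute[of "g 0"] u_scale g0)
  then show "\<Phi> (\<lambda>k. x k ^ p) = x 0"
    using psi_frobenius[OF is_ideal_zero kills_mono[OF kills], of "Suc 0" x] n
    by (simp add: \<Phi>_def psi_split)
  \<comment> \<open>Descending induction on the number i of leading zeros; for i = n nothing is left
    to evaluate.\<close>
  have van: "\<Phi> z \<in> idl B" if "i \<le> n" "\<And>j. j < i \<Longrightarrow> z j = 0" "\<And>j. z j \<in> idl B" for i z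
    using that
  proof (induction i arbitrary: z rule: inc_induct)
    case base
    then show ?case by (simp add: \<Phi>_def psi_low is_ideal_0[OF is_ideal_idl])
  next
    case (step i)
    \<comment> \<open>The entry \<open>z i\<close> is a sum of terms c x with c in M. Subtracting
      V^i[c x] removes one of them; it alters the later entries but keeps them in the ideal. When no
      term is left there is one more leading zero.\<close>
    have *: "\<Phi> z \<in> idl B"
      if "set as \<subseteq> M \<times> B" "z i = (\<Sum>(c, x)\<leftarrow>as. c * x)" "\<And>j. j < i \<Longrightarrow> z j = 0" "\<And>j. z j \<in> idl B" for as z
      using that
    proof (induction as arbitrary: z)
      case Nil
      then show ?case using step.IH[of z] by (auto simp: less_Suc_eq)
    next
      case (Cons cx as)
      obtain c x where cx: "cx = (c, x)" by (cases cx)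
      have cx': "c \<in> M" "x \<in> B" using Cons.prems(1) by (auto simp: cx)
      define v w where "v = wshift i (c * x)" and "w = wsub p z v"
      have "c * x \<in> idl B" using cx'(2) by (intro is_ideal_mult[OF is_ideal_idl] idl_base)
      then have v: "\<And>j. j < i \<Longrightarrow> v j = 0" "v i = c * x" "\<And>j. v j \<in> idl B"
        by (auto simp: v_def wshift_def is_ideal_0[OF is_ideal_idl])
      have "\<Phi> w \<in> idl B"
      proof (rule Cons.IH)
        show "set as \<subseteq> M \<times> B" using Cons.prems(1) by simp
        show "w i = (\<Sum>(c, x)\<leftarrow>as. c * x)"
          unfolding w_def using wsub_low(2)[OF prime_p Cons.prems(3) v(1), of i] Cons.prems(2) v(2) by (simp add: cx)
        show "w j = 0" if "j < i" for j
          unfolding w_def using wsub_low(1)[OF prime_p Cons.prems(3) v(1) that] by simp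
        show "w j \<in> idl B" for j
          unfolding w_def using Cons.prems(4) v(3)
          by (intro wsub_cong_ideal[OF prime_p is_ideal_idl] is_ideal_diff[OF is_ideal_idl])
      qed
      moreover have "\<Phi> v \<in> idl B"
      proof -
        have "\<Phi> v = (u ^^ Suc i) (c * obstruction g n i x)"
          using psi_wshift_mult[OF is_ideal_zero kills cx'(1) step.hyps(2)] by (simp add: \<Phi>_def v_def)
        then show ?thesis
          using pairing_mem[OF is_ideal_idl obs[OF step.hyps(2) cx'(2)]] by simp
      qed
      moreover have "\<Phi> z = \<Phi> v + \<Phi> w"
        by (simp add: w_def wadd_wsub[OF prime_p] flip: add)
      ultimately show ?case by (simp add: is_ideal_add[OF is_ideal_idl])
    qed
    show ?case using idl_M_combination[OF step.prems(2)[of i]] * step.prems by blast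
  qed
  show "\<Phi> x - \<Phi> y \<in> idl B" if "\<And>j. j < n \<Longrightarrow> x j - y j \<in> idl B"
  proof -
    define x' y' where "x' = (\<lambda>j. if j < n then x j else 0)" and "y' = (\<lambda>j. if j < n then y j else 0)"
    have xy: "\<Phi> x = \<Phi> x'" "\<Phi> y = \<Phi> y'"
      unfolding \<Phi>_def x'_def y'_def by (auto intro!: psi_cong)
    have "\<Phi> (wsub p x' y') \<in> idl B"
      by (rule van[of 0]) (auto intro!: wsub_cong_ideal[OF prime_p is_ideal_idl]
          simp: x'_def y'_def that is_ideal_0[OF is_ideal_idl])
    moreover have "\<Phi> x' = \<Phi> y' + \<Phi> (wsub p x' y')" by (simp add: wadd_wsub[OF prime_p] flip: add)
    ultimately show ?thesis by (simp add: xy)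
  qed
qed

text \<open>Here \<open>T z s a\<close> stands for $s \cdot \Psi(z) = a$, where $\Psi$ is a splitting with values in a
  localization of the quotient by \<open>K\<close> with denominators in \<open>D\<close>.\<close>

lemma data_of_splitting:
  assumes K: "is_ideal K" and D1: "1 \<in> D" and Dm: "\<And>s t. s \<in> D \<Longrightarrow> t \<in> D \<Longrightarrow> s * t \<in> D"
    and T_ex: "\<And>z. \<exists>s\<in>D. \<exists>a. T z s a"
    and T_scale: "\<And>z s a t. T z s a \<Longrightarrow> t \<in> D \<Longrightarrow> T z (t * s) (t * a)"
    and T_unique: "\<And>z s a b. T z s a \<Longrightarrow> T z s b \<Longrightarrow> a - b \<in> K"
    and T_cong: "\<And>z s a b. T z s a \<Longrightarrow> a - b \<in> K \<Longrightarrow> T z s b"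
    and T_add: "\<And>z w s a b. T z s a \<Longrightarrow> T w s b \<Longrightarrow> T (wadd p z w) s (a + b)"
    and T_mult: "\<And>z s a c. T z s a \<Longrightarrow> T (wmul p (\<lambda>k. c k ^ p) z) s (c 0 * a)"
    and T_frob: "\<And>z. T (\<lambda>k. z k ^ p) 1 (z 0)"
    and T_zero: "\<And>z. (\<And>j. j < n \<Longrightarrow> z j \<in> I) \<Longrightarrow> T z 1 0"
    and I: "is_ideal I" and n: "n > 0"
  shows "\<exists>g. \<exists>s\<in>D. u (g 0) - s \<in> K \<and> kills K 0 g n \<and>
    (\<forall>i<n. \<forall>x\<in>I. obstruction g n i x \<in> fpow K (p ^ Suc i))"
proof -
  \<comment> \<open>Descending induction on i: on Witt vectors with i leading zeros, s times the
    splitting is given by \<open>psi i g n\<close>. The denominator s grows at each step.\<close>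
  have P: "\<exists>s\<in>D. \<exists>g. kills K i g n \<and> (\<forall>z. (\<forall>j<i. z j = 0) \<longrightarrow> T z s (psi i g n z))" if "i \<le> n" for i
    using that
  proof (induction i rule: inc_induct)
    case base
    have "T z 1 0" if "\<forall>j<n. z j = 0" for z
      using that T_zero[of z] is_ideal_0[OF I] by auto
    then show ?case using D1 by (intro bexI[of _ 1] exI[of _ "\<lambda>_. 0"]) (auto simp: kills_def psi_def)
  next
    case (step i)
    from step.IH obtain s g where s: "s \<in> D" and kg: "kills K (Suc i) g n"
      and Tg: "\<And>z. (\<And>j. j < Suc i \<Longrightarrow> z j = 0) \<Longrightarrow> T z s (psi (Suc i) g n z)" by metis
    define G where "G = psi (Suc i) g n"
    note Gadd = psi_wadd[OF K kg, folded G_def] and Gmul = psi_wmul[OF K kg, folded G_def]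
    obtain ws where ws: "\<And>a. (\<Sum>(d, v)\<leftarrow>ws. (u ^^ Suc i) (d * a) ^ (p ^ Suc i) * v) = a"
      using dual_basis_iterate by blast
    \<comment> \<open>\<open>H t b a\<close> says that a represents t s \<Psi>(V^i[b]) - t
      G(V^i[b]), the part of the splitting not yet accounted for. It is additive in b, and a factor
      c^{p^{i+1}} of b comes out as c, so it must have the form u^{i+1}(\<gamma> b).\<close>
    define H where "H t b a \<longleftrightarrow> T (wshift i b) (t * s) (a + t * G (wshift i b))" for t b a
    have "\<exists>t\<in>D. \<forall>v\<in>set vs. \<exists>a. H t v a" for vs
    proof (induction vs)
      case Nil
      then show ?case using D1 by auto
    next
      case (Cons v vs)
      then obtain t where t: "t \<in> D" "\<And>v. v \<in> set vs \<Longrightarrow> \<exists>a. H t v a" by blast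
      obtain \<sigma> \<alpha> where \<sigma>: "\<sigma> \<in> D" "T (wshift i v) \<sigma> \<alpha>" using T_ex by blast
      have "H (\<sigma> * t) w (\<sigma> * a)" if "H t w a" for w a
        using T_scale[OF that[unfolded H_def] \<sigma>(1)] by (simp add: H_def distrib_left mult.assoc)
      moreover have "H (\<sigma> * t) v (t * s * \<alpha> - \<sigma> * t * G (wshift i v))"
        using T_scale[OF \<sigma>(2) Dm[OF t(1) s]] by (simp add: H_def mult_ac)
      ultimately have "\<forall>w\<in>set (v # vs). \<exists>a. H (\<sigma> * t) w a"
        using t(2) by (metis set_ConsD)
      then show ?case using Dm[OF \<sigma>(1) t(1)] by blast
    qed
    from this[of "map snd ws"] obtain t av where t: "t \<in> D"
      and av: "\<And>v. v \<in> snd ` set ws \<Longrightarrow> H t v (av v)" by (metis list.set_map)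
    \<comment> \<open>The functional is determined by its values \<open>av v\<close> on a basis, and
      \<gamma> is the element that the dual basis assigns to these values.\<close>
    define \<gamma> where "\<gamma> = (\<Sum>(d, v)\<leftarrow>ws. av v ^ (p ^ Suc i) * d)"
    have \<gamma>: "(u ^^ Suc i) (\<gamma> * b) = (\<Sum>(d, v)\<leftarrow>ws. (u ^^ Suc i) (d * b) * av v)" for b
    proof -
      have "(u ^^ Suc i) ((\<Sum>(d, v)\<leftarrow>us. av v ^ (p ^ Suc i) * d) * b) =
          (\<Sum>(d, v)\<leftarrow>us. (u ^^ Suc i) (d * b) * av v)" for us
      proof (induction us)
        case (Cons dv us)
        then show ?case
          by (cases dv) (simp add: distrib_right ui_add mult.assoc ui_scale mult.commute[of "av _"] del: funpow.simps power_Suc)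
      qed (simp del: funpow.simps)
      then show ?thesis by (simp only: \<gamma>_def)
    qed
    \<comment> \<open>Passing from the denominator s to t s multiplies the later part by t, and
      u^{j+1} turns the factor t^{p^{j+1}} into t.\<close>
    define g' where "g' = (\<lambda>j. if j = i then \<gamma> else t ^ (p ^ Suc j) * g j)"
    have g'_term: "(u ^^ Suc j) (g' j * r) = t * (u ^^ Suc j) (g j * r)" if "j \<noteq> i" for j r
      using that by (simp add: g'_def mult.assoc ui_scale del: funpow.simps power_Suc)
    have psi': "psi i g' n z = (u ^^ Suc i) (\<gamma> * wlog z i) + t * G z" for z
    proof -
      have "psi (Suc i) g' n z = t * G z"
        unfolding psi_def G_def sum_distrib_left by (rule sum.cong) (auto simp: g'_term simp del: funpow.simps)
      then show ?thesis using step.hyps(2) by (simp add: psi_split g'_def del: funpow.simps)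
    qed
    have ts: "t * s \<in> D" using t s by (rule Dm)
    have H0: "H t 0 0"
    proof -
      have "wshift i 0 = (\<lambda>_. 0 :: 'a)" by (auto simp: wshift_def)
      moreover have "G (\<lambda>_. 0) = 0" by (simp add: G_def psi_low)
      ultimately show ?thesis
        using T_scale[OF T_zero ts, of "\<lambda>_. 0"] is_ideal_0[OF I] by (simp add: H_def)
    qed
    have Hadd: "H t (b + b') (a + a')" if "H t b a" "H t b' a'" for b b' a a'
    proof -
      let ?x = "wadd p (wshift i b) (wshift i b')"
      define w where "w = wsub p (wshift i (b + b')) ?x"
      have x: "\<And>j. j < i \<Longrightarrow> ?x j = 0" "?x i = b + b'"
        using wadd_low[OF prime_p, of i "wshift i b" "wshift i b'"] by (auto simp: wshift_def)
      have sh: "wshift i (b + b') = wadd p ?x w" by (simp add: w_def wadd_wsub[OF prime_p])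
      have "w j = 0" if "j < Suc i" for j
        using wsub_low[OF prime_p, of i "wshift i (b + b')" ?x] x that
        by (auto simp: w_def wshift_def less_Suc_eq)
      then have "T w (t * s) (t * G w)" using T_scale[OF Tg t] by (simp add: G_def)
      then have "T (wshift i (b + b')) (t * s) (a + t * G (wshift i b) + (a' + t * G (wshift i b')) + t * G w)"
        unfolding sh using T_add[OF T_add[OF that[unfolded H_def]]] by blast
      moreover have "(a + t * G (wshift i b) + (a' + t * G (wshift i b')) + t * G w) -
          (a + a' + t * G (wshift i (b + b'))) \<in> K"
      proof -
        have "- t * ((G (wadd p ?x w) - (G ?x + G w)) + (G ?x - (G (wshift i b) + G (wshift i b')))) \<in> K"
          by (intro is_ideal_mult[OF K] is_ideal_add[OF K] Gadd)
        then show ?thesis unfolding sh[symmetric] by (simp add: algebra_simps)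
      qed
      ultimately show ?thesis unfolding H_def by (rule T_cong)
    qed
    have Hmul: "H t (c ^ (p ^ Suc i) * b) (c * a)" if "H t b a" for b c a
    proof -
      have sh: "wmul p (\<lambda>k. wshift 0 c k ^ p) (wshift i b) = wshift i (c ^ (p ^ Suc i) * b)"
      proof -
        have sq: "(\<lambda>k. wshift 0 c k ^ p) = wshift 0 (c ^ p)" by (auto simp: wshift_def)
        show ?thesis
          unfolding sq
          by (rule ext, subst wmul_wshift_0[OF prime_p]) (simp add: wshift_def flip: power_mult)
      qed
      have "T (wshift i (c ^ (p ^ Suc i) * b)) (t * s) (c * (a + t * G (wshift i b)))"
        using T_mult[OF that[unfolded H_def], of "wshift 0 c"] unfolding sh by (simp add: wshift_def)
      moreover have "c * (a + t * G (wshift i b)) - (c * a + t * G (wshift i (c ^ (p ^ Suc i) * b))) \<in> K"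
      proof -
        have "- t * (G (wshift i (c ^ (p ^ Suc i) * b)) - c * G (wshift i b)) \<in> K"
          using Gmul[of "wshift 0 c" "wshift i b"] unfolding sh
          by (intro is_ideal_mult[OF K]) (simp add: wshift_def)
        then show ?thesis by (simp add: algebra_simps)
      qed
      ultimately show ?thesis unfolding H_def by (rule T_cong)
    qed
    have H: "H t b ((u ^^ Suc i) (\<gamma> * b))" for b
    proof -
      have "H t (\<Sum>(d, v)\<leftarrow>us. (u ^^ Suc i) (d * b) ^ (p ^ Suc i) * v) (\<Sum>(d, v)\<leftarrow>us. (u ^^ Suc i) (d * b) * av v)"
        if "set us \<subseteq> set ws" for us
        using that
      proof (induction us)
        case (Cons dv us)
        obtain d v where dv: "dv = (d, v)" by (cases dv)
        then have "v \<in> snd ` set ws" using Cons.prems by force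
        then show ?case using Hadd[OF Hmul[OF av] Cons.IH] Cons.prems
          by (simp add: dv del: funpow.simps power_Suc)
      qed (simp add: H0)
      from this[OF subset_refl] show ?thesis unfolding ws \<gamma> .
    qed
    have T': "T z (t * s) (psi i g' n z)" if z: "\<And>j. j < i \<Longrightarrow> z j = 0" for z
    proof -
      define w where "w = wsub p z (wshift i (z i))"
      have zw: "z = wadd p (wshift i (z i)) w" by (simp add: w_def wadd_wsub[OF prime_p])
      have "w j = 0" if "j < Suc i" for j
        using wsub_low[OF prime_p, of i z "wshift i (z i)"] z that
        by (auto simp: w_def wshift_def less_Suc_eq)
      then have "T w (t * s) (t * G w)" using T_scale[OF Tg t] by (simp add: G_def)
      then have "T z (t * s) ((u ^^ Suc i) (\<gamma> * z i) + t * G (wshift i (z i)) + t * G w)"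
        by (subst zw) (rule T_add[OF H[unfolded H_def]])
      moreover have "((u ^^ Suc i) (\<gamma> * z i) + t * G (wshift i (z i)) + t * G w) - psi i g' n z \<in> K"
      proof -
        have "- t * (G (wadd p (wshift i (z i)) w) - (G (wshift i (z i)) + G w)) \<in> K"
          by (intro is_ideal_mult[OF K] Gadd)
        moreover have "wlog z i = z i" using z wlog_low[of i z i] by auto
        ultimately show ?thesis unfolding zw[symmetric] psi' by (simp add: algebra_simps del: funpow.simps)
      qed
      ultimately show ?thesis by (rule T_cong)
    qed
    moreover have "kills K i g' n"
      unfolding kills_def
    proof (intro ballI allI impI)
      fix j r assume j: "j \<in> {i..<n}" "j \<noteq> 0"
      show "(u ^^ Suc j) (g' j * r ^ p) \<in> K"
      proof (cases "j = i")
        case False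
        then show ?thesis using kg j is_ideal_mult[OF K] by (auto simp: g'_term kills_def simp del: funpow.simps)
      next
        case True
        \<comment> \<open>As i > 0, V^i[r^p] = F(V^i[r]) is the Frobenius of a vector with first
          component 0, so the splitting vanishes on it; this is what makes \<gamma> kill p-th
          powers.\<close>
        have sh: "(\<lambda>k. wshift i r k ^ p) = wshift i (r ^ p)" by (auto simp: wshift_def)
        have "T (wshift i (r ^ p)) (t * s) 0"
          using T_scale[OF T_frob[of "wshift i r"] ts] True j unfolding sh by (simp add: wshift_def)
        from T_unique[OF H[of "r ^ p", unfolded H_def] this]
        have "(u ^^ Suc i) (\<gamma> * r ^ p) + t * G (wshift i (r ^ p)) \<in> K" by simp
        moreover have "t * G (wshift i (r ^ p)) \<in> K"
          using psi_frobenius[OF K kg, of "wshift i r"] unfolding sh G_def by (intro is_ideal_mult[OF K]) simp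
        ultimately have "(u ^^ Suc i) (\<gamma> * r ^ p) + t * G (wshift i (r ^ p)) - t * G (wshift i (r ^ p)) \<in> K"
          by (rule is_ideal_diff[OF K])
        then show ?thesis by (simp add: True g'_def del: funpow.simps)
      qed
    qed
    ultimately show ?case using ts by blast
  qed
  from P[of 0] obtain s g where s: "s \<in> D" and kg: "kills K 0 g n" and T: "\<And>z. T z s (psi 0 g n z)" by auto
  \<comment> \<open>The splitting takes the value 1 at 1 = F(1), which pins down u (g 0) modulo
    K.\<close>
  have "u (g 0) - s \<in> K"
  proof -
    have sh: "(\<lambda>k. wshift 0 (1::'a) k ^ p) = wshift 0 1" by (auto simp: wshift_def)
    have "T (wshift 0 1) (s * 1) (s * 1)" using T_scale[OF T_frob[of "wshift 0 1"] s] unfolding sh by (simp add: wshift_def)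
    with T[of "wshift 0 1"] have 1: "psi 0 g n (wshift 0 1) - s \<in> K" using T_unique by simp
    have "psi (Suc 0) g n (wshift 0 1) \<in> K"
      using psi_frobenius[OF K kills_mono[OF kg], of "Suc 0" "wshift 0 1"] unfolding sh by simp
    from is_ideal_diff[OF K 1 this] show ?thesis using n by (simp add: psi_split wshift_def)
  qed
  moreover have "obstruction g n i x \<in> fpow K (p ^ Suc i)" if i: "i < n" and x: "x \<in> I" for i x
  proof (rule pairing_detect[OF K])
    fix b
    have M: "(u ^^ Suc i) (c * obstruction g n i x) \<in> K" if "c \<in> M" for c
    proof -
      have "T (wshift i (c * x)) 1 0"
        using x by (intro T_zero) (auto simp: wshift_def is_ideal_0[OF I] is_ideal_mult[OF I])
      then have "T (wshift i (c * x)) s 0" using T_scale[OF _ s] by fastforce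
      from T_unique[OF T this] have "psi 0 g n (wshift i (c * x)) - 0 \<in> K" .
      from is_ideal_diff[OF K this psi_wshift_mult[OF K kg that i, of x]] show ?thesis by simp
    qed
    obtain cs where cs: "set cs \<subseteq> M" "b = sum_list cs" using M_generate by blast
    have "set cs \<subseteq> M \<Longrightarrow> (u ^^ Suc i) (sum_list cs * obstruction g n i x) \<in> K" for cs
      by (induction cs) (auto simp: is_ideal_0[OF K] distrib_right ui_add M is_ideal_add[OF K] simp del: funpow.simps)
    then show "(u ^^ Suc i) (b * obstruction g n i x) \<in> K" using cs by blast
  qed
  ultimately show ?thesis using s kg by blast
qed

end

section \<open>Regular sequences\<close>

lemma idl_insert: "is_ideal J \<Longrightarrow> a \<in> idl (insert x J) \<longleftrightarrow> (\<exists>b. a - x * b \<in> J)"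
proof
  assume J: "is_ideal J"
  have "is_ideal {a. \<exists>b. a - x * b \<in> J}"
  proof (rule is_idealI)
    show "0 \<in> {a. \<exists>b. a - x * b \<in> J}" using is_ideal_0[OF J] by (auto intro!: exI[of _ 0])
  next
    fix a a' assume "a \<in> {a. \<exists>b. a - x * b \<in> J}" "a' \<in> {a. \<exists>b. a - x * b \<in> J}"
    then obtain b b' where "a - x * b \<in> J" "a' - x * b' \<in> J" by blast
    from is_ideal_add[OF J this] have "(a + a') - x * (b + b') \<in> J" by (simp add: algebra_simps)
    then show "a + a' \<in> {a. \<exists>b. a - x * b \<in> J}" by blast
  next
    fix c a assume "a \<in> {a. \<exists>b. a - x * b \<in> J}"
    then obtain b where "a - x * b \<in> J" by blast
    from is_ideal_mult[OF J this, of c] have "c * a - x * (c * b) \<in> J" by (simp add: algebra_simps)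
    then show "c * a \<in> {a. \<exists>b. a - x * b \<in> J}" by blast
  qed
  moreover have "insert x J \<subseteq> {a. \<exists>b. a - x * b \<in> J}"
    using is_ideal_0[OF J] by (auto intro: exI[of _ 1] exI[of _ 0])
  ultimately have "idl (insert x J) \<subseteq> {a. \<exists>b. a - x * b \<in> J}" by (rule idl_minimal)
  then show "a \<in> idl (insert x J) \<Longrightarrow> \<exists>b. a - x * b \<in> J" by blast
  show "\<exists>b. a - x * b \<in> J \<Longrightarrow> a \<in> idl (insert x J)"
  proof -
    assume "\<exists>b. a - x * b \<in> J"
    then obtain b where "a - x * b \<in> J" by blast
    then have "(a - x * b) + x * b \<in> idl (insert x J)"
      by (intro is_ideal_add[OF is_ideal_idl] is_ideal_mult2[OF is_ideal_idl] idl_base) auto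
    then show ?thesis by simp
  qed
qed

lemma idl_Un_idl: "idl (A \<union> idl B) = idl (A \<union> B)"
proof
  have "idl B \<subseteq> idl (A \<union> B)" by (rule idl_mono) (auto intro: idl_base)
  then show "idl (A \<union> idl B) \<subseteq> idl (A \<union> B)" by (intro idl_mono) (auto intro: idl_base)
  show "idl (A \<union> B) \<subseteq> idl (A \<union> idl B)" by (intro idl_mono) (auto intro!: idl_base)
qed

lemma idl_ideal: "is_ideal J \<Longrightarrow> idl J = J"
  using idl_minimal[of J J] idl_superset[of J] by auto

text \<open>Regularity is relative to a base ideal J, so that inductions can move elements of the
  sequence, or their powers, into J.\<close>

fun reg :: "'a::comm_ring_1 set \<Rightarrow> 'a list \<Rightarrow> bool" where
  "reg J [] \<longleftrightarrow> True"
| "reg J (x # xs) \<longleftrightarrow> (\<forall>a. a * x \<in> J \<longrightarrow> a \<in> J) \<and> reg (idl (insert x J)) xs"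

lemma idl_insert_commute:
  assumes "is_ideal J"
  shows "idl (insert x (idl (insert y J))) = idl (insert y (idl (insert x J)))"
  using idl_Un_idl[of "{x}" "insert y J"] idl_Un_idl[of "{y}" "insert x J"]
  by (simp add: insert_commute)

text \<open>A relation a x = x2 d modulo J forces d into (x) + J, since x2 is regular there; writing
  d = x e, the factor x cancels. So x stays regular modulo x2, although x2 need not be regular
  modulo J.\<close>

lemma reg_swap:
  assumes J: "is_ideal J" and r: "reg J (x # x2 # xs)"
  shows "reg (idl (insert x2 J)) (x # xs)"
proof -
  have 1: "\<And>a. a * x \<in> J \<Longrightarrow> a \<in> J" using r by simp
  have 2: "\<And>a. a * x2 \<in> idl (insert x J) \<Longrightarrow> a \<in> idl (insert x J)" using r by simp
  have "a \<in> idl (insert x2 J)" if a: "a * x \<in> idl (insert x2 J)" for a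
  proof -
    obtain d where d: "a * x - x2 * d \<in> J" using a idl_insert[OF J] by blast
    have "d * x2 \<in> idl (insert x J)"
      unfolding idl_insert[OF J] using is_ideal_uminus[OF J d] by (intro exI[of _ a]) (simp add: mult.commute)
    then obtain e where e: "d - x * e \<in> J" using 2 idl_insert[OF J] by blast
    have "(a * x - x2 * d) + x2 * (d - x * e) \<in> J"
      by (intro is_ideal_add[OF J] d is_ideal_mult[OF J] e)
    then have "(a - x2 * e) * x \<in> J" by (simp add: algebra_simps)
    then have "a - x2 * e \<in> J" by (rule 1)
    then show ?thesis using idl_insert[OF J] by blast
  qed
  moreover have "reg (idl (insert x (idl (insert x2 J)))) xs"
    using r idl_insert_commute[OF J, of x x2] by simp
  ultimately show ?thesis by simp
qed

lemma reg_head_cancel: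
  assumes "is_ideal J" "reg J (x # xs)" "b * x \<in> idl (set xs \<union> J)"
  shows "b \<in> idl (set xs \<union> J)"
  using assms
proof (induction xs arbitrary: J)
  case Nil
  then show ?case by (simp add: idl_ideal)
next
  case (Cons x2 xs)
  have eq: "idl (set xs \<union> idl (insert x2 J)) = idl (set (x2 # xs) \<union> J)"
    unfolding idl_Un_idl by simp
  from Cons.prems(3) have "b * x \<in> idl (set xs \<union> idl (insert x2 J))" unfolding eq .
  from Cons.IH[OF is_ideal_idl reg_swap[OF Cons.prems(1,2)] this] show ?case unfolding eq .
qed

lemma reg_head_cancel_power:
  assumes "is_ideal J" "reg J (x # xs)" "b * x ^ k \<in> idl (set xs \<union> J)"
  shows "b \<in> idl (set xs \<union> J)"
  using assms(3)
proof (induction k)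
  case (Suc k)
  then have "(b * x ^ k) * x \<in> idl (set xs \<union> J)" by (simp add: mult_ac)
  then show ?case using reg_head_cancel[OF assms(1,2)] Suc.IH by blast
qed simp

text \<open>That x2 stays regular modulo x^q is shown by induction on q: a relation modulo x^{q+1}
  also holds modulo x, which yields a factor x to cancel. The rest of the sequence is handled after
  \<open>reg_swap\<close>.\<close>

lemma reg_head_power:
  assumes "is_ideal J" "reg J (x # xs)"
  shows "reg (idl (insert (x ^ q) J)) xs"
  using assms
proof (induction xs arbitrary: J)
  case (Cons x2 xs)
  note J = Cons.prems(1)
  have 1: "\<And>a. a * x \<in> J \<Longrightarrow> a \<in> J" using Cons.prems by simp
  have 2: "\<And>a. a * x2 \<in> idl (insert x J) \<Longrightarrow> a \<in> idl (insert x J)" using Cons.prems by simp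
  have "c \<in> idl (insert (x ^ q) J)" if "c * x2 \<in> idl (insert (x ^ q) J)" for c
    using that
  proof (induction q arbitrary: c)
    case 0
    have "(1::'a) \<in> idl (insert 1 J)" by (auto intro: idl_base)
    from is_ideal_mult[OF is_ideal_idl this, of c] show ?case by simp
  next
    case (Suc q)
    obtain e where e: "c * x2 - x ^ Suc q * e \<in> J" using Suc.prems idl_insert[OF J] by blast
    then have "c * x2 - x * (x ^ q * e) \<in> J" by (simp add: mult.assoc)
    then have "c \<in> idl (insert x J)" using 2 idl_insert[OF J] by blast
    then obtain c' where c': "c - x * c' \<in> J" using idl_insert[OF J] by blast
    have "(c * x2 - x ^ Suc q * e) - x2 * (c - x * c') \<in> J"
      by (intro is_ideal_diff[OF J] e is_ideal_mult[OF J] c')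
    then have "(c' * x2 - x ^ q * e) * x \<in> J" by (simp add: algebra_simps)
    then have "c' * x2 - x ^ q * e \<in> J" by (rule 1)
    then have "c' \<in> idl (insert (x ^ q) J)" unfolding idl_insert[OF J, of _ "x ^ q"] using Suc.IH idl_insert[OF J, of _ "x ^ q"] by blast
    then obtain d where d: "c' - x ^ q * d \<in> J" using idl_insert[OF J] by blast
    have "(c - x * c') + x * (c' - x ^ q * d) \<in> J"
      by (intro is_ideal_add[OF J] c' is_ideal_mult[OF J] d)
    then have "c - x ^ Suc q * d \<in> J" by (simp add: algebra_simps)
    then show ?case using idl_insert[OF J] by blast
  qed
  moreover have "reg (idl (insert (x ^ q) (idl (insert x2 J)))) xs"
    by (rule Cons.IH[OF is_ideal_idl reg_swap[OF Cons.prems]])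
  ultimately show ?case using idl_insert_commute[OF J, of "x ^ q" x2] by simp
qed simp

text \<open>The inclusion of (x_1^q, ..., x_m^q) : (x_1 ... x_m)^{q-1} in (x_1, ..., x_m), over the
  base J. Factors are cancelled one element at a time, with x^q moved into the base so that the tail
  stays regular.\<close>

lemma reg_prod_power_cancel:
  assumes "is_ideal J" "reg J xs" "q > 0"
    "prod_list xs ^ (q - 1) * c \<in> idl ((\<lambda>y. y ^ q) ` set xs \<union> J)"
  shows "c \<in> idl (set xs \<union> J)"
  using assms(1,2,4)
proof (induction xs arbitrary: J c)
  case (Cons x xs)
  note J = Cons.prems(1)
  let ?J = "idl (insert (x ^ q) J)"
  have eq: "idl (A \<union> ?J) = idl (insert (x ^ q) A \<union> J)" for A
    unfolding idl_Un_idl by simp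
  have "prod_list xs ^ (q - 1) * (x ^ (q - 1) * c) \<in> idl ((\<lambda>y. y ^ q) ` set xs \<union> ?J)"
    using Cons.prems(3) unfolding eq by (simp add: power_mult_distrib mult_ac)
  from Cons.IH[OF is_ideal_idl reg_head_power[OF Cons.prems(1,2)] this]
  have "x ^ (q - 1) * c \<in> idl (insert (x ^ q) (set xs \<union> J))" unfolding eq by simp
  then have "x ^ (q - 1) * c \<in> idl (insert (x ^ q) (idl (set xs \<union> J)))"
    using idl_Un_idl[of "{x ^ q}" "set xs \<union> J"] by simp
  then obtain e where "x ^ (q - 1) * c - x ^ q * e \<in> idl (set xs \<union> J)"
    using idl_insert[OF is_ideal_idl] by blast
  moreover have "x ^ q = x ^ (q - 1) * x" using assms(3) by (cases q) auto
  ultimately have "(c - x * e) * x ^ (q - 1) \<in> idl (set xs \<union> J)" by (simp add: algebra_simps)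
  then have "c - x * e \<in> idl (set xs \<union> J)" by (rule reg_head_cancel_power[OF Cons.prems(1,2)])
  then have "c \<in> idl (insert x (idl (set xs \<union> J)))" using idl_insert[OF is_ideal_idl] by blast
  then show ?case using idl_Un_idl[of "{x}" "set xs \<union> J"] by simp
qed (simp add: idl_ideal)

lemma is_ideal_colon:
  assumes "is_ideal K"
  shows "is_ideal {a. c * a \<in> K}"
proof (rule is_idealI)
  fix d a assume "a \<in> {a. c * a \<in> K}"
  then show "d * a \<in> {a. c * a \<in> K}"
    using is_ideal_mult[OF assms, of "c * a" d] by (simp add: mult.left_commute)
qed (simp_all add: assms is_ideal_0 distrib_left is_ideal_add)

text \<open>The essential half of the colon ideal formula. The tail of the sequence gives g as b
  times the (q-1)-th power of its product; multiplying by x and applying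
  \<open>reg_prod_power_cancel\<close> puts x b into (xs, x^q) + J, and cancelling x gives b =
  x^{q-1} e modulo (xs) + J.\<close>

lemma reg_colon:
  assumes "is_ideal J" "reg J xs" "q > 0"
    "\<And>x. x \<in> set xs \<Longrightarrow> g * x \<in> idl ((\<lambda>y. y ^ q) ` set xs \<union> J)"
  shows "\<exists>b. g - prod_list xs ^ (q - 1) * b \<in> idl ((\<lambda>y. y ^ q) ` set xs \<union> J)"
  using assms(1,2,4)
proof (induction xs arbitrary: J g)
  case Nil
  then show ?case using is_ideal_0[OF is_ideal_idl, of J] by (auto intro!: exI[of _ g])
next
  case (Cons x xs)
  note J = Cons.prems(1)
  let ?J = "idl (insert (x ^ q) J)" and ?K = "idl ((\<lambda>y. y ^ q) ` set (x # xs) \<union> J)"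
  have eq: "idl (A \<union> ?J) = idl (insert (x ^ q) A \<union> J)" for A
    unfolding idl_Un_idl by simp
  have eqK: "idl ((\<lambda>y. y ^ q) ` set xs \<union> ?J) = ?K" unfolding eq by simp
  have xq: "x ^ q = x ^ (q - 1) * x" for x :: 'a using assms(3) by (cases q) auto
  have r: "reg ?J xs" by (rule reg_head_power[OF Cons.prems(1,2)])
  have "\<exists>b. g - prod_list xs ^ (q - 1) * b \<in> idl ((\<lambda>y. y ^ q) ` set xs \<union> ?J)"
    using Cons.prems(3) unfolding eqK[symmetric] by (intro Cons.IH[OF is_ideal_idl r]) simp
  then obtain b where b: "g - prod_list xs ^ (q - 1) * b \<in> ?K" unfolding eqK by blast
  have "g * x - x * (g - prod_list xs ^ (q - 1) * b) \<in> ?K"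
    by (intro is_ideal_diff[OF is_ideal_idl] Cons.prems(3) is_ideal_mult[OF is_ideal_idl] b) simp
  then have "prod_list xs ^ (q - 1) * (b * x) \<in> ?K" by (simp add: algebra_simps)
  then have "b * x \<in> idl (set xs \<union> ?J)"
    unfolding eqK[symmetric] by (rule reg_prod_power_cancel[OF is_ideal_idl r assms(3)])
  then have "b * x \<in> idl (insert (x ^ q) (idl (set xs \<union> J)))"
    unfolding eq using idl_Un_idl[of "{x ^ q}" "set xs \<union> J"] by simp
  then obtain e where "b * x - x ^ q * e \<in> idl (set xs \<union> J)" using idl_insert[OF is_ideal_idl] by blast
  then have "(b - x ^ (q - 1) * e) * x \<in> idl (set xs \<union> J)" by (simp add: xq algebra_simps)
  then have be: "b - x ^ (q - 1) * e \<in> idl (set xs \<union> J)" by (rule reg_head_cancel[OF Cons.prems(1,2)])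
  have "idl (set xs \<union> J) \<subseteq> {a. prod_list xs ^ (q - 1) * a \<in> ?K}"
  proof (rule idl_minimal)
    show "is_ideal {a. prod_list xs ^ (q - 1) * a \<in> ?K}"
      by (rule is_ideal_colon[OF is_ideal_idl])
    have "prod_list xs ^ (q - 1) * y \<in> ?K" if y: "y \<in> set xs" for y
    proof -
      have "y dvd prod_list xs" using y by (induction xs) (auto intro: dvd_mult)
      then obtain c where "prod_list xs = c * y" by (metis dvdE mult.commute)
      then have "prod_list xs ^ (q - 1) * y = c ^ (q - 1) * y ^ q"
        by (simp add: power_mult_distrib xq[of y] mult.assoc)
      moreover have "y ^ q \<in> ?K" using y by (intro idl_base) auto
      ultimately show ?thesis by (simp only: is_ideal_mult[OF is_ideal_idl])
    qed
    moreover have "prod_list xs ^ (q - 1) * y \<in> ?K" if "y \<in> J" for y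
      using that by (intro is_ideal_mult[OF is_ideal_idl] idl_base) auto
    ultimately show "set xs \<union> J \<subseteq> {a. prod_list xs ^ (q - 1) * a \<in> ?K}" by blast
  qed
  with be have "prod_list xs ^ (q - 1) * (b - x ^ (q - 1) * e) \<in> ?K" by blast
  from is_ideal_add[OF is_ideal_idl b this]
  have "g - prod_list (x # xs) ^ (q - 1) * e \<in> ?K" by (simp add: algebra_simps power_mult_distrib)
  then show ?case by blast
qed

section \<open>The Fedder-type criterion in a graded ring\<close>

text \<open>An axiomatic grading by natural numbers. In the application \<nu> is the total weight of
  the variables: u is dual to a monomial of degree (p-1) \<nu>, whence the shift in
  \<open>comp_u\<close>. By \<open>comp_unit\<close> the part of degree 0 is a field.\<close>

locale graded_fdual = fdual p M \<Delta> u DB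
  for p :: nat and M :: "'a::comm_ring_1 set" and \<Delta> u DB +
  fixes component :: "nat \<Rightarrow> 'a \<Rightarrow> 'a" and \<nu> :: nat
  assumes comp_add: "component d (a + b) = component d a + component d b"
    and comp_comp: "component d (component e a) = (if d = e then component d a else 0)"
    and comp_mult: "component e b = b \<Longrightarrow> component (d + e) (a * b) = component d a * b"
    and comp_mult_low: "component e b = b \<Longrightarrow> d < e \<Longrightarrow> component d (a * b) = 0"
    and comp_u: "component d (u a) = u (component (p * d + (p - 1) * \<nu>) a)"
    and comp_1: "component 0 1 = 1"
    and comp_unit: "component 0 a = a \<Longrightarrow> a \<noteq> 0 \<Longrightarrow> \<exists>b. component 0 b = b \<and> a * b = 1"
    and comp_\<Delta>: "component d a = a \<Longrightarrow> component (p * d) (\<Delta> a) = \<Delta> a"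
begin

definition hom :: "nat \<Rightarrow> 'a \<Rightarrow> bool" where
  "hom d a \<longleftrightarrow> component d a = a"

lemma comp_0 [simp]: "component d 0 = 0"
  using comp_add[of d 0 0] by simp

lemma comp_uminus: "component d (- a) = - component d a"
  using comp_add[of d a "- a"] by (simp add: eq_neg_iff_add_eq_0 add.commute)

lemma comp_diff: "component d (a - b) = component d a - component d b"
  using comp_add[of d a "- b"] by (simp add: comp_uminus)

lemma comp_sum: "component d (sum h A) = (\<Sum>x\<in>A. component d (h x))"
  by (induction A rule: infinite_finite_induct) (auto simp: comp_add)

lemma hom_0 [simp]: "hom d 0" by (simp add: hom_def)
lemma hom_1: "hom 0 1" by (simp add: hom_def comp_1)
lemma hom_add: "hom d a \<Longrightarrow> hom d b \<Longrightarrow> hom d (a + b)" by (simp add: hom_def comp_add)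
lemma hom_comp: "hom d (component d a)" by (simp add: hom_def comp_comp)

lemma hom_mult: "hom d a \<Longrightarrow> hom e b \<Longrightarrow> hom (d + e) (a * b)"
  by (simp add: hom_def comp_mult)

lemma hom_power: "hom d a \<Longrightarrow> hom (n * d) (a ^ n)"
  by (induction n) (auto simp: hom_1 hom_mult)

lemma hom_u: "hom (p * d + (p - 1) * \<nu>) a \<Longrightarrow> hom d (u a)"
  by (simp add: hom_def comp_u)

lemma comp_ui: "component d ((u ^^ i) a) = (u ^^ i) (component (p ^ i * d + (p ^ i - 1) * \<nu>) a)"
proof (induction i arbitrary: d)
  case (Suc i)
  have e: "p ^ i * (p * d + (p - 1) * \<nu>) + (p ^ i - 1) * \<nu> = p ^ Suc i * d + (p ^ Suc i - 1) * \<nu>"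
  proof -
    have "p ^ i * (p - 1) + (p ^ i - 1) = p ^ Suc i - 1"
      using p_gt_0 by (simp add: algebra_simps diff_mult_distrib2)
    then have "p ^ i * (p - 1) * \<nu> + (p ^ i - 1) * \<nu> = (p ^ Suc i - 1) * \<nu>"
      by (simp only: distrib_right[symmetric])
    then show ?thesis by (simp add: algebra_simps)
  qed
  show ?case by (simp add: comp_u Suc e[simplified])
qed simp

lemma comp_idl:
  assumes "\<And>x. x \<in> B \<Longrightarrow> \<exists>e. hom e x" "a \<in> idl B"
  shows "component d a \<in> idl B"
proof -
  \<comment> \<open>Quantifying over the multiples c makes this set an ideal, although taking
    components is not S-linear.\<close>
  have "is_ideal {a. \<forall>c d. component d (c * a) \<in> idl B}"
    by (intro is_idealI)
      (auto simp: is_ideal_0[OF is_ideal_idl] distrib_left comp_add is_ideal_add[OF is_ideal_idl] mult.assoc[symmetric])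
  moreover have "B \<subseteq> {a. \<forall>c d. component d (c * a) \<in> idl B}"
  proof safe
    fix x c d assume x: "x \<in> B"
    then obtain e where e: "hom e x" using assms(1) by blast
    show "component d (c * x) \<in> idl B"
    proof (cases "d < e")
      case True
      then show ?thesis using e by (simp add: hom_def comp_mult_low is_ideal_0[OF is_ideal_idl])
    next
      case False
      then have "component d (c * x) = component (d - e) c * x"
        using e comp_mult[of e x "d - e" c] by (simp add: hom_def)
      then show ?thesis using x by (simp add: is_ideal_mult[OF is_ideal_idl] idl_base)
    qed
  qed
  ultimately have "idl B \<subseteq> {a. \<forall>c d. component d (c * a) \<in> idl B}" by (rule idl_minimal)
  then have "component d (1 * a) \<in> idl B" using assms(2) by blast
  then show ?thesis by simp
qed

end

locale fedder = graded_fdual p M \<Delta> u DB component \<nu>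
  for p :: nat and M :: "'a::comm_ring_1 set" and \<Delta> u DB component \<nu> +
  fixes fs :: "'a list" and f \<delta> :: 'a
  assumes fs_hom: "x \<in> set fs \<Longrightarrow> \<exists>e. hom e x"
    and f_def: "f = prod_list fs"
    and f_hom: "hom \<nu> f"
    and \<delta>: "\<delta> \<approx> \<Delta> (f ^ (p - 1))"
    and \<delta>_hom: "hom (p * (p - 1) * \<nu>) \<delta>"
    and fs_reg: "reg {0} fs"
    and fs_proper: "1 \<notin> idl (set fs)"
begin

definition \<theta> :: "'a \<Rightarrow> 'a" where "\<theta> a = u (\<delta> * a)"

lemma \<theta>_add: "\<theta> (a + b) = \<theta> a + \<theta> b"
  by (simp add: \<theta>_def distrib_left u_add)

lemma \<theta>_0 [simp]: "\<theta> 0 = 0" by (simp add: \<theta>_def)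

lemma \<theta>i_add: "(\<theta> ^^ i) (a + b) = (\<theta> ^^ i) a + (\<theta> ^^ i) b"
  by (induction i) (auto simp: \<theta>_add)

lemma \<theta>_scale: "\<theta> (a ^ p * b) = a * \<theta> b"
  by (simp only: \<theta>_def mult.left_commute[of \<delta>] u_scale)

lemma \<theta>i_scale: "(\<theta> ^^ i) (a ^ (p ^ i) * b) = a * (\<theta> ^^ i) b"
proof (induction i arbitrary: a b)
  case (Suc i)
  have "(\<theta> ^^ Suc i) (a ^ (p ^ Suc i) * b) = \<theta> ((\<theta> ^^ i) ((a ^ p) ^ (p ^ i) * b))"
    by (simp add: power_mult)
  then show ?case by (simp add: Suc \<theta>_scale)
qed simp

lemma hom_\<theta>: "hom ((p - 1) * \<nu>) a \<Longrightarrow> hom ((p - 1) * \<nu>) (\<theta> a)"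
  unfolding \<theta>_def
proof (rule hom_u)
  assume "hom ((p - 1) * \<nu>) a"
  from hom_mult[OF \<delta>_hom this] show "hom (p * ((p - 1) * \<nu>) + (p - 1) * \<nu>) (\<delta> * a)" by (simp add: mult.assoc)
qed

lemma hom_f_power: "hom ((p - 1) * \<nu>) (f ^ (p - 1))"
  by (rule hom_power[OF f_hom])

lemma hom_start: "hom 0 c \<Longrightarrow> hom ((p - 1) * \<nu>) (f ^ (p - 1) * c)"
  using hom_mult[OF hom_f_power, of 0 c] by simp

lemma hom_\<theta>i: "hom ((p - 1) * \<nu>) a \<Longrightarrow> hom ((p - 1) * \<nu>) ((\<theta> ^^ i) a)"
  by (induction i) (simp_all add: hom_\<theta> del: One_nat_def)

lemma hom_u_zero: "hom ((p - 1) * \<nu>) a \<Longrightarrow> hom 0 (u a)"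
  by (rule hom_u) simp

text \<open>The condition that theta^{n-1}(f^{p-1} k) is not contained in m^[p], in a form without
  m: these elements have degree (p-1) \<nu>, where u takes values in the constants, and as they are
  stable under multiplication by constants they lie in m^[p] exactly when u vanishes on
  them.\<close>

definition crit :: "nat \<Rightarrow> bool" where
  "crit n \<longleftrightarrow> (\<exists>c. hom 0 c \<and> u ((\<theta> ^^ (n - 1)) (f ^ (p - 1) * c)) \<noteq> 0)"

lemma obtain_cofactor:
  assumes "x \<in> set fs"
  obtains G where "f = x * G"
proof -
  have "x dvd prod_list fs" using assms by (induction fs) (auto intro: dvd_mult)
  then show ?thesis using that by (auto simp: f_def elim: dvdE)
qed

text \<open>The product rule for \<open>\<Delta>\<close> applied to \<open>f = x G\<close>.\<close>

lemma \<theta>_cofactor: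
  assumes x: "x \<in> set fs" and w: "u w = 0"
  shows "\<exists>c. x * f ^ (p ^ Suc i - p) * \<theta> w + f ^ (p ^ Suc i - 1) * u (w * \<Delta> x) = x ^ (p ^ Suc i) * c"
proof -
  obtain G where G: "f = x * G" using obtain_cofactor[OF x] .
  have pp: "p * (p - 1 - 1) = p * (p - 2)" by (simp add: numeral_2_eq_2)
  have "\<Delta> (x ^ (p - 1)) \<approx> of_nat (p - 1) * (x ^ (p * (p - 2)) * \<Delta> x)"
    using \<Delta>_power[of x "p - 1"] unfolding pp .
  also have "(of_nat (p - 1) :: 'a) = - 1"
  proof -
    have "(of_nat p :: 'a) = of_nat (p - 1) + 1" using p_gt_0 of_nat_add[of "p - 1" 1, where 'a = 'a] by simp
    then show ?thesis by (simp add: char_p eq_neg_iff_add_eq_0)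
  qed
  finally have 1: "\<Delta> (x ^ (p - 1)) \<approx> - (x ^ (p * (p - 2)) * \<Delta> x)" by simp
  have "\<delta> \<approx> \<Delta> (x ^ (p - 1) * G ^ (p - 1))" using \<delta> by (simp add: G power_mult_distrib)
  also have "\<dots> \<approx> (x ^ (p - 1)) ^ p * \<Delta> (G ^ (p - 1)) + (G ^ (p - 1)) ^ p * \<Delta> (x ^ (p - 1))"
    by (rule \<Delta>_mult)
  also have "\<dots> \<approx> (x ^ (p - 1)) ^ p * \<Delta> (G ^ (p - 1)) + (G ^ (p - 1)) ^ p * (- (x ^ (p * (p - 2)) * \<Delta> x))"
    by (intro eqp_add eqp_refl eqp_mult 1)
  finally obtain r where r: "\<delta> = (x ^ (p - 1)) ^ p * \<Delta> (G ^ (p - 1)) +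
      (G ^ (p - 1)) ^ p * (- (x ^ (p * (p - 2)) * \<Delta> x)) + r ^ p" unfolding eqp_def by blast
  \<comment> \<open>The summand r^p of \<delta> contributes r u(w), which vanishes by
    assumption.\<close>
  have "\<theta> w = x ^ (p - 1) * u (w * \<Delta> (G ^ (p - 1))) - G ^ (p - 1) * x ^ (p - 2) * u (w * \<Delta> x)"
  proof -
    have "\<delta> * w = (x ^ (p - 1)) ^ p * (w * \<Delta> (G ^ (p - 1))) + (- (G ^ (p - 1) * x ^ (p - 2))) ^ p * (w * \<Delta> x) + r ^ p * w"
    proof -
      have "x ^ (p * (p - 2)) = (x ^ (p - 2)) ^ p" by (metis mult.commute power_mult)
      moreover have "(A * d + B * (- (C * e)) + R) * w = A * (w * d) + (- (B * C)) * (w * e) + R * w" for A B C R d e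
        by (simp add: algebra_simps)
      ultimately show ?thesis by (simp only: r frobenius_uminus power_mult_distrib)
    qed
    then show ?thesis by (simp only: \<theta>_def u_add u_scale w) simp
  qed
  moreover have "p \<le> p ^ Suc i" using p_gt_0 by simp
  then have q: "p ^ Suc i = (p ^ Suc i - p) + (p - 1) + 1" "p ^ Suc i - 1 = (p ^ Suc i - p) + (p - 1)" "p - 1 = Suc (p - 2)"
    using p_ge_2 by auto
  moreover have "x * f ^ e * (x ^ (p - 1) * A - G ^ (p - 1) * x ^ (p - 2) * B) + f ^ (e + (p - 1)) * B =
     x ^ (e + (p - 1) + 1) * (G ^ e * A)" for e A B
  proof -
    have "x ^ (p - 1) = x * x ^ (p - 2)" by (subst q(3)) simp
    then have "f ^ (e + (p - 1)) = f ^ e * G ^ (p - 1) * (x * x ^ (p - 2))"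
      by (simp add: G power_add power_mult_distrib mult_ac)
    then show ?thesis by (simp add: right_diff_distrib) (simp add: G power_add power_mult_distrib mult_ac)
  qed
  ultimately have "x * f ^ (p ^ Suc i - p) * \<theta> w + f ^ (p ^ Suc i - 1) * u (w * \<Delta> x) =
      x ^ (p ^ Suc i) * (G ^ (p ^ Suc i - p) * u (w * \<Delta> (G ^ (p - 1))))" by metis
  then show ?thesis by blast
qed

text \<open>A count of powers of x: f contributes p^{i+j+1} - p, and the other factor contributes
  p^j - p, which is at least p for j at least 2. Together they reach p^{i+1} p^j, and u^j extracts
  x^{p^{i+1}}.\<close>

lemma higher_term:
  assumes x: "x \<in> set fs" and j: "j \<ge> 2"
  shows "\<exists>c. (u ^^ j) (f ^ (p ^ Suc (i + j) - p) * h * (x ^ (p ^ j - p) * b)) = x ^ (p ^ Suc i) * c"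
proof -
  obtain G where G: "f = x * G" using obtain_cofactor[OF x] .
  have 1: "p * 2 \<le> p ^ j"
  proof -
    have "p * 2 \<le> p ^ 2" using p_ge_2 by (simp add: power2_eq_square)
    also have "\<dots> \<le> p ^ j" using j p_gt_0 by (intro power_increasing) auto
    finally show ?thesis .
  qed
  have 2: "p ^ j \<le> p ^ Suc (i + j)" using p_gt_0 by (intro power_increasing) auto
  define e where "e = (p ^ Suc (i + j) - p) + (p ^ j - p) - p ^ Suc i * p ^ j"
  have e: "(p ^ Suc (i + j) - p) + (p ^ j - p) = p ^ Suc i * p ^ j + e"
    using 1 2 by (simp add: e_def power_add)
  have "f ^ (p ^ Suc (i + j) - p) * h * (x ^ (p ^ j - p) * b) =
      x ^ ((p ^ Suc (i + j) - p) + (p ^ j - p)) * (G ^ (p ^ Suc (i + j) - p) * h * b)"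
  proof -
    have "(x * G) ^ A * h * (x ^ B * b) = x ^ (A + B) * (G ^ A * h * b)" for A B
      by (simp add: power_mult_distrib power_add mult_ac)
    then show ?thesis unfolding G .
  qed
  also have "\<dots> = (x ^ (p ^ Suc i)) ^ (p ^ j) * (x ^ e * (G ^ (p ^ Suc (i + j) - p) * h * b))"
    unfolding e by (simp add: power_add power_mult mult.assoc)
  finally show ?thesis by (simp only: ui_scale) blast
qed

text \<open>For j = 1 the factor in x is trivial and the count of powers falls short; what survives
  is the term that \<open>\<theta>_cofactor\<close> combines with \<theta>.\<close>

lemma first_term: "(u ^^ Suc 0) (f ^ (p ^ Suc (i + 1) - p) * h * (x ^ (p ^ 1 - p) * b)) = f ^ (p ^ Suc i - 1) * u (h * b)"
proof -
  have "p ^ Suc (i + 1) - p = (p ^ Suc i - 1) * p" by (simp add: algebra_simps diff_mult_distrib2)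
  then show ?thesis by (simp add: power_mult mult.assoc u_scale)
qed

lemma ideal_power_mem: "x \<in> set fs \<Longrightarrow> x ^ (p ^ i) * c \<in> fpow (idl (set fs)) (p ^ i)"
  by (intro is_ideal_mult2[OF is_ideal_fpow] fpow_base idl_base)

text \<open>Modulo the Frobenius power the terms with j at least 2 vanish, and the product rule
  turns the one with j = 1 into - x f^{p^{i+1}-p} \<theta>(h_{i+1}). The convention h_n = 0 covers
  the last index; the errors r j serve the converse direction, where g is known only modulo
  Frobenius powers.\<close>

lemma obstruction_shape:
  assumes x: "x \<in> set fs" and i: "i < n"
    and g: "\<And>j. i < j \<Longrightarrow> j < n \<Longrightarrow> g j = f ^ (p ^ Suc j - p) * h j + r j"
    and r: "\<And>j. i < j \<Longrightarrow> j < n \<Longrightarrow> r j \<in> fpow (idl (set fs)) (p ^ Suc j)"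
    and h: "Suc i < n \<Longrightarrow> u (h (Suc i)) = 0" "Suc i \<ge> n \<Longrightarrow> h (Suc i) = 0"
  shows "(obstruction g n i x) - (g i - f ^ (p ^ Suc i - p) * \<theta> (h (Suc i))) * x \<in> fpow (idl (set fs)) (p ^ Suc i)"
proof -
  let ?K = "fpow (idl (set fs)) (p ^ Suc i)"
  note K = is_ideal_fpow[of "idl (set fs)" "p ^ Suc i"]
  define t where "t = (\<lambda>j. (u ^^ j) (g (i + j) * (x ^ (p ^ j - p) * \<Delta> x)))"
  have tj: "t j - (u ^^ j) (f ^ (p ^ Suc (i + j) - p) * h (i + j) * (x ^ (p ^ j - p) * \<Delta> x)) \<in> ?K"
    if j: "j \<in> {1..<n - i}" for j
  proof -
    have ij: "i < i + j" "i + j < n" using j by auto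
    have "(u ^^ j) ((x ^ (p ^ j - p) * \<Delta> x) * r (i + j)) \<in> ?K"
      using r[OF ij] by (intro ui_fpow is_ideal_idl is_ideal_mult[OF is_ideal_fpow]) (simp add: add.commute)
    then show ?thesis unfolding t_def g[OF ij] distrib_right ui_add by (simp add: mult.commute)
  qed
  have high: "t j \<in> ?K" if j: "j \<in> {2..<n - i}" for j
  proof -
    have "(u ^^ j) (f ^ (p ^ Suc (i + j) - p) * h (i + j) * (x ^ (p ^ j - p) * \<Delta> x)) \<in> ?K"
      using higher_term[OF x, of j i "h (i + j)" "\<Delta> x"] j ideal_power_mem[OF x, of "Suc i"] by auto
    from is_ideal_add[OF K tj[of j] this] j show ?thesis by simp
  qed
  have key: "x * f ^ (p ^ Suc i - p) * \<theta> (h (Suc i)) + f ^ (p ^ Suc i - 1) * u (h (Suc i) * \<Delta> x) \<in> ?K"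
  proof -
    have "u (h (Suc i)) = 0" using h by (cases "Suc i < n") auto
    from \<theta>_cofactor[OF x this, of i] show ?thesis using ideal_power_mem[OF x, of "Suc i"] by auto
  qed
  have ob: "obstruction g n i x = g i * x + sum t {1..<n - i}"
    by (simp add: obstruction_def t_def)
  show ?thesis
  proof (cases "Suc i < n")
    case False
    then show ?thesis using h(2) is_ideal_0[OF K] by (simp add: ob)
  next
    case True
    have "sum t {1..<n - i} = t 1 + sum t {2..<n - i}"
      using True by (simp add: sum.atLeast_Suc_lessThan numeral_2_eq_2)
    moreover have "sum t {2..<n - i} \<in> ?K" by (rule is_ideal_sum[OF K high])
    moreover have "t 1 - f ^ (p ^ Suc i - 1) * u (h (Suc i) * \<Delta> x) \<in> ?K"
      using tj[of 1] first_term[of i "h (Suc i)" x "\<Delta> x"] True by (simp add: numeral_1_eq_Suc_0)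
    ultimately have "(sum t {2..<n - i} + (t 1 - f ^ (p ^ Suc i - 1) * u (h (Suc i) * \<Delta> x))) +
       (x * f ^ (p ^ Suc i - p) * \<theta> (h (Suc i)) + f ^ (p ^ Suc i - 1) * u (h (Suc i) * \<Delta> x)) \<in> ?K"
      by (intro is_ideal_add[OF K] key)
    then show ?thesis
      using \<open>sum t {1..<n - i} = t 1 + sum t {2..<n - i}\<close> by (simp add: ob algebra_simps)
  qed
qed

lemma data_of_crit:
  assumes n: "n \<ge> 1" and c: "crit n" and min: "\<And>j. 1 \<le> j \<Longrightarrow> j < n \<Longrightarrow> \<not> crit j"
  shows "\<exists>g. u (g 0) = 1 \<and> (\<forall>j. 0 < j \<longrightarrow> j < n \<longrightarrow> u (g j) = 0) \<and>
    (\<forall>i<n. \<forall>x\<in>set fs. obstruction g n i x \<in> fpow (idl (set fs)) (p ^ Suc i))"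
proof -
  obtain c where c: "hom 0 c" "u ((\<theta> ^^ (n - 1)) (f ^ (p - 1) * c)) \<noteq> 0" using c by (auto simp: crit_def)
  have "hom 0 (u ((\<theta> ^^ (n - 1)) (f ^ (p - 1) * c)))"
    by (intro hom_u_zero hom_\<theta>i hom_start c)
  then obtain b where b: "hom 0 b" "u ((\<theta> ^^ (n - 1)) (f ^ (p - 1) * c)) * b = 1"
    using comp_unit c(2) unfolding hom_def by metis
  \<comment> \<open>The exponent p^n is consumed by n - 1 applications of \<theta> and one of u, so
    that b comes out to the first power and normalizes u (h 0) to 1.\<close>
  define c' where "c' = b ^ (p ^ n) * c"
  have c': "hom 0 c'" using hom_mult[OF hom_power[OF b(1), of "p ^ n"] c(1)] by (simp add: c'_def)
  define h where "h i = (if i < n then (\<theta> ^^ (n - 1 - i)) (f ^ (p - 1) * c') else 0)" for i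
  define g where "g i = f ^ (p ^ Suc i - p) * h i" for i
  have "u (h 0) = 1"
  proof -
    have "f ^ (p - 1) * c' = (b ^ p) ^ (p ^ (n - 1)) * (f ^ (p - 1) * c)"
      using n by (cases n) (auto simp: c'_def mult_ac simp flip: power_mult)
    moreover have "h 0 = (\<theta> ^^ (n - 1)) (f ^ (p - 1) * c')" using n by (simp add: h_def)
    ultimately have "h 0 = b ^ p * (\<theta> ^^ (n - 1)) (f ^ (p - 1) * c)" by (simp only: \<theta>i_scale)
    then show ?thesis using b(2) by (simp add: u_scale mult.commute)
  qed
  then have g0: "u (g 0) = 1" by (simp add: g_def)
  have hj: "u (h j) = 0" if "0 < j" "j < n" for j
  proof -
    \<comment> \<open>Here \<open>h j\<close> is \<theta> applied n - j - 1 times to f^{p-1} c', so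
      the minimality of n gives u (h j) = 0.\<close>
    have "\<not> crit (n - j)" using that by (intro min) auto
    then show ?thesis using c' that by (auto simp: crit_def h_def diff_right_commute)
  qed
  have gj: "u (g j) = 0" if "0 < j" "j < n" for j
  proof -
    have "p ^ Suc j - p = (p ^ j - 1) * p" by (simp add: algebra_simps diff_mult_distrib2)
    then show ?thesis using hj[OF that] by (simp add: g_def power_mult u_scale)
  qed
  have "obstruction g n i x \<in> fpow (idl (set fs)) (p ^ Suc i)" if i: "i < n" and x: "x \<in> set fs" for i x
  proof -
    have 1: "obstruction g n i x - (g i - f ^ (p ^ Suc i - p) * \<theta> (h (Suc i))) * x \<in> fpow (idl (set fs)) (p ^ Suc i)"
    proof (rule obstruction_shape[OF x i, where r = "\<lambda>_. 0"])
      show "Suc i < n \<Longrightarrow> u (h (Suc i)) = 0" using hj by simp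
    qed (auto simp: g_def is_ideal_0[OF is_ideal_fpow] h_def[of "Suc i"])
    show ?thesis
    proof (cases "Suc i < n")
      case True
      then have "n - 1 - i = Suc (n - 1 - Suc i)" by auto
      then have "h i = \<theta> (h (Suc i))" using i True by (simp only: h_def if_True funpow.simps o_apply)
      then show ?thesis using 1 by (simp add: g_def)
    next
      case False
      then have "h i = f ^ (p - 1) * c'" "h (Suc i) = 0" using i by (auto simp: h_def)
      moreover obtain G where G: "f = x * G" using obtain_cofactor[OF x] .
      \<comment> \<open>At the last index i = n - 1 there is no recursion, but g i is a multiple of
        f^{p^{i+1}-1}, and x divides f.\<close>
      have "f ^ (p ^ Suc i - p) * f ^ (p - 1) * x \<in> fpow (idl (set fs)) (p ^ Suc i)"
      proof -
        have "(p ^ Suc i - p) + (p - 1) = p ^ Suc i - 1" using p_gt_0 by simp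
        then have "f ^ (p ^ Suc i - p) * f ^ (p - 1) * x = f ^ (p ^ Suc i - 1) * x"
          by (simp only: power_add[symmetric])
        also have "\<dots> = x ^ (p ^ Suc i - 1) * x * G ^ (p ^ Suc i - 1)"
          by (simp only: G power_mult_distrib mult_ac)
        also have "x ^ (p ^ Suc i - 1) * x = x ^ (p ^ Suc i)" using p_gt_0 by (metis power_minus_mult zero_less_power)
        finally show ?thesis by (simp only: ideal_power_mem[OF x])
      qed
      from is_ideal_mult[OF is_ideal_fpow this, of c'] have "g i * x \<in> fpow (idl (set fs)) (p ^ Suc i)"
        using calculation by (simp add: g_def mult_ac)
      from is_ideal_add[OF is_ideal_fpow 1 this] show ?thesis using calculation by simp
    qed
  qed
  then show ?thesis using g0 gj by blast
qed

lemma crit_of_data: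
  assumes n: "n \<ge> 1" and s: "component 0 s \<noteq> 0" and g0: "u (g 0) - s \<in> idl (set fs)"
    and obs: "\<And>i x. i < n \<Longrightarrow> x \<in> set fs \<Longrightarrow> obstruction g n i x \<in> fpow (idl (set fs)) (p ^ Suc i)"
  shows "\<exists>j. 1 \<le> j \<and> j \<le> n \<and> crit j"
proof (rule ccontr)
  assume "\<not> ?thesis"
  then have nc: "u ((\<theta> ^^ j) (f ^ (p - 1) * c)) = 0" if "j < n" "hom 0 c" for j c
    using that by (auto simp: crit_def dest!: spec[of _ "Suc j"])
  let ?I = "idl (set fs)"
  \<comment> \<open>By descending induction on \<open>i\<close>, modulo Frobenius powers the component of \<open>g i\<close> of degree
    $(p^{i+1}-1)\nu$ is $f^{p^{i+1}-p} h_i$ with $h_i = \theta(h_{i+1}) + f^{p-1} c$. The condition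
    \<open>Z (n - i)\<close> is what survives of the failure of \<open>crit\<close>.\<close>
  define Z where "Z m h \<longleftrightarrow> hom ((p - 1) * \<nu>) h \<and> (\<forall>j. j + m \<le> n \<longrightarrow> u ((\<theta> ^^ j) h) = 0) \<and> (m = 0 \<longrightarrow> h = 0)" for m h
  have Z0: "Z 0 0"
  proof -
    have "(\<theta> ^^ j) 0 = 0" for j by (induction j) auto
    then show ?thesis by (simp add: Z_def)
  qed
  have ZS: "Z (Suc m) (\<theta> h + f ^ (p - 1) * c)" if "Z m h" "hom 0 c" for m h c
  proof -
    have "u ((\<theta> ^^ j) (\<theta> h + f ^ (p - 1) * c)) = 0" if "j + Suc m \<le> n" for j
    proof -
      have "u ((\<theta> ^^ Suc j) h) = 0"
        using \<open>Z m h\<close> that unfolding Z_def by (metis add_Suc_shift)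
      then have "u ((\<theta> ^^ j) (\<theta> h)) = 0" by (simp add: funpow_swap1)
      moreover have "u ((\<theta> ^^ j) (f ^ (p - 1) * c)) = 0" using that \<open>hom 0 c\<close> by (intro nc) auto
      ultimately show ?thesis by (simp add: \<theta>i_add u_add)
    qed
    then show ?thesis using that by (simp add: Z_def hom_add hom_\<theta> hom_start del: One_nat_def)
  qed
  define D where "D i = (p ^ Suc i - 1) * \<nu>" for i
  have fpow_hom: "component d a \<in> fpow ?I (p ^ i)" if "a \<in> fpow ?I (p ^ i)" for d a i
    using that unfolding fpow_idl
    by (rule comp_idl[rotated]) (use fs_hom hom_power in blast)
  have "\<exists>h. Z (n - i) h \<and> component (D i) (g i) - f ^ (p ^ Suc i - p) * h \<in> fpow ?I (p ^ Suc i)" if "i < n" for i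
    using that
  proof (induction "n - i" arbitrary: i rule: less_induct)
    case less
    have "\<forall>j. \<exists>h. i < j \<longrightarrow> j < n \<longrightarrow> Z (n - j) h \<and> component (D j) (g j) - f ^ (p ^ Suc j - p) * h \<in> fpow ?I (p ^ Suc j)"
    proof
      fix j
      show "\<exists>h. i < j \<longrightarrow> j < n \<longrightarrow> Z (n - j) h \<and> component (D j) (g j) - f ^ (p ^ Suc j - p) * h \<in> fpow ?I (p ^ Suc j)"
        using less.hyps[of j] by (cases "i < j \<and> j < n") auto
    qed
    then obtain h' where h': "\<And>j. i < j \<Longrightarrow> j < n \<Longrightarrow> Z (n - j) (h' j)"
      "\<And>j. i < j \<Longrightarrow> j < n \<Longrightarrow> component (D j) (g j) - f ^ (p ^ Suc j - p) * h' j \<in> fpow ?I (p ^ Suc j)"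
      by metis
    define h where "h j = (if j < n then h' j else 0)" for j
    define g' where "g' j = component (D j) (g j)" for j
    have Zh: "Z (n - Suc i) (h (Suc i))" using h'(1)[of "Suc i"] Z0 by (auto simp: h_def)
    have "(g' i - f ^ (p ^ Suc i - p) * \<theta> (h (Suc i))) * x \<in> fpow ?I (p ^ Suc i)" if x: "x \<in> set fs" for x
    proof -
      obtain e where e: "hom e x" using fs_hom[OF x] by blast
      \<comment> \<open>The degrees D j are chosen so that u^j sends degree D (i + j) + p^j e to D i
        + e. Hence projecting the obstruction to one degree amounts to projecting every g j to
        degree D j.\<close>
      have "component (D i + e) (obstruction g n i x) = obstruction g' n i x"
      proof -
        have "component (D i + e) ((u ^^ j) (g (i + j) * (x ^ (p ^ j - p) * \<Delta> x))) =
            (u ^^ j) (g' (i + j) * (x ^ (p ^ j - p) * \<Delta> x))" if "j \<in> {1..<n - i}" for j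
        proof -
          have "p \<le> p ^ j" using that p_gt_0 by (cases j) auto
          then have "(p ^ j - p) * e + p * e = p ^ j * e" by (simp flip: distrib_right)
          then have y: "hom (p ^ j * e) (x ^ (p ^ j - p) * \<Delta> x)"
            using hom_mult[OF hom_power[OF e, of "p ^ j - p"], of "p * e" "\<Delta> x"] comp_\<Delta> e by (simp add: hom_def)
          have "p ^ j * (p ^ Suc i - 1) + (p ^ j - 1) = p ^ Suc (i + j) - 1"
            using p_gt_0 by (simp add: diff_mult_distrib2 power_add mult_ac)
          then have "p ^ j * D i + (p ^ j - 1) * \<nu> = D (i + j)"
            unfolding D_def by (metis distrib_right mult.assoc)
          then have d: "p ^ j * (D i + e) + (p ^ j - 1) * \<nu> = D (i + j) + p ^ j * e"
            by (simp add: distrib_left)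
          show ?thesis
            unfolding comp_ui d using y by (simp add: hom_def comp_mult g'_def)
        qed
        then show ?thesis
          using e by (simp add: obstruction_def comp_add comp_sum hom_def comp_mult g'_def)
      qed
      moreover have "obstruction g' n i x - (g' i - f ^ (p ^ Suc i - p) * \<theta> (h (Suc i))) * x \<in> fpow ?I (p ^ Suc i)"
      proof (rule obstruction_shape[OF x less.prems, where r = "\<lambda>j. g' j - f ^ (p ^ Suc j - p) * h j"])
        show "Suc i < n \<Longrightarrow> u (h (Suc i)) = 0" using Zh by (auto simp: Z_def dest!: spec[of _ 0])
      qed (use h'(2) in \<open>auto simp: g'_def h_def\<close>)
      ultimately show ?thesis
        using is_ideal_diff[OF is_ideal_fpow fpow_hom[OF obs[OF less.prems x], of "D i + e"]] by fastforce
    qed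
    moreover have eqI: "fpow ?I (p ^ Suc i) = idl ((\<lambda>y. y ^ (p ^ Suc i)) ` set fs \<union> {0})"
      unfolding fpow_idl using idl_Un_idl[of "{}" "(\<lambda>y. y ^ (p ^ Suc i)) ` set fs"]
      by (auto simp: idl_def is_ideal_0)
    \<comment> \<open>The condition holds for every generator x, so the colon formula applies with q
      = p^{i+1}.\<close>
    ultimately obtain b where b: "g' i - f ^ (p ^ Suc i - p) * \<theta> (h (Suc i)) - f ^ (p ^ Suc i - 1) * b \<in> fpow ?I (p ^ Suc i)"
      using reg_colon[OF is_ideal_zero fs_reg, of "p ^ Suc i" "g' i - f ^ (p ^ Suc i - p) * \<theta> (h (Suc i))"] p_gt_0
      unfolding f_def[symmetric] by auto
    have deg: "(p - 1) * \<nu> + (p ^ Suc i - p) * \<nu> = D i"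
    proof -
      have "p \<le> p ^ Suc i" using p_gt_0 by simp
      then have "(p - 1) + (p ^ Suc i - p) = p ^ Suc i - 1" using p_gt_0 by linarith
      then show ?thesis unfolding D_def by (simp only: distrib_right[symmetric])
    qed
    have "component (D i) (f ^ (p ^ Suc i - p) * \<theta> (h (Suc i))) = f ^ (p ^ Suc i - p) * \<theta> (h (Suc i))"
      using hom_mult[OF hom_\<theta> hom_power[OF f_hom, of "p ^ Suc i - p"], of "h (Suc i)"] Zh
      unfolding deg by (simp add: hom_def Z_def mult.commute)
    \<comment> \<open>This power of f already has degree D i, so only the constant term of b
      survives; it is the new constant c_i.\<close>
    moreover have "component (D i) (f ^ (p ^ Suc i - 1) * b) = f ^ (p ^ Suc i - 1) * component 0 b"
      using comp_mult[of "(p ^ Suc i - 1) * \<nu>" "f ^ (p ^ Suc i - 1)" 0 b] hom_power[OF f_hom, of "p ^ Suc i - 1"]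
      by (simp add: D_def hom_def mult.commute)
    moreover have "component (D i) (g' i) = g' i" by (simp add: g'_def comp_comp)
    ultimately have "g' i - f ^ (p ^ Suc i - p) * \<theta> (h (Suc i)) - f ^ (p ^ Suc i - 1) * component 0 b \<in> fpow ?I (p ^ Suc i)"
      using fpow_hom[OF b, of "D i"] by (simp add: comp_diff)
    moreover have "f ^ (p ^ Suc i - 1) = f ^ (p ^ Suc i - p) * f ^ (p - 1)"
    proof -
      have "p \<le> p ^ Suc i" using p_gt_0 by simp
      then have "p ^ Suc i - 1 = (p ^ Suc i - p) + (p - 1)" using p_gt_0 by linarith
      then show ?thesis by (simp only: power_add)
    qed
    ultimately have "g' i - f ^ (p ^ Suc i - p) * (\<theta> (h (Suc i)) + f ^ (p - 1) * component 0 b) \<in> fpow ?I (p ^ Suc i)"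
      by (simp add: algebra_simps)
    moreover have "Z (n - i) (\<theta> (h (Suc i)) + f ^ (p - 1) * component 0 b)"
      using ZS[OF Zh hom_comp, of b] less.prems by (simp add: Suc_diff_Suc)
    ultimately show ?case unfolding g'_def by blast
  qed
  \<comment> \<open>At i = 0 the condition Z gives u h = 0, so the degree 0 part of u (g 0) lies in
    I, and with it the unit \<open>component 0 s\<close>.\<close>
  from this[of 0] n obtain h where h: "Z n h" "component ((p - 1) * \<nu>) (g 0) - h \<in> fpow ?I p"
    by (auto simp: D_def)
  have "u h = 0" using h(1) by (auto simp: Z_def dest!: spec[of _ 0])
  moreover have "u (1 * (component ((p - 1) * \<nu>) (g 0) - h)) \<in> ?I"
    using pairing_mem[OF is_ideal_idl, of _ "set fs" 1 1] h(2) by simp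
  ultimately have "component 0 (u (g 0)) \<in> ?I"
    using ui_diff[of 1 "component ((p - 1) * \<nu>) (g 0)" h] by (simp add: comp_u)
  moreover have "component 0 (u (g 0) - s) \<in> ?I" by (rule comp_idl[OF fs_hom g0])
  ultimately have "component 0 (u (g 0)) - component 0 (u (g 0) - s) \<in> ?I" by (rule is_ideal_diff[OF is_ideal_idl])
  then have "component 0 s \<in> ?I" by (simp add: comp_diff)
  moreover obtain b where "component 0 s * b = 1" using comp_unit[of "component 0 s"] s by (auto simp: comp_comp)
  ultimately have "1 \<in> ?I" using is_ideal_mult2[OF is_ideal_idl] by metis
  then show False using fs_proper by simp
qed

end

section \<open>The multinomial theorem and \<open>\<Delta>\<^sub>1\<close>\<close>

definition compositions :: "nat \<Rightarrow> nat \<Rightarrow> (nat \<Rightarrow> nat) set" where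
  "compositions r m = {\<alpha> \<in> {..<r} \<rightarrow>\<^sub>E UNIV. (\<Sum>i<r. \<alpha> i) = m}"

lemma prod_fact_dvd:
  fixes r :: nat
  shows "(\<Prod>i<r. fact (\<alpha> i) :: nat) dvd fact (\<Sum>i<r. \<alpha> i)"
proof (induction r)
  case (Suc r)
  have "(\<Prod>i<r. fact (\<alpha> i) :: nat) * fact (\<alpha> r) dvd fact (\<Sum>i<r. \<alpha> i) * fact (\<alpha> r)"
    by (rule mult_dvd_mono[OF Suc]) simp
  also have "\<dots> dvd fact ((\<Sum>i<r. \<alpha> i) + \<alpha> r)" by (rule fact_fact_dvd_fact)
  finally show ?case by simp
qed simp

lemma finite_compositions: "finite (compositions r m)"
proof (rule finite_subset)
  show "compositions r m \<subseteq> {..<r} \<rightarrow>\<^sub>E {..m}"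
    by (auto simp: compositions_def PiE_def Pi_def extensional_def intro: member_le_sum)
qed (auto intro: finite_PiE)

lemma multinomial:
  fixes x :: "nat \<Rightarrow> 'a::comm_ring_1"
  shows "(\<Sum>i<r. x i) ^ m = (\<Sum>\<alpha>\<in>compositions r m. of_nat (fact m div (\<Prod>i<r. fact (\<alpha> i))) * (\<Prod>i<r. x i ^ \<alpha> i))"
proof (induction r arbitrary: m)
  case 0
  have "compositions 0 m = (if m = 0 then {\<lambda>_. undefined} else {})"
    by (auto simp: compositions_def)
  then show ?case by (simp add: power_0_left)
next
  case (Suc r)
  let ?t = "\<lambda>r m \<alpha>. of_nat (fact m div (\<Prod>i<r. fact (\<alpha> i))) * (\<Prod>i<r. x i ^ \<alpha> i)"
  have up: "(\<Sum>i<r. (\<alpha>(r := k)) i) = (\<Sum>i<r. \<alpha> i)" "(\<Prod>i<r. fact ((\<alpha>(r := k)) i)) = (\<Prod>i<r. fact (\<alpha> i) :: nat)"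
      "(\<Prod>i<r. x i ^ (\<alpha>(r := k)) i) = (\<Prod>i<r. x i ^ \<alpha> i)" for \<alpha> k
    by (auto intro!: sum.cong prod.cong)
  have "(\<Sum>i<Suc r. x i) ^ m = (x r + (\<Sum>i<r. x i)) ^ m" by (simp add: add.commute)
  also have "\<dots> = (\<Sum>k\<le>m. of_nat (m choose k) * x r ^ k * (\<Sum>i<r. x i) ^ (m - k))"
    by (rule binomial_ring)
  also have "\<dots> = (\<Sum>k\<le>m. \<Sum>\<alpha>\<in>compositions r (m - k). of_nat (m choose k) * x r ^ k * ?t r (m - k) \<alpha>)"
    by (simp only: Suc sum_distrib_left)
  also have "\<dots> = (\<Sum>(k, \<alpha>)\<in>(SIGMA k:{..m}. compositions r (m - k)). of_nat (m choose k) * x r ^ k * ?t r (m - k) \<alpha>)"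
    by (rule sum.Sigma) (auto simp: finite_compositions)
  also have "\<dots> = (\<Sum>\<beta>\<in>compositions (Suc r) m. ?t (Suc r) m \<beta>)"
  proof (rule sum.reindex_bij_witness[of _ "\<lambda>\<beta>. (\<beta> r, \<beta>(r := undefined))" "\<lambda>(k, \<alpha>). \<alpha>(r := k)"])
    fix a assume a: "a \<in> (SIGMA k:{..m}. compositions r (m - k))"
    then obtain k \<alpha> where ka: "a = (k, \<alpha>)" "k \<le> m" "\<alpha> \<in> compositions r (m - k)" by auto
    then have \<alpha>: "\<alpha> \<in> {..<r} \<rightarrow>\<^sub>E UNIV" "(\<Sum>i<r. \<alpha> i) = m - k" by (auto simp: compositions_def)
    then show "(\<lambda>\<beta>. (\<beta> r, \<beta>(r := undefined))) ((\<lambda>(k, \<alpha>). \<alpha>(r := k)) a) = a"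
      by (auto simp: ka PiE_def extensional_def fun_eq_iff)
    show "(\<lambda>(k, \<alpha>). \<alpha>(r := k)) a \<in> compositions (Suc r) m"
      using \<alpha> ka(2) by (auto simp: ka(1) compositions_def up PiE_def extensional_def)
    define P where "P = (\<Prod>i<r. fact (\<alpha> i) :: nat)"
    have "P dvd fact (m - k)" using prod_fact_dvd[of \<alpha> r] by (simp add: P_def \<alpha>(2))
    then obtain Q where Q: "fact (m - k) = P * Q" by (elim dvdE)
    have P: "P > 0" by (simp add: P_def prod_pos)
    have "fact m = (P * fact k) * ((m choose k) * Q)"
      using binomial_fact_lemma[OF ka(2)] by (simp add: Q mult_ac)
    then have "fact m div (P * fact k) = (m choose k) * (fact (m - k) div P)"
      using P by (simp add: Q)
    then have "of_nat (fact m div (P * fact k)) = (of_nat (m choose k) * of_nat (fact (m - k) div P) :: 'a)"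
      by simp
    then show "?t (Suc r) m ((\<lambda>(k, \<alpha>). \<alpha>(r := k)) a) =
        (case a of (k, \<alpha>) \<Rightarrow> of_nat (m choose k) * x r ^ k * ?t r (m - k) \<alpha>)"
      by (simp add: ka(1) up P_def[symmetric] mult_ac)
  next
    fix \<beta> assume "\<beta> \<in> compositions (Suc r) m"
    then have \<beta>: "\<beta> \<in> {..<Suc r} \<rightarrow>\<^sub>E UNIV" "(\<Sum>i<r. \<beta> i) + \<beta> r = m" by (auto simp: compositions_def)
    then show "(\<lambda>\<beta>. (\<beta> r, \<beta>(r := undefined))) \<beta> \<in> (SIGMA k:{..m}. compositions r (m - k))"
      by (auto simp: compositions_def up PiE_def extensional_def)
  qed auto
  finally show ?case .
qed

text \<open>The p-th power of the sum minus the sum of p-th powers, divided by p, computed one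
  summand at a time. In this form the cocycle identities apply.\<close>

fun cocyc_list :: "nat \<Rightarrow> 'a::comm_ring_1 list \<Rightarrow> 'a" where
  "cocyc_list p [] = 0"
| "cocyc_list p (a # as) = cocyc_list p as + cocyc p a (sum_list as)"

lemma sum_list_power_prime:
  assumes "prime p"
  shows "sum_list as ^ p = (\<Sum>a\<leftarrow>as. a ^ p) + of_nat p * cocyc_list p as"
  using prime_gt_0_nat[OF assms]
  by (induction as) (auto simp: add_power_prime[OF assms] algebra_simps power_0_left)

text \<open>In the multinomial expansion the exponent vectors with an entry at least p are those of
  the pure powers; for all others no factorial in the denominator is divisible by p, so the
  coefficient is.\<close>

lemma Delta1_sum_power:
  fixes as :: "'a::comm_ring_1 list"
  assumes "prime p"
  shows "sum_list as ^ p = (\<Sum>a\<leftarrow>as. a ^ p) + of_nat p * Delta1_sum p as"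
proof -
  define r where "r = length as"
  have p: "p > 0" using prime_gt_0_nat[OF assms] .
  let ?t = "\<lambda>\<alpha>. of_nat (fact p div (\<Prod>i<r. fact (\<alpha> i))) * (\<Prod>i<r. as ! i ^ \<alpha> i)"
  define S where "S = {\<alpha>. \<alpha> \<in> {..<r} \<rightarrow>\<^sub>E {0..p - 1} \<and> (\<Sum>i<r. \<alpha> i) = p}"
  define e where "e = (\<lambda>i. \<lambda>j\<in>{..<r}. if j = i then p else 0)"
  have S: "S \<subseteq> compositions r p" by (auto simp: S_def compositions_def PiE_def)
  have e: "e ` {..<r} \<subseteq> compositions r p"
  proof safe
    fix i assume "i < r"
    have "(\<Sum>j<r. e i j) = (\<Sum>j<r. if j = i then p else 0)" by (rule sum.cong) (auto simp: e_def)
    then show "e i \<in> compositions r p" using \<open>i < r\<close> by (auto simp: compositions_def e_def sum.delta)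
  qed
  have eS: "e i \<notin> S" if "i < r" for i
  proof
    assume "e i \<in> S"
    then have "e i i \<in> {0..p - 1}" using that unfolding S_def by (metis (no_types, lifting) PiE_mem lessThan_iff mem_Collect_eq)
    then show False using that p by (auto simp: e_def)
  qed
  have U: "compositions r p = S \<union> e ` {..<r}"
  proof
    show "compositions r p \<subseteq> S \<union> e ` {..<r}"
    proof
      fix \<alpha> assume a: "\<alpha> \<in> compositions r p"
      then have \<alpha>: "\<alpha> \<in> {..<r} \<rightarrow>\<^sub>E UNIV" "(\<Sum>i<r. \<alpha> i) = p" by (auto simp: compositions_def)
      show "\<alpha> \<in> S \<union> e ` {..<r}"
      proof (cases "\<exists>i<r. \<alpha> i \<ge> p")
        case True
        then obtain i where i: "i < r" "\<alpha> i \<ge> p" by blast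
        have "(\<Sum>i<r. \<alpha> i) = \<alpha> i + (\<Sum>i\<in>{..<r} - {i}. \<alpha> i)" using i by (intro sum.remove) auto
        then have 0: "(\<Sum>i\<in>{..<r} - {i}. \<alpha> i) = 0" "\<alpha> i = p" using \<alpha>(2) i(2) by auto
        have "\<alpha> = e i"
        proof
          fix j show "\<alpha> j = e i j"
            using 0 \<alpha>(1) by (cases "j < r") (auto simp: e_def PiE_def extensional_def)
        qed
        then show ?thesis using i by blast
      next
        case False
        then have "\<alpha> \<in> S" using \<alpha> p by (auto simp: S_def PiE_def Pi_def not_le)
        then show ?thesis by blast
      qed
    qed
  qed (use S e in blast)
  have inj: "inj_on e {..<r}"
  proof
    fix i j assume i: "i \<in> {..<r}" and "j \<in> {..<r}" and eq: "e i = e j"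
    from eq have "e i i = e j i" by (rule fun_cong)
    then show "i = j" using p i by (simp add: e_def split: if_splits)
  qed
  have "sum_list as = (\<Sum>i<r. as ! i)" by (simp add: sum_list_sum_nth r_def atLeast0LessThan)
  then have "sum_list as ^ p = (\<Sum>\<alpha>\<in>compositions r p. ?t \<alpha>)" by (simp add: multinomial)
  also have "\<dots> = sum ?t S + sum ?t (e ` {..<r})"
    unfolding U by (rule sum.union_disjoint) (use eS finite_subset[OF S finite_compositions] in auto)
  also have "sum ?t (e ` {..<r}) = (\<Sum>i<r. as ! i ^ p)"
    unfolding sum.reindex[OF inj] o_def
  proof (rule sum.cong)
    fix i assume i: "i \<in> {..<r}"
    have "(\<Prod>j<r. fact (e i j) :: nat) = (\<Prod>j<r. if j = i then fact p else 1)"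
      by (rule prod.cong) (auto simp: e_def)
    moreover have "(\<Prod>j<r. as ! j ^ e i j) = (\<Prod>j<r. if j = i then as ! i ^ p else 1)"
      by (rule prod.cong) (auto simp: e_def)
    ultimately show "?t (e i) = as ! i ^ p" using i by (simp add: prod.delta)
  qed simp
  also have "(\<Sum>i<r. as ! i ^ p) = (\<Sum>a\<leftarrow>as. a ^ p)"
    by (simp add: sum_list_sum_nth r_def atLeast0LessThan)
  also have "sum ?t S = of_nat p * Delta1_sum p as"
    unfolding Delta1_sum_def r_def[symmetric] S_def[symmetric] sum_distrib_left
  proof (rule sum.cong)
    fix \<alpha> assume \<alpha>: "\<alpha> \<in> S"
    define P where "P = (\<Prod>i<r. fact (\<alpha> i) :: nat)"
    have "P dvd fact p" using prod_fact_dvd[of \<alpha> r] \<alpha> by (simp add: P_def S_def)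
    then obtain Q where Q: "fact p = P * Q" by (elim dvdE)
    have "\<not> p dvd P"
    proof
      assume "p dvd P"
      then have "\<exists>i\<in>{..<r}. p dvd fact (\<alpha> i)"
        unfolding P_def by (subst (asm) prime_dvd_prod_iff) (simp_all add: assms)
      then obtain i where i: "i < r" "p dvd fact (\<alpha> i)" by blast
      have "p \<le> \<alpha> i" using i(2) by (simp only: prime_dvd_fact_iff[OF assms])
      moreover have "\<alpha> \<in> {..<r} \<rightarrow>\<^sub>E {0..p - 1}" using \<alpha> by (simp add: S_def)
      from PiE_mem[OF this, of i] have "\<alpha> i \<le> p - 1" using i(1) by simp
      ultimately show False using p by linarith
    qed
    moreover have "p dvd P * Q" unfolding Q[symmetric] using p by (simp add: dvd_fact)
    ultimately have "p dvd Q" using assms prime_dvd_mult_iff by blast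
    then obtain Q' where Q': "Q = p * Q'" by (elim dvdE)
    have "P > 0" by (simp add: P_def prod_pos)
    then have "fact p div P = p * (fact p div P div p)" using p by (simp add: Q Q')
    then have "(of_nat (fact p div P) :: 'a) = of_nat p * of_nat (fact p div P div p)"
      by (metis of_nat_mult)
    then show "?t \<alpha> = of_nat p * (of_nat (fact p div (\<Prod>i<r. fact (\<alpha> i)) div p) * (\<Prod>i<r. as ! i ^ \<alpha> i))"
      by (simp add: P_def mult.assoc)
  qed simp
  finally show ?thesis by (simp add: add.commute)
qed

lemma ev_sum_list: "ev \<rho> (sum_list xs) = (\<Sum>x\<leftarrow>xs. ev \<rho> x)"
  by (induction xs) (auto simp: ev_add)

text \<open>Multiplied by p the two sides agree by the two expansions of the p-th power; p is
  cancelled over the integers before evaluating.\<close>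

lemma Delta1_sum_eq_cocyc_list:
  fixes as :: "'a::comm_ring_1 list"
  assumes "prime p"
  shows "Delta1_sum p as = cocyc_list p as"
proof -
  let ?xs = "map Var as :: ('a, int) mpoly list"
  have "of_nat p * Delta1_sum p ?xs = of_nat p * cocyc_list p ?xs"
    using Delta1_sum_power[OF assms, of ?xs] sum_list_power_prime[OF assms, of ?xs] by simp
  from arg_cong[OF mpoly_of_nat_mult_cancel[OF this prime_gt_0_nat[OF assms]], of "ev (\<lambda>v. v)"]
  have "ev (\<lambda>v. v) (Delta1_sum p ?xs) = ev (\<lambda>v. v) (cocyc_list p ?xs)" .
  moreover have "ev (\<lambda>v. v) (Delta1_sum p ?xs) = Delta1_sum p as"
    unfolding Delta1_sum_def by (auto simp: ev_simps intro!: sum.cong prod.cong arg_cong2[where f = "(*)"])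
  moreover have "ev (\<lambda>v. v) (cocyc_list p ?xs) = cocyc_list p as"
    by (induction as) (auto simp: ev_add ev_cocyc ev_sum_list o_def)
  ultimately show ?thesis by simp
qed

text \<open>Both sides describe the total of all g v and h v, grouped by v on the left and by g and
  h on the right; regrouping is associativity and commutativity of the cocycle.\<close>

lemma cocyc_list_add:
  assumes "prime p"
  shows "cocyc_list p (map (\<lambda>v. g v + h v) vs) + (\<Sum>v\<leftarrow>vs. cocyc p (g v) (h v)) =
    cocyc_list p (map g vs) + cocyc_list p (map h vs) + cocyc p (\<Sum>v\<leftarrow>vs. g v) (\<Sum>v\<leftarrow>vs. h v)"
proof (induction vs)
  case (Cons v vs)
  define a b A B where "a = g v" and "b = h v" and "A = (\<Sum>v\<leftarrow>vs. g v)" and "B = (\<Sum>v\<leftarrow>vs. h v)"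
  have "cocyc p (a + b) (A + B) + cocyc p a b + cocyc p A B = cocyc p a A + cocyc p b B + cocyc p (a + A) (b + B)"
  proof -
    have 1: "cocyc p a b + cocyc p (a + b) (A + B) = cocyc p b (A + B) + cocyc p a (A + (b + B))"
      using cocyc_assoc[OF assms, of a b "A + B"] by (simp add: add_ac)
    have "cocyc p b A + cocyc p (b + A) B = cocyc p A B + cocyc p b (A + B)"
      by (rule cocyc_assoc[OF assms])
    moreover have "cocyc p b A + cocyc p (b + A) B = cocyc p b B + cocyc p A (b + B)"
      using cocyc_assoc[OF assms, of A b B] by (simp add: cocyc_commute[OF assms, of A b] add.commute[of A b])
    ultimately have 2: "cocyc p A B + cocyc p b (A + B) = cocyc p b B + cocyc p A (b + B)" by simp
    have 3: "cocyc p a A + cocyc p (a + A) (b + B) = cocyc p A (b + B) + cocyc p a (A + (b + B))"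
      by (rule cocyc_assoc[OF assms])
    have "cocyc p (a + b) (A + B) + cocyc p a b + cocyc p A B =
        (cocyc p A B + cocyc p b (A + B)) + cocyc p a (A + (b + B))"
      using 1 by (simp add: add_ac)
    also have "\<dots> = cocyc p b B + (cocyc p A (b + B) + cocyc p a (A + (b + B)))"
      unfolding 2 by (rule add.assoc)
    also have "\<dots> = cocyc p a A + cocyc p b B + cocyc p (a + A) (b + B)"
      unfolding 3[symmetric] by (simp only: add_ac)
    finally show ?thesis .
  qed
  then show ?case using Cons
    by (simp add: sum_list_addf a_def[symmetric] b_def[symmetric] A_def[symmetric] B_def[symmetric]) (simp add: algebra_simps)
qed (simp add: cocyc_0_right)

section \<open>Polynomial rings over a field with a finite \<open>p\<close>-basis\<close>

definition expv :: "('n::finite \<Rightarrow> nat) \<Rightarrow> ('n \<Rightarrow>\<^sub>0 nat)" where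
  "expv e = Poly_Mapping.Abs_poly_mapping e"

lemma lookup_expv [simp]: "Poly_Mapping.lookup (expv e) = e"
  by (simp add: expv_def)

lemma expv_lookup [simp]: "expv (Poly_Mapping.lookup m) = m"
  by (rule poly_mapping_eqI) simp

lemma expv_add: "expv e + expv e' = expv (\<lambda>i. e i + e' i)"
  by (rule poly_mapping_eqI) (simp add: lookup_add)

lemma expv_eq_iff: "expv e = expv e' \<longleftrightarrow> e = e'"
  by (metis lookup_expv)

lemma expv_0: "expv (\<lambda>_. 0) = 0"
  by (rule poly_mapping_eqI) simp

lemma single_expv_power:
  "(Poly_Mapping.single (expv e) c :: ('n::finite, 'k::comm_ring_1) mpoly) ^ n =
    Poly_Mapping.single (expv (\<lambda>i. n * e i)) (c ^ n)"
  by (induction n) (auto simp: expv_0 mult_single expv_add)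

lemma single_sum: "Poly_Mapping.single m (sum g A) = (\<Sum>x\<in>A. Poly_Mapping.single m (g x))"
  by (induction A rule: infinite_finite_induct) (auto simp: single_add)

locale poly_dual =
  fixes p s :: nat and y :: "nat \<Rightarrow> 'k::field"
    and u :: "('n::finite, 'k) mpoly \<Rightarrow> ('n, 'k) mpoly"
  assumes p_char: "p = CHAR('k)" "p > 0" and y_basis: "p_basis p s y" and u_top: "is_dual_top p s y u"
begin

lemma prime_p: "prime p"
  using p_char prime_CHAR_semidom[where 'a = 'k] by simp

lemma char_p: "of_nat p = (0 :: ('n, 'k) mpoly)"
proof -
  have "of_nat p = (0 :: 'k)" unfolding p_char(1) by (rule of_nat_CHAR)
  then show ?thesis by (metis single_of_nat single_zero)
qed

sublocale char_p_ring p "TYPE(('n, 'k) mpoly)"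
  by unfold_locales (rule prime_p, rule char_p)

lemma K_frobenius_add: "(a + b :: 'k) ^ p = a ^ p + b ^ p"
  using add_power_prime[OF prime_p, of a b] of_nat_CHAR[where 'a = 'k] by (simp flip: p_char(1))

abbreviation "PE \<equiv> p_exponents p s"

definition ymon :: "(nat \<Rightarrow> nat) \<Rightarrow> 'k" where "ymon j = (\<Prod>l<s. y l ^ j l)"

definition bm :: "(nat \<Rightarrow> nat) \<Rightarrow> ('n \<Rightarrow> nat) \<Rightarrow> ('n, 'k) mpoly" where
  "bm j e = Poly_Mapping.single (expv e) (ymon j)"

lemma prod_Var: "(\<Prod>i\<in>UNIV. Var i ^ e i) = (Poly_Mapping.single (expv e) 1 :: ('n, 'k) mpoly)"
proof -
  have 1: "(Var i :: ('n, 'k) mpoly) ^ n = Poly_Mapping.single (Poly_Mapping.single i n) 1" for i n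
    by (induction n) (auto simp: Var_def mult_single simp flip: single_add)
  have "finite A \<Longrightarrow> (\<Prod>i\<in>A. Var i ^ e i) =
      (Poly_Mapping.single (\<Sum>i\<in>A. Poly_Mapping.single i (e i)) 1 :: ('n, 'k) mpoly)" for A
    by (induction A rule: finite_induct) (auto simp: 1 mult_single)
  moreover have "(\<Sum>i\<in>UNIV. Poly_Mapping.single i (e i)) = expv e"
    by (rule poly_mapping_eqI) (simp add: lookup_sum lookup_single when_def)
  ultimately show ?thesis by simp
qed

lemma bm_eq: "Const (\<Prod>l<s. y l ^ j l) * (\<Prod>i\<in>UNIV. Var i ^ e i) = bm j e"
  by (simp add: bm_def ymon_def prod_Var Const_def mult_single)

lemma bm_mult: "bm j e * bm j' e' = bm (\<lambda>l. j l + j' l) (\<lambda>i. e i + e' i)"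
  by (simp add: bm_def mult_single expv_add ymon_def power_add prod.distrib)

lemma bm_power: "bm j e ^ n = bm (\<lambda>l. n * j l) (\<lambda>i. n * e i)"
  by (simp add: bm_def single_expv_power ymon_def prod_power_distrib mult.commute[of n] power_mult)

lemma bm_cong: "(\<And>l. l < s \<Longrightarrow> j l = j' l) \<Longrightarrow> bm j e = bm j' e"
  by (simp add: bm_def ymon_def)

definition red :: "(nat \<Rightarrow> nat) \<Rightarrow> nat \<Rightarrow> nat" where "red j = (\<lambda>l\<in>{..<s}. j l mod p)"

definition IX :: "((nat \<Rightarrow> nat) \<times> ('n \<Rightarrow> nat)) set" where
  "IX = PE \<times> {e. \<forall>i. e i \<le> p - 1}"

definition vv :: "(nat \<Rightarrow> nat) \<times> ('n \<Rightarrow> nat) \<Rightarrow> ('n, 'k) mpoly" where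
  "vv a = bm (fst a) (snd a)"

text \<open>The complementary monomial: \<open>dv a * vv a\<close> is the top monomial, so b ->
  \<open>u (dv a * b)\<close> is dual to \<open>vv a\<close>.\<close>

definition dv :: "(nat \<Rightarrow> nat) \<times> ('n \<Rightarrow> nat) \<Rightarrow> ('n, 'k) mpoly" where
  "dv a = bm (\<lambda>l. p - 1 - fst a l) (\<lambda>i. p - 1 - snd a i)"

lemma mod_le: "a mod p \<le> p - 1"
  using p_char(2) by (metis Suc_pred' less_Suc_eq_le mod_less_divisor)

lemma red_IX: "(red j, \<lambda>i. e i mod p) \<in> IX"
  by (auto simp: IX_def red_def p_exponents_def mod_le simp del: One_nat_def)

lemma finite_IX: "finite IX"
proof -
  have "finite PE" unfolding p_exponents_def by (intro finite_PiE) auto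
  moreover have "finite {e :: 'n \<Rightarrow> nat. \<forall>i. e i \<le> p - 1}"
    using finite_set_of_finite_funs[of "UNIV :: 'n set" "{..p - 1}"] by (simp add: subset_eq)
  ultimately show ?thesis by (simp add: IX_def)
qed

lemma basis_monomials_eq: "basis_monomials p s y = vv ` IX"
  unfolding basis_monomials_def bm_eq by (force simp: vv_def IX_def)

lemma bm_split: "bm j e = bm (\<lambda>l. j l div p) (\<lambda>i. e i div p) ^ p * vv (red j, \<lambda>i. e i mod p)"
  by (auto simp: vv_def bm_power bm_mult red_def fun_eq_iff intro!: bm_cong)

lemma module_frob_K: "Modules.module (frob_scale p :: 'k \<Rightarrow> 'k \<Rightarrow> 'k)"
  by unfold_locales (auto simp: frob_scale_def algebra_simps K_frobenius_add power_mult_distrib)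

lemma ymon_nonzero: "j \<in> PE \<Longrightarrow> ymon j \<noteq> 0"
proof
  assume j: "j \<in> PE" "ymon j = 0"
  interpret Modules.module "frob_scale p :: 'k \<Rightarrow> 'k \<Rightarrow> 'k" by (rule module_frob_K)
  have "0 \<in> (\<lambda>j. \<Prod>l<s. y l ^ j l) ` p_exponents p s" using j by (force simp: ymon_def)
  then have "Modules.module.dependent (frob_scale p) ((\<lambda>j. \<Prod>l<s. y l ^ j l) ` p_exponents p s)"
    by (rule dependent_zero)
  then show False using y_basis by (simp add: p_basis_def)
qed

lemma ymon_inj: "inj_on ymon PE"
  using y_basis by (simp add: p_basis_def ymon_def[abs_def])

lemma vv_inj: "inj_on vv IX"
proof
  fix a b assume ab: "a \<in> IX" "b \<in> IX" "vv a = vv b"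
  then have nz: "ymon (fst a) \<noteq> 0" "ymon (fst b) \<noteq> 0" by (auto simp: IX_def ymon_nonzero)
  have "Poly_Mapping.keys (vv a) = Poly_Mapping.keys (vv b)" using ab by simp
  then have "snd a = snd b" using nz by (simp add: vv_def bm_def expv_eq_iff)
  moreover from this have "ymon (fst a) = ymon (fst b)"
    using arg_cong[OF ab(3), of "\<lambda>t. Poly_Mapping.lookup t (expv (snd a))"] by (simp add: vv_def bm_def)
  then have "fst a = fst b" using ymon_inj ab(1,2) by (auto simp: IX_def dest: inj_onD)
  ultimately show "a = b" by (simp add: prod_eq_iff)
qed

definition top :: "(nat \<Rightarrow> nat) \<times> ('n \<Rightarrow> nat)" where
  "top = ((\<lambda>l\<in>{..<s}. p - 1), \<lambda>_. p - 1)"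

lemma top_IX: "top \<in> IX"
  by (auto simp: top_def IX_def p_exponents_def)

lemma top_monomial_eq: "top_monomial p s y = vv top"
proof -
  have "top_monomial p s y = bm (\<lambda>_. 1) (\<lambda>_. 1) ^ (p - 1)"
    using bm_eq[of "\<lambda>_. 1" "\<lambda>_. 1"] by (simp add: top_monomial_def)
  also have "\<dots> = vv top" unfolding bm_power vv_def top_def by (auto intro: bm_cong)
  finally show ?thesis .
qed

lemma u_add: "u (a + b) = u a + u b"
  and u_scale: "u (a ^ p * b) = a * u b"
proof -
  have "module_hom (frob_scale p) (*) u" using u_top by (simp add: is_dual_top_def)
  then interpret module_hom "frob_scale p" "(*)" u .
  show "u (a + b) = u a + u b" by (rule add)
  show "u (a ^ p * b) = a * u b" using scale[of a b] by (simp add: frob_scale_def)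
qed

lemma u_0 [simp]: "u 0 = 0" using u_add[of 0 0] by simp

lemma u_sum: "u (sum g A) = (\<Sum>x\<in>A. u (g x))"
  by (induction A rule: infinite_finite_induct) (auto simp: u_add)

lemma u_vv: "a \<in> IX \<Longrightarrow> u (vv a) = (if a = top then 1 else 0)"
  using u_top vv_inj top_IX
  by (auto simp: is_dual_top_def basis_monomials_eq top_monomial_eq dest: inj_onD)

text \<open>For i and k between 0 and p - 1 the exponent p - 1 - i + k is congruent to -1 modulo p
  only if i = k, and u vanishes on monomials with any other residue.\<close>

lemma u_dv_vv:
  assumes "a \<in> IX" "b \<in> IX"
  shows "u (dv a * vv b) = (if a = b then 1 else 0)"
proof -
  let ?j = "\<lambda>l. p - 1 - fst a l + fst b l" and ?e = "\<lambda>i. p - 1 - snd a i + snd b i"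
  have a: "\<And>l. l < s \<Longrightarrow> fst a l \<le> p - 1" "\<And>l. l < s \<Longrightarrow> fst b l \<le> p - 1"
      "\<And>i. snd a i \<le> p - 1" "\<And>i. snd b i \<le> p - 1"
    using assms PiE_mem by (fastforce simp: IX_def p_exponents_def)+
  have key: "(p - 1 - i + k) mod p = p - 1 \<longleftrightarrow> i = k" if "i \<le> p - 1" "k \<le> p - 1" for i k :: nat
  proof (cases "k \<le> i")
    case True
    then have "(p - 1 - i + k) mod p = p - 1 - i + k" using that p_char(2) by (intro mod_less) linarith
    then show ?thesis using that True by linarith
  next
    case False
    then have "p - 1 - i + k = (k - i - 1) + p" "k - i - 1 < p" using that p_char(2) by linarith+
    then have "(p - 1 - i + k) mod p = k - i - 1" by simp
    then show ?thesis using False that p_char(2) by linarith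
  qed
  have "u (dv a * vv b) = u (bm ?j ?e)" by (simp only: dv_def vv_def bm_mult)
  also have "\<dots> = bm (\<lambda>l. ?j l div p) (\<lambda>i. ?e i div p) * u (vv (red ?j, \<lambda>i. ?e i mod p))"
    by (subst bm_split) (rule u_scale)
  also have "\<dots> = (if a = b then 1 else 0)"
  proof (cases "a = b")
    case True
    have "bm (\<lambda>l. ?j l div p) (\<lambda>i. ?e i div p) = bm (\<lambda>_. 0) (\<lambda>_. 0)"
    proof -
      have "?e i div p = 0" for i using a(3)[of i] True p_char(2) by (intro div_less) simp
      moreover have "?j l div p = 0" if "l < s" for l using a(1)[OF that] True p_char(2) by (intro div_less) simp
      ultimately show ?thesis by (simp only:) (rule bm_cong, simp)
    qed
    moreover have "(red ?j, \<lambda>i. ?e i mod p) = top"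
    proof -
      have "?e i mod p = p - 1" for i using key[OF a(3,4)] True by simp
      moreover have "?j l mod p = p - 1" if "l < s" for l using key[OF a(1,2)] True that by simp
      ultimately show ?thesis by (auto simp: red_def top_def fun_eq_iff simp del: One_nat_def)
    qed
    ultimately show ?thesis using True u_vv[OF top_IX] by (simp add: bm_def ymon_def expv_0)
  next
    case False
    have "(red ?j, \<lambda>i. ?e i mod p) \<noteq> top"
    proof
      assume eq: "(red ?j, \<lambda>i. ?e i mod p) = top"
      have "fst a l = fst b l" if "l < s" for l
      proof -
        have "?j l mod p = p - 1" using arg_cong[OF eq, of "\<lambda>t. fst t l"] that by (simp add: red_def top_def)
        then show ?thesis using key[OF a(1,2)] that by simp
      qed
      then have "fst a = fst b"
        using assms by (intro PiE_ext[of "fst a" "{..<s}" "\<lambda>_. {0..p - 1}"]) (auto simp: IX_def p_exponents_def)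
      moreover have "snd a i = snd b i" for i
      proof -
        have "?e i mod p = p - 1" using arg_cong[OF eq, of "\<lambda>t. snd t i"] by (simp add: top_def)
        then show ?thesis using key[OF a(3,4)] by simp
      qed
      ultimately show False using False by (auto simp: prod_eq_iff)
    qed
    then show ?thesis using u_vv[OF red_IX, of ?j ?e] False by simp
  qed
  finally show ?thesis .
qed

lemma K_decomp: "\<exists>cc. c = (\<Sum>j\<in>PE. cc j ^ p * ymon j)"
proof -
  interpret Modules.module "frob_scale p :: 'k \<Rightarrow> 'k \<Rightarrow> 'k" by (rule module_frob_K)
  have fin: "finite PE" unfolding p_exponents_def by (intro finite_PiE) auto
  have "c \<in> span (ymon ` PE)" using y_basis by (simp add: p_basis_def ymon_def[abs_def])
  then obtain w where "c = (\<Sum>v\<in>ymon ` PE. frob_scale p (w v) v)"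
    using span_finite[of "ymon ` PE"] fin by auto
  also have "\<dots> = (\<Sum>j\<in>PE. w (ymon j) ^ p * ymon j)"
    by (simp add: sum.reindex[OF ymon_inj] frob_scale_def)
  finally show ?thesis by (rule exI[of _ "\<lambda>j. w (ymon j)"])
qed

text \<open>A decomposition of a term into p-monomials, recorded with the fact that each summand is
  again a term with exponent e. The second clause is what makes parts and u compatible with
  exponents, hence with the grading.\<close>

definition is_decomp :: "('n \<Rightarrow> nat) \<Rightarrow> 'k \<Rightarrow> ((nat \<Rightarrow> nat) \<Rightarrow> 'k) \<Rightarrow> bool" where
  "is_decomp e c cc \<longleftrightarrow> Poly_Mapping.single (expv e) c =
      (\<Sum>j\<in>PE. Poly_Mapping.single (expv (\<lambda>i. e i div p)) (cc j) ^ p * vv (j, \<lambda>i. e i mod p)) \<and>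
    (\<forall>j. Poly_Mapping.single (expv (\<lambda>i. e i div p)) (cc j) ^ p * vv (j, \<lambda>i. e i mod p) =
      Poly_Mapping.single (expv e) (cc j ^ p * ymon j))"

lemma single_decomp: "\<exists>cc. is_decomp e c cc"
proof -
  obtain cc where cc: "c = (\<Sum>j\<in>PE. cc j ^ p * ymon j)" using K_decomp by blast
  have 1: "Poly_Mapping.single (expv (\<lambda>i. e i div p)) d ^ p * vv (j, \<lambda>i. e i mod p) =
      Poly_Mapping.single (expv e) (d ^ p * ymon j)" for d j
    by (simp add: vv_def bm_def single_expv_power mult_single expv_add)
  have "Poly_Mapping.single (expv e) c = (\<Sum>j\<in>PE. Poly_Mapping.single (expv e) (cc j ^ p * ymon j))"
    unfolding cc by (rule single_sum)
  then show ?thesis unfolding is_decomp_def 1 by blast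
qed

lemma pmon_induct [case_names pmon add]:
  assumes "\<And>b a. a \<in> IX \<Longrightarrow> P (b ^ p * vv a)" "\<And>x x'. P x \<Longrightarrow> P x' \<Longrightarrow> P (x + x')"
  shows "P x"
proof -
  have 0: "P 0" using assms(1)[OF top_IX, of 0] p_char(2) by (simp add: power_0_left)
  have sum: "P (sum g A)" if "\<And>a. a \<in> A \<Longrightarrow> P (g a)" for g and A :: "(nat \<Rightarrow> nat) set"
    using that by (induction A rule: infinite_finite_induct) (auto intro: 0 assms)
  show ?thesis
  proof (induction x rule: poly_mapping_single_induct)
    case (single m c)
    define e where "e = Poly_Mapping.lookup m"
    have m: "m = expv e" by (simp add: e_def)
    obtain cc where "is_decomp e c cc" using single_decomp ..
    then have cc: "Poly_Mapping.single (expv e) c =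
      (\<Sum>j\<in>PE. Poly_Mapping.single (expv (\<lambda>i. e i div p)) (cc j) ^ p * vv (j, \<lambda>i. e i mod p))"
      "\<And>j. Poly_Mapping.single (expv (\<lambda>i. e i div p)) (cc j) ^ p * vv (j, \<lambda>i. e i mod p) =
      Poly_Mapping.single (expv e) (cc j ^ p * ymon j)"
      by (simp_all only: is_decomp_def)
    from cc(1) show ?case
      unfolding m by (simp only:) (intro sum assms(1), auto simp: IX_def mod_le simp del: One_nat_def)
  qed (auto intro: 0 assms)
qed

text \<open>By \<open>sum_part\<close> these are the p-monomials of the canonical decomposition of
  x.\<close>

definition part :: "(nat \<Rightarrow> nat) \<times> ('n \<Rightarrow> nat) \<Rightarrow> ('n, 'k) mpoly \<Rightarrow> ('n, 'k) mpoly" where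
  "part a x = u (dv a * x) ^ p * vv a"

lemma part_add: "part a (x + x') = part a x + part a x'"
  by (simp add: part_def distrib_left u_add frobenius_add distrib_right)

lemma part_0 [simp]: "part a 0 = 0"
  using part_add[of a 0 0] by simp

lemma part_sum: "part a (sum g A) = (\<Sum>x\<in>A. part a (g x))"
  by (induction A rule: infinite_finite_induct) (auto simp: part_add)

lemma part_pmon: "a \<in> IX \<Longrightarrow> c \<in> IX \<Longrightarrow> part a (b ^ p * vv c) = (if a = c then b ^ p * vv c else 0)"
  by (simp add: part_def mult.left_commute[of "dv a"] u_scale u_dv_vv)

lemma sum_part: "(\<Sum>a\<in>IX. part a x) = x"
proof (induction x rule: pmon_induct)
  case (pmon b a)
  have "(\<Sum>c\<in>IX. part c (b ^ p * vv a)) = (\<Sum>c\<in>IX. if c = a then b ^ p * vv a else 0)"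
    by (rule sum.cong) (auto simp: part_pmon pmon)
  then show ?case using pmon finite_IX by simp
qed (simp add: part_add sum.distrib)

lemma part_single:
  assumes "a \<in> IX"
  shows "\<exists>d. part a (Poly_Mapping.single m c) = Poly_Mapping.single m d"
proof -
  define e where "e = Poly_Mapping.lookup m"
  have m: "m = expv e" by (simp add: e_def)
  obtain cc where "is_decomp e c cc" using single_decomp ..
    then have cc: "Poly_Mapping.single (expv e) c =
      (\<Sum>j\<in>PE. Poly_Mapping.single (expv (\<lambda>i. e i div p)) (cc j) ^ p * vv (j, \<lambda>i. e i mod p))"
      "\<And>j. Poly_Mapping.single (expv (\<lambda>i. e i div p)) (cc j) ^ p * vv (j, \<lambda>i. e i mod p) =
      Poly_Mapping.single (expv e) (cc j ^ p * ymon j)"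
      by (simp_all only: is_decomp_def)
  have "part a (Poly_Mapping.single m c) =
      (\<Sum>j\<in>PE. if a = (j, \<lambda>i. e i mod p) then Poly_Mapping.single m (cc j ^ p * ymon j) else 0)"
    unfolding m cc(1) part_sum
  proof (rule sum.cong)
    fix j assume "j \<in> PE"
    then have "(j, \<lambda>i. e i mod p) \<in> IX" by (auto simp: IX_def mod_le simp del: One_nat_def)
    from part_pmon[OF assms this, of "Poly_Mapping.single (expv (\<lambda>i. e i div p)) (cc j)"] show "part a (Poly_Mapping.single (expv (\<lambda>i. e i div p)) (cc j) ^ p * vv (j, \<lambda>i. e i mod p)) =
      (if a = (j, \<lambda>i. e i mod p) then Poly_Mapping.single (expv e) (cc j ^ p * ymon j) else 0)"
      by (simp only: cc(2))
  qed simp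
  also have "\<dots> = Poly_Mapping.single m (\<Sum>j\<in>PE. if a = (j, \<lambda>i. e i mod p) then cc j ^ p * ymon j else 0)"
    unfolding single_sum by (rule sum.cong) auto
  finally show ?thesis by blast
qed

text \<open>Terms decompose into terms of the same exponent, so taking parts creates no new
  exponents; thus homogeneity passes to the parts.\<close>

lemma keys_part: "a \<in> IX \<Longrightarrow> Poly_Mapping.keys (part a x) \<subseteq> Poly_Mapping.keys x"
proof -
  assume a: "a \<in> IX"
  have "part a x = (\<Sum>m\<in>Poly_Mapping.keys x. part a (Poly_Mapping.single m (Poly_Mapping.lookup x m)))"
    using arg_cong[OF poly_mapping_eq_sum_single[of x], of "part a"] unfolding part_sum .
  moreover have "Poly_Mapping.keys (part a (Poly_Mapping.single m (Poly_Mapping.lookup x m))) \<subseteq> {m}" for m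
    using part_single[OF a, of m "Poly_Mapping.lookup x m"] by (auto split: if_splits)
  then have "(\<Union>m\<in>Poly_Mapping.keys x. Poly_Mapping.keys (part a (Poly_Mapping.single m (Poly_Mapping.lookup x m))))
      \<subseteq> Poly_Mapping.keys x" by blast
  ultimately show ?thesis
    using Poly_Mapping.keys_sum[of "\<lambda>m. part a (Poly_Mapping.single m (Poly_Mapping.lookup x m))" "Poly_Mapping.keys x"]
    by simp
qed

text \<open>Of the p-monomials in a term only the one at the top basis element survives. This is the
  source of the degree shift of u.\<close>

lemma u_single:
  "\<exists>d. u (Poly_Mapping.single (expv e) c) = Poly_Mapping.single (expv (\<lambda>i. e i div p)) d \<and>
    (d = 0 \<or> (\<forall>i. e i mod p = p - 1))"
proof -
  obtain cc where "is_decomp e c cc" using single_decomp ..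
    then have cc: "Poly_Mapping.single (expv e) c =
      (\<Sum>j\<in>PE. Poly_Mapping.single (expv (\<lambda>i. e i div p)) (cc j) ^ p * vv (j, \<lambda>i. e i mod p))"
      "\<And>j. Poly_Mapping.single (expv (\<lambda>i. e i div p)) (cc j) ^ p * vv (j, \<lambda>i. e i mod p) =
      Poly_Mapping.single (expv e) (cc j ^ p * ymon j)"
      by (simp_all only: is_decomp_def)
  have "u (Poly_Mapping.single (expv e) c) =
      (\<Sum>j\<in>PE. if (j, \<lambda>i. e i mod p) = top then Poly_Mapping.single (expv (\<lambda>i. e i div p)) (cc j) else 0)"
    unfolding cc(1) u_sum
  proof (rule sum.cong)
    fix j assume "j \<in> PE"
    then have "(j, \<lambda>i. e i mod p) \<in> IX" by (auto simp: IX_def mod_le simp del: One_nat_def)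
    then show "u (Poly_Mapping.single (expv (\<lambda>i. e i div p)) (cc j) ^ p * vv (j, \<lambda>i. e i mod p)) =
      (if (j, \<lambda>i. e i mod p) = top then Poly_Mapping.single (expv (\<lambda>i. e i div p)) (cc j) else 0)"
      by (simp add: u_scale u_vv)
  qed simp
  also have "\<dots> = Poly_Mapping.single (expv (\<lambda>i. e i div p)) (\<Sum>j\<in>PE. if (j, \<lambda>i. e i mod p) = top then cc j else 0)"
    unfolding single_sum by (rule sum.cong) auto
  finally have 1: "u (Poly_Mapping.single (expv e) c) =
    Poly_Mapping.single (expv (\<lambda>i. e i div p)) (\<Sum>j\<in>PE. if (j, \<lambda>i. e i mod p) = top then cc j else 0)" .
  have "(\<Sum>j\<in>PE. if (j, \<lambda>i. e i mod p) = top then cc j else 0) = 0" if "\<not> (\<forall>i. e i mod p = p - 1)"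
    using that by (intro sum.neutral) (auto simp: top_def fun_eq_iff)
  with 1 show ?thesis by blast
qed

end

section \<open>The operator Delta_1 as a single-valued function\<close>

context poly_dual
begin

definition idx :: "((nat \<Rightarrow> nat) \<times> ('n \<Rightarrow> nat)) list" where
  "idx = (SOME xs. set xs = IX \<and> distinct xs)"

lemma idx: "set idx = IX" "distinct idx"
  using someI_ex[OF finite_distinct_list[OF finite_IX]] unfolding idx_def by auto

text \<open>Delta_1 is evaluated on the canonical decomposition, which makes it a function; the
  order of the parts in \<open>idx\<close> is arbitrary but fixed.\<close>

definition Delta :: "('n, 'k) mpoly \<Rightarrow> ('n, 'k) mpoly" where
  "Delta a = cocyc_list p (map (\<lambda>i. part i a) idx)"

lemma sum_list_part: "(\<Sum>i\<leftarrow>idx. part i a) = a"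
  using sum_part[of a] by (simp add: sum_list_distinct_conv_sum_set idx)

lemma cocyc_power: "cocyc p (a ^ p) (b ^ p) = (cocyc p a b :: ('n, 'k) mpoly) ^ p"
  unfolding cocyc_def frobenius_sum
  by (intro sum.cong) (simp_all add: power_mult_distrib frobenius_of_nat mult.commute[of p] flip: power_mult)

text \<open>Both arguments are p-th powers times the same basis element, and \<open>cocyc p\<close>
  is homogeneous of degree p, so the value is a p-th power. Hence the parts with equal index add up
  without contributing to the class of Delta_1.\<close>

lemma cocyc_part: "cocyc p (part i a) (part i b) \<approx> 0"
proof -
  have "cocyc p (part i a) (part i b) = (vv i * cocyc p (u (dv i * a)) (u (dv i * b))) ^ p"
    by (simp add: part_def mult.commute[of _ "vv i"] cocyc_mult[OF prime_p] cocyc_power power_mult_distrib)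
  then show ?thesis by (simp add: eqp_pow)
qed

lemma eqp_sum_list_0: "(\<And>x. x \<in> set xs \<Longrightarrow> g x \<approx> 0) \<Longrightarrow> (\<Sum>x\<leftarrow>xs. g x) \<approx> 0"
  by (induction xs) (use eqp_add in force)+

lemma Delta_add: "Delta (a + b) \<approx> Delta a + Delta b + cocyc p a b"
proof -
  have "Delta (a + b) + (\<Sum>i\<leftarrow>idx. cocyc p (part i a) (part i b)) = Delta a + Delta b + cocyc p a b"
    unfolding Delta_def part_add by (simp add: cocyc_list_add[OF prime_p] sum_list_part)
  moreover have "(\<Sum>i\<leftarrow>idx. cocyc p (part i a) (part i b)) \<approx> 0"
    by (rule eqp_sum_list_0[OF cocyc_part])
  then have "Delta (a + b) + (\<Sum>i\<leftarrow>idx. cocyc p (part i a) (part i b)) \<approx> Delta (a + b) + 0"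
    by (intro eqp_add eqp_refl)
  ultimately show ?thesis by (simp add: eqp_sym)
qed

lemma cocyc_list_single:
  assumes "distinct xs"
  shows "cocyc_list p (map (\<lambda>i. if i = k then b else 0) xs) = (0 :: ('n, 'k) mpoly)"
proof -
  have 0: "(\<Sum>i\<leftarrow>xs. if i = k then b else 0) = 0" if "k \<notin> set xs" for xs
    using that by (induction xs) auto
  show ?thesis using assms
    by (induction xs) (auto simp: 0 cocyc_0_right cocyc_commute[OF prime_p, of 0])
qed

lemma Delta_pmon: "a \<in> IX \<Longrightarrow> Delta (b ^ p * vv a) = 0"
proof -
  assume a: "a \<in> IX"
  have "map (\<lambda>i. part i (b ^ p * vv a)) idx = map (\<lambda>i. if i = a then b ^ p * vv a else 0) idx"
    by (rule map_cong) (auto simp: idx part_pmon a)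
  then show ?thesis by (simp only: Delta_def cocyc_list_single[OF idx(2)])
qed

lemma Delta_0: "Delta 0 = 0"
  using Delta_pmon[OF top_IX, of 0] by simp

abbreviation "PM \<equiv> {c :: ('n, 'k) mpoly. p_monomial p s y c}"

lemma PM_iff: "c \<in> PM \<longleftrightarrow> (\<exists>b. \<exists>a\<in>IX. c = b ^ p * vv a)"
  by (auto simp: p_monomial_def basis_monomials_eq)

lemma vv_one: "\<exists>a\<in>IX. vv a = 1"
proof
  show "vv (\<lambda>l\<in>{..<s}. 0, \<lambda>_. 0) = 1" by (simp add: vv_def bm_def ymon_def expv_0)
qed (simp add: IX_def p_exponents_def)

sublocale delta_ring p PM Delta
proof
  fix c :: int
  obtain a where "a \<in> IX" "vv a = 1" using vv_one by blast
  then have "of_int c = of_int c ^ p * vv a" by (simp add: frobenius_of_int)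
  then show "of_int c \<in> PM" unfolding PM_iff using \<open>a \<in> IX\<close> by blast
next
  fix a b :: "('n, 'k) mpoly" assume "a \<in> PM" "b \<in> PM"
  then obtain a' b' i j where ab: "a = a' ^ p * vv i" "b = b' ^ p * vv j" unfolding PM_iff by blast
  obtain c k where c: "k \<in> IX" "vv i * vv j = c ^ p * vv k"
  proof (rule that[OF red_IX])
    show "vv i * vv j = bm (\<lambda>l. (fst i l + fst j l) div p) (\<lambda>l. (snd i l + snd j l) div p) ^ p *
        vv (red (\<lambda>l. fst i l + fst j l), \<lambda>l. (snd i l + snd j l) mod p)"
      unfolding vv_def[of i] vv_def[of j] bm_mult by (rule bm_split)
  qed
  have "a * b = (a' * b' * c) ^ p * vv k"
    unfolding ab power_mult_distrib using c(2) by (simp add: mult_ac)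
  then show "a * b \<in> PM" using c(1) unfolding PM_iff by blast
next
  fix a :: "('n, 'k) mpoly"
  have "set (map (\<lambda>i. part i a) idx) \<subseteq> PM"
    unfolding set_map idx(1) image_subset_iff PM_iff part_def by blast
  then show "\<exists>as. set as \<subseteq> PM \<and> a = sum_list as" using sum_list_part[of a] by metis
next
  fix a b :: "('n, 'k) mpoly"
  show "Delta (a + b) \<approx> Delta a + Delta b + cocyc p a b" by (rule Delta_add)
  show "Delta 0 = 0" by (rule Delta_0)
  show "a \<in> PM \<Longrightarrow> Delta a \<approx> 0" unfolding PM_iff using Delta_pmon by fastforce
qed

text \<open>The addition rule evaluates \<open>Delta\<close> on any sum of p-monomials, one summand
  at a time, as \<open>cocyc_list\<close>. So a representative agrees with \<open>Delta\<close>
  modulo p-th powers whatever decomposition it came from.\<close>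

lemma Delta1_eqp:
  assumes "\<delta> \<in> Delta1 p s y a"
  shows "\<delta> \<approx> Delta a"
proof -
  obtain as b where as: "\<delta> = Delta1_sum p as + b ^ p" "\<forall>c\<in>set as. p_monomial p s y c" "sum_list as = a"
    using assms by (auto simp: Delta1_def)
  have "\<forall>c\<in>set as. p_monomial p s y c \<Longrightarrow> Delta (sum_list as) \<approx> cocyc_list p as" for as
  proof (induction as)
    case (Cons c as)
    have "Delta (c + sum_list as) \<approx> Delta c + Delta (sum_list as) + cocyc p c (sum_list as)" by (rule \<Delta>_add)
    also have "\<dots> \<approx> 0 + cocyc_list p as + cocyc p c (sum_list as)"
      using Cons by (intro eqp_add eqp_refl \<Delta>_M) auto
    finally show ?case by simp
  qed simp
  from this[OF as(2)] have 1: "cocyc_list p as \<approx> Delta a" unfolding as(3) by (rule eqp_sym)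
  have "\<delta> \<approx> cocyc_list p as"
    unfolding as(1) Delta1_sum_eq_cocyc_list[OF prime_p] by (rule eqp_add_pow)
  from eqp_trans[OF this 1] show ?thesis .
qed

sublocale fdual p PM Delta u "map (\<lambda>a. (dv a, vv a)) idx"
proof
  fix a
  show "(\<Sum>(d, v)\<leftarrow>map (\<lambda>a. (dv a, vv a)) idx. u (d * a) ^ p * v) = a"
    using sum_list_part[of a] by (simp add: o_def part_def)
qed (rule u_add, rule u_scale)

end

section \<open>The grading by total weight\<close>

locale poly_graded = poly_dual p s y u for p s :: nat and y :: "nat \<Rightarrow> 'k::field"
    and u :: "('n::finite, 'k) mpoly \<Rightarrow> ('n, 'k) mpoly" +
  fixes wt :: "'n \<Rightarrow> nat"
  assumes wt_pos: "wt i > 0"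
begin

definition wdeg :: "('n \<Rightarrow>\<^sub>0 nat) \<Rightarrow> nat" where
  "wdeg m = (\<Sum>i\<in>UNIV. wt i * Poly_Mapping.lookup m i)"

lemma wdeg_add: "wdeg (m + m') = wdeg m + wdeg m'"
  by (simp add: wdeg_def lookup_add distrib_left sum.distrib)

lemma wdeg_0 [simp]: "wdeg 0 = 0"
  by (simp add: wdeg_def)

lemma wdeg_eq_0: "wdeg m = 0 \<Longrightarrow> m = 0"
proof (rule poly_mapping_eqI)
  fix i assume "wdeg m = 0"
  then have "wt i * Poly_Mapping.lookup m i = 0" by (simp add: wdeg_def)
  then show "Poly_Mapping.lookup m i = Poly_Mapping.lookup 0 i" using wt_pos[of i] by simp
qed

definition \<nu> :: nat where "\<nu> = (\<Sum>i\<in>UNIV. wt i)"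

definition component :: "nat \<Rightarrow> ('n, 'k) mpoly \<Rightarrow> ('n, 'k) mpoly" where
  "component d a = (\<Sum>m | m \<in> Poly_Mapping.keys a \<and> wdeg m = d. Poly_Mapping.single m (Poly_Mapping.lookup a m))"

lemma lookup_component: "Poly_Mapping.lookup (component d a) m = (if wdeg m = d then Poly_Mapping.lookup a m else 0)"
proof -
  have "Poly_Mapping.lookup (component d a) m =
      (\<Sum>m' | m' \<in> Poly_Mapping.keys a \<and> wdeg m' = d. if m' = m then Poly_Mapping.lookup a m else 0)"
    by (auto simp: component_def lookup_sum lookup_single when_def intro!: sum.cong)
  then show ?thesis by (simp add: sum.delta in_keys_iff)
qed

lemma component_0 [simp]: "component d 0 = 0"
  by (simp add: component_def)

lemma component_add: "component d (a + b) = component d a + component d b"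
  by (rule poly_mapping_eqI) (simp add: lookup_component lookup_add)

lemma component_sum: "component d (sum g A) = (\<Sum>x\<in>A. component d (g x))"
proof -
  have "component d 0 = 0" by (simp add: component_def)
  then show ?thesis
    by (induction A rule: infinite_finite_induct) (auto simp: component_add)
qed

lemma component_single:
  "component d (Poly_Mapping.single m c) = (if wdeg m = d then Poly_Mapping.single m c else 0)"
  by (rule poly_mapping_eqI) (auto simp: lookup_component lookup_single when_def)

lemma component_eq_iff: "component d a = a \<longleftrightarrow> (\<forall>m\<in>Poly_Mapping.keys a. wdeg m = d)"
proof
  assume a: "component d a = a"
  show "\<forall>m\<in>Poly_Mapping.keys a. wdeg m = d"
    using arg_cong[OF a, of "\<lambda>t. Poly_Mapping.lookup t _"] by (metis in_keys_iff lookup_component)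
next
  assume "\<forall>m\<in>Poly_Mapping.keys a. wdeg m = d"
  then show "component d a = a"
    by (intro poly_mapping_eqI) (auto simp: lookup_component in_keys_iff)
qed

lemma component_mult:
  assumes b: "component e b = b"
  shows "component (d + e) (a * b) = component d a * b"
proof (induction a rule: poly_mapping_single_induct)
  case (single m c)
  have "Poly_Mapping.single m c * b =
      (\<Sum>m'\<in>Poly_Mapping.keys b. Poly_Mapping.single (m + m') (c * Poly_Mapping.lookup b m'))"
    using arg_cong[OF poly_mapping_eq_sum_single[of b], of "\<lambda>t. Poly_Mapping.single m c * t"]
    by (simp add: sum_distrib_left mult_single)
  moreover have "component (d + e) (Poly_Mapping.single (m + m') (c * Poly_Mapping.lookup b m')) =
      (if wdeg m = d then Poly_Mapping.single (m + m') (c * Poly_Mapping.lookup b m') else 0)"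
    if "m' \<in> Poly_Mapping.keys b" for m'
    using b that unfolding component_eq_iff by (simp add: component_single wdeg_add)
  ultimately show ?case by (simp add: component_sum component_single)
next
  case zero
  show ?case by (simp add: component_def)
qed (simp add: component_add distrib_right)

lemma component_mult_low:
  assumes b: "component e b = b" and d: "d < e"
  shows "component d (a * b) = 0"
proof -
  have "wdeg m \<noteq> d" if "m \<in> Poly_Mapping.keys (a * b)" for m
  proof -
    from that obtain x z where "m = x + z" "z \<in> Poly_Mapping.keys b" using keys_mult[of a b] by blast
    then show ?thesis using b d unfolding component_eq_iff by (auto simp: wdeg_add)
  qed
  then show ?thesis by (intro poly_mapping_eqI) (auto simp: lookup_component in_keys_iff)
qed

lemma component_u: "component d (u a) = u (component (p * d + (p - 1) * \<nu>) a)"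
proof (induction a rule: poly_mapping_single_induct)
  case (single m c)
  define e where "e = Poly_Mapping.lookup m"
  have m: "m = expv e" by (simp add: e_def)
  obtain c' where c': "u (Poly_Mapping.single (expv e) c) = Poly_Mapping.single (expv (\<lambda>i. e i div p)) c'"
      "c' = 0 \<or> (\<forall>i. e i mod p = p - 1)" using u_single by blast
  show ?case
  proof (cases "c' = 0")
    case True
    then show ?thesis using c'(1) unfolding m by (simp add: component_single)
  next
    case False
    then have "e i = p * (e i div p) + (p - 1)" for i using c'(2) by (metis mult_div_mod_eq)
    then have "wdeg (expv e) = (\<Sum>i\<in>UNIV. wt i * (p * (e i div p) + (p - 1)))" by (simp add: wdeg_def)
    also have "\<dots> = p * wdeg (expv (\<lambda>i. e i div p)) + (p - 1) * \<nu>"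
      by (simp add: wdeg_def \<nu>_def distrib_left sum.distrib sum_distrib_left sum_distrib_right mult_ac)
    finally have "wdeg (expv (\<lambda>i. e i div p)) = d \<longleftrightarrow> wdeg (expv e) = p * d + (p - 1) * \<nu>"
      using p_char(2) by auto
    then show ?thesis unfolding m component_single c'(1) by (simp add: c'(1))
  qed
next
  case zero
  show ?case by (simp add: component_def)
qed (simp add: component_add u_add)

lemma component_mult_hom: "component d a = a \<Longrightarrow> component e b = b \<Longrightarrow> component (d + e) (a * b) = a * b"
  by (simp add: component_mult)

lemma component_1: "component 0 1 = 1"
  by (simp add: component_eq_iff)

lemma component_power_hom: "component d a = a \<Longrightarrow> component (n * d) (a ^ n) = a ^ n"
proof (induction n)
  case (Suc n)
  then show ?case using component_mult_hom[of d a "n * d" "a ^ n"] by simp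
qed (simp add: component_1)

lemma component_of_nat: "component 0 (of_nat n) = of_nat n"
  by (induction n) (auto simp: component_add component_1)

lemma component_cocyc:
  assumes "component d a = a" "component d b = b"
  shows "component (p * d) (cocyc p a b) = cocyc p a b"
  unfolding cocyc_def component_sum
proof (rule sum.cong)
  fix i assume i: "i \<in> {1..<p}"
  have "component (0 + i * d + (p - i) * d) (of_nat ((p choose i) div p) * a ^ i * b ^ (p - i)) =
      of_nat ((p choose i) div p) * a ^ i * b ^ (p - i)"
    by (intro component_mult_hom component_of_nat component_power_hom assms)
  moreover have "0 + i * d + (p - i) * d = p * d" using i by (simp flip: distrib_right)
  ultimately show "component (p * d) (of_nat ((p choose i) div p) * a ^ i * b ^ (p - i)) =
      of_nat ((p choose i) div p) * a ^ i * b ^ (p - i)" by simp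
qed simp

lemma component_Delta:
  assumes "component d a = a"
  shows "component (p * d) (Delta a) = Delta a"
proof -
  have part: "component d (part i a) = part i a" if "i \<in> IX" for i
    using assms keys_part[OF that, of a] by (auto simp: component_eq_iff)
  have "component d (\<Sum>i\<leftarrow>xs. part i a) = (\<Sum>i\<leftarrow>xs. part i a) \<and>
      component (p * d) (cocyc_list p (map (\<lambda>i. part i a) xs)) = cocyc_list p (map (\<lambda>i. part i a) xs)"
    if "set xs \<subseteq> IX" for xs
    using that
  proof (induction xs)
    case Nil
    show ?case by (simp add: component_def)
  qed (auto simp: component_add part component_cocyc)
  from this[of idx] show ?thesis by (simp add: Delta_def idx)
qed

sublocale graded_fdual p PM Delta u "map (\<lambda>a. (dv a, vv a)) idx" component \<nu>
proof
  fix d e :: nat and a b :: "('n, 'k) mpoly"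
  show "component d (component e a) = (if d = e then component d a else 0)"
    by (rule poly_mapping_eqI) (auto simp: lookup_component)
  show "\<exists>b. component 0 b = b \<and> a * b = 1" if "component 0 a = a" "a \<noteq> 0"
  proof -
    have "Poly_Mapping.keys a \<subseteq> {0}" using that(1) wdeg_eq_0 unfolding component_eq_iff by blast
    then have a: "a = Poly_Mapping.single 0 (Poly_Mapping.lookup a 0)"
      by (intro poly_mapping_eqI) (auto simp: lookup_single when_def in_keys_iff)
    then have "Poly_Mapping.lookup a 0 \<noteq> 0" using that(2) by (metis single_zero)
    then have "a * Poly_Mapping.single 0 (1 / Poly_Mapping.lookup a 0) = 1"
      by (subst a) (simp add: mult_single)
    moreover have "component 0 (Poly_Mapping.single 0 (1 / Poly_Mapping.lookup a 0)) = Poly_Mapping.single 0 (1 / Poly_Mapping.lookup a 0)"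
      by (simp add: component_single)
    ultimately show ?thesis by blast
  qed
qed (simp_all add: component_add component_mult component_mult_low component_u component_1 component_Delta)

end

section \<open>Polynomial rings are domains\<close>

text \<open>Renaming the variables by natural numbers is an injective ring homomorphism into a
  polynomial ring whose exponent vectors are linearly ordered, and which is a domain.\<close>

lemma mpoly_no_zero_divisors:
  fixes a b :: "('n::finite, 'k::field) mpoly"
  assumes "a * b = 0"
  shows "a = 0 \<or> b = 0"
proof -
  define ren :: "('n \<Rightarrow>\<^sub>0 nat) \<Rightarrow> (nat \<Rightarrow>\<^sub>0 nat)" where
    "ren m = (\<Sum>i\<in>UNIV. Poly_Mapping.single (to_nat i) (Poly_Mapping.lookup m i))" for m
  define \<phi> :: "('n, 'k) mpoly \<Rightarrow> (nat, 'k) mpoly" where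
    "\<phi> a = (\<Sum>m\<in>Poly_Mapping.keys a. Poly_Mapping.single (ren m) (Poly_Mapping.lookup a m))" for a
  have ren_add: "ren (m + m') = ren m + ren m'" for m m'
    by (simp add: ren_def lookup_add single_add sum.distrib)
  have lookup_ren: "Poly_Mapping.lookup (ren m) (to_nat i) = Poly_Mapping.lookup m i" for m i
    by (simp add: ren_def lookup_sum lookup_single when_def)
  have ren_inj: "ren m = ren m' \<Longrightarrow> m = m'" for m m'
    by (intro poly_mapping_eqI) (metis lookup_ren)
  have \<phi>_superset: "\<phi> a = (\<Sum>m\<in>A. Poly_Mapping.single (ren m) (Poly_Mapping.lookup a m))"
    if "finite A" "Poly_Mapping.keys a \<subseteq> A" for a A
    unfolding \<phi>_def using that by (intro sum.mono_neutral_left) (auto simp: in_keys_iff)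
  have \<phi>_add: "\<phi> (a + b) = \<phi> a + \<phi> b" for a b
  proof -
    let ?A = "Poly_Mapping.keys a \<union> Poly_Mapping.keys b"
    have A: "finite ?A" "Poly_Mapping.keys a \<subseteq> ?A" "Poly_Mapping.keys b \<subseteq> ?A"
      "Poly_Mapping.keys (a + b) \<subseteq> ?A" using keys_add[of a b] by auto
    show ?thesis
      unfolding \<phi>_superset[OF A(1,2)] \<phi>_superset[OF A(1,3)] \<phi>_superset[OF A(1,4)]
      by (simp add: lookup_add single_add sum.distrib)
  qed
  have \<phi>_single: "\<phi> (Poly_Mapping.single m c) = Poly_Mapping.single (ren m) c" for m c
    by (simp add: \<phi>_def)
  have \<phi>_0: "\<phi> 0 = 0" by (simp add: \<phi>_def)
  have \<phi>_mult: "\<phi> (a * b) = \<phi> a * \<phi> b" for a b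
  proof (induction a rule: poly_mapping_single_induct)
    case (single m c)
    show ?case
      by (induction b rule: poly_mapping_single_induct)
        (auto simp: \<phi>_single \<phi>_0 mult_single ren_add \<phi>_add distrib_left)
  qed (auto simp: \<phi>_0 \<phi>_add distrib_right)
  have \<phi>_inj: "a = 0" if "\<phi> a = 0" for a
  proof (rule poly_mapping_eqI)
    fix m
    have "Poly_Mapping.lookup (\<phi> a) (ren m) =
        (\<Sum>m'\<in>Poly_Mapping.keys a. if m' = m then Poly_Mapping.lookup a m else 0)"
      unfolding \<phi>_def lookup_sum by (rule sum.cong) (auto simp: lookup_single when_def dest: ren_inj)
    then show "Poly_Mapping.lookup a m = Poly_Mapping.lookup 0 m"
      using that by (simp add: sum.delta in_keys_iff split: if_splits)
  qed
  have "\<phi> a * \<phi> b = 0" using assms \<phi>_0 by (simp flip: \<phi>_mult)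
  then show ?thesis using \<phi>_inj by auto
qed

section \<open>Localizations and the structure sheaf\<close>

locale mult_set = cring R for R (structure) and M +
  assumes M_subset: "M \<subseteq> carrier R" and M_one [simp]: "\<one> \<in> M"
    and M_mult [simp]: "s \<in> M \<Longrightarrow> t \<in> M \<Longrightarrow> s \<otimes> t \<in> M"
begin

abbreviation "frct \<equiv> fraction R M"
abbreviation "L \<equiv> localization R M"

lemma M_closed [simp]: "s \<in> M \<Longrightarrow> s \<in> carrier R"
  using M_subset by blast

lemma frac_self: "a \<in> carrier R \<Longrightarrow> s \<in> M \<Longrightarrow> (a, s) \<in> frct a s"
  using M_one by (auto simp: fraction_def)

text \<open>Transitivity of the equivalence of fractions. Without cancellation the witness has to
  collect v, w and the denominator s.\<close>

lemma frac_trans: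
  assumes "a \<in> carrier R" "b \<in> carrier R" "c \<in> carrier R" "s \<in> M" "t \<in> M" "r \<in> M" "w \<in> M" "v \<in> M"
    "w \<otimes> (a \<otimes> r) = w \<otimes> (c \<otimes> s)" "v \<otimes> (a \<otimes> t) = v \<otimes> (b \<otimes> s)"
  shows "(v \<otimes> w \<otimes> s) \<otimes> (b \<otimes> r) = (v \<otimes> w \<otimes> s) \<otimes> (c \<otimes> t)"
proof -
  have "(v \<otimes> w \<otimes> s) \<otimes> (b \<otimes> r) = w \<otimes> r \<otimes> (v \<otimes> (b \<otimes> s))"
    using assms(1-8) by (simp add: m_ac)
  also have "\<dots> = w \<otimes> r \<otimes> (v \<otimes> (a \<otimes> t))" by (simp only: assms(10))
  also have "\<dots> = v \<otimes> t \<otimes> (w \<otimes> (a \<otimes> r))"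
    using assms(1-8) by (simp add: m_ac)
  also have "\<dots> = v \<otimes> t \<otimes> (w \<otimes> (c \<otimes> s))" by (simp only: assms(9))
  also have "\<dots> = (v \<otimes> w \<otimes> s) \<otimes> (c \<otimes> t)"
    using assms(1-8) by (simp add: m_ac)
  finally show ?thesis .
qed

lemma frac_eq_iff:
  assumes "a \<in> carrier R" "b \<in> carrier R" "s \<in> M" "t \<in> M"
  shows "frct a s = frct b t \<longleftrightarrow> (\<exists>w\<in>M. w \<otimes> (a \<otimes> t) = w \<otimes> (b \<otimes> s))"
proof
  assume "frct a s = frct b t"
  then have "(b, t) \<in> frct a s" using frac_self[OF assms(2,4)] by simp
  then show "\<exists>w\<in>M. w \<otimes> (a \<otimes> t) = w \<otimes> (b \<otimes> s)" by (auto simp: fraction_def)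
next
  have sub: "frct a s \<subseteq> frct b t"
    if "a \<in> carrier R" "b \<in> carrier R" "s \<in> M" "t \<in> M" "v \<in> M" "v \<otimes> (a \<otimes> t) = v \<otimes> (b \<otimes> s)" for a b s t v
  proof
    fix x assume "x \<in> frct a s"
    then obtain c r w where x: "x = (c, r)" "c \<in> carrier R" "r \<in> M" "w \<in> M" "w \<otimes> (a \<otimes> r) = w \<otimes> (c \<otimes> s)"
      by (auto simp: fraction_def)
    have "(v \<otimes> w \<otimes> s) \<otimes> (b \<otimes> r) = (v \<otimes> w \<otimes> s) \<otimes> (c \<otimes> t)"
      by (rule frac_trans[OF that(1,2) x(2) that(3,4) x(3,4) that(5) x(5) that(6)])
    moreover have "v \<otimes> w \<otimes> s \<in> M" using x that by (intro M_mult)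
    ultimately show "x \<in> frct b t" using x by (auto simp: fraction_def)
  qed
  assume "\<exists>w\<in>M. w \<otimes> (a \<otimes> t) = w \<otimes> (b \<otimes> s)"
  then obtain w where w: "w \<in> M" "w \<otimes> (a \<otimes> t) = w \<otimes> (b \<otimes> s)" by blast
  show "frct a s = frct b t"
    using sub[OF assms w] sub[OF assms(2,1,4,3) w(1) w(2)[symmetric]] by blast
qed

lemma frac_eqI:
  assumes "a \<in> carrier R" "b \<in> carrier R" "s \<in> M" "t \<in> M" "a \<otimes> t = b \<otimes> s"
  shows "frct a s = frct b t"
  using assms M_one frac_eq_iff by auto

lemma frac_closed: "a \<in> carrier R \<Longrightarrow> s \<in> M \<Longrightarrow> frct a s \<in> carrier L"
  by (auto simp: localization_def)

lemma frac_cases: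
  assumes "x \<in> carrier L"
  obtains a s where "x = frct a s" "a \<in> carrier R" "s \<in> M"
  using assms by (auto simp: localization_def)

lemma frac_mult:
  assumes "a \<in> carrier R" "b \<in> carrier R" "s \<in> M" "t \<in> M"
  shows "frct a s \<otimes>\<^bsub>L\<^esub> frct b t = frct (a \<otimes> b) (s \<otimes> t)"
proof -
  have "frct (a' \<otimes> b') (s' \<otimes> t') = frct (a \<otimes> b) (s \<otimes> t)"
    if as: "(a', s') \<in> frct a s" and bt: "(b', t') \<in> frct b t" for a' s' b' t'
  proof -
    from as obtain w where w: "a' \<in> carrier R" "s' \<in> M" "w \<in> M" "w \<otimes> (a \<otimes> s') = w \<otimes> (a' \<otimes> s)"
      by (auto simp: fraction_def)
    from bt obtain v where v: "b' \<in> carrier R" "t' \<in> M" "v \<in> M" "v \<otimes> (b \<otimes> t') = v \<otimes> (b' \<otimes> t)"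
      by (auto simp: fraction_def)
    have "(w \<otimes> v) \<otimes> (a' \<otimes> b' \<otimes> (s \<otimes> t)) = (w \<otimes> (a' \<otimes> s)) \<otimes> (v \<otimes> (b' \<otimes> t))"
      using assms w(1-3) v(1-3) by (simp add: m_ac)
    also have "\<dots> = (w \<otimes> (a \<otimes> s')) \<otimes> (v \<otimes> (b \<otimes> t'))" by (simp only: w(4) v(4))
    also have "\<dots> = (w \<otimes> v) \<otimes> (a \<otimes> b \<otimes> (s' \<otimes> t'))"
      using assms w(1-3) v(1-3) by (simp add: m_ac)
    finally show ?thesis using assms w(1-3) v(1-3) by (subst frac_eq_iff) (auto intro: M_mult)
  qed
  then have "(\<Union>(a', s')\<in>frct a s. \<Union>(b', t')\<in>frct b t. frct (a' \<otimes> b') (s' \<otimes> t')) = frct (a \<otimes> b) (s \<otimes> t)"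
    using frac_self[OF assms(1,3)] frac_self[OF assms(2,4)] by blast
  then show ?thesis by (simp add: localization_def)
qed

lemma frac_add:
  assumes "a \<in> carrier R" "b \<in> carrier R" "s \<in> M" "t \<in> M"
  shows "frct a s \<oplus>\<^bsub>L\<^esub> frct b t = frct (a \<otimes> t \<oplus> b \<otimes> s) (s \<otimes> t)"
proof -
  have "frct (a' \<otimes> t' \<oplus> b' \<otimes> s') (s' \<otimes> t') = frct (a \<otimes> t \<oplus> b \<otimes> s) (s \<otimes> t)"
    if as: "(a', s') \<in> frct a s" and bt: "(b', t') \<in> frct b t" for a' s' b' t'
  proof -
    from as obtain w where w: "a' \<in> carrier R" "s' \<in> M" "w \<in> M" "w \<otimes> (a \<otimes> s') = w \<otimes> (a' \<otimes> s)"
      by (auto simp: fraction_def)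
    from bt obtain v where v: "b' \<in> carrier R" "t' \<in> M" "v \<in> M" "v \<otimes> (b \<otimes> t') = v \<otimes> (b' \<otimes> t)"
      by (auto simp: fraction_def)
    have "(w \<otimes> v) \<otimes> ((a' \<otimes> t' \<oplus> b' \<otimes> s') \<otimes> (s \<otimes> t)) =
        (w \<otimes> (a' \<otimes> s)) \<otimes> (v \<otimes> t' \<otimes> t) \<oplus> (v \<otimes> (b' \<otimes> t)) \<otimes> (w \<otimes> s' \<otimes> s)"
      using assms w(1-3) v(1-3) by (simp add: m_ac l_distr r_distr)
    also have "\<dots> = (w \<otimes> (a \<otimes> s')) \<otimes> (v \<otimes> t' \<otimes> t) \<oplus> (v \<otimes> (b \<otimes> t')) \<otimes> (w \<otimes> s' \<otimes> s)"
      by (simp only: w(4) v(4))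
    also have "\<dots> = (w \<otimes> v) \<otimes> ((a \<otimes> t \<oplus> b \<otimes> s) \<otimes> (s' \<otimes> t'))"
      using assms w(1-3) v(1-3) by (simp add: m_ac l_distr r_distr)
    finally show ?thesis using assms w(1-3) v(1-3) by (subst frac_eq_iff) (auto intro: M_mult)
  qed
  then have "(\<Union>(a', s')\<in>frct a s. \<Union>(b', t')\<in>frct b t. frct (a' \<otimes> t' \<oplus> b' \<otimes> s') (s' \<otimes> t')) =
      frct (a \<otimes> t \<oplus> b \<otimes> s) (s \<otimes> t)"
    using frac_self[OF assms(1,3)] frac_self[OF assms(2,4)] by blast
  then show ?thesis by (simp add: localization_def)
qed

lemma L_zero: "\<zero>\<^bsub>L\<^esub> = frct \<zero> \<one>" and L_one: "\<one>\<^bsub>L\<^esub> = frct \<one> \<one>"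
  by (simp_all add: localization_def)

lemma frac_zero: "s \<in> M \<Longrightarrow> frct \<zero> s = \<zero>\<^bsub>L\<^esub>"
  using M_one by (simp add: L_zero frac_eqI)

lemma cring_L: "cring L"
proof (rule cringI)
  show "abelian_group L"
  proof (rule abelian_groupI)
    fix x y assume x: "x \<in> carrier L" and y: "y \<in> carrier L"
    obtain a s where a: "x = frct a s" "a \<in> carrier R" "s \<in> M" using x by (rule frac_cases)
    obtain b t where b: "y = frct b t" "b \<in> carrier R" "t \<in> M" using y by (rule frac_cases)
    show "x \<oplus>\<^bsub>L\<^esub> y \<in> carrier L"
      unfolding a(1) b(1) by (simp add: a(2,3) b(2,3) frac_add frac_closed)
    show "x \<oplus>\<^bsub>L\<^esub> y = y \<oplus>\<^bsub>L\<^esub> x"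
      unfolding a(1) b(1) by (simp add: a(2,3) b(2,3) frac_add frac_eqI m_ac a_ac)
    fix z assume "z \<in> carrier L"
    then obtain c r where c: "z = frct c r" "c \<in> carrier R" "r \<in> M" by (rule frac_cases)
    show "x \<oplus>\<^bsub>L\<^esub> y \<oplus>\<^bsub>L\<^esub> z = x \<oplus>\<^bsub>L\<^esub> (y \<oplus>\<^bsub>L\<^esub> z)"
      unfolding a(1) b(1) c(1) by (simp add: a(2,3) b(2,3) c(2,3) frac_add frac_eqI m_ac a_ac l_distr r_distr)
  next
    show "\<zero>\<^bsub>L\<^esub> \<in> carrier L" by (simp add: L_zero frac_closed)
    fix x assume x: "x \<in> carrier L"
    obtain a s where a: "x = frct a s" "a \<in> carrier R" "s \<in> M" using x by (rule frac_cases)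
    show "\<zero>\<^bsub>L\<^esub> \<oplus>\<^bsub>L\<^esub> x = x"
      unfolding a(1) L_zero by (simp add: a(2,3) frac_add frac_eqI)
    show "\<exists>y\<in>carrier L. y \<oplus>\<^bsub>L\<^esub> x = \<zero>\<^bsub>L\<^esub>"
    proof
      show "frct (\<ominus> a) s \<in> carrier L" using a by (simp add: frac_closed)
      have "\<ominus> a \<otimes> s \<oplus> a \<otimes> s = \<zero>" using a(2,3) by (simp add: l_minus l_neg)
      then show "frct (\<ominus> a) s \<oplus>\<^bsub>L\<^esub> x = \<zero>\<^bsub>L\<^esub>"
        unfolding a(1) by (simp add: a(2,3) frac_add frac_zero)
    qed
  qed
  show "comm_monoid L"
  proof (rule comm_monoidI)
    show "\<one>\<^bsub>L\<^esub> \<in> carrier L" by (simp add: L_one frac_closed)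
    fix x y assume x: "x \<in> carrier L" and y: "y \<in> carrier L"
    obtain a s where a: "x = frct a s" "a \<in> carrier R" "s \<in> M" using x by (rule frac_cases)
    obtain b t where b: "y = frct b t" "b \<in> carrier R" "t \<in> M" using y by (rule frac_cases)
    show "x \<otimes>\<^bsub>L\<^esub> y \<in> carrier L"
      unfolding a(1) b(1) by (simp add: a(2,3) b(2,3) frac_mult frac_closed)
    show "x \<otimes>\<^bsub>L\<^esub> y = y \<otimes>\<^bsub>L\<^esub> x"
      unfolding a(1) b(1) by (simp add: a(2,3) b(2,3) frac_mult frac_eqI m_ac)
    show "\<one>\<^bsub>L\<^esub> \<otimes>\<^bsub>L\<^esub> x = x"
      unfolding a(1) L_one by (simp add: a(2,3) frac_mult frac_eqI)
    fix z assume "z \<in> carrier L"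
    then obtain c r where c: "z = frct c r" "c \<in> carrier R" "r \<in> M" by (rule frac_cases)
    show "x \<otimes>\<^bsub>L\<^esub> y \<otimes>\<^bsub>L\<^esub> z = x \<otimes>\<^bsub>L\<^esub> (y \<otimes>\<^bsub>L\<^esub> z)"
      unfolding a(1) b(1) c(1) by (simp add: a(2,3) b(2,3) c(2,3) frac_mult frac_eqI m_ac)
  qed
  fix x y z assume x: "x \<in> carrier L" and y: "y \<in> carrier L" and z: "z \<in> carrier L"
  obtain a s where a: "x = frct a s" "a \<in> carrier R" "s \<in> M" using x by (rule frac_cases)
  obtain b t where b: "y = frct b t" "b \<in> carrier R" "t \<in> M" using y by (rule frac_cases)
  obtain c r where c: "z = frct c r" "c \<in> carrier R" "r \<in> M" using z by (rule frac_cases)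
  show "(x \<oplus>\<^bsub>L\<^esub> y) \<otimes>\<^bsub>L\<^esub> z = x \<otimes>\<^bsub>L\<^esub> z \<oplus>\<^bsub>L\<^esub> y \<otimes>\<^bsub>L\<^esub> z"
    unfolding a(1) b(1) c(1) by (simp add: a(2,3) b(2,3) c(2,3) frac_mult frac_add frac_eqI m_ac a_ac l_distr r_distr)
qed

lemma frac_hom: "(\<lambda>a. frct a \<one>) \<in> ring_hom R L"
  by (intro ring_hom_memI) (auto simp: frac_closed frac_mult frac_add L_one)

text \<open>Division by a denominator: an element is recognized as a fraction after the denominator
  has been cleared.\<close>

lemma frac_solve:
  assumes "y \<in> carrier L" "t \<in> M" "a \<in> carrier R" "frct t \<one> \<otimes>\<^bsub>L\<^esub> y = frct a \<one>"
  shows "y = frct a t"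
proof -
  obtain b s where b: "y = frct b s" "b \<in> carrier R" "s \<in> M" using assms(1) by (rule frac_cases)
  have "frct (t \<otimes> b) s = frct a \<one>"
    using assms(4) b(2,3) assms(2) M_one unfolding b(1) by (simp add: frac_mult)
  then obtain w where "w \<in> M" "w \<otimes> (t \<otimes> b) = w \<otimes> (a \<otimes> s)"
    using b(2,3) assms(2,3) M_one by (auto simp: frac_eq_iff)
  then show ?thesis unfolding b(1) using b(2,3) assms(2,3)
    by (subst frac_eq_iff) (auto simp: m_comm intro!: bexI[of _ w])
qed

end

section \<open>Sections of the structure sheaf\<close>

context cring
begin

lemma mult_set_prime: "primeideal P R \<Longrightarrow> mult_set R (carrier R - P)"
proof -
  assume "primeideal P R"
  then interpret P: primeideal P R .
  have "\<one> \<notin> P" using P.I_notcarr P.one_imp_carrier by blast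
  then show ?thesis
    by unfold_locales (use P.I_prime in auto)
qed

lemma zariski_open_basic:
  assumes "V \<in> zariski_opens R" "P \<in> V"
  shows "\<exists>g\<in>carrier R. g \<notin> P \<and> (\<forall>Q\<in>Spec R. g \<notin> Q \<longrightarrow> Q \<in> V)"
  using assms by (auto simp: zariski_opens_def)

lemma basic_open: "g \<in> carrier R \<Longrightarrow> {Q \<in> Spec R. g \<notin> Q} \<in> zariski_opens R"
  by (auto simp: zariski_opens_def intro!: exI[of _ "{g}"])

lemma open_subset_Spec: "U \<in> zariski_opens R \<Longrightarrow> U \<subseteq> Spec R"
  by (auto simp: zariski_opens_def)

lemma Spec_open: "Spec R \<in> zariski_opens R"
proof -
  have "{Q \<in> Spec R. \<one> \<notin> Q} = Spec R"
    using mult_set.M_one[OF mult_set_prime] by (auto simp: Spec_def)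
  then show ?thesis using basic_open[of \<one>] by simp
qed

lemma section_local:
  assumes \<xi>: "\<xi> \<in> spec_sections R U" and P: "P \<in> U"
  shows "\<exists>g\<in>carrier R. \<exists>a\<in>carrier R. \<exists>s\<in>carrier R. g \<notin> P \<and>
    (\<forall>Q\<in>Spec R. g \<notin> Q \<longrightarrow> Q \<in> U \<and> s \<notin> Q \<and> \<xi> Q = fraction R (carrier R - Q) a s)"
proof -
  obtain V a s where V: "V \<in> zariski_opens R" "P \<in> V" "V \<subseteq> U" "a \<in> carrier R" "s \<in> carrier R"
      "\<And>Q. Q \<in> V \<Longrightarrow> s \<notin> Q \<and> \<xi> Q = fraction R (carrier R - Q) a s"
    using \<xi> P by (auto simp: spec_sections_def)
  obtain g where g: "g \<in> carrier R" "g \<notin> P" "\<forall>Q\<in>Spec R. g \<notin> Q \<longrightarrow> Q \<in> V"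
    using zariski_open_basic[OF V(1,2)] by blast
  have "\<forall>Q\<in>Spec R. g \<notin> Q \<longrightarrow> Q \<in> U \<and> s \<notin> Q \<and> \<xi> Q = fraction R (carrier R - Q) a s"
    using V(3,6) g(3) by blast
  then show ?thesis using V(4,5) g(1,2) by blast
qed

lemma section_value: "\<xi> \<in> spec_sections R U \<Longrightarrow> P \<in> U \<Longrightarrow> \<xi> P \<in> carrier (localization R (carrier R - P))"
  unfolding spec_sections_def by (blast dest: PiE_mem)

lemma section_extensional: "\<xi> \<in> spec_sections R U \<Longrightarrow> \<xi> \<in> extensional U"
  unfolding spec_sections_def PiE_def by blast

lemma section_eqI:
  "\<xi> \<in> spec_sections R U \<Longrightarrow> \<eta> \<in> spec_sections R U \<Longrightarrow> (\<And>P. P \<in> U \<Longrightarrow> \<xi> P = \<eta> P) \<Longrightarrow> \<xi> = \<eta>"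
  by (rule extensionalityI[OF section_extensional section_extensional])

lemma prime_mult_notin: "Q \<in> Spec R \<Longrightarrow> a \<in> carrier R \<Longrightarrow> b \<in> carrier R \<Longrightarrow> a \<otimes> b \<notin> Q \<longleftrightarrow> a \<notin> Q \<and> b \<notin> Q"
proof -
  assume Q: "Q \<in> Spec R" and ab: "a \<in> carrier R" "b \<in> carrier R"
  interpret Q: primeideal Q R using Q by (simp add: Spec_def)
  show ?thesis using ab Q.I_prime Q.I_l_closed Q.I_r_closed by blast
qed

text \<open>It suffices to give fractions on the points of U where some g does not vanish: the basic
  open set of h g, with the basic open set of h inside U, is then a neighbourhood as required by the
  definition.\<close>

lemma sectionI:
  assumes U: "U \<in> zariski_opens R"
    and loc: "\<And>P. P \<in> U \<Longrightarrow> \<exists>g\<in>carrier R. g \<notin> P \<and> (\<exists>a\<in>carrier R. \<exists>s\<in>carrier R.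
       \<forall>Q\<in>U. g \<notin> Q \<longrightarrow> s \<notin> Q \<and> \<xi> Q = fraction R (carrier R - Q) a s)"
  shows "restrict \<xi> U \<in> spec_sections R U"
proof -
  have main: "\<xi> P \<in> carrier (localization R (carrier R - P)) \<and>
      (\<exists>V\<in>zariski_opens R. P \<in> V \<and> V \<subseteq> U \<and> (\<exists>a\<in>carrier R. \<exists>s\<in>carrier R.
        \<forall>Q\<in>V. s \<notin> Q \<and> restrict \<xi> U Q = fraction R (carrier R - Q) a s))" if P: "P \<in> U" for P
  proof -
    obtain g a s where g: "g \<in> carrier R" "g \<notin> P" "a \<in> carrier R" "s \<in> carrier R"
        "\<forall>Q\<in>U. g \<notin> Q \<longrightarrow> s \<notin> Q \<and> \<xi> Q = fraction R (carrier R - Q) a s"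
      using loc[OF P] by blast
    have PS: "P \<in> Spec R" using U P open_subset_Spec by blast
    then have "primeideal P R" by (simp add: Spec_def)
    then interpret mult_set R "carrier R - P" by (rule mult_set_prime)
    have 1: "\<xi> P \<in> carrier (localization R (carrier R - P))"
      using g P frac_closed[of a s] by simp
    obtain h where h: "h \<in> carrier R" "h \<notin> P" "\<forall>Q\<in>Spec R. h \<notin> Q \<longrightarrow> Q \<in> U"
      using zariski_open_basic[OF U P] by blast
    let ?V = "{Q \<in> Spec R. h \<otimes> g \<notin> Q}"
    have hg: "h \<notin> Q \<and> g \<notin> Q" if "Q \<in> ?V" for Q
      using that prime_mult_notin[of Q h g] h g by simp
    have PV: "P \<in> ?V" using prime_mult_notin[OF PS h(1) g(1)] h g PS by simp
    have V: "?V \<in> zariski_opens R" using h g by (intro basic_open) simp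
    have sub: "?V \<subseteq> U"
    proof
      fix Q assume "Q \<in> ?V"
      then show "Q \<in> U" using h(3) hg[of Q] by simp
    qed
    have eq: "\<forall>Q\<in>?V. s \<notin> Q \<and> restrict \<xi> U Q = fraction R (carrier R - Q) a s"
    proof
      fix Q assume Q: "Q \<in> ?V"
      then have "Q \<in> U" using sub by (rule subsetD[rotated])
      then show "s \<notin> Q \<and> restrict \<xi> U Q = fraction R (carrier R - Q) a s"
        using g(5) hg[OF Q] by simp
    qed
    show ?thesis
      by (intro conjI 1 bexI[of _ ?V] PV sub V bexI[of _ a] bexI[of _ s] eq g(3,4))
  qed
  show ?thesis
    unfolding spec_sections_def
  proof (intro CollectI conjI PiE_I ballI)
    fix P assume "P \<in> U"
    from main[OF this] show "restrict \<xi> U P \<in> carrier (localization R (carrier R - P))"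
      using \<open>P \<in> U\<close> by simp
  next
    fix P assume "P \<in> U"
    from main[OF this] show "\<exists>V\<in>zariski_opens R. P \<in> V \<and> V \<subseteq> U \<and> (\<exists>a\<in>carrier R. \<exists>s\<in>carrier R.
        \<forall>Q\<in>V. s \<notin> Q \<and> restrict \<xi> U Q = fraction R (carrier R - Q) a s)"
      by (rule conjunct2)
  qed simp
qed

lemma constant_section:
  assumes U: "U \<in> zariski_opens R" and a: "a \<in> carrier R"
  shows "(\<lambda>P\<in>U. fraction R (carrier R - P) a \<one>) \<in> spec_sections R U"
proof (rule sectionI[OF U])
  fix P assume "P \<in> U"
  have one: "\<one> \<notin> Q" if "Q \<in> U" for Q
    using that U open_subset_Spec mult_set.M_one[OF mult_set_prime] by (auto simp: Spec_def)
  show "\<exists>g\<in>carrier R. g \<notin> P \<and> (\<exists>a'\<in>carrier R. \<exists>s\<in>carrier R.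
      \<forall>Q\<in>U. g \<notin> Q \<longrightarrow> s \<notin> Q \<and> fraction R (carrier R - Q) a \<one> = fraction R (carrier R - Q) a' s)"
  proof (rule bexI[OF conjI one_closed])
    show "\<exists>a'\<in>carrier R. \<exists>s\<in>carrier R.
      \<forall>Q\<in>U. \<one> \<notin> Q \<longrightarrow> s \<notin> Q \<and> fraction R (carrier R - Q) a \<one> = fraction R (carrier R - Q) a' s"
      by (rule bexI[OF _ a], rule bexI[OF _ one_closed]) simp
  qed (rule one[OF \<open>P \<in> U\<close>])
qed

text \<open>Sum and product are treated at once: an operation with a formula for the numerator and
  the product of the denominators preserves local fractions.\<close>

lemma section_binop:
  assumes U: "U \<in> zariski_opens R" and \<xi>: "\<xi> \<in> spec_sections R U" and \<eta>: "\<eta> \<in> spec_sections R U"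
    and f_closed: "\<And>a s b t. a \<in> carrier R \<Longrightarrow> s \<in> carrier R \<Longrightarrow> b \<in> carrier R \<Longrightarrow> t \<in> carrier R \<Longrightarrow> f a s b t \<in> carrier R"
    and op: "\<And>Q a s b t. Q \<in> Spec R \<Longrightarrow> a \<in> carrier R \<Longrightarrow> b \<in> carrier R \<Longrightarrow> s \<in> carrier R - Q \<Longrightarrow> t \<in> carrier R - Q \<Longrightarrow>
      opn Q (fraction R (carrier R - Q) a s) (fraction R (carrier R - Q) b t) = fraction R (carrier R - Q) (f a s b t) (s \<otimes> t)"
  shows "(\<lambda>P\<in>U. opn P (\<xi> P) (\<eta> P)) \<in> spec_sections R U"
proof (rule sectionI[OF U])
  fix P assume P: "P \<in> U"
  obtain g a s where g: "g \<in> carrier R" "a \<in> carrier R" "s \<in> carrier R" "g \<notin> P"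
    "\<forall>Q\<in>Spec R. g \<notin> Q \<longrightarrow> Q \<in> U \<and> s \<notin> Q \<and> \<xi> Q = fraction R (carrier R - Q) a s"
    using section_local[OF \<xi> P] by blast
  obtain h b t where h: "h \<in> carrier R" "b \<in> carrier R" "t \<in> carrier R" "h \<notin> P"
    "\<forall>Q\<in>Spec R. h \<notin> Q \<longrightarrow> Q \<in> U \<and> t \<notin> Q \<and> \<eta> Q = fraction R (carrier R - Q) b t"
    using section_local[OF \<eta> P] by blast
  have S: "Q \<in> Spec R" if "Q \<in> U" for Q using that U open_subset_Spec by blast
  have gP: "g \<otimes> h \<notin> P" using prime_mult_notin[OF S[OF P] g(1) h(1)] g(4) h(4) by simp
  have gh: "g \<otimes> h \<in> carrier R" "f a s b t \<in> carrier R" "s \<otimes> t \<in> carrier R"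
    using g h f_closed by auto
  have eq: "\<forall>Q\<in>U. g \<otimes> h \<notin> Q \<longrightarrow> s \<otimes> t \<notin> Q \<and>
      opn Q (\<xi> Q) (\<eta> Q) = fraction R (carrier R - Q) (f a s b t) (s \<otimes> t)"
  proof (intro ballI impI)
    fix Q assume Q: "Q \<in> U" "g \<otimes> h \<notin> Q"
    note QS = S[OF Q(1)]
    have gh: "g \<notin> Q" "h \<notin> Q" using prime_mult_notin[OF QS g(1) h(1)] Q(2) by auto
    have \<xi>Q: "s \<notin> Q" "\<xi> Q = fraction R (carrier R - Q) a s" using g(5) QS gh by auto
    have \<eta>Q: "t \<notin> Q" "\<eta> Q = fraction R (carrier R - Q) b t" using h(5) QS gh by auto
    show "s \<otimes> t \<notin> Q \<and> opn Q (\<xi> Q) (\<eta> Q) = fraction R (carrier R - Q) (f a s b t) (s \<otimes> t)"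
      unfolding \<xi>Q(2) \<eta>Q(2) using op[OF QS g(2) h(2)] g(3) h(3) \<xi>Q(1) \<eta>Q(1) prime_mult_notin[OF QS g(3) h(3)] by simp
  qed
  show "\<exists>g\<in>carrier R. g \<notin> P \<and> (\<exists>a\<in>carrier R. \<exists>s\<in>carrier R.
      \<forall>Q\<in>U. g \<notin> Q \<longrightarrow> s \<notin> Q \<and> opn Q (\<xi> Q) (\<eta> Q) = fraction R (carrier R - Q) a s)"
    by (rule bexI[OF conjI gh(1)], rule gP, rule bexI[OF _ gh(2)], rule bexI[OF _ gh(3)], rule eq)
qed

lemma sheaf_simps:
  "carrier (spec_sheaf R U) = spec_sections R U"
  "P \<in> U \<Longrightarrow> (\<xi> \<otimes>\<^bsub>spec_sheaf R U\<^esub> \<eta>) P = \<xi> P \<otimes>\<^bsub>localization R (carrier R - P)\<^esub> \<eta> P"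
  "P \<in> U \<Longrightarrow> (\<xi> \<oplus>\<^bsub>spec_sheaf R U\<^esub> \<eta>) P = \<xi> P \<oplus>\<^bsub>localization R (carrier R - P)\<^esub> \<eta> P"
  "P \<in> U \<Longrightarrow> \<one>\<^bsub>spec_sheaf R U\<^esub> P = \<one>\<^bsub>localization R (carrier R - P)\<^esub>"
  "P \<in> U \<Longrightarrow> \<zero>\<^bsub>spec_sheaf R U\<^esub> P = \<zero>\<^bsub>localization R (carrier R - P)\<^esub>"
  by (simp_all add: spec_sheaf_def)

lemma cring_stalk: "U \<in> zariski_opens R \<Longrightarrow> P \<in> U \<Longrightarrow> cring (localization R (carrier R - P))"
  using open_subset_Spec mult_set.cring_L[OF mult_set_prime] by (auto simp: Spec_def)

lemma sheaf_add_closed: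
  assumes "U \<in> zariski_opens R" "\<xi> \<in> spec_sections R U" "\<eta> \<in> spec_sections R U"
  shows "\<xi> \<oplus>\<^bsub>spec_sheaf R U\<^esub> \<eta> \<in> spec_sections R U"
proof -
  have "(\<lambda>P\<in>U. \<xi> P \<oplus>\<^bsub>localization R (carrier R - P)\<^esub> \<eta> P) \<in> spec_sections R U"
    by (rule section_binop[OF assms, where f = "\<lambda>a s b t. a \<otimes> t \<oplus> b \<otimes> s"])
      (auto simp: Spec_def mult_set.frac_add[OF mult_set_prime])
  then show ?thesis by (simp add: spec_sheaf_def)
qed

lemma sheaf_mult_closed:
  assumes "U \<in> zariski_opens R" "\<xi> \<in> spec_sections R U" "\<eta> \<in> spec_sections R U"
  shows "\<xi> \<otimes>\<^bsub>spec_sheaf R U\<^esub> \<eta> \<in> spec_sections R U"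
proof -
  have "(\<lambda>P\<in>U. \<xi> P \<otimes>\<^bsub>localization R (carrier R - P)\<^esub> \<eta> P) \<in> spec_sections R U"
    by (rule section_binop[OF assms, where f = "\<lambda>a s b t. a \<otimes> b"])
      (auto simp: Spec_def mult_set.frac_mult[OF mult_set_prime])
  then show ?thesis by (simp add: spec_sheaf_def)
qed

lemma cring_sheaf:
  assumes U: "U \<in> zariski_opens R"
  shows "cring (spec_sheaf R U)"
proof -
  note st = cring_stalk[OF U]
  have st2: "monoid (localization R (carrier R - P))" "abelian_group (localization R (carrier R - P))"
    "abelian_monoid (localization R (carrier R - P))" "ring (localization R (carrier R - P))"
    "comm_monoid (localization R (carrier R - P))" "semiring (localization R (carrier R - P))" if "P \<in> U" for P
  proof -
    interpret st: cring "localization R (carrier R - P)" by (rule st[OF that])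
    show "monoid (localization R (carrier R - P))" "abelian_group (localization R (carrier R - P))"
      "abelian_monoid (localization R (carrier R - P))" "ring (localization R (carrier R - P))"
      "comm_monoid (localization R (carrier R - P))" "semiring (localization R (carrier R - P))"
      by unfold_locales
  qed
  have one: "\<one>\<^bsub>spec_sheaf R U\<^esub> \<in> spec_sections R U" and zero: "\<zero>\<^bsub>spec_sheaf R U\<^esub> \<in> spec_sections R U"
    using constant_section[OF U, of \<one>] constant_section[OF U, of \<zero>]
    by (simp_all add: spec_sheaf_def localization_def)
  note cl = sheaf_add_closed[OF U] sheaf_mult_closed[OF U] one zero section_value[where U = U]
  show ?thesis
  proof (rule cringI)
    show "abelian_group (spec_sheaf R U)"
    proof (rule abelian_groupI, unfold sheaf_simps(1))
      fix x y assume x: "x \<in> spec_sections R U" and y: "y \<in> spec_sections R U"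
      show "x \<oplus>\<^bsub>spec_sheaf R U\<^esub> y \<in> spec_sections R U" using x y by (rule cl)
      show "x \<oplus>\<^bsub>spec_sheaf R U\<^esub> y = y \<oplus>\<^bsub>spec_sheaf R U\<^esub> x"
        by (rule section_eqI[where U = U]) (simp_all add: sheaf_simps x y cl abelian_monoid.a_comm[OF st2(3)])
      fix z assume z: "z \<in> spec_sections R U"
      show "x \<oplus>\<^bsub>spec_sheaf R U\<^esub> y \<oplus>\<^bsub>spec_sheaf R U\<^esub> z = x \<oplus>\<^bsub>spec_sheaf R U\<^esub> (y \<oplus>\<^bsub>spec_sheaf R U\<^esub> z)"
        by (rule section_eqI[where U = U]) (simp_all add: sheaf_simps x y z cl abelian_monoid.a_assoc[OF st2(3)])
    next
      show "\<zero>\<^bsub>spec_sheaf R U\<^esub> \<in> spec_sections R U" by (rule zero)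
      fix x assume x: "x \<in> spec_sections R U"
      show "\<zero>\<^bsub>spec_sheaf R U\<^esub> \<oplus>\<^bsub>spec_sheaf R U\<^esub> x = x"
        by (rule section_eqI[where U = U]) (simp_all add: sheaf_simps x cl abelian_monoid.l_zero[OF st2(3)])
      \<comment> \<open>The negative of a section is its product with the constant section -1, so
        closure under products already provides it.\<close>
      define m where "m = (\<lambda>P\<in>U. fraction R (carrier R - P) (\<ominus> \<one>) \<one>)"
      have m: "m \<in> spec_sections R U" unfolding m_def by (rule constant_section[OF U]) simp
      show "\<exists>y\<in>spec_sections R U. y \<oplus>\<^bsub>spec_sheaf R U\<^esub> x = \<zero>\<^bsub>spec_sheaf R U\<^esub>"
      proof
        show mx: "m \<otimes>\<^bsub>spec_sheaf R U\<^esub> x \<in> spec_sections R U" using m x by (rule cl)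
        show "m \<otimes>\<^bsub>spec_sheaf R U\<^esub> x \<oplus>\<^bsub>spec_sheaf R U\<^esub> x = \<zero>\<^bsub>spec_sheaf R U\<^esub>"
        proof (rule section_eqI[where U = U])
          fix P assume P: "P \<in> U"
          then have "primeideal P R" using U open_subset_Spec by (auto simp: Spec_def)
          then interpret mult_set R "carrier R - P" by (rule mult_set_prime)
          obtain a s where a: "x P = frct a s" "a \<in> carrier R" "s \<in> carrier R - P"
            using section_value[OF x P] by (rule frac_cases)
          have "\<ominus> a \<otimes> s \<oplus> a \<otimes> s = \<zero>" using a(2,3) by (simp add: l_minus l_neg)
          then have "frct (\<ominus> \<one>) \<one> \<otimes>\<^bsub>L\<^esub> frct a s \<oplus>\<^bsub>L\<^esub> frct a s = \<zero>\<^bsub>L\<^esub>"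
            using a(2,3) M_one M_mult[OF a(3) a(3)]
            by (simp only: frac_mult frac_add a_inv_closed one_closed m_closed M_closed l_minus l_one frac_zero)
          then show "(m \<otimes>\<^bsub>spec_sheaf R U\<^esub> x \<oplus>\<^bsub>spec_sheaf R U\<^esub> x) P = \<zero>\<^bsub>spec_sheaf R U\<^esub> P"
            using P by (simp add: sheaf_simps m_def a(1))
        qed (use mx x cl in auto)
      qed
    qed
    show "comm_monoid (spec_sheaf R U)"
    proof (rule comm_monoidI, unfold sheaf_simps(1))
      show "\<one>\<^bsub>spec_sheaf R U\<^esub> \<in> spec_sections R U" by (rule one)
      fix x y assume x: "x \<in> spec_sections R U" and y: "y \<in> spec_sections R U"
      show "x \<otimes>\<^bsub>spec_sheaf R U\<^esub> y \<in> spec_sections R U" using x y by (rule cl)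
      show "x \<otimes>\<^bsub>spec_sheaf R U\<^esub> y = y \<otimes>\<^bsub>spec_sheaf R U\<^esub> x"
        by (rule section_eqI[where U = U]) (simp_all add: sheaf_simps x y cl comm_monoid.m_comm[OF st2(5)])
      show "\<one>\<^bsub>spec_sheaf R U\<^esub> \<otimes>\<^bsub>spec_sheaf R U\<^esub> x = x"
        by (rule section_eqI[where U = U]) (simp_all add: sheaf_simps x cl monoid.l_one[OF st2(1)])
      fix z assume z: "z \<in> spec_sections R U"
      show "x \<otimes>\<^bsub>spec_sheaf R U\<^esub> y \<otimes>\<^bsub>spec_sheaf R U\<^esub> z = x \<otimes>\<^bsub>spec_sheaf R U\<^esub> (y \<otimes>\<^bsub>spec_sheaf R U\<^esub> z)"
        by (rule section_eqI[where U = U]) (simp_all add: sheaf_simps x y z cl monoid.m_assoc[OF st2(1)])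
    qed
    fix x y z assume xyz: "x \<in> carrier (spec_sheaf R U)" "y \<in> carrier (spec_sheaf R U)" "z \<in> carrier (spec_sheaf R U)"
    then show "(x \<oplus>\<^bsub>spec_sheaf R U\<^esub> y) \<otimes>\<^bsub>spec_sheaf R U\<^esub> z =
        x \<otimes>\<^bsub>spec_sheaf R U\<^esub> z \<oplus>\<^bsub>spec_sheaf R U\<^esub> y \<otimes>\<^bsub>spec_sheaf R U\<^esub> z"
      unfolding sheaf_simps(1)
      by (intro section_eqI[where U = U]) (simp_all add: sheaf_simps cl semiring.l_distr[OF st2(6)])
  qed
qed

lemma stalk_hom: "P \<in> U \<Longrightarrow> (\<lambda>\<xi>. \<xi> P) \<in> ring_hom (spec_sheaf R U) (localization R (carrier R - P))"
  by (intro ring_hom_memI) (auto simp: sheaf_simps section_value)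

lemma constant_hom:
  assumes U: "U \<in> zariski_opens R"
  shows "(\<lambda>a. \<lambda>P\<in>U. fraction R (carrier R - P) a \<one>) \<in> ring_hom R (spec_sheaf R U)"
proof -
  have hom: "(\<lambda>a. fraction R (carrier R - P) a \<one>) \<in> ring_hom R (localization R (carrier R - P))" if "P \<in> U" for P
    using that U open_subset_Spec mult_set.frac_hom[OF mult_set_prime] by (auto simp: Spec_def)
  show ?thesis
    by (intro ring_hom_memI)
      (auto simp: sheaf_simps constant_section[OF U] ring_hom_mult[OF hom] ring_hom_add[OF hom]
        ring_hom_one[OF hom] spec_sheaf_def cong: restrict_cong)
qed

end

section \<open>Splittings of a ring and of its spectrum\<close>

lemma ring_of_type_algebra_simps [simp]:
  "carrier (ring_of_type_algebra :: 'a::comm_ring_1 ring) = UNIV"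
  "x \<otimes>\<^bsub>ring_of_type_algebra\<^esub> y = x * (y :: 'a)"
  "x \<oplus>\<^bsub>ring_of_type_algebra\<^esub> y = x + (y :: 'a)"
  "\<one>\<^bsub>ring_of_type_algebra\<^esub> = (1 :: 'a)" "\<zero>\<^bsub>ring_of_type_algebra\<^esub> = (0 :: 'a)"
  by (auto simp: ring_of_type_algebra_def)

lemma cring_type_algebra: "cring (ring_of_type_algebra :: 'a::comm_ring_1 ring)"
  by (rule cring_from_type_algebra)

lemma type_algebra_pow: "x [^]\<^bsub>ring_of_type_algebra\<^esub> (k :: nat) = (x :: 'a::comm_ring_1) ^ k"
proof -
  interpret cring "ring_of_type_algebra :: 'a ring" by (rule cring_type_algebra)
  show ?thesis by (induction k) (auto simp: mult.commute)
qed

lemma type_algebra_add_pow: "[k] \<cdot>\<^bsub>ring_of_type_algebra\<^esub> (x :: 'a::comm_ring_1) = of_int (k :: int) * x"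
proof -
  interpret cring "ring_of_type_algebra :: 'a ring" by (rule cring_type_algebra)
  have nat: "[m] \<cdot>\<^bsub>ring_of_type_algebra\<^esub> x = of_nat m * x" for m :: nat
    by (induction m) (auto simp: algebra_simps)
  have inv: "\<ominus>\<^bsub>ring_of_type_algebra\<^esub> y = - y" for y :: 'a
    using minus_equality[of "- y" y] by simp
  show ?thesis
    by (cases k rule: int_cases2) (auto simp: nat inv add.int_pow_neg add_pow_int_ge)
qed

lemma type_algebra_finsum: "finite A \<Longrightarrow> finsum ring_of_type_algebra g A = (\<Sum>x\<in>A. g x :: 'a::comm_ring_1)"
proof (induction A rule: finite_induct)
  interpret cring "ring_of_type_algebra :: 'a ring" by (rule cring_type_algebra)
  case empty show ?case by simp
  case (insert x A) then show ?case by (subst finsum_insert) auto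
qed

lemma type_algebra_finprod: "finite A \<Longrightarrow> finprod ring_of_type_algebra g A = (\<Prod>x\<in>A. g x :: 'a::comm_ring_1)"
proof (induction A rule: finite_induct)
  interpret cring "ring_of_type_algebra :: 'a ring" by (rule cring_type_algebra)
  case empty show ?case by simp
  case (insert x A) then show ?case by (subst finprod_insert) auto
qed

lemma eval_int_poly_type_algebra: "eval_int_poly ring_of_type_algebra P \<rho> = ev \<rho> P"
  by (simp add: eval_int_poly_def ev_def mpoly_monom_def type_algebra_finsum type_algebra_finprod
      type_algebra_add_pow type_algebra_pow)

text \<open>The passage from sequences over S to lists over the target ring: truncation to W_n
  together with the map induced by h.\<close>

definition wlist :: "nat \<Rightarrow> ('s \<Rightarrow> 'a) \<Rightarrow> (nat \<Rightarrow> 's) \<Rightarrow> 'a list" where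
  "wlist n h z = map (\<lambda>i. h (z i)) [0..<n]"

lemma length_wlist [simp]: "length (wlist n h z) = n"
  by (simp add: wlist_def)

lemma nth_wlist [simp]: "i < n \<Longrightarrow> wlist n h z ! i = h (z i)"
  by (simp add: wlist_def)

lemma list_eq_wlist: "length x = n \<Longrightarrow> (\<And>i. i < n \<Longrightarrow> x ! i = h (z i)) \<Longrightarrow> x = wlist n h z"
  by (rule nth_equalityI) auto

lemma witt_ring_simps:
  "carrier (witt_ring p n R) = {x. length x = n \<and> set x \<subseteq> carrier R}"
  "i < n \<Longrightarrow> (x \<oplus>\<^bsub>witt_ring p n R\<^esub> y) ! i = eval_int_poly R (witt_add_poly p i) (case_sum (nth x) (nth y))"
  "i < n \<Longrightarrow> (x \<otimes>\<^bsub>witt_ring p n R\<^esub> y) ! i = eval_int_poly R (witt_mult_poly p i) (case_sum (nth x) (nth y))"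
  "length (x \<oplus>\<^bsub>witt_ring p n R\<^esub> y) = n" "length (x \<otimes>\<^bsub>witt_ring p n R\<^esub> y) = n"
  by (auto simp: witt_ring_def)

lemma witt_carrier_nth: "x \<in> carrier (witt_ring p n R) \<Longrightarrow> i < n \<Longrightarrow> x ! i \<in> carrier R"
  by (auto simp: witt_ring_simps)

lemma eval_witt_hom:
  assumes p: "prime p" and R: "cring R" and h: "h \<in> ring_hom ring_of_type_algebra R"
    and xy: "\<And>j. j \<le> i \<Longrightarrow> x ! j = h (z j)" "\<And>j. j \<le> i \<Longrightarrow> y ! j = h (w j)"
  shows "eval_int_poly R (witt_add_poly p i) (case_sum (nth x) (nth y)) = h (wadd p z w i)"
    and "eval_int_poly R (witt_mult_poly p i) (case_sum (nth x) (nth y)) = h (wmul p z w i)"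
proof -
  have hc: "h a \<in> carrier R" for a using ring_hom_closed[OF h, of a] by simp
  have eq: "case_sum (nth x) (nth y) v = h (case_sum z w v)" if "v \<in> witt_vars i" for v
    using that xy by (auto simp: witt_vars_def)
  show "eval_int_poly R (witt_add_poly p i) (case_sum (nth x) (nth y)) = h (wadd p z w i)"
    unfolding wadd_def eval_int_poly_type_algebra[symmetric]
    by (subst eval_int_poly_hom[OF cring_type_algebra R h isobaric_witt_add[OF p]], simp,
      rule eval_int_poly_cong[OF R isobaric_witt_add[OF p]]) (simp_all add: eq hc)
  show "eval_int_poly R (witt_mult_poly p i) (case_sum (nth x) (nth y)) = h (wmul p z w i)"
    unfolding wmul_def eval_int_poly_type_algebra[symmetric]
    by (subst eval_int_poly_hom[OF cring_type_algebra R h isobaric_witt_mult[OF p, of 0 0]], simp,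
      rule eval_int_poly_cong[OF R isobaric_witt_mult[OF p, of 0 0]]) (simp_all add: eq hc)
qed

lemma wlist_closed:
  fixes h :: "'s::comm_ring_1 \<Rightarrow> 'a"
  assumes h: "h \<in> ring_hom ring_of_type_algebra R"
  shows "wlist n h z \<in> carrier (witt_ring p n R)"
  using ring_hom_closed[OF h] by (auto simp: witt_ring_simps wlist_def)

lemma wlist_add:
  assumes p: "prime p" and R: "cring R" and h: "h \<in> ring_hom ring_of_type_algebra R"
  shows "wlist n h z \<oplus>\<^bsub>witt_ring p n R\<^esub> wlist n h w = wlist n h (wadd p z w)"
  by (rule list_eq_wlist) (auto simp: witt_ring_simps intro!: eval_witt_hom[OF p R h])

lemma wlist_mult:
  assumes p: "prime p" and R: "cring R" and h: "h \<in> ring_hom ring_of_type_algebra R"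
  shows "wlist n h z \<otimes>\<^bsub>witt_ring p n R\<^esub> wlist n h w = wlist n h (wmul p z w)"
  by (rule list_eq_wlist) (auto simp: witt_ring_simps intro!: eval_witt_hom[OF p R h])

lemma hom_type_pow:
  fixes h :: "'s::comm_ring_1 \<Rightarrow> 'a"
  assumes R: "cring R" and h: "h \<in> ring_hom ring_of_type_algebra R"
  shows "h (a ^ k) = h a [^]\<^bsub>R\<^esub> k"
proof -
  interpret R: cring R by fact
  have hc: "h a \<in> carrier R" using ring_hom_closed[OF h, of a] by simp
  show ?thesis
    using ring_hom_one[OF h] ring_hom_mult[OF h, of a] hc
    by (induction k) (auto simp: R.m_comm)
qed

lemma wlist_frob:
  fixes h :: "'s::comm_ring_1 \<Rightarrow> 'a"
  assumes R: "cring R" and h: "h \<in> ring_hom ring_of_type_algebra R"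
  shows "witt_frob p R (wlist n h z) = wlist n h (\<lambda>i. z i ^ p)"
  by (simp add: witt_frob_def wlist_def hom_type_pow[OF R h])

section \<open>Witt vectors over the localizations of a presented ring\<close>

locale presented = cring R for R (structure) +
  fixes p n :: nat and \<pi> :: "'s::comm_ring_1 \<Rightarrow> 'a"
  assumes prime_p: "prime p" and n_pos: "n > 0"
    and \<pi>_hom: "\<pi> \<in> ring_hom ring_of_type_algebra R" and \<pi>_surj: "carrier R = range \<pi>"
begin

lemma p_gt_0: "p > 0" using prime_gt_0_nat[OF prime_p] .

lemma \<pi>_closed [simp]: "\<pi> a \<in> carrier R"
  using \<pi>_surj by blast

lemma \<pi>_mult: "\<pi> (a * b) = \<pi> a \<otimes> \<pi> b" and \<pi>_add: "\<pi> (a + b) = \<pi> a \<oplus> \<pi> b" and \<pi>_one: "\<pi> 1 = \<one>"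
  using ring_hom_mult[OF \<pi>_hom] ring_hom_add[OF \<pi>_hom] ring_hom_one[OF \<pi>_hom] by simp_all

lemma \<pi>_zero: "\<pi> 0 = \<zero>"
  using \<pi>_add[of 0 0] by simp

lemma frac_pi_hom: "mult_set R M \<Longrightarrow> (\<lambda>a. fraction R M (\<pi> a) \<one>) \<in> ring_hom ring_of_type_algebra (localization R M)"
proof -
  assume "mult_set R M"
  then interpret mult_set R M .
  show ?thesis
    using ring_hom_trans[OF \<pi>_hom frac_hom] by (simp add: o_def)
qed

lemma prod_mem: "mult_set R M \<Longrightarrow> (\<And>i. i \<in> A \<Longrightarrow> \<pi> (s i) \<in> M) \<Longrightarrow> \<pi> (\<Prod>i\<in>A. s i) \<in> M"
proof -
  assume "mult_set R M" and s: "\<And>i. i \<in> A \<Longrightarrow> \<pi> (s i) \<in> M"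
  then interpret mult_set R M by simp
  show ?thesis using s by (induction A rule: infinite_finite_induct) (auto simp: \<pi>_one \<pi>_mult)
qed

lemma pow_mem: "mult_set R M \<Longrightarrow> \<pi> t \<in> M \<Longrightarrow> \<pi> (t ^ k) \<in> M"
  using prod_mem[of M "{..<k}" "\<lambda>_. t"] by simp

text \<open>The elements z and t are chosen before M, because the same fractions must serve at all
  primes of a neighbourhood. The exponents k i are prescribed since the weights of Witt vectors call
  for denominators t^{p^{i+1}} or t^{p^i} in component i.\<close>

lemma common_denominator:
  fixes a s :: "nat \<Rightarrow> 's"
  assumes k: "\<And>i. k i > 0"
  shows "\<exists>z t. \<forall>M. mult_set R M \<longrightarrow> (\<forall>i<n. \<pi> (s i) \<in> M) \<longrightarrow> \<pi> t \<in> M \<and>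
    (\<forall>i<n. fraction R M (\<pi> (a i)) (\<pi> (s i)) = fraction R M (\<pi> (z i)) (\<pi> (t ^ k i)))"
proof -
  define t where "t = (\<Prod>i<n. s i)"
  define r where "r i = (\<Prod>j\<in>{..<n} - {i}. s j)" for i
  \<comment> \<open>Since t = s i * r i, the fraction a i / s i acquires the denominator t^{k i}
    when expanded by r i and k i - 1 further factors t.\<close>
  define z where "z i = a i * r i * t ^ (k i - 1)" for i
  have tr: "t = s i * r i" if "i < n" for i
    using that by (simp add: t_def r_def prod.remove[of "{..<n}" i])
  have "\<pi> t \<in> M \<and> (\<forall>i<n. fraction R M (\<pi> (a i)) (\<pi> (s i)) = fraction R M (\<pi> (z i)) (\<pi> (t ^ k i)))"
    if M: "mult_set R M" and s: "\<forall>i<n. \<pi> (s i) \<in> M" for M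
  proof
    interpret mult_set R M by fact
    show tM: "\<pi> t \<in> M" unfolding t_def using s by (intro prod_mem M) auto
    show "\<forall>i<n. fraction R M (\<pi> (a i)) (\<pi> (s i)) = fraction R M (\<pi> (z i)) (\<pi> (t ^ k i))"
    proof (intro allI impI frac_eqI \<pi>_closed)
      fix i assume i: "i < n"
      show "\<pi> (s i) \<in> M" using s i by blast
      show "\<pi> (t ^ k i) \<in> M" by (rule pow_mem[OF M tM])
      have "t ^ k i = t ^ (k i - 1) * (s i * r i)"
        using k[of i] tr[OF i] by (cases "k i") (auto simp: mult.commute)
      then have "a i * t ^ k i = z i * s i" by (simp add: z_def mult_ac)
      then show "\<pi> (a i) \<otimes> \<pi> (t ^ k i) = \<pi> (z i) \<otimes> \<pi> (s i)" by (simp flip: \<pi>_mult)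
    qed
  qed
  then show ?thesis by blast
qed

lemma stalk_common_denominator:
  assumes M: "mult_set R M" and x: "x \<in> carrier (witt_ring p n (localization R M))" and k: "\<And>i. k i > 0"
  shows "\<exists>z t. \<pi> t \<in> M \<and> (\<forall>i<n. x ! i = fraction R M (\<pi> (z i)) (\<pi> (t ^ k i)))"
proof -
  interpret mult_set R M by fact
  have "\<exists>a s. \<pi> s \<in> M \<and> x ! i = fraction R M (\<pi> a) (\<pi> s)" if i: "i < n" for i
  proof -
    obtain b t where b: "x ! i = fraction R M b t" "b \<in> carrier R" "t \<in> M"
      using witt_carrier_nth[OF x i] by (rule frac_cases)
    moreover have "t \<in> carrier R" using b by simp
    ultimately show ?thesis using \<pi>_surj by (metis imageE)
  qed
  then have "\<forall>i. \<exists>q. i < n \<longrightarrow> \<pi> (snd q) \<in> M \<and> x ! i = fraction R M (\<pi> (fst q)) (\<pi> (snd q))"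
    by simp
  from choice[OF this] obtain q where
    "\<forall>i. i < n \<longrightarrow> \<pi> (snd (q i)) \<in> M \<and> x ! i = fraction R M (\<pi> (fst (q i))) (\<pi> (snd (q i)))" ..
  then have q: "\<forall>i<n. \<pi> (snd (q i)) \<in> M"
      "\<And>i. i < n \<Longrightarrow> x ! i = fraction R M (\<pi> (fst (q i))) (\<pi> (snd (q i)))" by simp_all
  from common_denominator[OF k, where s = "\<lambda>i. snd (q i)" and a = "\<lambda>i. fst (q i)"]
  obtain z where "\<exists>t. \<forall>M. mult_set R M \<longrightarrow> (\<forall>i<n. \<pi> (snd (q i)) \<in> M) \<longrightarrow> \<pi> t \<in> M \<and>
    (\<forall>i<n. fraction R M (\<pi> (fst (q i))) (\<pi> (snd (q i))) = fraction R M (\<pi> (z i)) (\<pi> (t ^ k i)))" ..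
  then obtain t where "\<forall>M. mult_set R M \<longrightarrow> (\<forall>i<n. \<pi> (snd (q i)) \<in> M) \<longrightarrow> \<pi> t \<in> M \<and>
    (\<forall>i<n. fraction R M (\<pi> (fst (q i))) (\<pi> (snd (q i))) = fraction R M (\<pi> (z i)) (\<pi> (t ^ k i)))" ..
  from this[rule_format, OF M] q(1) have "\<pi> t \<in> M \<and>
    (\<forall>i<n. fraction R M (\<pi> (fst (q i))) (\<pi> (snd (q i))) = fraction R M (\<pi> (z i)) (\<pi> (t ^ k i)))" by simp
  then show ?thesis by (intro exI[of _ z] exI[of _ t]) (simp add: q(2))
qed

lemma frac_pow:
  assumes M: "mult_set R M" and s: "\<pi> s \<in> M"
  shows "fraction R M (\<pi> c) (\<pi> s) [^]\<^bsub>localization R M\<^esub> (m :: nat) = fraction R M (\<pi> (c ^ m)) (\<pi> (s ^ m))"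
proof -
  interpret mult_set R M by fact
  interpret L: cring L by (rule cring_L)
  show ?thesis
    using pow_mem[OF M s] s
    by (induction m) (auto simp: L_one \<pi>_one frac_mult \<pi>_mult m_comm)
qed

lemma frac_cancel:
  assumes M: "mult_set R M" and t: "\<pi> t \<in> M"
  shows "fraction R M (\<pi> t) \<one> \<otimes>\<^bsub>localization R M\<^esub> fraction R M (\<pi> z) (\<pi> t) = fraction R M (\<pi> z) \<one>"
proof -
  interpret mult_set R M by fact
  show ?thesis using t by (simp add: frac_mult frac_eqI m_ac)
qed

text \<open>Components with denominators $t^{p^{i+1}}$ make a Witt vector over a localization of the form
  $F([1/t])\, z$, and a splitting takes it to \<open>1 / t\<close> times its value at \<open>z\<close>.\<close>

definition rep :: "(nat \<Rightarrow> nat) \<Rightarrow> 'a set \<Rightarrow> ('a \<times> 'a) set list \<Rightarrow> (nat \<Rightarrow> 's) \<Rightarrow> 's \<Rightarrow> bool" where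
  "rep k M x z t \<longleftrightarrow> length x = n \<and> \<pi> t \<in> M \<and> (\<forall>i<n. x ! i = fraction R M (\<pi> (z i)) (\<pi> (t ^ k i)))"

abbreviation "rep1 \<equiv> rep (\<lambda>i. p ^ Suc i)"
abbreviation "rep0 \<equiv> rep (\<lambda>i. p ^ i)"

lemma rep_exists:
  assumes "mult_set R M" "x \<in> carrier (witt_ring p n (localization R M))" "\<And>i. k i > 0"
  shows "\<exists>z t. rep k M x z t"
  using stalk_common_denominator[OF assms] assms(2) by (auto simp: rep_def witt_ring_simps)

lemma rep_scale:
  assumes M: "mult_set R M" and r: "rep1 M x z t" and s: "\<pi> s \<in> M"
  shows "rep1 M x (\<lambda>i. s ^ (p ^ Suc i) * z i) (s * t)"
proof -
  interpret mult_set R M by fact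
  have t: "\<pi> t \<in> M" using r by (simp add: rep_def)
  have "fraction R M (\<pi> (z i)) (\<pi> (t ^ k)) = fraction R M (\<pi> (s ^ k * z i)) (\<pi> ((s * t) ^ k))" for i k
    using pow_mem[OF M t, of k] pow_mem[OF M s, of k]
    by (intro frac_eqI) (auto simp: power_mult_distrib \<pi>_mult m_ac)
  then show ?thesis using r s t by (simp add: rep_def \<pi>_mult)
qed

text \<open>The scaling law clears denominators: multiplying component j by t^{p^{j+1}} =
  (t^p)^{p^j} turns the fractions into images of z and w, where the sum is \<open>wadd\<close>;
  \<open>frac_solve\<close> then divides again.\<close>

lemma rep_add:
  assumes M: "mult_set R M" and x: "rep1 M x z t" and y: "rep1 M y w t"
  shows "rep1 M (x \<oplus>\<^bsub>witt_ring p n (localization R M)\<^esub> y) (wadd p z w) t"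
  unfolding rep_def
proof (intro conjI allI impI)
  interpret mult_set R M by fact
  interpret L: cring L by (rule cring_L)
  show t: "\<pi> t \<in> M" using x by (simp add: rep_def)
  define h where "h a = frct (\<pi> a) \<one>" for a
  have h: "h \<in> ring_hom ring_of_type_algebra L" unfolding h_def by (rule frac_pi_hom[OF M])
  have hc: "h a \<in> carrier L" for a by (simp add: h_def frac_closed)
  fix i assume i: "i < n"
  let ?P = "witt_add_poly p i" and ?\<rho> = "case_sum (nth x) (nth y)" and ?wt = "case_sum ((^) p) ((^) p)"
  note iso = isobaric_witt_add[OF prime_p, of i]
  have xy: "x ! j = frct (\<pi> (z j)) (\<pi> (t ^ p ^ Suc j))" "y ! j = frct (\<pi> (w j)) (\<pi> (t ^ p ^ Suc j))" if "j \<le> i" for j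
    using x y i that by (auto simp: rep_def)
  have \<rho>: "?\<rho> v \<in> carrier L" if "v \<in> witt_vars i" for v
    using that by (auto simp: witt_vars_def xy frac_closed pow_mem[OF M t] simp del: power_Suc)
  have tp: "h (t ^ p) [^]\<^bsub>L\<^esub> (p ^ j) = frct (\<pi> (t ^ p ^ Suc j)) \<one>" for j
  proof -
    have "h (t ^ p) [^]\<^bsub>L\<^esub> (p ^ j) = h (t ^ p ^ Suc j)"
      unfolding hom_type_pow[OF cring_L h, symmetric] by (simp flip: power_mult)
    then show ?thesis by (simp only: h_def)
  qed
  have y_cl: "eval_int_poly L ?P ?\<rho> \<in> carrier L" by (rule L.eval_int_poly_closed[OF \<rho> iso])
  have "h (t ^ p) [^]\<^bsub>L\<^esub> (p ^ i) \<otimes>\<^bsub>L\<^esub> eval_int_poly L ?P ?\<rho> =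
      eval_int_poly L ?P (\<lambda>v. h (t ^ p) [^]\<^bsub>L\<^esub> ?wt v \<otimes>\<^bsub>L\<^esub> ?\<rho> v)"
    by (rule eval_int_poly_scale[OF cring_L iso \<rho> hc, symmetric])
  also have "\<dots> = eval_int_poly L ?P (\<lambda>v. h (case_sum z w v))"
  proof (rule eval_int_poly_cong[OF cring_L iso])
    fix v assume "v \<in> witt_vars i"
    then obtain j where "j \<le> i" "v = Inl j \<or> v = Inr j" by (auto simp: witt_vars_def)
    then have "h (t ^ p) [^]\<^bsub>L\<^esub> ?wt v \<otimes>\<^bsub>L\<^esub> ?\<rho> v = frct (\<pi> (case_sum z w v)) \<one>"
      by (elim disjE) (simp_all only: sum.case xy tp frac_cancel[OF M pow_mem[OF M t]])
    then show "h (t ^ p) [^]\<^bsub>L\<^esub> ?wt v \<otimes>\<^bsub>L\<^esub> ?\<rho> v = h (case_sum z w v)"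
      unfolding h_def .
  qed (rule hc)
  also have "\<dots> = h (wadd p z w i)"
    unfolding wadd_def eval_int_poly_type_algebra[symmetric]
    by (rule eval_int_poly_hom[OF cring_type_algebra cring_L h iso, symmetric]) simp
  finally have "frct (\<pi> (t ^ p ^ Suc i)) \<one> \<otimes>\<^bsub>L\<^esub> eval_int_poly L ?P ?\<rho> = frct (\<pi> (wadd p z w i)) \<one>"
    by (simp only: tp) (simp only: h_def)
  then have "eval_int_poly L ?P ?\<rho> = frct (\<pi> (wadd p z w i)) (\<pi> (t ^ p ^ Suc i))"
    by (rule frac_solve[OF y_cl pow_mem[OF M t] \<pi>_closed])
  then show "(x \<oplus>\<^bsub>witt_ring p n L\<^esub> y) ! i = frct (\<pi> (wadd p z w i)) (\<pi> (t ^ p ^ Suc i))"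
    using i by (simp add: witt_ring_simps)
qed (simp add: witt_ring_simps)

text \<open>Frobenius raises the denominators t^{p^i} to t^{p^{i+1}}; this is why
  \<open>rep0\<close> is kept beside \<open>rep1\<close>.\<close>

lemma rep_frob:
  assumes M: "mult_set R M" and x: "rep0 M x z t"
  shows "rep1 M (witt_frob p (localization R M) x) (\<lambda>i. z i ^ p) t"
proof -
  have "(t ^ p ^ i) ^ p = t ^ p ^ Suc i" for i by (simp add: mult.commute flip: power_mult)
  then show ?thesis
    using x by (simp add: rep_def witt_frob_def frac_pow[OF M pow_mem[OF M]] del: power_Suc)
qed

text \<open>The product polynomials are scaled in one argument at a time, by s with weights (0, 1)
  and by t with weights (1, 0), so the two denominators may differ.\<close>

lemma rep_mult:
  assumes M: "mult_set R M" and x: "rep1 M x z t" and y: "rep1 M y w s"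
  shows "rep1 M (x \<otimes>\<^bsub>witt_ring p n (localization R M)\<^esub> y) (wmul p z w) (t * s)"
  unfolding rep_def
proof (intro conjI allI impI)
  interpret mult_set R M by fact
  interpret L: cring L by (rule cring_L)
  have t: "\<pi> t \<in> M" and s: "\<pi> s \<in> M" using x y by (simp_all add: rep_def)
  then show ts: "\<pi> (t * s) \<in> M" by (simp add: \<pi>_mult)
  define h where "h a = frct (\<pi> a) \<one>" for a
  have h: "h \<in> ring_hom ring_of_type_algebra L" unfolding h_def by (rule frac_pi_hom[OF M])
  have hc: "h a \<in> carrier L" for a by (simp add: h_def frac_closed)
  fix i assume i: "i < n"
  let ?P = "witt_mult_poly p i" and ?\<rho> = "case_sum (nth x) (nth y)"
  let ?wt = "\<lambda>a b. case_sum (\<lambda>j. p ^ j * a) (\<lambda>j. p ^ j * b)"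
  note iso = isobaric_witt_mult[OF prime_p]
  have xy: "x ! j = frct (\<pi> (z j)) (\<pi> (t ^ p ^ Suc j))" "y ! j = frct (\<pi> (w j)) (\<pi> (s ^ p ^ Suc j))" if "j \<le> i" for j
    using x y i that by (auto simp: rep_def)
  have \<rho>: "?\<rho> v \<in> carrier L" if "v \<in> witt_vars i" for v
    using that by (auto simp: witt_vars_def xy frac_closed pow_mem[OF M t] pow_mem[OF M s] simp del: power_Suc)
  have tp: "h (r ^ p) [^]\<^bsub>L\<^esub> (p ^ j) = frct (\<pi> (r ^ p ^ Suc j)) \<one>" for j r
  proof -
    have "h (r ^ p) [^]\<^bsub>L\<^esub> (p ^ j) = h (r ^ p ^ Suc j)"
      unfolding hom_type_pow[OF cring_L h, symmetric] by (simp flip: power_mult)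
    then show ?thesis by (simp only: h_def)
  qed
  let ?\<rho>' = "\<lambda>v. h (s ^ p) [^]\<^bsub>L\<^esub> ?wt 0 1 v \<otimes>\<^bsub>L\<^esub> ?\<rho> v"
  have \<rho>': "?\<rho>' v \<in> carrier L" if "v \<in> witt_vars i" for v
    using \<rho>[OF that] hc by simp
  have y_cl: "eval_int_poly L ?P ?\<rho> \<in> carrier L" by (rule L.eval_int_poly_closed[OF \<rho> iso[where a = 0 and b = 0]])
  have "h (t ^ p) [^]\<^bsub>L\<^esub> (p ^ i * (1 + 0)) \<otimes>\<^bsub>L\<^esub> (h (s ^ p) [^]\<^bsub>L\<^esub> (p ^ i * (0 + 1)) \<otimes>\<^bsub>L\<^esub> eval_int_poly L ?P ?\<rho>) =
      h (t ^ p) [^]\<^bsub>L\<^esub> (p ^ i * (1 + 0)) \<otimes>\<^bsub>L\<^esub> eval_int_poly L ?P ?\<rho>'"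
    by (subst eval_int_poly_scale[OF cring_L iso[where a = 0 and b = 1] \<rho> hc]) simp_all
  also have "\<dots> = eval_int_poly L ?P (\<lambda>v. h (t ^ p) [^]\<^bsub>L\<^esub> ?wt 1 0 v \<otimes>\<^bsub>L\<^esub> ?\<rho>' v)"
    by (rule eval_int_poly_scale[OF cring_L iso[where a = 1 and b = 0] \<rho>' hc, symmetric])
  also have "\<dots> = eval_int_poly L ?P (\<lambda>v. h (case_sum z w v))"
  proof (rule eval_int_poly_cong[OF cring_L iso[where a = 0 and b = 0]])
    fix v assume "v \<in> witt_vars i"
    then obtain j where j: "j \<le> i" "v = Inl j \<or> v = Inr j" by (auto simp: witt_vars_def)
    have cl: "x ! j \<in> carrier L" "frct (\<pi> (w j)) \<one> \<in> carrier L"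
      using j(1) by (simp_all only: xy frac_closed pow_mem[OF M t] \<pi>_closed M_one)
    from j(2) have "h (t ^ p) [^]\<^bsub>L\<^esub> ?wt 1 0 v \<otimes>\<^bsub>L\<^esub> ?\<rho>' v = frct (\<pi> (case_sum z w v)) \<one>"
    proof
      assume v: "v = Inl j"
      show ?thesis using cl(1)
        by (simp only: v sum.case mult_0_right mult_1_right nat_pow_0 L.nat_pow_0 L.l_one)
          (simp only: tp xy(1)[OF j(1)] frac_cancel[OF M pow_mem[OF M t]])
    next
      assume v: "v = Inr j"
      show ?thesis using cl(2)
        by (simp only: v sum.case mult_0_right mult_1_right tp xy(2)[OF j(1)]
            frac_cancel[OF M pow_mem[OF M s]] L.nat_pow_0 L.l_one)
    qed
    then show "h (t ^ p) [^]\<^bsub>L\<^esub> ?wt 1 0 v \<otimes>\<^bsub>L\<^esub> ?\<rho>' v = h (case_sum z w v)"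
      unfolding h_def .
  qed (rule hc)
  also have "\<dots> = h (wmul p z w i)"
    unfolding wmul_def eval_int_poly_type_algebra[symmetric]
    by (rule eval_int_poly_hom[OF cring_type_algebra cring_L h iso[where a = 0 and b = 0], symmetric]) simp
  finally have 1: "frct (\<pi> (t ^ p ^ Suc i)) \<one> \<otimes>\<^bsub>L\<^esub> (frct (\<pi> (s ^ p ^ Suc i)) \<one> \<otimes>\<^bsub>L\<^esub> eval_int_poly L ?P ?\<rho>) =
      frct (\<pi> (wmul p z w i)) \<one>"
    by (simp only: add_0_left add_0_right mult_1_right tp) (simp only: h_def)
  have "frct (\<pi> ((t * s) ^ p ^ Suc i)) \<one> = frct (\<pi> (t ^ p ^ Suc i)) \<one> \<otimes>\<^bsub>L\<^esub> frct (\<pi> (s ^ p ^ Suc i)) \<one>"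
    by (simp add: frac_mult power_mult_distrib \<pi>_mult del: power_Suc)
  then have "frct (\<pi> ((t * s) ^ p ^ Suc i)) \<one> \<otimes>\<^bsub>L\<^esub> eval_int_poly L ?P ?\<rho> = frct (\<pi> (wmul p z w i)) \<one>"
    using 1 y_cl by (simp add: L.m_assoc frac_closed del: power_Suc)
  then have "eval_int_poly L ?P ?\<rho> = frct (\<pi> (wmul p z w i)) (\<pi> ((t * s) ^ p ^ Suc i))"
    by (rule frac_solve[OF y_cl pow_mem[OF M ts] \<pi>_closed])
  then show "(x \<otimes>\<^bsub>witt_ring p n L\<^esub> y) ! i = frct (\<pi> (wmul p z w i)) (\<pi> ((t * s) ^ p ^ Suc i))"
    using i by (simp add: witt_ring_simps)
qed (simp add: witt_ring_simps)

end

lemma witt_map_hom: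
  assumes p: "prime p" and R: "cring R" and R': "cring R'" and h: "h \<in> ring_hom R R'"
    and x: "x \<in> carrier (witt_ring p n R)" and y: "y \<in> carrier (witt_ring p n R)"
  shows "map h (x \<oplus>\<^bsub>witt_ring p n R\<^esub> y) = map h x \<oplus>\<^bsub>witt_ring p n R'\<^esub> map h y"
    and "map h (x \<otimes>\<^bsub>witt_ring p n R\<^esub> y) = map h x \<otimes>\<^bsub>witt_ring p n R'\<^esub> map h y"
    and "map h x \<in> carrier (witt_ring p n R')"
    and "witt_frob p R' (map h x) = map h (witt_frob p R x)"
proof -
  have len: "length x = n" "length y = n" using x y by (auto simp: witt_ring_simps)
  have xc: "x ! j \<in> carrier R" "y ! j \<in> carrier R" if "j < n" for j
    using that witt_carrier_nth[OF x] witt_carrier_nth[OF y] by auto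
  have hc: "h a \<in> carrier R'" if "a \<in> carrier R" for a using ring_hom_closed[OF h that] .
  have c: "case_sum (nth x) (nth y) v \<in> carrier R"
    "h (case_sum (nth x) (nth y) v) = case_sum (nth (map h x)) (nth (map h y)) v"
    "case_sum (nth (map h x)) (nth (map h y)) v \<in> carrier R'"
    if "v \<in> witt_vars i" "i < n" for v i
  proof -
    from that obtain j where j: "j < n" "v = Inl j \<or> v = Inr j" by (auto simp: witt_vars_def)
    then show "case_sum (nth x) (nth y) v \<in> carrier R"
      "h (case_sum (nth x) (nth y) v) = case_sum (nth (map h x)) (nth (map h y)) v"
      "case_sum (nth (map h x)) (nth (map h y)) v \<in> carrier R'"
      using xc hc len by auto
  qed
  have ev: "h (eval_int_poly R P (case_sum (nth x) (nth y))) =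
      eval_int_poly R' P (case_sum (nth (map h x)) (nth (map h y)))"
    if iso: "isobaric wt (witt_vars i) k P" and i: "i < n" for wt k P i
    using eval_int_poly_hom[OF R R' h iso c(1)[OF _ i]] eval_int_poly_cong[OF R' iso c(2)[OF _ i] c(3)[OF _ i]]
    by simp
  show "map h (x \<oplus>\<^bsub>witt_ring p n R\<^esub> y) = map h x \<oplus>\<^bsub>witt_ring p n R'\<^esub> map h y"
    by (rule nth_equalityI) (simp_all add: witt_ring_simps ev[OF isobaric_witt_add[OF p]])
  show "map h (x \<otimes>\<^bsub>witt_ring p n R\<^esub> y) = map h x \<otimes>\<^bsub>witt_ring p n R'\<^esub> map h y"
    by (rule nth_equalityI) (simp_all add: witt_ring_simps ev[OF isobaric_witt_mult[OF p, of 0 0]])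
  show "map h x \<in> carrier (witt_ring p n R')"
    using x hc by (auto simp: witt_ring_simps)
  interpret h: ring_hom_cring R R' h using R R' h by (intro ring_hom_cringI ring_hom_ringI2) (auto simp: cring.axioms)
  show "witt_frob p R' (map h x) = map h (witt_frob p R x)"
    using x by (auto simp: witt_frob_def witt_ring_simps)
qed

section \<open>From a splitting of W_n(R) to a splitting on the spectrum\<close>

locale ring_split = presented R p n \<pi> for R (structure) and p n :: nat and \<pi> :: "'s::comm_ring_1 \<Rightarrow> 'a" +
  fixes split :: "(nat \<Rightarrow> 's) \<Rightarrow> 'a"
  assumes split_closed: "split z \<in> carrier R"
    and split_cong: "(\<And>i. i < n \<Longrightarrow> \<pi> (z i) = \<pi> (z' i)) \<Longrightarrow> split z = split z'"
    and split_add: "split (wadd p z w) = split z \<oplus> split w"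
    and split_mult: "split (wmul p (\<lambda>k. a k ^ p) z) = \<pi> (a 0) \<otimes> split z"
    and split_frob: "split (\<lambda>k. z k ^ p) = \<pi> (z 0)"
begin

lemma split_scale: "split (\<lambda>i. c ^ (p ^ Suc i) * z i) = \<pi> c \<otimes> split z"
proof -
  have fw: "(\<lambda>k. wshift 0 c k ^ p) = wshift 0 (c ^ p)" using p_gt_0 by (auto simp: wshift_def fun_eq_iff power_0_left)
  have "wmul p (\<lambda>k. wshift 0 c k ^ p) z = (\<lambda>i. c ^ (p ^ Suc i) * z i)"
    unfolding fw by (rule ext, subst wmul_wshift_0[OF prime_p]) (simp flip: power_mult)
  then show ?thesis using split_mult[of "wshift 0 c" z] by (simp add: wshift_def)
qed

text \<open>Equality of components in the localization is witnessed by elements w i, and their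
  product W serves for all i. Multiplying component i of z by (W t')^{p^{i+1}} and that of z' by (W
  t)^{p^{i+1}} gives the same Witt vector over R, and \<open>split_scale\<close> extracts W t' and W
  t.\<close>

lemma rep_unique:
  assumes M: "mult_set R M" and r: "rep1 M x z t" and r': "rep1 M x z' t'"
  shows "fraction R M (split z) (\<pi> t) = fraction R M (split z') (\<pi> t')"
proof -
  interpret mult_set R M by fact
  have t: "\<pi> t \<in> M" "\<pi> t' \<in> M" using r r' by (simp_all add: rep_def)
  have "\<exists>w. i < n \<longrightarrow> \<pi> w \<in> M \<and> \<pi> (w * (z i * t' ^ p ^ Suc i)) = \<pi> (w * (z' i * t ^ p ^ Suc i))" for i
  proof (cases "i < n")
    case True
    have "fraction R M (\<pi> (z i)) (\<pi> (t ^ p ^ Suc i)) = fraction R M (\<pi> (z' i)) (\<pi> (t' ^ p ^ Suc i))"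
      using r r' True by (simp add: rep_def del: power_Suc)
    then obtain v where v: "v \<in> M" "v \<otimes> (\<pi> (z i) \<otimes> \<pi> (t' ^ p ^ Suc i)) = v \<otimes> (\<pi> (z' i) \<otimes> \<pi> (t ^ p ^ Suc i))"
      using pow_mem[OF M t(1)] pow_mem[OF M t(2)] by (subst (asm) frac_eq_iff) auto
    moreover obtain w where "v = \<pi> w" using M_closed[OF v(1)] \<pi>_surj by auto
    ultimately show ?thesis by (intro exI[of _ w]) (simp add: \<pi>_mult)
  qed simp
  then have "\<forall>i. \<exists>w. i < n \<longrightarrow> \<pi> w \<in> M \<and> \<pi> (w * (z i * t' ^ p ^ Suc i)) = \<pi> (w * (z' i * t ^ p ^ Suc i))" ..
  from choice[OF this] obtain w where
    w: "\<forall>i. i < n \<longrightarrow> \<pi> (w i) \<in> M \<and> \<pi> (w i * (z i * t' ^ p ^ Suc i)) = \<pi> (w i * (z' i * t ^ p ^ Suc i))" ..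
  define W where "W = (\<Prod>i<n. w i)"
  have WM: "\<pi> W \<in> M" unfolding W_def using w by (intro prod_mem[OF M]) auto
  have "split (\<lambda>i. (W * t') ^ (p ^ Suc i) * z i) = split (\<lambda>i. (W * t) ^ (p ^ Suc i) * z' i)"
  proof (rule split_cong)
    fix i assume i: "i < n"
    define c where "c = (\<Prod>j\<in>{..<n} - {i}. w j) * W ^ (p ^ Suc i - 1)"
    have "p ^ Suc i = Suc (p ^ Suc i - 1)" using p_gt_0 by simp
    then have "W ^ (p ^ Suc i) = W * W ^ (p ^ Suc i - 1)" by (metis power_Suc)
    moreover have "W = w i * (\<Prod>j\<in>{..<n} - {i}. w j)"
      using i by (simp add: W_def prod.remove[of "{..<n}" i])
    ultimately have "W ^ (p ^ Suc i) = w i * c" unfolding c_def by (metis mult.assoc)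
    then have *: "(W * a) ^ (p ^ Suc i) * b = c * (w i * (b * a ^ (p ^ Suc i)))" for a b
      by (simp only: power_mult_distrib mult_ac)
    show "\<pi> ((W * t') ^ (p ^ Suc i) * z i) = \<pi> ((W * t) ^ (p ^ Suc i) * z' i)"
      unfolding * \<pi>_mult[of c] using w i by simp
  qed
  then have "\<pi> W \<otimes> (split z \<otimes> \<pi> t') = \<pi> W \<otimes> (split z' \<otimes> \<pi> t)"
    unfolding split_scale using t split_closed by (simp add: \<pi>_mult m_ac)
  then show ?thesis using WM t split_closed by (subst frac_eq_iff) auto
qed

text \<open>The only possible value at F([1/t]) z, namely the value at z divided by t;
  \<open>rep_unique\<close> makes the choice of z and t immaterial.\<close>

definition germ_split :: "'a set \<Rightarrow> ('a \<times> 'a) set list \<Rightarrow> ('a \<times> 'a) set" where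
  "germ_split M x = (SOME y. \<exists>z t. rep1 M x z t \<and> y = fraction R M (split z) (\<pi> t))"

lemma germ_split_eq:
  assumes M: "mult_set R M" and r: "rep1 M x z t"
  shows "germ_split M x = fraction R M (split z) (\<pi> t)"
proof -
  have "\<exists>y z t. rep1 M x z t \<and> y = fraction R M (split z) (\<pi> t)" using r by blast
  from someI_ex[OF this] obtain z' t' where "rep1 M x z' t'" "germ_split M x = fraction R M (split z') (\<pi> t')"
    unfolding germ_split_def by blast
  then show ?thesis using rep_unique[OF M r, of z' t'] by simp
qed

lemma rep1_exists: "mult_set R M \<Longrightarrow> x \<in> carrier (witt_ring p n (localization R M)) \<Longrightarrow> \<exists>z t. rep1 M x z t"
  using p_gt_0 by (intro rep_exists) auto

lemma rep0_exists: "mult_set R M \<Longrightarrow> x \<in> carrier (witt_ring p n (localization R M)) \<Longrightarrow> \<exists>z t. rep0 M x z t"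
  using p_gt_0 by (intro rep_exists) auto

lemma germ_split_add:
  assumes M: "mult_set R M" and x: "x \<in> carrier (witt_ring p n (localization R M))"
    and y: "y \<in> carrier (witt_ring p n (localization R M))"
  shows "germ_split M (x \<oplus>\<^bsub>witt_ring p n (localization R M)\<^esub> y) = germ_split M x \<oplus>\<^bsub>localization R M\<^esub> germ_split M y"
proof -
  interpret mult_set R M by fact
  obtain z t w s where r: "rep1 M x z t" "rep1 M y w s"
    using rep1_exists[OF M x] rep1_exists[OF M y] by blast
  then have M2: "\<pi> t \<in> M" "\<pi> s \<in> M" by (simp_all add: rep_def)
  have x': "rep1 M x (\<lambda>i. s ^ (p ^ Suc i) * z i) (s * t)" by (rule rep_scale[OF M r(1) M2(2)])
  have y': "rep1 M y (\<lambda>i. t ^ (p ^ Suc i) * w i) (s * t)"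
    using rep_scale[OF M r(2) M2(1)] by (simp only: mult.commute[of s t])
  show ?thesis
    unfolding germ_split_eq[OF M rep_add[OF M x' y']] germ_split_eq[OF M r(1)] germ_split_eq[OF M r(2)]
      split_add split_scale
    using M2 split_closed by (simp add: frac_add \<pi>_mult m_ac)
qed

lemma germ_split_mult:
  assumes M: "mult_set R M" and a: "a \<in> carrier (witt_ring p n (localization R M))"
    and x: "x \<in> carrier (witt_ring p n (localization R M))"
  shows "germ_split M (witt_frob p (localization R M) a \<otimes>\<^bsub>witt_ring p n (localization R M)\<^esub> x) =
    hd a \<otimes>\<^bsub>localization R M\<^esub> germ_split M x"
proof -
  interpret mult_set R M by fact
  obtain z t w s where r: "rep1 M x z t" "rep0 M a w s"
    using rep1_exists[OF M x] rep0_exists[OF M a] by blast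
  then have M2: "\<pi> t \<in> M" "\<pi> s \<in> M" by (simp_all add: rep_def)
  have "hd a = a ! 0" using r(2) n_pos by (intro hd_conv_nth) (auto simp: rep_def)
  then have "hd a = frct (\<pi> (w 0)) (\<pi> s)" using r(2) n_pos by (simp add: rep_def)
  then show ?thesis
    unfolding germ_split_eq[OF M rep_mult[OF M rep_frob[OF M r(2)] r(1)]] germ_split_eq[OF M r(1)] split_mult
    using M2 split_closed by (simp add: frac_mult \<pi>_mult)
qed

lemma germ_split_frob:
  assumes M: "mult_set R M" and a: "a \<in> carrier (witt_ring p n (localization R M))"
  shows "germ_split M (witt_frob p (localization R M) a) = hd a"
proof -
  obtain w s where r: "rep0 M a w s" using rep0_exists[OF M a] by blast
  have "hd a = a ! 0" using r n_pos by (intro hd_conv_nth) (auto simp: rep_def)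
  then have "hd a = fraction R M (\<pi> (w 0)) (\<pi> s)" using r n_pos by (simp add: rep_def)
  then show ?thesis unfolding germ_split_eq[OF M rep_frob[OF M r]] split_frob by simp
qed

text \<open>On a basic open set where all components of x are given by fixed fractions, one pair z,
  t represents x at every prime, thanks to the uniformity of \<open>common_denominator\<close>. So
  the germs come from the single fraction \<open>split z\<close> over t.\<close>

lemma sheaf_split_section:
  assumes U: "U \<in> zariski_opens R" and x: "x \<in> carrier (witt_ring p n (spec_sheaf R U))"
  shows "(\<lambda>P\<in>U. germ_split (carrier R - P) (map (\<lambda>\<xi>. \<xi> P) x)) \<in> spec_sections R U"
proof (rule sectionI[OF U])
  fix P assume P: "P \<in> U"
  have S: "Q \<in> Spec R" if "Q \<in> U" for Q using that U open_subset_Spec by blast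
  have MQ: "mult_set R (carrier R - Q)" if "Q \<in> U" for Q
    using S[OF that] mult_set_prime by (simp add: Spec_def)
  have len: "length x = n" using x by (simp add: witt_ring_simps)
  have "\<exists>q. i < n \<longrightarrow> \<pi> (fst q) \<notin> P \<and> (\<forall>Q\<in>Spec R. \<pi> (fst q) \<notin> Q \<longrightarrow> Q \<in> U \<and>
      \<pi> (snd (snd q)) \<notin> Q \<and> (x ! i) Q = fraction R (carrier R - Q) (\<pi> (fst (snd q))) (\<pi> (snd (snd q))))" for i
  proof (cases "i < n")
    case True
    then have "x ! i \<in> spec_sections R U" using witt_carrier_nth[OF x] by (simp add: sheaf_simps)
    from section_local[OF this P] obtain g a s where g: "g \<in> carrier R" "a \<in> carrier R" "s \<in> carrier R" "g \<notin> P"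
      "\<forall>Q\<in>Spec R. g \<notin> Q \<longrightarrow> Q \<in> U \<and> s \<notin> Q \<and> (x ! i) Q = fraction R (carrier R - Q) a s" by blast
    obtain g' a' s' where "g = \<pi> g'" "a = \<pi> a'" "s = \<pi> s'" using g(1-3) \<pi>_surj by auto
    then show ?thesis using g(4,5) by (intro exI[of _ "(g', a', s')"]) simp
  qed simp
  then have "\<forall>i. \<exists>q. i < n \<longrightarrow> \<pi> (fst q) \<notin> P \<and> (\<forall>Q\<in>Spec R. \<pi> (fst q) \<notin> Q \<longrightarrow> Q \<in> U \<and>
      \<pi> (snd (snd q)) \<notin> Q \<and> (x ! i) Q = fraction R (carrier R - Q) (\<pi> (fst (snd q))) (\<pi> (snd (snd q))))" ..
  from choice[OF this] obtain q where q: "\<forall>i. i < n \<longrightarrow> \<pi> (fst (q i)) \<notin> P \<and> (\<forall>Q\<in>Spec R. \<pi> (fst (q i)) \<notin> Q \<longrightarrow> Q \<in> U \<and>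
      \<pi> (snd (snd (q i))) \<notin> Q \<and> (x ! i) Q = fraction R (carrier R - Q) (\<pi> (fst (snd (q i)))) (\<pi> (snd (snd (q i)))))" ..
  define \<gamma> a s where "\<gamma> i = fst (q i)" and "a i = fst (snd (q i))" and "s i = snd (snd (q i))" for i
  have q': "\<pi> (\<gamma> i) \<notin> P" "\<And>Q. Q \<in> Spec R \<Longrightarrow> \<pi> (\<gamma> i) \<notin> Q \<Longrightarrow>
      \<pi> (s i) \<notin> Q \<and> (x ! i) Q = fraction R (carrier R - Q) (\<pi> (a i)) (\<pi> (s i))" if "i < n" for i
    using q that by (simp_all add: \<gamma>_def a_def s_def)
  have "p ^ Suc i > 0" for i using p_gt_0 by simp
  from common_denominator[OF this, where s = s and a = a]
  obtain z where "\<exists>t. \<forall>M. mult_set R M \<longrightarrow> (\<forall>i<n. \<pi> (s i) \<in> M) \<longrightarrow> \<pi> t \<in> M \<and>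
    (\<forall>i<n. fraction R M (\<pi> (a i)) (\<pi> (s i)) = fraction R M (\<pi> (z i)) (\<pi> (t ^ p ^ Suc i)))" ..
  then obtain t where zt: "\<forall>M. mult_set R M \<longrightarrow> (\<forall>i<n. \<pi> (s i) \<in> M) \<longrightarrow> \<pi> t \<in> M \<and>
    (\<forall>i<n. fraction R M (\<pi> (a i)) (\<pi> (s i)) = fraction R M (\<pi> (z i)) (\<pi> (t ^ p ^ Suc i)))" ..
  let ?g = "\<pi> (\<Prod>i<n. \<gamma> i)"
  have gP: "?g \<notin> P" using prod_mem[OF MQ[OF P], of "{..<n}" \<gamma>] q'(1) by simp
  have loc: "\<pi> t \<notin> Q \<and> germ_split (carrier R - Q) (map (\<lambda>\<xi>. \<xi> Q) x) = fraction R (carrier R - Q) (split z) (\<pi> t)"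
    if Q: "Q \<in> U" and g: "?g \<notin> Q" for Q
  proof -
    have \<gamma>Q: "\<pi> (\<gamma> i) \<notin> Q" if "i < n" for i
    proof -
      have "?g = \<pi> (\<gamma> i) \<otimes> \<pi> (\<Prod>j\<in>{..<n} - {i}. \<gamma> j)"
        using that by (simp add: prod.remove[of "{..<n}" i] flip: \<pi>_mult)
      then show ?thesis using g prime_mult_notin[OF S[OF Q] \<pi>_closed \<pi>_closed] by simp
    qed
    have sQ: "\<pi> (s i) \<notin> Q" "(x ! i) Q = fraction R (carrier R - Q) (\<pi> (a i)) (\<pi> (s i))" if "i < n" for i
      using q'(2)[OF that S[OF Q] \<gamma>Q[OF that]] by simp_all
    have tQ: "\<pi> t \<in> carrier R - Q \<and> (\<forall>i<n. fraction R (carrier R - Q) (\<pi> (a i)) (\<pi> (s i)) =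
        fraction R (carrier R - Q) (\<pi> (z i)) (\<pi> (t ^ p ^ Suc i)))"
      using zt[rule_format, OF MQ[OF Q]] sQ(1) by simp
    have "rep1 (carrier R - Q) (map (\<lambda>\<xi>. \<xi> Q) x) z t"
      using tQ sQ(2) len unfolding rep_def by simp
    from germ_split_eq[OF MQ[OF Q] this] tQ show ?thesis by simp
  qed
  have eq: "\<forall>Q\<in>U. ?g \<notin> Q \<longrightarrow> \<pi> t \<notin> Q \<and>
      germ_split (carrier R - Q) (map (\<lambda>\<xi>. \<xi> Q) x) = fraction R (carrier R - Q) (split z) (\<pi> t)"
    using loc by simp
  show "\<exists>g\<in>carrier R. g \<notin> P \<and> (\<exists>a\<in>carrier R. \<exists>s\<in>carrier R. \<forall>Q\<in>U. g \<notin> Q \<longrightarrow>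
      s \<notin> Q \<and> germ_split (carrier R - Q) (map (\<lambda>\<xi>. \<xi> Q) x) = fraction R (carrier R - Q) a s)"
    by (rule bexI[OF conjI \<pi>_closed], rule gP, rule bexI[OF _ split_closed], rule bexI[OF _ \<pi>_closed], rule eq)
qed

text \<open>Sections are determined by their germs, so linearity and compatibility with Frobenius
  are checked one prime at a time.\<close>

lemma n_quasi_F_split_Spec:
  "n_quasi_F_split p n (zariski_opens R) (spec_sheaf R) (\<lambda>U V \<xi>. restrict \<xi> V)"
proof -
  define \<phi> where "\<phi> U x = (\<lambda>P\<in>U. germ_split (carrier R - P) (map (\<lambda>\<xi>. \<xi> P) x))" for U x
  have \<phi>_P: "\<phi> U x P = germ_split (carrier R - P) (map (\<lambda>\<xi>. \<xi> P) x)" if "P \<in> U" for U x P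
    using that by (simp add: \<phi>_def)
  have \<phi>_sec: "\<phi> U x \<in> spec_sections R U" if "U \<in> zariski_opens R" "x \<in> carrier (witt_ring p n (spec_sheaf R U))" for U x
    unfolding \<phi>_def using that by (rule sheaf_split_section)
  have MQ: "mult_set R (carrier R - Q)" if "Q \<in> U" "U \<in> zariski_opens R" for Q U
    using that open_subset_Spec mult_set_prime by (auto simp: Spec_def)
  note wh = witt_map_hom[OF prime_p cring_sheaf cring_stalk stalk_hom]
  have hd_sec: "hd a \<in> spec_sections R U" "(hd a) P = hd (map (\<lambda>\<xi>. \<xi> P) a)"
    if "a \<in> carrier (witt_ring p n (spec_sheaf R U))" for a U P
    using that n_pos by (cases a; auto simp: witt_ring_simps sheaf_simps)+
  have frob_closed: "witt_frob p (spec_sheaf R U) a \<in> carrier (witt_ring p n (spec_sheaf R U))"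
    if "U \<in> zariski_opens R" "a \<in> carrier (witt_ring p n (spec_sheaf R U))" for U a
  proof -
    interpret sh: cring "spec_sheaf R U" by (rule cring_sheaf[OF that(1)])
    show ?thesis using that(2) by (auto simp: witt_frob_def witt_ring_simps subset_eq)
  qed
  have add_closed: "x \<oplus>\<^bsub>witt_ring p n (spec_sheaf R U)\<^esub> y \<in> carrier (witt_ring p n (spec_sheaf R U))"
    and mult_closed: "x \<otimes>\<^bsub>witt_ring p n (spec_sheaf R U)\<^esub> y \<in> carrier (witt_ring p n (spec_sheaf R U))"
    if U: "U \<in> zariski_opens R" and x: "x \<in> carrier (witt_ring p n (spec_sheaf R U))"
      and y: "y \<in> carrier (witt_ring p n (spec_sheaf R U))" for U x y
  proof -
    interpret sh: cring "spec_sheaf R U" by (rule cring_sheaf[OF U])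
    have c: "case_sum (nth x) (nth y) v \<in> carrier (spec_sheaf R U)" if "v \<in> witt_vars i" "i < n" for v i
      using that witt_carrier_nth[OF x] witt_carrier_nth[OF y] by (auto simp: witt_vars_def)
    show "x \<oplus>\<^bsub>witt_ring p n (spec_sheaf R U)\<^esub> y \<in> carrier (witt_ring p n (spec_sheaf R U))"
      using sh.eval_int_poly_closed[OF c isobaric_witt_add[OF prime_p]] by (auto simp: witt_ring_def)
    show "x \<otimes>\<^bsub>witt_ring p n (spec_sheaf R U)\<^esub> y \<in> carrier (witt_ring p n (spec_sheaf R U))"
      using sh.eval_int_poly_closed[OF c isobaric_witt_mult[OF prime_p, of 0 0]] by (auto simp: witt_ring_def)
  qed
  have lin: "witt_frob_linear p n (spec_sheaf R U) (\<phi> U)" if U: "U \<in> zariski_opens R" for U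
    unfolding witt_frob_linear_def
  proof (intro conjI ballI)
    show "\<phi> U \<in> carrier (witt_ring p n (spec_sheaf R U)) \<rightarrow> carrier (spec_sheaf R U)"
      using \<phi>_sec[OF U] by (simp add: sheaf_simps)
  next
    fix x y assume x: "x \<in> carrier (witt_ring p n (spec_sheaf R U))" and y: "y \<in> carrier (witt_ring p n (spec_sheaf R U))"
    show "\<phi> U (x \<oplus>\<^bsub>witt_ring p n (spec_sheaf R U)\<^esub> y) = \<phi> U x \<oplus>\<^bsub>spec_sheaf R U\<^esub> \<phi> U y"
    proof (rule section_eqI[where U = U])
      fix P assume P: "P \<in> U"
      show "\<phi> U (x \<oplus>\<^bsub>witt_ring p n (spec_sheaf R U)\<^esub> y) P = (\<phi> U x \<oplus>\<^bsub>spec_sheaf R U\<^esub> \<phi> U y) P"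
        unfolding sheaf_simps(3)[OF P] \<phi>_P[OF P] wh(1)[OF U U P P x y]
        by (rule germ_split_add[OF MQ[OF P U] wh(3)[OF U U P P x x] wh(3)[OF U U P P y y]])
    qed (intro \<phi>_sec U sheaf_add_closed add_closed x y)+
  next
    fix a x assume a: "a \<in> carrier (witt_ring p n (spec_sheaf R U))" and x: "x \<in> carrier (witt_ring p n (spec_sheaf R U))"
    note fa = frob_closed[OF U a]
    show "\<phi> U (witt_frob p (spec_sheaf R U) a \<otimes>\<^bsub>witt_ring p n (spec_sheaf R U)\<^esub> x) = hd a \<otimes>\<^bsub>spec_sheaf R U\<^esub> \<phi> U x"
    proof (rule section_eqI[where U = U])
      fix P assume P: "P \<in> U"
      show "\<phi> U (witt_frob p (spec_sheaf R U) a \<otimes>\<^bsub>witt_ring p n (spec_sheaf R U)\<^esub> x) P = (hd a \<otimes>\<^bsub>spec_sheaf R U\<^esub> \<phi> U x) P"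
        unfolding sheaf_simps(2)[OF P] \<phi>_P[OF P] wh(2)[OF U U P P fa x] wh(4)[OF U U P P a a, symmetric] hd_sec(2)[OF a]
        by (rule germ_split_mult[OF MQ[OF P U] wh(3)[OF U U P P a a] wh(3)[OF U U P P x x]])
    qed (intro \<phi>_sec U sheaf_mult_closed mult_closed fa x hd_sec(1)[OF a])+
  qed
  have res: "\<phi> V (map (\<lambda>\<xi>. restrict \<xi> V) x) = restrict (\<phi> U x) V" if "V \<subseteq> U" for U V x
    using that by (auto simp: \<phi>_def fun_eq_iff o_def restrict_def)
  have frob: "\<phi> U (witt_frob p (spec_sheaf R U) x) = hd x"
    if U: "U \<in> zariski_opens R" and x: "x \<in> carrier (witt_ring p n (spec_sheaf R U))" for U x
  proof (rule section_eqI[where U = U])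
    fix P assume P: "P \<in> U"
    show "\<phi> U (witt_frob p (spec_sheaf R U) x) P = hd x P"
      unfolding \<phi>_P[OF P] wh(4)[OF U U P P x x, symmetric] hd_sec(2)[OF x]
      by (rule germ_split_frob[OF MQ[OF P U] wh(3)[OF U U P P x x]])
  qed (intro \<phi>_sec U frob_closed x hd_sec(1)[OF x])+
  show ?thesis
    unfolding n_quasi_F_split_def using lin res frob by (intro exI[of _ \<phi>]) simp
qed

end

section \<open>From a splitting on the spectrum to a splitting with values in a stalk\<close>

context presented
begin

text \<open>The splitting on global sections is evaluated on the constant sections coming from S,
  and the germ at P is taken. Values in the stalk suffice, so global sections of the structure sheaf
  need not be identified with R.\<close>

lemma stalk_split:
  assumes sp: "n_quasi_F_split p n (zariski_opens R) (spec_sheaf R) (\<lambda>U V \<xi>. restrict \<xi> V)"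
    and P: "P \<in> Spec R"
  defines "L \<equiv> localization R (carrier R - P)" and "h \<equiv> \<lambda>a. fraction R (carrier R - P) (\<pi> a) \<one>"
  shows "\<exists>\<Psi>. (\<forall>z. \<Psi> z \<in> carrier L) \<and> (\<forall>z w. \<Psi> (wadd p z w) = \<Psi> z \<oplus>\<^bsub>L\<^esub> \<Psi> w) \<and>
    (\<forall>a z. \<Psi> (wmul p (\<lambda>k. a k ^ p) z) = h (a 0) \<otimes>\<^bsub>L\<^esub> \<Psi> z) \<and> (\<forall>z. \<Psi> (\<lambda>k. z k ^ p) = h (z 0)) \<and>
    (\<forall>z z'. (\<forall>i<n. \<pi> (z i) = \<pi> (z' i)) \<longrightarrow> \<Psi> z = \<Psi> z')"
proof -
  define X' where "X' = Spec R"
  have X: "X' \<in> zariski_opens R" "P \<in> X'" using Spec_open P by (simp_all add: X'_def)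
  from sp[unfolded n_quasi_F_split_def] obtain \<phi> where \<phi>':
    "(\<forall>U\<in>zariski_opens R. witt_frob_linear p n (spec_sheaf R U) (\<phi> U)) \<and>
     (\<forall>U\<in>zariski_opens R. \<forall>V\<in>zariski_opens R. V \<subseteq> U \<longrightarrow> (\<forall>x\<in>carrier (witt_ring p n (spec_sheaf R U)).
        \<phi> V (map (\<lambda>\<xi>. restrict \<xi> V) x) = restrict (\<phi> U x) V)) \<and>
     (\<forall>U\<in>zariski_opens R. \<forall>x\<in>carrier (witt_ring p n (spec_sheaf R U)). \<phi> U (witt_frob p (spec_sheaf R U) x) = hd x)" ..
  note \<phi> = bspec[OF conjunct1[OF \<phi>'] X(1)] bspec[OF conjunct2[OF conjunct2[OF \<phi>']] X(1)]
  define \<gamma> where "\<gamma> a = (\<lambda>Q\<in>X'. fraction R (carrier R - Q) (\<pi> a) \<one>)" for a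
  have \<gamma>: "\<gamma> \<in> ring_hom ring_of_type_algebra (spec_sheaf R X')"
    using ring_hom_trans[OF \<pi>_hom constant_hom[OF X(1)]] by (simp add: \<gamma>_def[abs_def] o_def)
  note cr = cring_sheaf[OF X(1)]
  have \<gamma>P: "\<gamma> a P = h a" for a using X by (simp add: \<gamma>_def h_def)
  define \<Psi> where "\<Psi> z = \<phi> X' (wlist n \<gamma> z) P" for z
  have hd: "hd (wlist n \<gamma> z) = \<gamma> (z 0)" for z
    using n_pos by (simp add: wlist_def hd_map)
  note cl = wlist_closed[OF \<gamma>]
  have "\<Psi> z \<in> carrier L" for z
    unfolding \<Psi>_def L_def using \<phi>(1) cl X(2)
    by (intro section_value[where U = X']) (auto simp: witt_frob_linear_def sheaf_simps Pi_def)
  moreover have "\<Psi> (wadd p z w) = \<Psi> z \<oplus>\<^bsub>L\<^esub> \<Psi> w" for z w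
  proof -
    have "\<phi> X' (wlist n \<gamma> z \<oplus>\<^bsub>witt_ring p n (spec_sheaf R X')\<^esub> wlist n \<gamma> w) =
        \<phi> X' (wlist n \<gamma> z) \<oplus>\<^bsub>spec_sheaf R X'\<^esub> \<phi> X' (wlist n \<gamma> w)"
      using \<phi>(1) cl unfolding witt_frob_linear_def by blast
    then show ?thesis
      unfolding wlist_add[OF prime_p cr \<gamma>] \<Psi>_def by (simp add: sheaf_simps(3)[OF X(2)] L_def)
  qed
  moreover have "\<Psi> (wmul p (\<lambda>k. a k ^ p) z) = h (a 0) \<otimes>\<^bsub>L\<^esub> \<Psi> z" for a z
  proof -
    have "\<phi> X' (witt_frob p (spec_sheaf R X') (wlist n \<gamma> a) \<otimes>\<^bsub>witt_ring p n (spec_sheaf R X')\<^esub> wlist n \<gamma> z) =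
        hd (wlist n \<gamma> a) \<otimes>\<^bsub>spec_sheaf R X'\<^esub> \<phi> X' (wlist n \<gamma> z)"
      using \<phi>(1) cl unfolding witt_frob_linear_def by blast
    then show ?thesis
      unfolding wlist_frob[OF cr \<gamma>] wlist_mult[OF prime_p cr \<gamma>] hd \<Psi>_def
      by (simp add: sheaf_simps(2)[OF X(2)] L_def \<gamma>P)
  qed
  moreover have "\<Psi> (\<lambda>k. z k ^ p) = h (z 0)" for z
    using \<phi>(2) cl[of n z p] unfolding \<Psi>_def wlist_frob[OF cr \<gamma>, symmetric] by (simp add: hd \<gamma>P)
  moreover have "\<Psi> z = \<Psi> z'" if "\<forall>i<n. \<pi> (z i) = \<pi> (z' i)" for z z'
  proof -
    have "wlist n \<gamma> z = wlist n \<gamma> z'" using that by (simp add: wlist_def \<gamma>_def)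
    then show ?thesis by (simp add: \<Psi>_def)
  qed
  ultimately show ?thesis by blast
qed

end

section \<open>Ideals and quotients of polynomial rings\<close>

lemma ideal_iff_is_ideal: "ideal J ring_of_type_algebra \<longleftrightarrow> is_ideal J" for J :: "'a::comm_ring_1 set"
proof
  assume "ideal J ring_of_type_algebra"
  then interpret ideal J "ring_of_type_algebra :: 'a ring" .
  show "is_ideal J"
    using additive_subgroup.zero_closed[OF is_additive_subgroup] additive_subgroup.a_closed[OF is_additive_subgroup] I_l_closed
    by (intro is_idealI) simp_all
next
  assume J: "is_ideal J"
  interpret cring "ring_of_type_algebra :: 'a ring" by (rule cring_from_type_algebra)
  show "ideal J ring_of_type_algebra"
  proof (rule idealI[OF ring_axioms])
    show "subgroup J (add_monoid ring_of_type_algebra)"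
    proof (rule add.subgroupI)
      fix a assume a: "a \<in> J"
      have "\<ominus>\<^bsub>ring_of_type_algebra\<^esub> a = - a" by (rule minus_equality) simp_all
      then show "\<ominus>\<^bsub>ring_of_type_algebra\<^esub> a \<in> J" using is_ideal_uminus[OF J a] by simp
    qed (use is_ideal_0[OF J] is_ideal_add[OF J] in auto)
  qed (simp_all add: is_ideal_mult[OF J] is_ideal_mult2[OF J])
qed

lemma genideal_eq_idl: "Idl\<^bsub>ring_of_type_algebra\<^esub> A = idl A" for A :: "'a::comm_ring_1 set"
  by (simp add: genideal_def idl_def ideal_iff_is_ideal)

lemma frobenius_power_eq_fpow: "frobenius_power ring_of_type_algebra J q = fpow J q" for J :: "'a::comm_ring_1 set"
  by (simp add: frobenius_power_def genideal_eq_idl fpow_def type_algebra_pow image_def conj_commute Bex_def)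

lemma reg_if_nth:
  fixes J :: "'a::comm_ring_1 set"
  assumes "is_ideal J" "\<And>i a. i < length gs \<Longrightarrow> a * gs ! i \<in> idl (set (take i gs) \<union> J) \<Longrightarrow> a \<in> idl (set (take i gs) \<union> J)"
  shows "reg J gs"
  using assms
proof (induction gs arbitrary: J)
  case (Cons x gs)
  have "reg (idl (insert x J)) gs"
  proof (rule Cons.IH[OF is_ideal_idl])
    fix i a
    have e: "idl (set (take (Suc i) (x # gs)) \<union> J) = idl (set (take i gs) \<union> idl (insert x J))"
      by (simp add: idl_Un_idl insert_commute)
    assume "i < length gs" "a * gs ! i \<in> idl (set (take i gs) \<union> idl (insert x J))"
    with Cons.prems(2)[of "Suc i" a] show "a \<in> idl (set (take i gs) \<union> idl (insert x J))"
      unfolding e by simp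
  qed
  with Cons.prems(2)[of 0] show ?case by (simp add: idl_ideal[OF Cons.prems(1)])
qed simp

lemma idl_insert_zero: "idl (insert 0 A) = idl A"
  by (intro equalityI idl_mono) (auto intro: idl_base is_ideal_0[OF is_ideal_idl])

lemma regular_sequence_reg:
  assumes "regular_sequence ring_of_type_algebra (gs :: 'a::comm_ring_1 list)"
  shows "reg {0} gs" "1 \<notin> idl (set gs)"
proof -
  show "reg {0} gs"
    using assms by (intro reg_if_nth is_ideal_zero) (simp add: idl_insert_zero regular_sequence_def genideal_eq_idl)
  show "1 \<notin> idl (set gs)"
  proof
    assume "1 \<in> idl (set gs)"
    then have "a \<in> idl (set gs)" for a using is_ideal_mult[OF is_ideal_idl, of 1 "set gs" a] by simp
    then have "idl (set gs) = UNIV" by auto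
    then show False using assms by (simp add: regular_sequence_def genideal_eq_idl)
  qed
qed

lemma quotient_presentation:
  fixes J :: "'a::comm_ring_1 set"
  assumes J: "is_ideal J"
  defines "R \<equiv> ring_of_type_algebra Quot J" and "\<pi> \<equiv> \<lambda>a. J +>\<^bsub>ring_of_type_algebra\<^esub> a"
  shows "cring R" "\<pi> \<in> ring_hom ring_of_type_algebra R" "carrier R = range \<pi>" "\<pi> a = \<pi> b \<longleftrightarrow> a - b \<in> J"
proof -
  interpret cring "ring_of_type_algebra :: 'a ring" by (rule cring_from_type_algebra)
  interpret ideal J "ring_of_type_algebra :: 'a ring" using J by (simp add: ideal_iff_is_ideal)
  show "cring R" unfolding R_def by (rule quotient_is_cring[OF cring_axioms])
  show "\<pi> \<in> ring_hom ring_of_type_algebra R" unfolding R_def \<pi>_def by (rule rcos_ring_hom)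
  show "carrier R = range \<pi>" by (auto simp: R_def \<pi>_def FactRing_def A_RCOSETS_def')
  have \<pi>: "\<pi> a = (\<lambda>j. j + a) ` J" for a by (auto simp: \<pi>_def a_r_coset_def')
  show "\<pi> a = \<pi> b \<longleftrightarrow> a - b \<in> J"
  proof
    assume "\<pi> a = \<pi> b"
    moreover have "a \<in> \<pi> a" unfolding \<pi> using is_ideal_0[OF J] by force
    ultimately have "a \<in> \<pi> b" by simp
    then show "a - b \<in> J" unfolding \<pi> by auto
  next
    assume d: "a - b \<in> J"
    have "x - b \<in> J \<longleftrightarrow> x - a \<in> J" for x
      using is_ideal_add[OF J _ d, of "x - a"] is_ideal_diff[OF J _ d, of "x - b"] by auto
    moreover have "x \<in> \<pi> c \<longleftrightarrow> x - c \<in> J" for x c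
      unfolding \<pi> by (auto simp: image_iff intro: bexI[of _ "x - c"])
    ultimately show "\<pi> a = \<pi> b" by auto
  qed
qed

section \<open>Constant terms and the irrelevant ideal\<close>

context poly_graded
begin

text \<open>All variables have positive weight, so the component of degree 0 is the constant
  term.\<close>

lemma component_zero_mult: "component 0 (a * b) = component 0 a * component 0 b"
proof (induction b rule: poly_mapping_single_induct)
  case (single m c)
  let ?b = "Poly_Mapping.single m c :: ('n, 'k) mpoly"
  show ?case
  proof (cases "m = 0")
    case True
    then show ?thesis using component_mult[of 0 ?b 0 a] by (simp add: component_single)
  next
    case False
    then have "wdeg m \<noteq> 0" using wdeg_eq_0 by blast
    then show ?thesis using component_mult_low[of "wdeg m" ?b 0 a] by (simp add: component_single)
  qed
qed (simp_all add: distrib_left component_add)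

lemma sum_components: "(\<Sum>d\<in>wdeg ` Poly_Mapping.keys a. component d a) = a"
proof (rule poly_mapping_eqI)
  fix m
  show "Poly_Mapping.lookup (\<Sum>d\<in>wdeg ` Poly_Mapping.keys a. component d a) m = Poly_Mapping.lookup a m"
    by (auto simp: lookup_sum lookup_component in_keys_iff)
qed

text \<open>In degree d the product w a has the summand w_0 a_d with w_0 a unit, and the other
  summands involve components of a of smaller degree, which lie in J by induction. This is what
  embeds S/I into its localization at the irrelevant ideal.\<close>

lemma homogeneous_ideal_cancel:
  assumes J: "is_ideal J" "\<And>d a. a \<in> J \<Longrightarrow> component d a \<in> J"
    and w: "component 0 w \<noteq> 0" "w * a \<in> J"
  shows "a \<in> J"
proof -
  obtain b where b: "component 0 w * b = 1" using comp_unit[of "component 0 w"] w(1) comp_comp by auto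
  let ?E = "wdeg ` Poly_Mapping.keys a"
  have "component d a \<in> J" for d
  proof (induction d rule: less_induct)
    case (less d)
    have mult: "component d (w * component e a) = (if e \<le> d then component (d - e) w * component e a else 0)" for e
      using comp_mult[of e "component e a" "d - e" w] comp_mult_low[of e "component e a" d w] comp_comp by auto
    show ?case
    proof (cases "d \<in> ?E")
      case True
      have "component d (w * a) = (\<Sum>e\<in>?E. component d (w * component e a))"
        by (simp add: sum_components flip: component_sum sum_distrib_left)
      also have "\<dots> = component 0 w * component d a + (\<Sum>e\<in>?E - {d}. component d (w * component e a))"
        using True by (simp add: sum.remove[of _ d] mult)
      finally have "component 0 w * component d a = component d (w * a) - (\<Sum>e\<in>?E - {d}. component d (w * component e a))"
        by simp
      moreover have "(\<Sum>e\<in>?E - {d}. component d (w * component e a)) \<in> J"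
        using less is_ideal_0[OF J(1)] by (intro is_ideal_sum[OF J(1)]) (auto simp: mult intro!: is_ideal_mult[OF J(1)])
      ultimately have "component 0 w * component d a \<in> J"
        using J(2)[OF w(2)] by (simp add: is_ideal_diff[OF J(1)])
      from is_ideal_mult[OF J(1) this, of b] show ?thesis
        using b by (simp add: mult.assoc[symmetric] mult.commute[of b])
    next
      case False
      then have "component d a = 0"
        by (intro poly_mapping_eqI) (auto simp: lookup_component in_keys_iff)
      then show ?thesis using is_ideal_0[OF J(1)] by simp
    qed
  qed
  then have "(\<Sum>d\<in>?E. component d a) \<in> J" by (intro is_ideal_sum[OF J(1)])
  then show ?thesis by (simp add: sum_components)
qed

lemma hom_0_iff: "hom 0 a \<longleftrightarrow> (\<exists>c. a = Const c)"
proof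
  assume a: "hom 0 a"
  have "a = Const (Poly_Mapping.lookup a 0)"
  proof (rule poly_mapping_eqI)
    fix m
    have "m \<notin> Poly_Mapping.keys a" if "m \<noteq> 0"
      using a that wdeg_eq_0[of m] by (auto simp: hom_def component_eq_iff)
    then show "Poly_Mapping.lookup a m = Poly_Mapping.lookup (Const (Poly_Mapping.lookup a 0)) m"
      by (auto simp: Const_def lookup_single when_def in_keys_iff)
  qed
  then show "\<exists>c. a = Const c" ..
qed (auto simp: hom_def Const_def component_single)

definition irrelevant :: "('n, 'k) mpoly set" where "irrelevant = {a. component 0 a = 0}"

lemma is_ideal_irrelevant: "is_ideal irrelevant"
  by (intro is_idealI) (simp_all add: irrelevant_def component_add component_zero_mult)

lemma wdeg_single: "wdeg (Poly_Mapping.single i k) = wt i * k"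
proof -
  have "(\<Sum>j\<in>UNIV. wt j * Poly_Mapping.lookup (Poly_Mapping.single i k) j) = (\<Sum>j\<in>UNIV. if j = i then wt i * k else 0)"
    by (rule sum.cong) (auto simp: lookup_single when_def)
  then show ?thesis by (simp add: wdeg_def)
qed

lemma idl_Var: "idl (range Var) = irrelevant"
proof
  have wt_nz: "wt i \<noteq> 0" for i using wt_pos[of i] by simp
  show "idl (range Var) \<subseteq> irrelevant"
    by (intro idl_minimal is_ideal_irrelevant) (auto simp: irrelevant_def Var_def component_single wdeg_single wt_nz)
  have d: "a - component 0 a \<in> idl (range Var)" for a :: "('n, 'k) mpoly"
  proof (induction a rule: poly_mapping_single_induct)
    case (single m c)
    show ?case
    proof (cases "m = 0")
      case True
      then show ?thesis by (simp add: component_single is_ideal_0[OF is_ideal_idl])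
    next
      case False
      then obtain i where i: "Poly_Mapping.lookup m i \<noteq> 0" by (metis poly_mapping_eqI lookup_zero)
      have "m = (m - Poly_Mapping.single i 1) + Poly_Mapping.single i 1"
        using i by (intro poly_mapping_eqI) (auto simp: lookup_add lookup_minus lookup_single when_def)
      then have "Poly_Mapping.single m c = Poly_Mapping.single (m - Poly_Mapping.single i 1) c * Var i"
        by (simp add: Var_def mult_single)
      moreover have "component 0 (Poly_Mapping.single m c) = 0"
        using False wdeg_eq_0[of m] by (auto simp: component_single)
      ultimately show ?thesis using is_ideal_mult[OF is_ideal_idl idl_base, of "Var i" "range Var"] by simp
    qed
  next
    case zero
    then show ?case by (simp add: is_ideal_0[OF is_ideal_idl])
  next
    case (add a b)
    then show ?case using is_ideal_add[OF is_ideal_idl add(1) add(2)] by (simp add: component_add algebra_simps)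
  qed
  show "irrelevant \<subseteq> idl (range Var)" using d unfolding irrelevant_def by (metis (mono_tags) diff_zero mem_Collect_eq subsetI)
qed

end

section \<open>The criterion over polynomial rings and its two reformulations\<close>

locale fedder_poly = poly_graded p s y u wt for p s :: nat and y :: "nat \<Rightarrow> 'k::field"
    and u :: "('n::finite, 'k) mpoly \<Rightarrow> ('n, 'k) mpoly" and wt :: "'n \<Rightarrow> nat" +
  fixes fs :: "('n, 'k) mpoly list" and f \<delta> :: "('n, 'k) mpoly"
  assumes hom_fs: "x \<in> set fs \<Longrightarrow> \<exists>e. hom e x"
    and prod_fs: "f = prod_list fs"
    and hom_f: "hom \<nu> f"
    and \<delta>_Delta: "\<delta> \<approx> Delta (f ^ (p - 1))"
    and hom_\<delta>: "hom (p * (p - 1) * \<nu>) \<delta>"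
    and reg_fs: "reg {0} fs"
    and proper_fs: "1 \<notin> idl (set fs)"

sublocale fedder_poly \<subseteq> fedder p PM Delta u "map (\<lambda>a. (dv a, vv a)) idx" component \<nu> fs f \<delta>
  by unfold_locales (fact hom_fs prod_fs hom_f \<delta>_Delta hom_\<delta> reg_fs proper_fs)+

context fedder_poly
begin

text \<open>Pushing \<delta>^e through u makes it \<delta>^{pe}, and \<theta> brings one more factor
  \<delta>: the exponent e becomes p e + 1, which produces 1 + p + ... + p^{j-1}.\<close>

lemma theta_eq_u_power: "u ((\<theta> ^^ j) b) = (u ^^ Suc j) (\<delta> ^ (\<Sum>i<j. p ^ i) * b)"
proof (induction j arbitrary: b)
  case (Suc j)
  have "(\<Sum>i<Suc j. p ^ i) = (\<Sum>i<j. p ^ i) * p + 1"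
    by (simp add: sum.lessThan_Suc_shift sum_distrib_left mult.commute[of _ p] del: sum.lessThan_Suc)
  then have e: "\<delta> ^ (\<Sum>i<Suc j. p ^ i) = (\<delta> ^ (\<Sum>i<j. p ^ i)) ^ p * \<delta>"
    by (simp only: power_add power_mult power_one_right)
  have "u ((\<theta> ^^ Suc j) b) = (u ^^ Suc j) (\<delta> ^ (\<Sum>i<j. p ^ i) * u (\<delta> * b))"
    using Suc[of "\<theta> b"] by (simp only: funpow_Suc_right o_apply \<theta>_def[of b])
  also have "\<dots> = (u ^^ Suc j) (u ((\<delta> ^ (\<Sum>i<j. p ^ i)) ^ p * (\<delta> * b)))" by (simp only: u_scale)
  also have "\<dots> = (u ^^ Suc (Suc j)) (\<delta> ^ (\<Sum>i<Suc j. p ^ i) * b)"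
    by (simp only: e mult.assoc funpow_Suc_right[of "Suc j"] o_apply)
  finally show ?case .
qed simp

text \<open>By the pairing lemmas, a lies in m^[p] if and only if every u (b a) has constant term 0.
  That constant term is u (b_0 a), where b_0 is the constant term of b, and b_0 is absorbed into c
  as its p^{n-1}-th power.\<close>

lemma crit_iff_theta:
  "crit n \<longleftrightarrow> \<not> (\<theta> ^^ (n - 1)) ` {f ^ (p - 1) * Const c | c. True} \<subseteq> fpow irrelevant p"
proof
  assume "crit n"
  then obtain c where c: "hom 0 c" "u ((\<theta> ^^ (n - 1)) (f ^ (p - 1) * c)) \<noteq> 0" by (auto simp: crit_def)
  let ?a = "(\<theta> ^^ (n - 1)) (f ^ (p - 1) * c)"
  have "hom 0 (u ?a)" by (intro hom_u_zero hom_\<theta>i hom_start c)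
  then have "u ?a \<notin> irrelevant" using c(2) by (simp add: irrelevant_def hom_def)
  then have "?a \<notin> fpow irrelevant p" using pairing_mem[OF is_ideal_irrelevant, of ?a 1 1] by auto
  then show "\<not> (\<theta> ^^ (n - 1)) ` {f ^ (p - 1) * Const c | c. True} \<subseteq> fpow irrelevant p"
    using c(1) by (auto simp: hom_0_iff)
next
  assume "\<not> (\<theta> ^^ (n - 1)) ` {f ^ (p - 1) * Const c | c. True} \<subseteq> fpow irrelevant p"
  then obtain c' where "(\<theta> ^^ (n - 1)) (f ^ (p - 1) * Const c') \<notin> fpow irrelevant p" by blast
  then obtain c where c: "hom 0 c" "(\<theta> ^^ (n - 1)) (f ^ (p - 1) * c) \<notin> fpow irrelevant p" (is "?a \<notin> _")
    using hom_0_iff by blast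
  from c(2) have "\<exists>b. u (b * ?a) \<notin> irrelevant"
    using pairing_detect[OF is_ideal_irrelevant, of 1 ?a] by auto
  then obtain b where b: "u (b * ?a) \<notin> irrelevant" ..
  have a: "hom ((p - 1) * \<nu>) ?a" by (intro hom_\<theta>i hom_start c)
  have "component 0 (u (b * ?a)) = u (component 0 b * ?a)"
    using comp_mult[OF a[unfolded hom_def], of 0 b] by (simp add: comp_u del: One_nat_def)
  also have "component 0 b * ?a = (\<theta> ^^ (n - 1)) (f ^ (p - 1) * (component 0 b ^ (p ^ (n - 1)) * c))"
    by (simp add: mult.left_commute[of "f ^ _"] \<theta>i_scale del: One_nat_def)
  finally show "crit n" using b hom_mult[OF hom_power[OF hom_comp[of 0 b], of "p ^ (n - 1)"] c(1)]
    by (auto simp: crit_def irrelevant_def)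
qed

text \<open>The element f_n has degree (p^n - 1) \<nu>, which u^n sends to degree 0. So only
  constant multiples of f_n matter in the pairing, and by \<open>theta_eq_u_power\<close> their
  images under u^n are the values in \<open>crit\<close>.\<close>

lemma crit_iff_power:
  assumes n: "n \<ge> 1"
  shows "crit n \<longleftrightarrow> f ^ (p - 1) * \<delta> ^ (\<Sum>i<n - 1. p ^ i) \<notin> fpow irrelevant (p ^ n)"
proof -
  let ?F = "f ^ (p - 1) * \<delta> ^ (\<Sum>i<n - 1. p ^ i)"
  have u: "u ((\<theta> ^^ (n - 1)) (f ^ (p - 1) * c)) = (u ^^ n) (c * ?F)" for c
    using n theta_eq_u_power[of "n - 1"] by (simp add: mult_ac del: funpow.simps)
  have geo: "(p - 1) * (\<Sum>i<m. p ^ i) = p ^ m - 1" for m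
  proof (induction m)
    case (Suc m)
    have "(p - 1) * (\<Sum>i<Suc m. p ^ i) = (p ^ m - 1) + (p - 1) * p ^ m"
      unfolding Suc[symmetric] by (simp only: sum.lessThan_Suc distrib_left)
    also have "\<dots> = p ^ Suc m - 1"
      using p_gt_0 by (simp add: diff_mult_distrib)
    finally show ?case .
  qed simp
  have "hom ((p - 1) * \<nu> + (\<Sum>i<n - 1. p ^ i) * (p * (p - 1) * \<nu>)) ?F"
    by (intro hom_mult hom_f_power hom_power \<delta>_hom)
  moreover have "(p - 1) * \<nu> + (\<Sum>i<n - 1. p ^ i) * (p * (p - 1) * \<nu>) = (p ^ n - 1) * \<nu>"
  proof -
    have "(p - 1) * \<nu> + (\<Sum>i<n - 1. p ^ i) * (p * (p - 1) * \<nu>) = ((p - 1) + p * ((p - 1) * (\<Sum>i<n - 1. p ^ i))) * \<nu>"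
      by (simp add: algebra_simps)
    also have "(p - 1) + p * ((p - 1) * (\<Sum>i<n - 1. p ^ i)) = p ^ n - 1"
      using n p_gt_0 unfolding geo by (cases n) (auto simp: diff_mult_distrib2)
    finally show ?thesis .
  qed
  ultimately have F: "hom ((p ^ n - 1) * \<nu>) ?F" by simp
  have comp: "component 0 ((u ^^ n) (b * ?F)) = (u ^^ n) (component 0 b * ?F)" for b
    using comp_mult[OF F[unfolded hom_def], of 0 b] by (simp add: comp_ui del: One_nat_def)
  have "?F \<in> fpow irrelevant (p ^ n) \<longleftrightarrow> (\<forall>b. (u ^^ n) (b * ?F) \<in> irrelevant)"
    using pairing_mem[OF is_ideal_irrelevant, of ?F n] pairing_detect[OF is_ideal_irrelevant, of n ?F] by blast
  also have "\<dots> \<longleftrightarrow> (\<forall>b. (u ^^ n) (component 0 b * ?F) = 0)"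
    unfolding irrelevant_def mem_Collect_eq comp ..
  also have "\<dots> \<longleftrightarrow> (\<forall>c. hom 0 c \<longrightarrow> (u ^^ n) (c * ?F) = 0)"
    using hom_comp by (metis hom_def)
  finally show ?thesis unfolding crit_def u by blast
qed

end

section \<open>The height of a graded complete intersection\<close>

context fedder_poly
begin

abbreviation "ideal_fs \<equiv> idl (set fs)"
abbreviation "quot \<equiv> ring_of_type_algebra Quot ideal_fs"
abbreviation "coset \<equiv> (+>\<^bsub>ring_of_type_algebra\<^esub>) ideal_fs"

lemma coset_eq_iff: "coset a = coset b \<longleftrightarrow> a - b \<in> ideal_fs"
  by (rule quotient_presentation(4)[OF is_ideal_idl])

lemma presented_quot: "n > 0 \<Longrightarrow> presented quot p n coset"
  using prime_p quotient_presentation[OF is_ideal_idl, of "set fs"]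
  by (intro presented.intro presented_axioms.intro)

lemma component_ideal: "a \<in> ideal_fs \<Longrightarrow> component d a \<in> ideal_fs"
  by (rule comp_idl[OF hom_fs])

text \<open>A generator with nonzero constant term would put this unit into the homogeneous
  ideal.\<close>

lemma ideal_subset_irrelevant: "ideal_fs \<subseteq> irrelevant"
proof (rule idl_minimal[OF is_ideal_irrelevant], rule subsetI)
  fix x assume x: "x \<in> set fs"
  then have "component 0 x \<in> ideal_fs" by (intro component_ideal idl_base)
  moreover have "component 0 (component 0 x) = component 0 x" by (simp add: comp_comp)
  ultimately have "component 0 x = 0"
    using comp_unit[of "component 0 x"] proper_fs is_ideal_mult2[OF is_ideal_idl] by metis
  then show "x \<in> irrelevant" by (simp add: irrelevant_def)
qed

lemma coset_irrelevant_iff: "coset a \<in> coset ` irrelevant \<longleftrightarrow> component 0 a = 0"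
proof
  assume "coset a \<in> coset ` irrelevant"
  then obtain b where "component 0 b = 0" "a - b \<in> ideal_fs"
    unfolding image_iff coset_eq_iff by (auto simp: irrelevant_def)
  then show "component 0 a = 0" using ideal_subset_irrelevant by (auto simp: irrelevant_def comp_diff)
qed (auto simp: irrelevant_def)

text \<open>The constant term is multiplicative, so primality reduces to the absence of zero
  divisors.\<close>

lemma prime_irrelevant: "coset ` irrelevant \<in> Spec quot"
proof -
  interpret presented quot p 1 coset by (rule presented_quot) simp
  have cr: "coset ` irrelevant \<subseteq> carrier quot" using \<pi>_closed by blast
  show ?thesis unfolding Spec_def mem_Collect_eq
  proof (rule primeidealI[OF idealI[OF ring_axioms] cring_axioms])
    show "subgroup (coset ` irrelevant) (add_monoid quot)"
    proof (rule add.subgroupI)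
      show "coset ` irrelevant \<noteq> {}" using is_ideal_0[OF is_ideal_irrelevant] by blast
      fix a assume "a \<in> coset ` irrelevant"
      then obtain a' where a: "a = coset a'" "a' \<in> irrelevant" by blast
      have "\<ominus>\<^bsub>quot\<^esub> a = coset (- a')"
        unfolding a(1) by (rule minus_equality) (simp_all add: \<pi>_zero flip: \<pi>_add)
      then show "\<ominus>\<^bsub>quot\<^esub> a \<in> coset ` irrelevant" using a(2) is_ideal_uminus[OF is_ideal_irrelevant] by simp
      fix b assume "b \<in> coset ` irrelevant"
      then show "a \<oplus>\<^bsub>quot\<^esub> b \<in> coset ` irrelevant"
        using a is_ideal_add[OF is_ideal_irrelevant] by (auto simp flip: \<pi>_add)
    qed (rule cr)
    show "x \<otimes>\<^bsub>quot\<^esub> a \<in> coset ` irrelevant" "a \<otimes>\<^bsub>quot\<^esub> x \<in> coset ` irrelevant"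
      if "a \<in> coset ` irrelevant" "x \<in> carrier quot" for a x
      using that is_ideal_mult[OF is_ideal_irrelevant] is_ideal_mult2[OF is_ideal_irrelevant]
      unfolding \<pi>_surj by (auto simp flip: \<pi>_mult)
    have "coset 1 \<notin> coset ` irrelevant" unfolding coset_irrelevant_iff by (simp add: comp_1)
    then show "carrier quot \<noteq> coset ` irrelevant" using \<pi>_closed by metis
    fix a b assume "a \<in> carrier quot" "b \<in> carrier quot" and ab: "a \<otimes>\<^bsub>quot\<^esub> b \<in> coset ` irrelevant"
    then obtain a' b' where a: "a = coset a'" "b = coset b'" unfolding \<pi>_surj by blast
    show "a \<in> coset ` irrelevant \<or> b \<in> coset ` irrelevant"
      using ab mpoly_no_zero_divisors unfolding a \<pi>_mult[symmetric] coset_irrelevant_iff component_zero_mult by blast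
  qed
qed

lemma crit_of_split:
  assumes n: "n \<ge> 1" and sp: "n_quasi_F_split p n (zariski_opens quot) (spec_sheaf quot) (\<lambda>U V \<xi>. restrict \<xi> V)"
  shows "\<exists>j. 1 \<le> j \<and> j \<le> n \<and> crit j"
proof -
  interpret presented quot p n coset by (rule presented_quot) (use n in simp)
  let ?P = "coset ` irrelevant" and ?D = "{s. component 0 s \<noteq> 0}"
  let ?M = "carrier quot - ?P"
  let ?L = "localization quot ?M"
  interpret mult_set quot ?M by (rule mult_set_prime) (use prime_irrelevant in \<open>simp add: Spec_def\<close>)
  interpret L: cring ?L by (rule cring_L)
  define h where "h a = fraction quot ?M (coset a) \<one>\<^bsub>quot\<^esub>" for a
  have M_iff: "coset s \<in> ?M \<longleftrightarrow> component 0 s \<noteq> 0" for s using coset_irrelevant_iff[of s] by simp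
  have hM: "h \<in> ring_hom ring_of_type_algebra ?L"
    unfolding h_def by (rule frac_pi_hom) unfold_locales
  have h: "h (a * b) = h a \<otimes>\<^bsub>?L\<^esub> h b" "h (a + b) = h a \<oplus>\<^bsub>?L\<^esub> h b" "h 1 = \<one>\<^bsub>?L\<^esub>" "h a \<in> carrier ?L" for a b
    using ring_hom_mult[OF hM] ring_hom_add[OF hM] ring_hom_one[OF hM] ring_hom_closed[OF hM] by simp_all
  \<comment> \<open>The map from S to the stalk at the irrelevant ideal has kernel exactly I, so
    relations in the stalk descend to S.\<close>
  have h_eq: "h a = h b \<longleftrightarrow> a - b \<in> ideal_fs" for a b
  proof
    assume "h a = h b"
    then obtain w where w: "w \<in> ?M" "w \<otimes>\<^bsub>quot\<^esub> coset a = w \<otimes>\<^bsub>quot\<^esub> coset b"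
      unfolding h_def using M_one frac_eq_iff[of "coset a" "coset b" "\<one>\<^bsub>quot\<^esub>" "\<one>\<^bsub>quot\<^esub>"] by auto
    obtain w' where w': "w = coset w'" using w(1) \<pi>_surj by blast
    have "w' * (a - b) \<in> ideal_fs"
      using w(2) unfolding w' \<pi>_mult[symmetric] coset_eq_iff by (simp add: right_diff_distrib)
    moreover have "component 0 w' \<noteq> 0" using w(1) unfolding w' M_iff .
    ultimately show "a - b \<in> ideal_fs" using homogeneous_ideal_cancel[OF is_ideal_idl component_ideal] by blast
  next
    assume "a - b \<in> ideal_fs"
    then show "h a = h b" unfolding h_def coset_eq_iff[symmetric] by simp
  qed
  from stalk_split[OF sp prime_irrelevant] obtain \<Psi> where \<Psi>: "(\<forall>z. \<Psi> z \<in> carrier ?L) \<and>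
      (\<forall>z w. \<Psi> (wadd p z w) = \<Psi> z \<oplus>\<^bsub>?L\<^esub> \<Psi> w) \<and>
      (\<forall>a z. \<Psi> (wmul p (\<lambda>k. a k ^ p) z) = h (a 0) \<otimes>\<^bsub>?L\<^esub> \<Psi> z) \<and> (\<forall>z. \<Psi> (\<lambda>k. z k ^ p) = h (z 0)) \<and>
      (\<forall>z z'. (\<forall>i<n. coset (z i) = coset (z' i)) \<longrightarrow> \<Psi> z = \<Psi> z')" unfolding h_def ..
  have \<Psi>1: "\<Psi> z \<in> carrier ?L" "\<Psi> (wadd p z w) = \<Psi> z \<oplus>\<^bsub>?L\<^esub> \<Psi> w"
      "\<Psi> (wmul p (\<lambda>k. a k ^ p) z) = h (a 0) \<otimes>\<^bsub>?L\<^esub> \<Psi> z" "\<Psi> (\<lambda>k. z k ^ p) = h (z 0)" for z w a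
    using \<Psi> by (auto simp only:)
  have \<Psi>2: "\<Psi> z = \<Psi> z'" if "\<forall>i<n. coset (z i) = coset (z' i)" for z z'
    using \<Psi> that by (simp only:)
  define T where "T z s a \<longleftrightarrow> h s \<otimes>\<^bsub>?L\<^esub> \<Psi> z = h a" for z s a
  have "\<exists>g. \<exists>s\<in>?D. u (g 0) - s \<in> ideal_fs \<and> kills ideal_fs 0 g n \<and>
      (\<forall>i<n. \<forall>x\<in>ideal_fs. obstruction g n i x \<in> fpow ideal_fs (p ^ Suc i))"
  proof (rule data_of_splitting[where T = T])
    show "s * t \<in> ?D" if "s \<in> ?D" "t \<in> ?D" for s t
      using that mpoly_no_zero_divisors[of "component 0 s" "component 0 t"] by (auto simp: component_zero_mult)
    show "\<exists>s\<in>?D. \<exists>a. T z s a" for z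
    proof -
      obtain b t where b: "\<Psi> z = fraction quot ?M b t" "b \<in> carrier quot" "t \<in> ?M" using \<Psi>1(1)[of z] by (rule frac_cases)
      obtain a where a1: "b = coset a" using b(2) \<pi>_surj by blast
      obtain s where "t = coset s" using b(3) \<pi>_surj by blast
      note a = a1 this
      have s: "s \<in> ?D" using b(3) M_iff[of s] by (simp add: a)
      have "h s \<otimes>\<^bsub>?L\<^esub> \<Psi> z = fraction quot ?M (coset s \<otimes>\<^bsub>quot\<^esub> coset a) (\<one>\<^bsub>quot\<^esub> \<otimes>\<^bsub>quot\<^esub> coset s)"
        unfolding h_def b(1) a using b(3)[unfolded a] M_one by (intro frac_mult) (auto simp only: \<pi>_closed)
      also have "\<dots> = h a" unfolding h_def
        using b(3)[unfolded a] M_one by (intro frac_eqI) (auto simp: m_comm)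
      finally show ?thesis using s unfolding T_def by blast
    qed
    show "T z (t * s) (t * a)" if "T z s a" for z s a t
      using that h \<Psi>1(1) by (simp add: T_def L.m_assoc)
    show "a - b \<in> ideal_fs" if "T z s a" "T z s b" for z s a b
      using that by (simp add: T_def flip: h_eq)
    show "T z s b" if "T z s a" "a - b \<in> ideal_fs" for z s a b
      using that by (simp add: T_def flip: h_eq)
    show "T (wadd p z w) s (a + b)" if "T z s a" "T w s b" for z w s a b
      using that h \<Psi>1 by (simp add: T_def L.r_distr)
    show "T (wmul p (\<lambda>k. c k ^ p) z) s (c 0 * a)" if "T z s a" for z s a c
      using that L.m_lcomm[of "h s" "h (c 0)" "\<Psi> z"] h(4) \<Psi>1(1) by (simp add: T_def h(1) \<Psi>1(3))
    show "T (\<lambda>k. z k ^ p) 1 (z 0)" for z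
      using h \<Psi>1 by (simp add: T_def)
    show "T z 1 0" if "\<And>j. j < n \<Longrightarrow> z j \<in> ideal_fs" for z
    proof -
      have "coset (z j) = coset (0 ^ p)" if "j < n" for j
        using \<open>\<And>j. j < n \<Longrightarrow> z j \<in> ideal_fs\<close>[OF that] p_gt_0 unfolding coset_eq_iff by simp
      then have "\<Psi> z = \<Psi> (\<lambda>k. 0 ^ p)" by (intro \<Psi>2) blast
      also have "\<dots> = h 0" using \<Psi>1(4)[of "\<lambda>_. 0"] .
      finally show ?thesis using h by (simp add: T_def)
    qed
  qed (use n in \<open>simp_all add: is_ideal_idl comp_1\<close>)
  then obtain g s where "component 0 s \<noteq> 0" "u (g 0) - s \<in> ideal_fs"
    and "\<forall>i<n. \<forall>x\<in>ideal_fs. obstruction g n i x \<in> fpow ideal_fs (p ^ Suc i)" by blast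
  then show ?thesis using n idl_superset[of "set fs"] by (intro crit_of_data) auto
qed

lemma split_of_crit:
  assumes n: "n \<ge> 1" and c: "crit n" and min: "\<And>j. 1 \<le> j \<Longrightarrow> j < n \<Longrightarrow> \<not> crit j"
  shows "n_quasi_F_split p n (zariski_opens quot) (spec_sheaf quot) (\<lambda>U V \<xi>. restrict \<xi> V)"
proof -
  interpret presented quot p n coset by (rule presented_quot) (use n in simp)
  from data_of_crit[OF assms] obtain g where g: "u (g 0) = 1 \<and> (\<forall>j. 0 < j \<longrightarrow> j < n \<longrightarrow> u (g j) = 0) \<and>
    (\<forall>i<n. \<forall>x\<in>set fs. obstruction g n i x \<in> fpow ideal_fs (p ^ Suc i))" ..
  then have g': "u (g 0) = 1" "\<And>j. 0 < j \<Longrightarrow> j < n \<Longrightarrow> u (g j) = 0" "0 < n"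
    "\<And>i x. i < n \<Longrightarrow> x \<in> set fs \<Longrightarrow> obstruction g n i x \<in> fpow ideal_fs (p ^ Suc i)" using n by auto
  note \<Phi> = splitting_of_data[OF g']
  interpret ring_split quot p n coset "\<lambda>z. coset (psi 0 g n z)"
  proof unfold_locales
    fix z z' assume "\<And>i. i < n \<Longrightarrow> coset (z i) = coset (z' i)"
    then have "psi 0 g n z - psi 0 g n z' \<in> ideal_fs" unfolding coset_eq_iff by (intro \<Phi>(4)) auto
    then show "coset (psi 0 g n z) = coset (psi 0 g n z')" unfolding coset_eq_iff .
  qed (simp_all add: \<Phi>(1-3) \<pi>_add \<pi>_mult)
  show ?thesis by (rule n_quasi_F_split_Spec)
qed

text \<open>The two sets of integers are not compared elementwise, since
  \<open>split_of_crit\<close> is available only at the least n with \<open>crit\<close> and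
  \<open>crit_of_split\<close> gives some j up to n. Each element of either set is instead bounded
  below by an element of the other.\<close>

lemma height_eq: "ht p quot = Inf {enat n | n. n \<ge> 1 \<and> crit n}"
  unfolding ht_def ht_ringed_space_def
proof (rule antisym; rule Inf_mono; clarify)
  fix n assume "1 \<le> n" "crit n"
  define j where "j = (LEAST j. 1 \<le> j \<and> crit j)"
  have j: "1 \<le> j" "crit j" "j \<le> n" and "\<And>i. 1 \<le> i \<Longrightarrow> i < j \<Longrightarrow> \<not> crit i"
    using LeastI[of "\<lambda>j. 1 \<le> j \<and> crit j" n] Least_le[of "\<lambda>j. 1 \<le> j \<and> crit j"] \<open>1 \<le> n\<close> \<open>crit n\<close>
    unfolding j_def[symmetric] by (auto simp: not_le[symmetric])
  then show "\<exists>a\<in>{enat n |n. 1 \<le> n \<and>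
      n_quasi_F_split p n (zariski_opens quot) (spec_sheaf quot) (\<lambda>U V \<xi>. restrict \<xi> V)}. a \<le> enat n"
    using split_of_crit[of j] by (intro bexI[of _ "enat j"]) auto
next
  fix n assume "1 \<le> n" "n_quasi_F_split p n (zariski_opens quot) (spec_sheaf quot) (\<lambda>U V \<xi>. restrict \<xi> V)"
  then obtain j where "1 \<le> j" "j \<le> n" "crit j" using crit_of_split by blast
  then show "\<exists>a\<in>{enat n |n. 1 \<le> n \<and> crit n}. a \<le> enat n" by (intro bexI[of _ "enat j"]) auto
qed

lemma \<nu>_pos: "\<nu> > 0"
  unfolding \<nu>_def using wt_pos by (intro sum_pos) auto

lemma f_nonzero: "f \<noteq> 0"
proof
  assume "f = 0"
  \<comment> \<open>With q = 2 and f = 0, cancelling the power of the product would put 1 into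
    I.\<close>
  then have "prod_list fs ^ (2 - 1) * 1 \<in> idl ((\<lambda>y. y ^ 2) ` set fs \<union> {0})"
    by (simp add: prod_fs is_ideal_0[OF is_ideal_idl])
  then have "1 \<in> idl (set fs \<union> {0})" by (rule reg_prod_power_cancel[OF is_ideal_zero reg_fs, rotated]) simp
  then show False using proper_fs by (simp add: idl_insert_zero)
qed

text \<open>The one-element sequence satisfies the same hypotheses: f is a nonzero element of a
  domain and, being of positive degree, generates a proper ideal.\<close>

lemma fedder_poly_principal: "fedder_poly p s y u wt [f] f \<delta>"
proof unfold_locales
  have "component 0 f = 0"
    using hom_f comp_comp[of 0 \<nu> f] \<nu>_pos by (simp add: hom_def)
  then have "idl (set [f]) \<subseteq> irrelevant"
    by (intro idl_minimal is_ideal_irrelevant) (simp add: irrelevant_def)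
  moreover have "1 \<notin> irrelevant" by (simp add: irrelevant_def comp_1)
  ultimately show "1 \<notin> idl (set [f])" by blast
  show "reg {0} [f]" using f_nonzero mpoly_no_zero_divisors by auto
qed (use hom_f hom_\<delta> \<delta>_Delta in auto)

lemma \<theta>_eqI: "(\<And>a. t a = u (\<delta> * a)) \<Longrightarrow> t = \<theta>"
  by (simp add: fun_eq_iff \<theta>_def)

text \<open>The predicate \<open>crit\<close> depends on f and \<delta> but not on the sequence, so
  both heights are the same infimum.\<close>

lemma height_principal: "ht p quot = ht p (ring_of_type_algebra Quot idl {f})"
proof -
  interpret B: fedder_poly p s y u wt "[f]" f \<delta> by (rule fedder_poly_principal)
  show ?thesis using height_eq B.height_eq by simp
qed

end

section \<open>Passage from the multigrading to total weight\<close>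

lemma wdeg_eq_sum_monom_degree:
  "(\<Sum>i\<in>UNIV. (\<Sum>q\<in>UNIV. vec_nth (\<mu> i) q) * Poly_Mapping.lookup m i) = (\<Sum>q\<in>UNIV. vec_nth (monom_degree \<mu> m) q)"
proof -
  have "(\<Sum>q\<in>UNIV. vec_nth (monom_degree \<mu> m) q) = (\<Sum>q\<in>UNIV. \<Sum>i\<in>UNIV. vec_nth (\<mu> i) q * Poly_Mapping.lookup m i)"
    by (simp add: monom_degree_def mult.commute)
  also have "\<dots> = (\<Sum>i\<in>UNIV. \<Sum>q\<in>UNIV. vec_nth (\<mu> i) q * Poly_Mapping.lookup m i)" by (rule sum.swap)
  finally show ?thesis by (simp add: sum_distrib_right)
qed

theorem theorem5p8:
  fixes p s :: nat
    and y :: "nat \<Rightarrow> 'k::field"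
    and \<mu> :: "'n::finite \<Rightarrow> nat ^ 'q"
    and fs :: "('n, 'k) mpoly list"
    and f \<delta> :: "('n, 'k) mpoly"
    and u \<theta> :: "('n, 'k) mpoly \<Rightarrow> ('n, 'k) mpoly"
    and F :: "nat \<Rightarrow> ('n, 'k) mpoly"
    and S :: "('n, 'k) mpoly ring"
    and I \<mm> :: "('n, 'k) mpoly set"
  assumes char: "p = CHAR('k)" "p > 0"
    and ffin: "F_finite TYPE('k)"
    and pbasis: "p_basis p s y"
    and u: "is_dual_top p s y u"
    and deg_nz: "\<And>i. \<mu> i \<noteq> 0"
    and S_def: "S = ring_of_type_algebra"
    and m_def: "\<mm> = Idl\<^bsub>S\<^esub> (range Var)"
    and hom: "\<And>g. g \<in> set fs \<Longrightarrow> \<exists>d. homogeneous \<mu> d g"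
    and reg: "regular_sequence S fs"
    and I_def: "I = Idl\<^bsub>S\<^esub> (set fs)"
    and f_def: "f = prod_list fs"
    and f_hom: "homogeneous \<mu> (\<Sum>i\<in>UNIV. \<mu> i) f"
    and \<delta>: "\<delta> \<in> Delta1 p s y (f ^ (p - 1))"
    and \<delta>_hom: "homogeneous \<mu> ((p * (p - 1)) *s (\<Sum>i\<in>UNIV. \<mu> i)) \<delta>"
    and \<theta>_def: "\<And>a. \<theta> a = u (\<delta> * a)"
    and F_1: "F 1 = f ^ (p - 1)"
    and F_n: "\<And>n. n \<ge> 2 \<Longrightarrow> F n = f ^ (p - 1) * \<delta> ^ (\<Sum>i\<le>n - 2. p ^ i)"
  shows "ht p (S Quot I) =
           Inf {enat n | n. n \<ge> 1 \<and>
             \<not> (\<theta> ^^ (n - 1)) ` {f ^ (p - 1) * Const c | c. True} \<subseteq> frobenius_power S \<mm> p}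
       \<and> ht p (S Quot I) =
           Inf {enat n | n. n \<ge> 1 \<and> F n \<notin> frobenius_power S \<mm> (p ^ n)}
       \<and> ht p (S Quot I) = ht p (S Quot (Idl\<^bsub>S\<^esub> {f}))"
proof -
  define wt where "wt i = (\<Sum>q\<in>UNIV. vec_nth (\<mu> i) q)" for i
  have wt: "wt i > 0" for i
  proof -
    obtain q where "vec_nth (\<mu> i) q \<noteq> 0" using deg_nz[of i] by (auto simp: vec_eq_iff)
    then have "vec_nth (\<mu> i) q > 0" by simp
    also have "vec_nth (\<mu> i) q \<le> wt i" unfolding wt_def by (rule member_le_sum) auto
    finally show ?thesis .
  qed
  interpret poly_graded p s y u wt by unfold_locales (rule char pbasis u wt)+
  have wdeg_eq: "wdeg m = (\<Sum>q\<in>UNIV. vec_nth (monom_degree \<mu> m) q)" for m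
    unfolding wdeg_def wt_def by (rule wdeg_eq_sum_monom_degree)
  have hom_if: "hom (\<Sum>q\<in>UNIV. vec_nth d q) g" if "homogeneous \<mu> d g" for d g
    unfolding hom_def component_eq_iff wdeg_eq using that by (simp add: homogeneous_def)
  have \<nu>_eq: "(\<Sum>q\<in>UNIV. vec_nth (\<Sum>i\<in>UNIV. \<mu> i) q) = \<nu>"
    unfolding \<nu>_def wt_def sum_component by (rule sum.swap)
  interpret fedder_poly p s y u wt fs f \<delta>
  proof
    show "\<exists>e. hom e g" if "g \<in> set fs" for g using \<open>g \<in> set fs\<close> assms(9) hom_if by blast
    show "f = prod_list fs" by fact
    show "hom \<nu> f" using hom_if[OF f_hom] unfolding \<nu>_eq .
    show "\<delta> \<approx> Delta (f ^ (p - 1))" by (rule Delta1_eqp[OF \<delta>])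
    show "hom (p * (p - 1) * \<nu>) \<delta>"
      using hom_if[OF \<delta>_hom] by (simp only: vector_smult_component \<nu>_eq flip: sum_distrib_left)
    show "reg {0} fs" "1 \<notin> idl (set fs)"
      using regular_sequence_reg reg unfolding S_def by auto
  qed
  note \<theta> = \<theta>_eqI[OF \<open>\<And>a. \<theta> a = u (\<delta> * a)\<close>]
  \<comment> \<open>The two clauses for F are one formula: for n = 1 the sum in the exponent is
    empty.\<close>
  have F: "F n = f ^ (p - 1) * \<delta> ^ (\<Sum>i<n - 1. p ^ i)" if "n \<ge> 1" for n
  proof (cases "n = 1")
    case True
    then show ?thesis using F_1 by simp
  next
    case False
    then have "{..<n - 1} = {..n - 2}" "n \<ge> 2" using that by auto
    then show ?thesis using F_n by simp
  qed
  have q: "S Quot I = quot" by (simp add: S_def I_def genideal_eq_idl)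
  have m: "frobenius_power S \<mm> k = fpow irrelevant k" for k
    by (simp add: S_def m_def genideal_eq_idl idl_Var frobenius_power_eq_fpow)
  have crit_F: "n \<ge> 1 \<and> crit n \<longleftrightarrow> n \<ge> 1 \<and> F n \<notin> fpow irrelevant (p ^ n)" for n
    using crit_iff_power[of n] F[of n] by auto
  have f: "S Quot (Idl\<^bsub>S\<^esub> {f}) = ring_of_type_algebra Quot idl {f}" by (simp add: S_def genideal_eq_idl)
  show ?thesis
    unfolding q f m \<theta> crit_iff_theta[symmetric] crit_F[symmetric]
    using height_eq height_principal by (intro conjI)
qed

end
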